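(* Let $\mathcal{Q}$ be a quasi-abelian category. Then $\mathcal{L}_{\mathcal{Q}} \cong \mathrm{mod}\, \Lambda$ for a right noetherian (resp. right artinian) ring $\Lambda$ if and only if $\mathcal{Q}$ is noetherian (resp. noetherian and artinian) with respect to subobjects and has a strong projective generator $P$. Moreover, in this case $\Lambda \cong \mathrm{End}_{\mathcal{Q}}(P)$.
   Context: An additive category is pre-abelian if every morphism has a kernel and a cokernel. It is quasi-abelian if it is pre-abelian and cokernels are stable under pullback and kernels are stable under pushout. A category is noetherian (resp. artinian) with respect to subobjects if every ascending (resp. descending) chain of subobjects of an object stabilises, a subobject being represented by a monomorphism. An object $P\in\mathcal{Q}$ is projective if for every cokernel $f:X\to Y$ in $\mathcal{Q}$ every morphism $P\to Y$ factors through $f$. It is a strong projective generator if it is projective and for every $X\in\mathcal{Q}$ there is a cokernel $P^{I}\to X$ for some set $I$, where $P^I$ is a coproduct of copies of $P$ indexed by $I$. The (left) associated abelian category $\mathcal{L}_{\mathcal{Q}}$: let $\mathcal{K}$ be the full subcategory of the homotopy category of complexes $\mathsf{K}(\mathcal{Q})$ whose objects are the complexes concentrated in degrees $0$ and $1$ whose differential is a monomorphism $f:X\to Y$. Explicitly, a morphism from $f:X\to Y$ to $f':X'\to Y'$ is a pair $(\alpha:X\to X',\ \beta:Y\to Y')$ with $\beta f=f'\alpha$, modulo those pairs for which there is $h:Y\to X'$ with $hf=\alpha$ and $f'h=\beta$. A morphism is regular if it is both monic and epic in $\mathcal{K}$. $\mathcal{L}_{\mathcal{Q}}$ is the category obtained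 from $\mathcal{K}$ by formally inverting all regular morphisms; it is abelian. $\mathrm{mod}\,\Lambda$ is the category of finitely generated right $\Lambda$-modules and $\cong$ between categories means equivalence. *)

theory Defs
  imports "HOL-Algebra.QuotRing" "HOL-Algebra.Module"
begin

section \<open>Categories, functors, equivalences\<close>

text \<open>
  The objects and the arrows form sets in two arbitrary types. Every arrow determines its domain
  and its codomain; \<open>g \<cdot> f\<close> (first \<open>f\<close>, then \<open>g\<close>) is meaningful only if \<open>Dom g = Cod f\<close>.
\<close>

record ('o, 'm) cat =
  Obj :: "'o set"
  Arr :: "'m set"
  Dom :: "'m \<Rightarrow> 'o"
  Cod :: "'m \<Rightarrow> 'o"
  Ident :: "'o \<Rightarrow> 'm"
  Comp :: "'m \<Rightarrow> 'm \<Rightarrow> 'm"  (infixl \<open>\<cdot>\<index>\<close> 70)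

definition Hom :: "('o, 'm, 'z) cat_scheme \<Rightarrow> 'o \<Rightarrow> 'o \<Rightarrow> 'm set" where
  "Hom C X Y = {f \<in> Arr C. Dom C f = X \<and> Cod C f = Y}"

locale category =
  fixes C :: "('o, 'm, 'z) cat_scheme" (structure)
  assumes dom_obj: "f \<in> Arr C \<Longrightarrow> Dom C f \<in> Obj C"
    and cod_obj: "f \<in> Arr C \<Longrightarrow> Cod C f \<in> Obj C"
    and ident_hom: "X \<in> Obj C \<Longrightarrow> Ident C X \<in> Hom C X X"
    and comp_hom: "\<lbrakk>f \<in> Hom C X Y; g \<in> Hom C Y Z\<rbrakk> \<Longrightarrow> g \<cdot> f \<in> Hom C X Z"
    and comp_ident_left: "f \<in> Hom C X Y \<Longrightarrow> Ident C Y \<cdot> f = f"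
    and comp_ident_right: "f \<in> Hom C X Y \<Longrightarrow> f \<cdot> Ident C X = f"
    and comp_assoc: "\<lbrakk>f \<in> Hom C W X; g \<in> Hom C X Y; h \<in> Hom C Y Z\<rbrakk> \<Longrightarrow>
      (h \<cdot> g) \<cdot> f = h \<cdot> (g \<cdot> f)"

definition is_functor ::
  "('o, 'm, 'z) cat_scheme \<Rightarrow> ('p, 'n, 'y) cat_scheme \<Rightarrow> ('o \<Rightarrow> 'p) \<Rightarrow> ('m \<Rightarrow> 'n) \<Rightarrow> bool" where
  "is_functor C D Fo Fa \<longleftrightarrow>
     (\<forall>X \<in> Obj C. Fo X \<in> Obj D) \<and>
     (\<forall>f \<in> Arr C. Fa f \<in> Hom D (Fo (Dom C f)) (Fo (Cod C f))) \<and>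
     (\<forall>X \<in> Obj C. Fa (Ident C X) = Ident D (Fo X)) \<and>
     (\<forall>f \<in> Arr C. \<forall>g \<in> Arr C. Dom C g = Cod C f \<longrightarrow>
        Fa (g \<cdot>\<^bsub>C\<^esub> f) = Fa g \<cdot>\<^bsub>D\<^esub> Fa f)"

definition is_iso_arrow :: "('o, 'm, 'z) cat_scheme \<Rightarrow> 'm \<Rightarrow> bool" where
  "is_iso_arrow C f \<longleftrightarrow> f \<in> Arr C \<and>
     (\<exists>g \<in> Hom C (Cod C f) (Dom C f).
        g \<cdot>\<^bsub>C\<^esub> f = Ident C (Dom C f) \<and> f \<cdot>\<^bsub>C\<^esub> g = Ident C (Cod C f))"

definition is_natural_iso ::
  "('o, 'm, 'z) cat_scheme \<Rightarrow> ('p, 'n, 'y) cat_scheme \<Rightarrow> ('o \<Rightarrow> 'p) \<Rightarrow> ('m \<Rightarrow> 'n) \<Rightarrow>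
     ('o \<Rightarrow> 'p) \<Rightarrow> ('m \<Rightarrow> 'n) \<Rightarrow> ('o \<Rightarrow> 'n) \<Rightarrow> bool" where
  "is_natural_iso C D Fo Fa Go Ga \<eta> \<longleftrightarrow>
     (\<forall>X \<in> Obj C. \<eta> X \<in> Hom D (Fo X) (Go X) \<and> is_iso_arrow D (\<eta> X)) \<and>
     (\<forall>f \<in> Arr C. \<eta> (Cod C f) \<cdot>\<^bsub>D\<^esub> Fa f = Ga f \<cdot>\<^bsub>D\<^esub> \<eta> (Dom C f))"

definition equivalent_categories ::
  "('o, 'm, 'z) cat_scheme \<Rightarrow> ('p, 'n, 'y) cat_scheme \<Rightarrow> bool"  (infix \<open>\<approx>\<^sub>c\<close> 50) where
  "C \<approx>\<^sub>c D \<longleftrightarrow> (\<exists>Fo Fa Go Ga \<eta> \<epsilon>.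
     is_functor C D Fo Fa \<and> is_functor D C Go Ga \<and>
     is_natural_iso C C (\<lambda>X. X) (\<lambda>f. f) (Go \<circ> Fo) (Ga \<circ> Fa) \<eta> \<and>
     is_natural_iso D D (Fo \<circ> Go) (Fa \<circ> Ga) (\<lambda>Y. Y) (\<lambda>g. g) \<epsilon>)"

definition is_monic :: "('o, 'm, 'z) cat_scheme \<Rightarrow> 'm \<Rightarrow> bool" where
  "is_monic C f \<longleftrightarrow> f \<in> Arr C \<and>
     (\<forall>W \<in> Obj C. \<forall>g \<in> Hom C W (Dom C f). \<forall>h \<in> Hom C W (Dom C f).
        f \<cdot>\<^bsub>C\<^esub> g = f \<cdot>\<^bsub>C\<^esub> h \<longrightarrow> g = h)"

definition is_epic :: "('o, 'm, 'z) cat_scheme \<Rightarrow> 'm \<Rightarrow> bool" where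
  "is_epic C f \<longleftrightarrow> f \<in> Arr C \<and>
     (\<forall>Z \<in> Obj C. \<forall>g \<in> Hom C (Cod C f) Z. \<forall>h \<in> Hom C (Cod C f) Z.
        g \<cdot>\<^bsub>C\<^esub> f = h \<cdot>\<^bsub>C\<^esub> f \<longrightarrow> g = h)"

definition is_regular :: "('o, 'm, 'z) cat_scheme \<Rightarrow> 'm \<Rightarrow> bool" where
  "is_regular C f \<longleftrightarrow> is_monic C f \<and> is_epic C f"

definition is_pullback :: "('o, 'm, 'z) cat_scheme \<Rightarrow> 'm \<Rightarrow> 'm \<Rightarrow> 'm \<Rightarrow> 'm \<Rightarrow> bool" where
  \<comment> \<open>the square \<open>f \<cdot> p = g \<cdot> q\<close> is a pullback of \<open>f\<close> and \<open>g\<close>; \<open>q\<close> is the pullback of \<open>f\<close> along \<open>g\<close>\<close>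
  "is_pullback C f g p q \<longleftrightarrow>
     f \<in> Arr C \<and> g \<in> Arr C \<and> Cod C f = Cod C g \<and>
     p \<in> Arr C \<and> q \<in> Arr C \<and> Dom C p = Dom C q \<and>
     Cod C p = Dom C f \<and> Cod C q = Dom C g \<and> f \<cdot>\<^bsub>C\<^esub> p = g \<cdot>\<^bsub>C\<^esub> q \<and>
     (\<forall>W \<in> Obj C. \<forall>u \<in> Hom C W (Dom C f). \<forall>v \<in> Hom C W (Dom C g).
        f \<cdot>\<^bsub>C\<^esub> u = g \<cdot>\<^bsub>C\<^esub> v \<longrightarrow>
        (\<exists>!h. h \<in> Hom C W (Dom C p) \<and> p \<cdot>\<^bsub>C\<^esub> h = u \<and> q \<cdot>\<^bsub>C\<^esub> h = v))"

definition is_pushout :: "('o, 'm, 'z) cat_scheme \<Rightarrow> 'm \<Rightarrow> 'm \<Rightarrow> 'm \<Rightarrow> 'm \<Rightarrow> bool" where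
  \<comment> \<open>the square \<open>p \<cdot> f = q \<cdot> g\<close> is a pushout of \<open>f\<close> and \<open>g\<close>; \<open>q\<close> is the pushout of \<open>f\<close> along \<open>g\<close>\<close>
  "is_pushout C f g p q \<longleftrightarrow>
     f \<in> Arr C \<and> g \<in> Arr C \<and> Dom C f = Dom C g \<and>
     p \<in> Arr C \<and> q \<in> Arr C \<and> Cod C p = Cod C q \<and>
     Dom C p = Cod C f \<and> Dom C q = Cod C g \<and> p \<cdot>\<^bsub>C\<^esub> f = q \<cdot>\<^bsub>C\<^esub> g \<and>
     (\<forall>W \<in> Obj C. \<forall>u \<in> Hom C (Cod C f) W. \<forall>v \<in> Hom C (Cod C g) W.
        u \<cdot>\<^bsub>C\<^esub> f = v \<cdot>\<^bsub>C\<^esub> g \<longrightarrow>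
        (\<exists>!h. h \<in> Hom C (Cod C p) W \<and> h \<cdot>\<^bsub>C\<^esub> p = u \<and> h \<cdot>\<^bsub>C\<^esub> q = v))"

definition is_copower ::
  "('o, 'm, 'z) cat_scheme \<Rightarrow> 'o \<Rightarrow> 'i set \<Rightarrow> 'o \<Rightarrow> ('i \<Rightarrow> 'm) \<Rightarrow> bool" where
  \<comment> \<open>\<open>S\<close> with the injections \<open>\<iota>\<close> is a coproduct of copies of \<open>P\<close> indexed by \<open>I\<close>\<close>
  "is_copower C P I S \<iota> \<longleftrightarrow>
     S \<in> Obj C \<and> (\<forall>i \<in> I. \<iota> i \<in> Hom C P S) \<and>
     (\<forall>Y \<in> Obj C. \<forall>g. (\<forall>i \<in> I. g i \<in> Hom C P Y) \<longrightarrow>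
        (\<exists>!h. h \<in> Hom C S Y \<and> (\<forall>i \<in> I. h \<cdot>\<^bsub>C\<^esub> \<iota> i = g i)))"


section \<open>Additive and quasi-abelian categories\<close>

record ('o, 'm) precat = "('o, 'm) cat" +
  HZero :: "'o \<Rightarrow> 'o \<Rightarrow> 'm"
  HAdd :: "'m \<Rightarrow> 'm \<Rightarrow> 'm"  (infixl \<open>\<boxplus>\<index>\<close> 65)

definition hom_group :: "('o, 'm, 'z) precat_scheme \<Rightarrow> 'o \<Rightarrow> 'o \<Rightarrow> 'm monoid" where
  "hom_group C X Y = \<lparr>carrier = Hom C X Y, mult = HAdd C, one = HZero C X Y\<rparr>"

definition End_ring :: "('o, 'm, 'z) precat_scheme \<Rightarrow> 'o \<Rightarrow> 'm ring" where
  "End_ring C X = \<lparr>carrier = Hom C X X, mult = Comp C, one = Ident C X,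
     zero = HZero C X X, add = HAdd C\<rparr>"

locale additive_category = category C
  for C :: "('o, 'm, 'z) precat_scheme" (structure) +
  assumes hom_comm_group: "\<lbrakk>X \<in> Obj C; Y \<in> Obj C\<rbrakk> \<Longrightarrow> comm_group (hom_group C X Y)"
    and comp_add_left: "\<lbrakk>f \<in> Hom C X Y; g \<in> Hom C Y Z; g' \<in> Hom C Y Z\<rbrakk> \<Longrightarrow>
      (g \<boxplus> g') \<cdot> f = (g \<cdot> f) \<boxplus> (g' \<cdot> f)"
    and comp_add_right: "\<lbrakk>f \<in> Hom C X Y; f' \<in> Hom C X Y; g \<in> Hom C Y Z\<rbrakk> \<Longrightarrow>
      g \<cdot> (f \<boxplus> f') = (g \<cdot> f) \<boxplus> (g \<cdot> f')"
    and zero_object: "\<exists>Z \<in> Obj C. \<forall>X \<in> Obj C. (\<exists>!f. f \<in> Hom C Z X) \<and> (\<exists>!f. f \<in> Hom C X Z)"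
    and biproducts: "\<lbrakk>X \<in> Obj C; Y \<in> Obj C\<rbrakk> \<Longrightarrow>
      \<exists>S \<in> Obj C. \<exists>i \<in> Hom C X S. \<exists>j \<in> Hom C Y S. \<exists>p \<in> Hom C S X. \<exists>q \<in> Hom C S Y.
        p \<cdot> i = Ident C X \<and> q \<cdot> j = Ident C Y \<and>
        p \<cdot> j = HZero C Y X \<and> q \<cdot> i = HZero C X Y \<and> (i \<cdot> p) \<boxplus> (j \<cdot> q) = Ident C S"

definition is_kernel :: "('o, 'm, 'z) precat_scheme \<Rightarrow> 'm \<Rightarrow> 'm \<Rightarrow> bool" where
  "is_kernel C f k \<longleftrightarrow> f \<in> Arr C \<and> k \<in> Arr C \<and> Cod C k = Dom C f \<and>
     f \<cdot>\<^bsub>C\<^esub> k = HZero C (Dom C k) (Cod C f) \<and>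
     (\<forall>W \<in> Obj C. \<forall>g \<in> Hom C W (Dom C f). f \<cdot>\<^bsub>C\<^esub> g = HZero C W (Cod C f) \<longrightarrow>
        (\<exists>!h. h \<in> Hom C W (Dom C k) \<and> k \<cdot>\<^bsub>C\<^esub> h = g))"

definition is_cokernel :: "('o, 'm, 'z) precat_scheme \<Rightarrow> 'm \<Rightarrow> 'm \<Rightarrow> bool" where
  "is_cokernel C f c \<longleftrightarrow> f \<in> Arr C \<and> c \<in> Arr C \<and> Dom C c = Cod C f \<and>
     c \<cdot>\<^bsub>C\<^esub> f = HZero C (Dom C f) (Cod C c) \<and>
     (\<forall>W \<in> Obj C. \<forall>g \<in> Hom C (Cod C f) W. g \<cdot>\<^bsub>C\<^esub> f = HZero C (Dom C f) W \<longrightarrow>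
        (\<exists>!h. h \<in> Hom C (Cod C c) W \<and> h \<cdot>\<^bsub>C\<^esub> c = g))"

definition kernel_arrow :: "('o, 'm, 'z) precat_scheme \<Rightarrow> 'm \<Rightarrow> bool" where
  "kernel_arrow C k \<longleftrightarrow> (\<exists>f. is_kernel C f k)"

definition cokernel_arrow :: "('o, 'm, 'z) precat_scheme \<Rightarrow> 'm \<Rightarrow> bool" where
  "cokernel_arrow C c \<longleftrightarrow> (\<exists>f. is_cokernel C f c)"

locale pre_abelian_category = additive_category C
  for C :: "('o, 'm, 'z) precat_scheme" (structure) +
  assumes has_kernel: "f \<in> Arr C \<Longrightarrow> \<exists>k. is_kernel C f k"
    and has_cokernel: "f \<in> Arr C \<Longrightarrow> \<exists>c. is_cokernel C f c"

locale quasi_abelian_category = pre_abelian_category C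
  for C :: "('o, 'm, 'z) precat_scheme" (structure) +
  assumes cokernel_pullback: "\<lbrakk>cokernel_arrow C f; is_pullback C f g p q\<rbrakk> \<Longrightarrow> cokernel_arrow C q"
    and kernel_pushout: "\<lbrakk>kernel_arrow C f; is_pushout C f g p q\<rbrakk> \<Longrightarrow> kernel_arrow C q"


section \<open>Chain conditions on subobjects, strong projective generators\<close>

definition is_subobject :: "('o, 'm, 'z) cat_scheme \<Rightarrow> 'o \<Rightarrow> 'm \<Rightarrow> bool" where
  "is_subobject C X s \<longleftrightarrow> is_monic C s \<and> Cod C s = X"

text \<open>
  The preorder on monomorphisms representing subobjects; \<open>s\<close> and \<open>t\<close> represent the same
  subobject iff \<open>subobject_le C s t\<close> and \<open>subobject_le C t s\<close>.
\<close>

definition subobject_le :: "('o, 'm, 'z) cat_scheme \<Rightarrow> 'm \<Rightarrow> 'm \<Rightarrow> bool" where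
  "subobject_le C s t \<longleftrightarrow> (\<exists>h \<in> Hom C (Dom C s) (Dom C t). s = t \<cdot>\<^bsub>C\<^esub> h)"

definition subobject_eq :: "('o, 'm, 'z) cat_scheme \<Rightarrow> 'm \<Rightarrow> 'm \<Rightarrow> bool" where
  "subobject_eq C s t \<longleftrightarrow> subobject_le C s t \<and> subobject_le C t s"

definition noetherian_subobjects :: "('o, 'm, 'z) cat_scheme \<Rightarrow> bool" where
  "noetherian_subobjects C \<longleftrightarrow> (\<forall>X \<in> Obj C. \<forall>s :: nat \<Rightarrow> 'm.
     (\<forall>n. is_subobject C X (s n)) \<and> (\<forall>n. subobject_le C (s n) (s (Suc n))) \<longrightarrow>
     (\<exists>N. \<forall>n \<ge> N. subobject_eq C (s n) (s N)))"

definition artinian_subobjects :: "('o, 'm, 'z) cat_scheme \<Rightarrow> bool" where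
  "artinian_subobjects C \<longleftrightarrow> (\<forall>X \<in> Obj C. \<forall>s :: nat \<Rightarrow> 'm.
     (\<forall>n. is_subobject C X (s n)) \<and> (\<forall>n. subobject_le C (s (Suc n)) (s n)) \<longrightarrow>
     (\<exists>N. \<forall>n \<ge> N. subobject_eq C (s n) (s N)))"

definition is_projective :: "('o, 'm, 'z) precat_scheme \<Rightarrow> 'o \<Rightarrow> bool" where
  "is_projective C P \<longleftrightarrow> P \<in> Obj C \<and>
     (\<forall>f. cokernel_arrow C f \<longrightarrow>
        (\<forall>g \<in> Hom C P (Cod C f). \<exists>h \<in> Hom C P (Dom C f). f \<cdot>\<^bsub>C\<^esub> h = g))"

text \<open>
  The index sets \<open>I\<close> range over subsets of the arrow type. This is no restriction in a preadditive
  category: if \<open>P\<close> is nonzero, the injections into a coproduct of copies of \<open>P\<close> are pairwise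
  distinct arrows, and if \<open>P\<close> is zero, so is the coproduct and one can take \<open>I\<close> empty.
\<close>

definition strong_projective_generator :: "('o, 'm, 'z) precat_scheme \<Rightarrow> 'o \<Rightarrow> bool" where
  "strong_projective_generator C P \<longleftrightarrow> is_projective C P \<and>
     (\<forall>X \<in> Obj C. \<exists>(I :: 'm set) S \<iota> c.
        is_copower C P I S \<iota> \<and> cokernel_arrow C c \<and> c \<in> Hom C S X)"


section \<open>The category \<open>\<K>\<close>\<close>

text \<open>
  An object is a monic arrow \<open>f\<close> of \<open>Q\<close>, i.e. the two-term complex \<open>f : X \<rightarrow> Y\<close>. An arrow from
  \<open>f\<close> to \<open>f'\<close> is a triple \<open>(f, T, f')\<close>, where \<open>T\<close> is a homotopy class of chain maps \<open>(\<alpha>, \<beta>)\<close>.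
\<close>

definition chain_maps :: "('o, 'm, 'z) precat_scheme \<Rightarrow> 'm \<Rightarrow> 'm \<Rightarrow> ('m \<times> 'm) set" where
  "chain_maps Q f f' = {(\<alpha>, \<beta>).
     \<alpha> \<in> Hom Q (Dom Q f) (Dom Q f') \<and> \<beta> \<in> Hom Q (Cod Q f) (Cod Q f') \<and>
     \<beta> \<cdot>\<^bsub>Q\<^esub> f = f' \<cdot>\<^bsub>Q\<^esub> \<alpha>}"

definition homotopic :: "('o, 'm, 'z) precat_scheme \<Rightarrow> 'm \<Rightarrow> 'm \<Rightarrow> 'm \<times> 'm \<Rightarrow> 'm \<times> 'm \<Rightarrow> bool" where
  \<comment> \<open>the difference of the two chain maps is \<open>(h \<cdot> f, f' \<cdot> h)\<close> for some \<open>h\<close>\<close>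
  "homotopic Q f f' u v \<longleftrightarrow> (\<exists>h \<in> Hom Q (Cod Q f) (Dom Q f').
     fst u = fst v \<boxplus>\<^bsub>Q\<^esub> (h \<cdot>\<^bsub>Q\<^esub> f) \<and> snd u = snd v \<boxplus>\<^bsub>Q\<^esub> (f' \<cdot>\<^bsub>Q\<^esub> h))"

definition homotopy_class ::
  "('o, 'm, 'z) precat_scheme \<Rightarrow> 'm \<Rightarrow> 'm \<Rightarrow> 'm \<times> 'm \<Rightarrow> ('m \<times> 'm) set" where
  "homotopy_class Q f f' u = {v \<in> chain_maps Q f f'. homotopic Q f f' u v}"

type_synonym 'm K_arr = "'m \<times> ('m \<times> 'm) set \<times> 'm"

definition K_cat :: "('o, 'm, 'z) precat_scheme \<Rightarrow> ('m, 'm K_arr) cat" where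
  "K_cat Q = \<lparr>
     Obj = {f. is_monic Q f},
     Arr = {(f, homotopy_class Q f f' u, f') | f f' u.
              is_monic Q f \<and> is_monic Q f' \<and> u \<in> chain_maps Q f f'},
     Dom = (\<lambda>(f, T, f'). f),
     Cod = (\<lambda>(f, T, f'). f'),
     Ident = (\<lambda>f. (f, homotopy_class Q f f (Ident Q (Dom Q f), Ident Q (Cod Q f)), f)),
     Comp = (\<lambda>(g, T', g') (f, T, f').
       (f, \<Union>(\<alpha>', \<beta>') \<in> T'. \<Union>(\<alpha>, \<beta>) \<in> T. homotopy_class Q f g' (\<alpha>' \<cdot>\<^bsub>Q\<^esub> \<alpha>, \<beta>' \<cdot>\<^bsub>Q\<^esub> \<beta>), g'))\<rparr>"


section \<open>Formal inversion of a class of arrows\<close>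

text \<open>
  The category of fractions \<open>C[S\<^sup>-\<^sup>1]\<close> of Gabriel and Zisman: the objects are those of \<open>C\<close>, the arrows
  are zigzags in \<open>C\<close> whose backward steps lie in \<open>S\<close>, modulo the congruence generated by the
  composition of \<open>C\<close> and by declaring the backward step of \<open>s \<in> S\<close> inverse to \<open>s\<close>. A zigzag is a
  list of steps, the head being the first one to be traversed.
\<close>

datatype 'm step = Fwd 'm | Bwd 'm

fun step_src :: "('o, 'm, 'z) cat_scheme \<Rightarrow> 'm step \<Rightarrow> 'o" where
  "step_src C (Fwd f) = Dom C f"
| "step_src C (Bwd s) = Cod C s"

fun step_tgt :: "('o, 'm, 'z) cat_scheme \<Rightarrow> 'm step \<Rightarrow> 'o" where
  "step_tgt C (Fwd f) = Cod C f"
| "step_tgt C (Bwd s) = Dom C s"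

fun step_ok :: "('o, 'm, 'z) cat_scheme \<Rightarrow> 'm set \<Rightarrow> 'm step \<Rightarrow> bool" where
  "step_ok C S (Fwd f) \<longleftrightarrow> f \<in> Arr C"
| "step_ok C S (Bwd s) \<longleftrightarrow> s \<in> Arr C \<and> s \<in> S"

fun zigzag :: "('o, 'm, 'z) cat_scheme \<Rightarrow> 'm set \<Rightarrow> 'o \<Rightarrow> 'm step list \<Rightarrow> 'o \<Rightarrow> bool" where
  "zigzag C S X [] Y \<longleftrightarrow> X \<in> Obj C \<and> X = Y"
| "zigzag C S X (a # w) Y \<longleftrightarrow> step_ok C S a \<and> step_src C a = X \<and> zigzag C S (step_tgt C a) w Y"

inductive zigzag_eq ::
  "('o, 'm, 'z) cat_scheme \<Rightarrow> 'm set \<Rightarrow> 'o \<Rightarrow> 'o \<Rightarrow> 'm step list \<Rightarrow> 'm step list \<Rightarrow> bool"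
  for C S where
  refl: "zigzag C S X w Y \<Longrightarrow> zigzag_eq C S X Y w w"
| sym: "zigzag_eq C S X Y v w \<Longrightarrow> zigzag_eq C S X Y w v"
| trans: "\<lbrakk>zigzag_eq C S X Y u v; zigzag_eq C S X Y v w\<rbrakk> \<Longrightarrow> zigzag_eq C S X Y u w"
| congr: "\<lbrakk>zigzag C S X a X'; zigzag_eq C S X' Y' v w; zigzag C S Y' b Y\<rbrakk> \<Longrightarrow>
    zigzag_eq C S X Y (a @ v @ b) (a @ w @ b)"
| ident: "X \<in> Obj C \<Longrightarrow> zigzag_eq C S X X [Fwd (Ident C X)] []"
| comp: "\<lbrakk>f \<in> Hom C X Y; g \<in> Hom C Y Z\<rbrakk> \<Longrightarrow> zigzag_eq C S X Z [Fwd f, Fwd g] [Fwd (g \<cdot>\<^bsub>C\<^esub> f)]"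
| fwd_bwd: "\<lbrakk>s \<in> S; s \<in> Hom C X Y\<rbrakk> \<Longrightarrow> zigzag_eq C S X X [Fwd s, Bwd s] []"
| bwd_fwd: "\<lbrakk>s \<in> S; s \<in> Hom C X Y\<rbrakk> \<Longrightarrow> zigzag_eq C S Y Y [Bwd s, Fwd s] []"

type_synonym ('o, 'm) loc_arr = "'o \<times> 'm step list set \<times> 'o"

definition localization :: "('o, 'm, 'z) cat_scheme \<Rightarrow> 'm set \<Rightarrow> ('o, ('o, 'm) loc_arr) cat" where
  "localization C S = \<lparr>
     Obj = Obj C,
     Arr = {(X, {v. zigzag_eq C S X Y w v}, Y) | X Y w. zigzag C S X w Y},
     Dom = (\<lambda>(X, A, Y). X),
     Cod = (\<lambda>(X, A, Y). Y),
     Ident = (\<lambda>X. (X, {v. zigzag_eq C S X X [] v}, X)),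
     Comp = (\<lambda>(Y, B, Z) (X, A, Y').
       (X, \<Union>b \<in> B. \<Union>a \<in> A. {v. zigzag_eq C S X Z (a @ b) v}, Z))\<rparr>"

definition left_associated_abelian ::
  "('o, 'm, 'z) precat_scheme \<Rightarrow> ('m, ('m, 'm K_arr) loc_arr) cat"
where
  "left_associated_abelian Q = localization (K_cat Q) {f. is_regular (K_cat Q) f}"


section \<open>Right modules\<close>

definition right_ideal :: "('r, 'z) ring_scheme \<Rightarrow> 'r set \<Rightarrow> bool" where
  "right_ideal R I \<longleftrightarrow> additive_subgroup I R \<and>
     (\<forall>x \<in> I. \<forall>r \<in> carrier R. x \<otimes>\<^bsub>R\<^esub> r \<in> I)"

text \<open>The library's \<open>noetherian_ring\<close> is about two-sided ideals.\<close>

definition right_noetherian_ring :: "('r, 'z) ring_scheme \<Rightarrow> bool" where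
  "right_noetherian_ring R \<longleftrightarrow> ring R \<and> (\<forall>I :: nat \<Rightarrow> 'r set.
     (\<forall>n. right_ideal R (I n)) \<and> (\<forall>n. I n \<subseteq> I (Suc n)) \<longrightarrow> (\<exists>N. \<forall>n \<ge> N. I n = I N))"

definition right_artinian_ring :: "('r, 'z) ring_scheme \<Rightarrow> bool" where
  "right_artinian_ring R \<longleftrightarrow> ring R \<and> (\<forall>I :: nat \<Rightarrow> 'r set.
     (\<forall>n. right_ideal R (I n)) \<and> (\<forall>n. I (Suc n) \<subseteq> I n) \<longrightarrow> (\<exists>N. \<forall>n \<ge> N. I n = I N))"

text \<open>
  The library's locale \<open>module\<close> requires a commutative ring. Its record type is reused: \<open>r \<odot> x\<close>
  is to be read as the right action \<open>x r\<close>, whence the order of the factors in \<open>smult_assoc\<close>.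
  The fields \<open>mult\<close> and \<open>one\<close>, which that record type inherits from rings, play no role.
\<close>

locale right_module = R?: ring R + M?: abelian_group M
  for R :: "('r, 'z) ring_scheme" (structure) and M :: "('r, 'x, 'y) module_scheme" (structure) +
  assumes smult_closed:
      "\<lbrakk>r \<in> carrier R; x \<in> carrier M\<rbrakk> \<Longrightarrow> r \<odot>\<^bsub>M\<^esub> x \<in> carrier M"
    and smult_add_ring: "\<lbrakk>r \<in> carrier R; s \<in> carrier R; x \<in> carrier M\<rbrakk> \<Longrightarrow>
      (r \<oplus> s) \<odot>\<^bsub>M\<^esub> x = (r \<odot>\<^bsub>M\<^esub> x) \<oplus>\<^bsub>M\<^esub> (s \<odot>\<^bsub>M\<^esub> x)"
    and smult_add_module: "\<lbrakk>r \<in> carrier R; x \<in> carrier M; y \<in> carrier M\<rbrakk> \<Longrightarrow>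
      r \<odot>\<^bsub>M\<^esub> (x \<oplus>\<^bsub>M\<^esub> y) = (r \<odot>\<^bsub>M\<^esub> x) \<oplus>\<^bsub>M\<^esub> (r \<odot>\<^bsub>M\<^esub> y)"
    and smult_assoc: "\<lbrakk>r \<in> carrier R; s \<in> carrier R; x \<in> carrier M\<rbrakk> \<Longrightarrow>
      (r \<otimes> s) \<odot>\<^bsub>M\<^esub> x = s \<odot>\<^bsub>M\<^esub> (r \<odot>\<^bsub>M\<^esub> x)"
    and smult_one: "x \<in> carrier M \<Longrightarrow> \<one> \<odot>\<^bsub>M\<^esub> x = x"

definition finitely_generated_module ::
  "('r, 'z) ring_scheme \<Rightarrow> ('r, 'x, 'y) module_scheme \<Rightarrow> bool" where
  "finitely_generated_module R M \<longleftrightarrow> (\<exists>A. finite A \<and> A \<subseteq> carrier M \<and>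
     (\<forall>x \<in> carrier M. \<exists>c \<in> A \<rightarrow> carrier R. x = (\<Oplus>\<^bsub>M\<^esub>a\<in>A. c a \<odot>\<^bsub>M\<^esub> a)))"

definition module_homs ::
  "('r, 'z) ring_scheme \<Rightarrow> ('r, 'x, 'y) module_scheme \<Rightarrow> ('r, 'w, 'v) module_scheme \<Rightarrow> ('x \<Rightarrow> 'w) set"
where
  "module_homs R M N = {f \<in> carrier M \<rightarrow>\<^sub>E carrier N.
     (\<forall>x \<in> carrier M. \<forall>y \<in> carrier M. f (x \<oplus>\<^bsub>M\<^esub> y) = f x \<oplus>\<^bsub>N\<^esub> f y) \<and>
     (\<forall>r \<in> carrier R. \<forall>x \<in> carrier M. f (r \<odot>\<^bsub>M\<^esub> x) = r \<odot>\<^bsub>N\<^esub> f x)}"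

text \<open>
  The objects are the finitely generated right \<open>R\<close>-modules whose elements are lists over \<open>R\<close>.
  Up to isomorphism these are all finitely generated right modules, whatever the type of their
  elements: see \<open>fg_right_module_representable\<close> below.
\<close>

type_synonym 'r list_module = "('r, 'r list) module"

definition mod_cat ::
  "('r, 'z) ring_scheme \<Rightarrow> ('r list_module, 'r list_module \<times> ('r list \<Rightarrow> 'r list) \<times> 'r list_module) cat"
where
  "mod_cat R = \<lparr>
     Obj = {M. right_module R M \<and> finitely_generated_module R M},
     Arr = {(M, f, N) | M f N. right_module R M \<and> finitely_generated_module R M \<and>
              right_module R N \<and> finitely_generated_module R N \<and> f \<in> module_homs R M N},
     Dom = (\<lambda>(M, f, N). M),
     Cod = (\<lambda>(M, f, N). N),
     Ident = (\<lambda>M. (M, (\<lambda>x \<in> carrier M. x), M)),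
     Comp = (\<lambda>(M', g, N) (M, f, M''). (M, compose (carrier M) g f, N))\<rparr>"


section \<open>Well-definedness\<close>

lemma HomD: "f \<in> Hom C X Y \<Longrightarrow> f \<in> Arr C" "f \<in> Hom C X Y \<Longrightarrow> Dom C f = X"
  "f \<in> Hom C X Y \<Longrightarrow> Cod C f = Y"
  by (simp_all add: Hom_def)

lemma (in category) Hom_objD: "f \<in> Hom C X Y \<Longrightarrow> X \<in> Obj C \<and> Y \<in> Obj C"
  using dom_obj cod_obj by (auto simp: Hom_def)

lemma zigzag_append:
  "zigzag C S X u Y \<Longrightarrow> zigzag C S Y v Z \<Longrightarrow> zigzag C S X (u @ v) Z"
  by (induction u arbitrary: X) auto

lemma zigzag_eq_append:
  assumes "zigzag_eq C S X Y a a'" "zigzag_eq C S Y Z b b'"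
    and "zigzag C S X a Y" "zigzag C S X a' Y" "zigzag C S Y b Z" "zigzag C S Y b' Z"
    and "X \<in> Obj C" "Z \<in> Obj C"
  shows "zigzag_eq C S X Z (a @ b) (a' @ b')"
proof (rule zigzag_eq.trans)
  show "zigzag_eq C S X Z (a @ b) (a' @ b)"
    using zigzag_eq.congr[of C S X "[]" X Y a a' b Z] assms by auto
  show "zigzag_eq C S X Z (a' @ b) (a' @ b')"
    using zigzag_eq.congr[of C S X a' Y Z b b' "[]" Z] assms by auto
qed

context category
begin

lemma zigzag_obj: "zigzag C S X w Y \<Longrightarrow> X \<in> Obj C \<and> Y \<in> Obj C"
proof (induction w arbitrary: X)
  case (Cons a w)
  then show ?case using dom_obj cod_obj by (cases a) auto
qed auto

lemma zigzag_eq_zigzag: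
  "zigzag_eq C S X Y v w \<Longrightarrow> zigzag C S X v Y \<and> zigzag C S X w Y"
proof (induction rule: zigzag_eq.induct)
  case (congr X a X' Y' v w b Y)
  then show ?case by (blast intro: zigzag_append)
next
  case (comp f X Y g Z)
  then show ?case using comp_hom[OF comp] cod_obj by (auto simp: Hom_def)
next
  case (ident X)
  then show ?case using ident_hom by (auto simp: Hom_def)
qed (auto simp: Hom_def dom_obj cod_obj)

lemma zigzag_class_eq:
  assumes "zigzag_eq C S X Y v w"
  shows "{u. zigzag_eq C S X Y v u} = {u. zigzag_eq C S X Y w u}"
  using assms by (blast intro: zigzag_eq.trans zigzag_eq.sym)

lemma localization_comp:
  assumes "zigzag C S X a Y" "zigzag C S Y b Z"
  shows "(Y, {v. zigzag_eq C S Y Z b v}, Z) \<cdot>\<^bsub>localization C S\<^esub> (X, {v. zigzag_eq C S X Y a v}, Y')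
    = (X, {v. zigzag_eq C S X Z (a @ b) v}, Z)"
proof -
  have eq: "zigzag_eq C S X Z (a @ b) (a' @ b')"
    if "zigzag_eq C S X Y a a'" "zigzag_eq C S Y Z b b'" for a' b'
    using zigzag_eq_append[OF that] that zigzag_eq_zigzag zigzag_obj by metis
  have 1: "zigzag_eq C S X Y a a" "zigzag_eq C S Y Z b b" using assms by (auto intro: zigzag_eq.refl)
  have "(\<Union>b' \<in> {v. zigzag_eq C S Y Z b v}. \<Union>a' \<in> {v. zigzag_eq C S X Y a v}.
      {v. zigzag_eq C S X Z (a' @ b') v}) = {v. zigzag_eq C S X Z (a @ b) v}"
    using eq 1 by (auto intro: zigzag_eq.trans zigzag_eq.sym)
  then show ?thesis by (simp add: localization_def)
qed

lemma localization_HomE: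
  assumes "F \<in> Hom (localization C S) X Y"
  obtains w where "zigzag C S X w Y" "F = (X, {v. zigzag_eq C S X Y w v}, Y)"
  using assms by (auto simp: Hom_def localization_def)

lemma localization_HomI:
  "zigzag C S X w Y \<Longrightarrow> (X, {v. zigzag_eq C S X Y w v}, Y) \<in> Hom (localization C S) X Y"
  by (auto simp: Hom_def localization_def)

theorem category_localization: "category (localization C S)"
proof
  fix F assume "F \<in> Arr (localization C S)"
  then show "Dom (localization C S) F \<in> Obj (localization C S)"
    "Cod (localization C S) F \<in> Obj (localization C S)"
    using zigzag_obj by (auto simp: localization_def)
next
  fix X assume "X \<in> Obj (localization C S)"
  then have "zigzag C S X [] X" by (simp add: localization_def)
  from localization_HomI[OF this]
  show "Ident (localization C S) X \<in> Hom (localization C S) X X"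
    by (simp add: localization_def)
next
  fix F G X Y Z
  assume F: "F \<in> Hom (localization C S) X Y" and G: "G \<in> Hom (localization C S) Y Z"
  obtain a where a: "zigzag C S X a Y" "F = (X, {v. zigzag_eq C S X Y a v}, Y)"
    using F by (rule localization_HomE)
  obtain b where b: "zigzag C S Y b Z" "G = (Y, {v. zigzag_eq C S Y Z b v}, Z)"
    using G by (rule localization_HomE)
  show "G \<cdot>\<^bsub>localization C S\<^esub> F \<in> Hom (localization C S) X Z"
    unfolding a(2) b(2) localization_comp[OF a(1) b(1)]
    by (rule localization_HomI[OF zigzag_append[OF a(1) b(1)]])
next
  fix F X Y assume "F \<in> Hom (localization C S) X Y"
  then obtain w where w: "zigzag C S X w Y" "F = (X, {v. zigzag_eq C S X Y w v}, Y)"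
    by (rule localization_HomE)
  have XY: "zigzag C S X [] X" "zigzag C S Y [] Y" using zigzag_obj[OF w(1)] by auto
  have id: "Ident (localization C S) Z = (Z, {v. zigzag_eq C S Z Z [] v}, Z)" for Z
    by (simp add: localization_def)
  show "Ident (localization C S) Y \<cdot>\<^bsub>localization C S\<^esub> F = F"
    using localization_comp[OF w(1) XY(2)] by (simp add: id w(2))
  show "F \<cdot>\<^bsub>localization C S\<^esub> Ident (localization C S) X = F"
    using localization_comp[OF XY(1) w(1)] by (simp add: id w(2))
next
  fix F G H W X Y Z
  assume F: "F \<in> Hom (localization C S) W X" and G: "G \<in> Hom (localization C S) X Y"
    and H: "H \<in> Hom (localization C S) Y Z"
  obtain a where a: "zigzag C S W a X" "F = (W, {v. zigzag_eq C S W X a v}, X)"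
    using F by (rule localization_HomE)
  obtain b where b: "zigzag C S X b Y" "G = (X, {v. zigzag_eq C S X Y b v}, Y)"
    using G by (rule localization_HomE)
  obtain c where c: "zigzag C S Y c Z" "H = (Y, {v. zigzag_eq C S Y Z c v}, Z)"
    using H by (rule localization_HomE)
  show "H \<cdot>\<^bsub>localization C S\<^esub> G \<cdot>\<^bsub>localization C S\<^esub> F
    = H \<cdot>\<^bsub>localization C S\<^esub> (G \<cdot>\<^bsub>localization C S\<^esub> F)"
    unfolding a(2) b(2) c(2) localization_comp[OF a(1) b(1)] localization_comp[OF b(1) c(1)]
      localization_comp[OF zigzag_append[OF a(1) b(1)] c(1)]
      localization_comp[OF a(1) zigzag_append[OF b(1) c(1)]]
    by simp
qed

end

context additive_category
begin

lemma hom_group_simps [simp]: "carrier (hom_group C X Y) = Hom C X Y"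
  "mult (hom_group C X Y) = HAdd C" "one (hom_group C X Y) = HZero C X Y"
  by (simp_all add: hom_group_def)

lemma zero_hom: "X \<in> Obj C \<Longrightarrow> Y \<in> Obj C \<Longrightarrow> HZero C X Y \<in> Hom C X Y"
  using comm_group.axioms(2)[OF hom_comm_group, THEN group.is_monoid, THEN monoid.one_closed] by force

lemma add_hom: "f \<in> Hom C X Y \<Longrightarrow> g \<in> Hom C X Y \<Longrightarrow> f \<boxplus> g \<in> Hom C X Y"
  using comm_group.axioms(2)[OF hom_comm_group[of X Y], THEN group.is_monoid, THEN monoid.m_closed, of f g]
    Hom_objD[of f X Y] by simp

lemma add_assoc: "f \<in> Hom C X Y \<Longrightarrow> g \<in> Hom C X Y \<Longrightarrow> h \<in> Hom C X Y \<Longrightarrow>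
    (f \<boxplus> g) \<boxplus> h = f \<boxplus> (g \<boxplus> h)"
  using comm_group.axioms(2)[OF hom_comm_group[of X Y], THEN group.is_monoid, THEN monoid.m_assoc, of f g h]
    Hom_objD[of f X Y] by simp

lemma add_comm: "f \<in> Hom C X Y \<Longrightarrow> g \<in> Hom C X Y \<Longrightarrow> f \<boxplus> g = g \<boxplus> f"
  using comm_monoid.m_comm[OF comm_group.axioms(1)[OF hom_comm_group[of X Y]], of f g]
    Hom_objD[of f X Y] by simp

lemma add_zero: "f \<in> Hom C X Y \<Longrightarrow> f \<boxplus> HZero C X Y = f"
  using comm_group.axioms(2)[OF hom_comm_group[of X Y], THEN group.is_monoid, THEN monoid.r_one, of f]
    Hom_objD[of f X Y] by simp

lemma add_zero_left: "f \<in> Hom C X Y \<Longrightarrow> HZero C X Y \<boxplus> f = f"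
  using add_zero add_comm zero_hom Hom_objD by metis

lemma add_inv: "f \<in> Hom C X Y \<Longrightarrow> \<exists>g \<in> Hom C X Y. f \<boxplus> g = HZero C X Y"
  using comm_group.axioms(2)[OF hom_comm_group[of X Y], THEN group.r_inv_ex, of f]
    Hom_objD[of f X Y] by simp

lemma add_cancel:
  assumes f: "f \<in> Hom C X Y" and ff: "f \<boxplus> f = f"
  shows "f = HZero C X Y"
proof -
  obtain g where g: "g \<in> Hom C X Y" "f \<boxplus> g = HZero C X Y" using add_inv[OF f] by blast
  have "f = f \<boxplus> (f \<boxplus> g)" using add_zero[OF f] g(2) by simp
  also have "\<dots> = f \<boxplus> g" using add_assoc[OF f f g(1)] ff by simp
  finally show ?thesis using g(2) by simp
qed

lemma comp_zero:
  assumes f: "f \<in> Hom C X Y" and Z: "Z \<in> Obj C"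
  shows "HZero C Y Z \<cdot> f = HZero C X Z"
proof -
  have z: "HZero C Y Z \<in> Hom C Y Z" using zero_hom Hom_objD[OF f] Z by blast
  show ?thesis
    using comp_add_left[OF f z z] add_zero[OF z] by (intro add_cancel[OF comp_hom[OF f z]]) simp
qed

lemma zero_comp:
  assumes f: "f \<in> Hom C X Y" and Z: "Z \<in> Obj C"
  shows "f \<cdot> HZero C Z X = HZero C Z Y"
proof -
  have z: "HZero C Z X \<in> Hom C Z X" using zero_hom Hom_objD[OF f] Z by blast
  show ?thesis
    using comp_add_right[OF z z f] add_zero[OF z] by (intro add_cancel[OF comp_hom[OF z f]]) simp
qed

theorem ring_End_ring:
  assumes X: "X \<in> Obj C"
  shows "ring (End_ring C X)"
proof -
  have E: "carrier (End_ring C X) = Hom C X X" "mult (End_ring C X) = Comp C"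
    "one (End_ring C X) = Ident C X" "zero (End_ring C X) = HZero C X X" "add (End_ring C X) = HAdd C"
    by (simp_all add: End_ring_def)
  show ?thesis
  proof (rule ringI)
    show "abelian_group (End_ring C X)"
    proof (rule abelian_groupI, unfold E)
      fix x assume x: "x \<in> Hom C X X"
      then obtain y where "y \<in> Hom C X X" "x \<boxplus> y = HZero C X X" using add_inv by blast
      then show "\<exists>y \<in> Hom C X X. y \<boxplus> x = HZero C X X" using add_comm[OF x] by metis
    qed (fact add_hom zero_hom[OF X X] add_assoc add_comm add_zero_left)+
    show "Group.monoid (End_ring C X)"
      by (rule monoidI, unfold E)
        (fact comp_hom ident_hom[OF X] comp_assoc comp_ident_left comp_ident_right | erule (2) comp_assoc
          | erule (1) comp_hom)+
  next
    fix x y z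
    assume *: "x \<in> carrier (End_ring C X)" "y \<in> carrier (End_ring C X)" "z \<in> carrier (End_ring C X)"
    note * = *[unfolded E]
    show "(x \<oplus>\<^bsub>End_ring C X\<^esub> y) \<otimes>\<^bsub>End_ring C X\<^esub> z
        = x \<otimes>\<^bsub>End_ring C X\<^esub> z \<oplus>\<^bsub>End_ring C X\<^esub> y \<otimes>\<^bsub>End_ring C X\<^esub> z"
      using comp_add_left[OF *(3,1,2)] by (simp add: E)
    show "z \<otimes>\<^bsub>End_ring C X\<^esub> (x \<oplus>\<^bsub>End_ring C X\<^esub> y)
        = z \<otimes>\<^bsub>End_ring C X\<^esub> x \<oplus>\<^bsub>End_ring C X\<^esub> z \<otimes>\<^bsub>End_ring C X\<^esub> y"
      using comp_add_right[OF *(1,2,3)] by (simp add: E)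
  qed
qed

lemma chain_mapsD:
  assumes "u \<in> chain_maps C f g"
  shows "fst u \<in> Hom C (Dom C f) (Dom C g)" "snd u \<in> Hom C (Cod C f) (Cod C g)"
    "snd u \<cdot> f = g \<cdot> fst u"
  using assms by (auto simp: chain_maps_def)

lemma homotopic_refl:
  assumes "u \<in> chain_maps C f g" "f \<in> Arr C" "g \<in> Arr C"
  shows "homotopic C f g u u"
proof -
  have f: "f \<in> Hom C (Dom C f) (Cod C f)" and g: "g \<in> Hom C (Dom C g) (Cod C g)"
    using assms by (auto simp: Hom_def)
  then show ?thesis
    unfolding homotopic_def using chain_mapsD[OF assms(1)] Hom_objD[OF f] Hom_objD[OF g]
    by (intro bexI[of _ "HZero C (Cod C f) (Dom C g)"])
       (auto simp: comp_zero[OF f] zero_comp[OF g] add_zero zero_hom)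
qed

lemma homotopic_sym:
  assumes h: "homotopic C f g u v" and u: "u \<in> chain_maps C f g" and v: "v \<in> chain_maps C f g"
    and fg: "f \<in> Arr C" "g \<in> Arr C"
  shows "homotopic C f g v u"
proof -
  have f: "f \<in> Hom C (Dom C f) (Cod C f)" and g: "g \<in> Hom C (Dom C g) (Cod C g)"
    using fg by (auto simp: Hom_def)
  obtain h where h: "h \<in> Hom C (Cod C f) (Dom C g)" "fst u = fst v \<boxplus> h \<cdot> f" "snd u = snd v \<boxplus> g \<cdot> h"
    using h by (auto simp: homotopic_def)
  obtain k where k: "k \<in> Hom C (Cod C f) (Dom C g)" "h \<boxplus> k = HZero C (Cod C f) (Dom C g)"
    using add_inv[OF h(1)] by auto
  have "h \<cdot> f \<boxplus> k \<cdot> f = HZero C (Dom C f) (Dom C g)"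
    using comp_add_left[OF f h(1) k(1)] k(2) comp_zero[OF f] Hom_objD[OF g] by simp
  moreover have "g \<cdot> h \<boxplus> g \<cdot> k = HZero C (Cod C f) (Cod C g)"
    using comp_add_right[OF h(1) k(1) g] k(2) zero_comp[OF g] Hom_objD[OF f] by simp
  ultimately have "fst v = fst u \<boxplus> k \<cdot> f" "snd v = snd u \<boxplus> g \<cdot> k"
    using h k chain_mapsD[OF v] by (simp_all add: add_assoc comp_hom[OF f] comp_hom[OF _ g] add_zero)
  then show ?thesis using k by (auto simp: homotopic_def)
qed

lemma homotopic_trans:
  assumes "homotopic C f g u v" "homotopic C f g v w" and w: "w \<in> chain_maps C f g"
    and fg: "f \<in> Arr C" "g \<in> Arr C"
  shows "homotopic C f g u w"
proof -
  have f: "f \<in> Hom C (Dom C f) (Cod C f)" and g: "g \<in> Hom C (Dom C g) (Cod C g)"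
    using fg by (auto simp: Hom_def)
  obtain h where h: "h \<in> Hom C (Cod C f) (Dom C g)" "fst u = fst v \<boxplus> h \<cdot> f" "snd u = snd v \<boxplus> g \<cdot> h"
    using assms(1) by (auto simp: homotopic_def)
  obtain k where k: "k \<in> Hom C (Cod C f) (Dom C g)" "fst v = fst w \<boxplus> k \<cdot> f" "snd v = snd w \<boxplus> g \<cdot> k"
    using assms(2) by (auto simp: homotopic_def)
  have "fst u = fst w \<boxplus> (k \<boxplus> h) \<cdot> f" "snd u = snd w \<boxplus> g \<cdot> (k \<boxplus> h)"
    using h k chain_mapsD[OF w]
    by (simp_all add: add_assoc comp_hom[OF f] comp_hom[OF _ g] comp_add_left[OF f] comp_add_right[OF _ _ g])
  then show ?thesis using h k add_hom by (auto simp: homotopic_def)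
qed

lemma chain_maps_comp:
  assumes "u \<in> chain_maps C f g" "v \<in> chain_maps C g h" "f \<in> Arr C" "g \<in> Arr C" "h \<in> Arr C"
  shows "(fst v \<cdot> fst u, snd v \<cdot> snd u) \<in> chain_maps C f h"
proof -
  have f: "f \<in> Hom C (Dom C f) (Cod C f)" and g: "g \<in> Hom C (Dom C g) (Cod C g)"
    and h: "h \<in> Hom C (Dom C h) (Cod C h)" using assms by (auto simp: Hom_def)
  note u = chain_mapsD[OF assms(1)] and v = chain_mapsD[OF assms(2)]
  have "snd v \<cdot> snd u \<cdot> f = snd v \<cdot> (g \<cdot> fst u)" using comp_assoc[OF f u(2) v(2)] u(3) by simp
  also have "\<dots> = h \<cdot> fst v \<cdot> fst u" using comp_assoc[OF u(1) g v(2)] v(3) by simp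
  also have "\<dots> = h \<cdot> (fst v \<cdot> fst u)" using comp_assoc[OF u(1) v(1) h] .
  finally show ?thesis using comp_hom[OF u(1) v(1)] comp_hom[OF u(2) v(2)] by (auto simp: chain_maps_def)
qed

lemma homotopic_comp:
  assumes hu: "homotopic C f g u u'" and hv: "homotopic C g h v v'"
    and cm: "u \<in> chain_maps C f g" "v \<in> chain_maps C g h" "u' \<in> chain_maps C f g" "v' \<in> chain_maps C g h"
    and arr: "f \<in> Arr C" "g \<in> Arr C" "h \<in> Arr C"
  shows "homotopic C f h (fst v \<cdot> fst u, snd v \<cdot> snd u) (fst v' \<cdot> fst u', snd v' \<cdot> snd u')"
proof -
  have f: "f \<in> Hom C (Dom C f) (Cod C f)" and g: "g \<in> Hom C (Dom C g) (Cod C g)"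
    and h: "h \<in> Hom C (Dom C h) (Cod C h)" using arr by (auto simp: Hom_def)
  note u = chain_mapsD[OF cm(1)] and v = chain_mapsD[OF cm(2)]
  note u' = chain_mapsD[OF cm(3)] and v' = chain_mapsD[OF cm(4)]
  obtain s where s: "s \<in> Hom C (Cod C f) (Dom C g)" "fst u = fst u' \<boxplus> s \<cdot> f" "snd u = snd u' \<boxplus> g \<cdot> s"
    using hu by (auto simp: homotopic_def)
  obtain t where t: "t \<in> Hom C (Cod C g) (Dom C h)" "fst v = fst v' \<boxplus> t \<cdot> g" "snd v = snd v' \<boxplus> h \<cdot> t"
    using hv by (auto simp: homotopic_def)
  define k where "k = fst v' \<cdot> s \<boxplus> t \<cdot> snd u"
  have k: "k \<in> Hom C (Cod C f) (Dom C h)"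
    unfolding k_def by (intro add_hom comp_hom[OF s(1) v'(1)] comp_hom[OF u(2) t(1)])
  have sf: "s \<cdot> f \<in> Hom C (Dom C f) (Dom C g)" and gs: "g \<cdot> s \<in> Hom C (Cod C f) (Cod C g)"
    and tg: "t \<cdot> g \<in> Hom C (Dom C g) (Dom C h)" and ht: "h \<cdot> t \<in> Hom C (Cod C g) (Cod C h)"
    using comp_hom f g h s t by blast+
  have "fst v \<cdot> fst u = fst v' \<cdot> fst u \<boxplus> t \<cdot> g \<cdot> fst u"
    using comp_add_left[OF u(1) v'(1) tg] t(2) by simp
  also have "t \<cdot> g \<cdot> fst u = t \<cdot> snd u \<cdot> f"
    using comp_assoc[OF u(1) g t(1)] comp_assoc[OF f u(2) t(1)] u(3) by simp
  also have "fst v' \<cdot> fst u = fst v' \<cdot> fst u' \<boxplus> fst v' \<cdot> s \<cdot> f"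
    using comp_add_right[OF u'(1) sf v'(1)] s(2) comp_assoc[OF f s(1) v'(1)] by simp
  also have "fst v' \<cdot> fst u' \<boxplus> fst v' \<cdot> s \<cdot> f \<boxplus> t \<cdot> snd u \<cdot> f
      = fst v' \<cdot> fst u' \<boxplus> (fst v' \<cdot> s \<cdot> f \<boxplus> t \<cdot> snd u \<cdot> f)"
    by (rule add_assoc[OF comp_hom[OF u'(1) v'(1)] comp_hom[OF f comp_hom[OF s(1) v'(1)]]
          comp_hom[OF f comp_hom[OF u(2) t(1)]]])
  also have "fst v' \<cdot> s \<cdot> f \<boxplus> t \<cdot> snd u \<cdot> f = k \<cdot> f"
    unfolding k_def using comp_add_left[OF f comp_hom[OF s(1) v'(1)] comp_hom[OF u(2) t(1)]] by simp
  finally have 1: "fst v \<cdot> fst u = fst v' \<cdot> fst u' \<boxplus> k \<cdot> f" .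
  have "snd v \<cdot> snd u = snd v' \<cdot> snd u \<boxplus> h \<cdot> t \<cdot> snd u"
    using comp_add_left[OF u(2) v'(2) ht] t(3) by simp
  also have "h \<cdot> t \<cdot> snd u = h \<cdot> (t \<cdot> snd u)" using comp_assoc[OF u(2) t(1) h] .
  also have "snd v' \<cdot> snd u = snd v' \<cdot> snd u' \<boxplus> snd v' \<cdot> g \<cdot> s"
    using comp_add_right[OF u'(2) gs v'(2)] s(3) comp_assoc[OF s(1) g v'(2)] by simp
  also have "snd v' \<cdot> g \<cdot> s = h \<cdot> (fst v' \<cdot> s)" using comp_assoc[OF s(1) v'(1) h] v'(3) by simp
  also have "snd v' \<cdot> snd u' \<boxplus> h \<cdot> (fst v' \<cdot> s) \<boxplus> h \<cdot> (t \<cdot> snd u)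
      = snd v' \<cdot> snd u' \<boxplus> (h \<cdot> (fst v' \<cdot> s) \<boxplus> h \<cdot> (t \<cdot> snd u))"
    by (rule add_assoc[OF comp_hom[OF u'(2) v'(2)] comp_hom[OF comp_hom[OF s(1) v'(1)] h]
          comp_hom[OF comp_hom[OF u(2) t(1)] h]])
  also have "h \<cdot> (fst v' \<cdot> s) \<boxplus> h \<cdot> (t \<cdot> snd u) = h \<cdot> k"
    unfolding k_def using comp_add_right[OF comp_hom[OF s(1) v'(1)] comp_hom[OF u(2) t(1)] h] by simp
  finally have 2: "snd v \<cdot> snd u = snd v' \<cdot> snd u' \<boxplus> h \<cdot> k" .
  show ?thesis using k 1 2 by (auto simp: homotopic_def)
qed

lemma homotopy_class_eq:
  assumes "homotopic C f g u v" "u \<in> chain_maps C f g" "v \<in> chain_maps C f g" "f \<in> Arr C" "g \<in> Arr C"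
  shows "homotopy_class C f g u = homotopy_class C f g v"
  using assms homotopic_trans homotopic_sym unfolding homotopy_class_def by blast

lemma K_comp:
  assumes u: "u \<in> chain_maps C f g" and v: "v \<in> chain_maps C g h"
    and arr: "f \<in> Arr C" "g \<in> Arr C" "h \<in> Arr C"
  shows "(g, homotopy_class C g h v, h) \<cdot>\<^bsub>K_cat C\<^esub> (f, homotopy_class C f g u, g')
    = (f, homotopy_class C f h (fst v \<cdot> fst u, snd v \<cdot> snd u), h)"
proof -
  have eq: "homotopy_class C f h (fst v' \<cdot> fst u', snd v' \<cdot> snd u')
      = homotopy_class C f h (fst v \<cdot> fst u, snd v \<cdot> snd u)"
    if "u' \<in> homotopy_class C f g u" "v' \<in> homotopy_class C g h v" for u' v'
  proof -
    have u': "u' \<in> chain_maps C f g" "homotopic C f g u u'"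
      and v': "v' \<in> chain_maps C g h" "homotopic C g h v v'"
      using that by (simp_all add: homotopy_class_def)
    show ?thesis
      by (rule homotopy_class_eq[OF homotopic_comp[OF u'(2) v'(2) u v u'(1) v'(1) arr]
          chain_maps_comp[OF u v arr] chain_maps_comp[OF u'(1) v'(1) arr] arr(1,3), symmetric])
  qed
  have mem: "u \<in> homotopy_class C f g u" "v \<in> homotopy_class C g h v"
    using u v homotopic_refl[OF u arr(1,2)] homotopic_refl[OF v arr(2,3)]
    by (simp_all add: homotopy_class_def)
  have "(\<Union>v' \<in> homotopy_class C g h v. \<Union>u' \<in> homotopy_class C f g u.
      homotopy_class C f h (fst v' \<cdot> fst u', snd v' \<cdot> snd u'))
      = homotopy_class C f h (fst v \<cdot> fst u, snd v \<cdot> snd u)"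
  proof (intro equalityI subsetI)
    fix x assume "x \<in> homotopy_class C f h (fst v \<cdot> fst u, snd v \<cdot> snd u)"
    then show "x \<in> (\<Union>v' \<in> homotopy_class C g h v. \<Union>u' \<in> homotopy_class C f g u.
      homotopy_class C f h (fst v' \<cdot> fst u', snd v' \<cdot> snd u'))" using mem by blast
  qed (use eq in blast)
  then show ?thesis by (simp add: K_cat_def split_beta)
qed

lemma K_HomE:
  assumes "F \<in> Hom (K_cat C) f g"
  obtains u where "u \<in> chain_maps C f g" "F = (f, homotopy_class C f g u, g)"
    "f \<in> Arr C" "g \<in> Arr C" "is_monic C f" "is_monic C g"
  using assms by (auto simp: Hom_def K_cat_def is_monic_def)

lemma K_HomI:
  assumes "u \<in> chain_maps C f g" "is_monic C f" "is_monic C g"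
  shows "(f, homotopy_class C f g u, g) \<in> Hom (K_cat C) f g"
proof -
  have "(f, homotopy_class C f g u, g) \<in> Arr (K_cat C)"
    unfolding K_cat_def cat.simps using assms by blast
  then show ?thesis by (simp add: Hom_def K_cat_def)
qed

lemma chain_maps_ident:
  assumes "f \<in> Arr C"
  shows "(Ident C (Dom C f), Ident C (Cod C f)) \<in> chain_maps C f f"
proof -
  have f: "f \<in> Hom C (Dom C f) (Cod C f)" using assms by (simp add: Hom_def)
  show ?thesis
    using ident_hom Hom_objD[OF f] comp_ident_left[OF f] comp_ident_right[OF f]
    by (simp add: chain_maps_def)
qed

theorem category_K_cat: "category (K_cat C)"
proof
  fix F assume "F \<in> Arr (K_cat C)"
  then show "Dom (K_cat C) F \<in> Obj (K_cat C)" "Cod (K_cat C) F \<in> Obj (K_cat C)"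
    by (auto simp: K_cat_def)
next
  fix f assume "f \<in> Obj (K_cat C)"
  then have f: "is_monic C f" "f \<in> Arr C" by (auto simp: K_cat_def is_monic_def)
  from K_HomI[OF chain_maps_ident[OF f(2)] f(1) f(1)]
  show "Ident (K_cat C) f \<in> Hom (K_cat C) f f" by (simp add: K_cat_def)
next
  fix F G f g h assume F: "F \<in> Hom (K_cat C) f g" and G: "G \<in> Hom (K_cat C) g h"
  obtain u where u: "F = (f, homotopy_class C f g u, g)" "u \<in> chain_maps C f g" "f \<in> Arr C"
    "g \<in> Arr C" "is_monic C f" using F by (rule K_HomE)
  obtain v where v: "G = (g, homotopy_class C g h v, h)" "v \<in> chain_maps C g h" "h \<in> Arr C"
    "is_monic C h" using G by (rule K_HomE)
  show "G \<cdot>\<^bsub>K_cat C\<^esub> F \<in> Hom (K_cat C) f h"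
    unfolding u(1) v(1) K_comp[OF u(2) v(2) u(3,4) v(3)]
    by (rule K_HomI[OF chain_maps_comp[OF u(2) v(2) u(3,4) v(3)] u(5) v(4)])
next
  fix F f g assume "F \<in> Hom (K_cat C) f g"
  then obtain u where u: "u \<in> chain_maps C f g" "F = (f, homotopy_class C f g u, g)"
    "f \<in> Arr C" "g \<in> Arr C" by (rule K_HomE)
  have id: "Ident (K_cat C) k = (k, homotopy_class C k k (Ident C (Dom C k), Ident C (Cod C k)), k)" for k
    by (simp add: K_cat_def)
  show "Ident (K_cat C) g \<cdot>\<^bsub>K_cat C\<^esub> F = F"
    using K_comp[OF u(1) chain_maps_ident[OF u(4)] u(3,4,4)] chain_mapsD[OF u(1)]
    by (simp add: id u(2) comp_ident_left)
  show "F \<cdot>\<^bsub>K_cat C\<^esub> Ident (K_cat C) f = F"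
    using K_comp[OF chain_maps_ident[OF u(3)] u(1) u(3,3,4)] chain_mapsD[OF u(1)]
    by (simp add: id u(2) comp_ident_right)
next
  fix F G H e f g h
  assume FGH: "F \<in> Hom (K_cat C) e f" "G \<in> Hom (K_cat C) f g" "H \<in> Hom (K_cat C) g h"
  obtain u where F: "F = (e, homotopy_class C e f u, f)" and u: "u \<in> chain_maps C e f"
    and ef: "e \<in> Arr C" "f \<in> Arr C" using FGH(1) by (rule K_HomE)
  obtain v where G: "G = (f, homotopy_class C f g v, g)" and v: "v \<in> chain_maps C f g"
    using FGH(2) by (rule K_HomE)
  obtain w where H: "H = (g, homotopy_class C g h w, h)" and w: "w \<in> chain_maps C g h"
    and gh: "g \<in> Arr C" "h \<in> Arr C" using FGH(3) by (rule K_HomE)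
  note cm = u v w and arr = ef gh
  note vu = chain_maps_comp[OF cm(1,2) arr(1,2,3)] and wv = chain_maps_comp[OF cm(2,3) arr(2,3,4)]
  note d = chain_mapsD[OF cm(1)] chain_mapsD[OF cm(2)] chain_mapsD[OF cm(3)]
  show "H \<cdot>\<^bsub>K_cat C\<^esub> G \<cdot>\<^bsub>K_cat C\<^esub> F = H \<cdot>\<^bsub>K_cat C\<^esub> (G \<cdot>\<^bsub>K_cat C\<^esub> F)"
    unfolding F G H K_comp[OF cm(1,2) arr(1,2,3)] K_comp[OF cm(2,3) arr(2,3,4)]
      K_comp[OF vu cm(3) arr(1,3,4)] K_comp[OF cm(1) wv arr(1,2,4)]
    by (simp add: comp_assoc[OF d(1,4,7)] comp_assoc[OF d(2,5,8)])
qed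

theorem category_left_associated_abelian: "category (left_associated_abelian C)"
  unfolding left_associated_abelian_def by (rule category.category_localization[OF category_K_cat])

end

lemma module_homs_compose:
  assumes "f \<in> module_homs R L M" "g \<in> module_homs R M N" "right_module R L"
  shows "compose (carrier L) g f \<in> module_homs R L N"
proof -
  interpret L: right_module R L by fact
  show ?thesis using assms by (auto simp: module_homs_def compose_def PiE_iff L.smult_closed)
qed

lemma mod_HomE:
  assumes "F \<in> Hom (mod_cat R) M N"
  obtains f where "F = (M, f, N)" "f \<in> module_homs R M N" "right_module R M" "right_module R N"
    "finitely_generated_module R M" "finitely_generated_module R N"
  using assms by (auto simp: Hom_def mod_cat_def)

lemma mod_HomI:
  assumes "f \<in> module_homs R M N" "right_module R M" "right_module R N"
    "finitely_generated_module R M" "finitely_generated_module R N"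
  shows "(M, f, N) \<in> Hom (mod_cat R) M N"
  using assms by (simp add: Hom_def mod_cat_def)

lemma mod_comp:
  "(M', g, N) \<cdot>\<^bsub>mod_cat R\<^esub> (M, f, M'') = (M, compose (carrier M) g f, N)"
  by (simp add: mod_cat_def)

theorem category_mod_cat: "category (mod_cat R)"
proof
  fix F assume "F \<in> Arr (mod_cat R)"
  then show "Dom (mod_cat R) F \<in> Obj (mod_cat R)" "Cod (mod_cat R) F \<in> Obj (mod_cat R)"
    by (auto simp: mod_cat_def)
next
  fix M assume "M \<in> Obj (mod_cat R)"
  then have M: "right_module R M" "finitely_generated_module R M" by (auto simp: mod_cat_def)
  interpret M: right_module R M by fact
  have "(\<lambda>x \<in> carrier M. x) \<in> module_homs R M M"
    by (auto simp: module_homs_def M.smult_closed)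
  from mod_HomI[OF this M(1,1,2,2)] show "Ident (mod_cat R) M \<in> Hom (mod_cat R) M M"
    by (simp add: mod_cat_def)
next
  fix F G L M N assume "F \<in> Hom (mod_cat R) L M" "G \<in> Hom (mod_cat R) M N"
  then show "G \<cdot>\<^bsub>mod_cat R\<^esub> F \<in> Hom (mod_cat R) L N"
    by (elim mod_HomE) (simp add: mod_comp mod_HomI module_homs_compose)
next
  fix F M N assume "F \<in> Hom (mod_cat R) M N"
  then obtain f where f: "F = (M, f, N)" "f \<in> carrier M \<rightarrow>\<^sub>E carrier N"
    by (auto elim!: mod_HomE simp: module_homs_def)
  have id: "Ident (mod_cat R) L = (L, (\<lambda>x \<in> carrier L. x), L)" for L
    by (simp add: mod_cat_def)
  show "Ident (mod_cat R) N \<cdot>\<^bsub>mod_cat R\<^esub> F = F" "F \<cdot>\<^bsub>mod_cat R\<^esub> Ident (mod_cat R) M = F"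
    using f(2) by (auto simp: f(1) id mod_comp compose_def fun_eq_iff PiE_iff extensional_def)
next
  fix F G H K L M N
  assume "F \<in> Hom (mod_cat R) K L" "G \<in> Hom (mod_cat R) L M" "H \<in> Hom (mod_cat R) M N"
  note FGH = this
  obtain f where f: "F = (K, f, L)" "f \<in> carrier K \<rightarrow> carrier L"
    using FGH(1) by (rule mod_HomE) (auto simp: module_homs_def)
  obtain g where g: "G = (L, g, M)" using FGH(2) by (rule mod_HomE)
  obtain h where h: "H = (M, h, N)" using FGH(3) by (rule mod_HomE)
  show "H \<cdot>\<^bsub>mod_cat R\<^esub> G \<cdot>\<^bsub>mod_cat R\<^esub> F = H \<cdot>\<^bsub>mod_cat R\<^esub> (G \<cdot>\<^bsub>mod_cat R\<^esub> F)"
    using compose_assoc[OF f(2), of h g] by (simp add: f(1) g h mod_comp)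
qed

text \<open>Every finitely generated right module, on any type, is isomorphic to an object of \<open>mod_cat\<close>.\<close>

theorem fg_right_module_representable:
  fixes M :: "('r, 'x, 'y) module_scheme"
  assumes M: "right_module R M" and fg: "finitely_generated_module R M"
  shows "\<exists>N \<in> Obj (mod_cat R). \<exists>f \<in> module_homs R M N. bij_betw f (carrier M) (carrier N)"
proof -
  interpret M: right_module R M by fact
  obtain A where A: "finite A" "A \<subseteq> carrier M"
    "\<And>x. x \<in> carrier M \<Longrightarrow> \<exists>c \<in> A \<rightarrow> carrier R. x = (\<Oplus>\<^bsub>M\<^esub>a\<in>A. c a \<odot>\<^bsub>M\<^esub> a)"
    using fg unfolding finitely_generated_module_def by blast
  obtain as where as: "set as = A" using finite_list[OF A(1)] by blast
  have "\<exists>e. \<forall>x \<in> carrier M. e x \<in> A \<rightarrow> carrier R \<and> x = (\<Oplus>\<^bsub>M\<^esub>a\<in>A. e x a \<odot>\<^bsub>M\<^esub> a)"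
    by (rule bchoice) (use A(3) in blast)
  then obtain e where e: "\<And>x. x \<in> carrier M \<Longrightarrow> e x \<in> A \<rightarrow> carrier R"
    "\<And>x. x \<in> carrier M \<Longrightarrow> x = (\<Oplus>\<^bsub>M\<^esub>a\<in>A. e x a \<odot>\<^bsub>M\<^esub> a)" by blast
  define l where "l = (\<lambda>x. map (e x) as)"
  have inj: "inj_on l (carrier M)"
  proof (rule inj_onI)
    fix x y assume xy: "x \<in> carrier M" "y \<in> carrier M" "l x = l y"
    then have eq: "\<And>a. a \<in> A \<Longrightarrow> e x a = e y a" by (auto simp: l_def as)
    have "(\<Oplus>\<^bsub>M\<^esub>a\<in>A. e x a \<odot>\<^bsub>M\<^esub> a) = (\<Oplus>\<^bsub>M\<^esub>a\<in>A. e y a \<odot>\<^bsub>M\<^esub> a)"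
    proof (rule M.finsum_cong')
      show "(\<lambda>a. e y a \<odot>\<^bsub>M\<^esub> a) \<in> A \<rightarrow> carrier M"
        using e(1)[OF xy(2)] A(2) M.smult_closed by blast
    qed (auto simp: eq)
    then show "x = y" using e(2) xy by metis
  qed
  define p where "p = inv_into (carrier M) l"
  have pl: "\<And>x. x \<in> carrier M \<Longrightarrow> p (l x) = x" using inj by (simp add: p_def)
  define N :: "('r, 'r list) module" where
    "N = \<lparr>carrier = l ` carrier M, mult = undefined, one = undefined, zero = l \<zero>\<^bsub>M\<^esub>,
       add = (\<lambda>u v. l (p u \<oplus>\<^bsub>M\<^esub> p v)), smult = (\<lambda>r u. l (r \<odot>\<^bsub>M\<^esub> p u))\<rparr>"
  have N: "carrier N = l ` carrier M" "\<zero>\<^bsub>N\<^esub> = l \<zero>\<^bsub>M\<^esub>"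
    "\<And>x y. x \<in> carrier M \<Longrightarrow> y \<in> carrier M \<Longrightarrow> l x \<oplus>\<^bsub>N\<^esub> l y = l (x \<oplus>\<^bsub>M\<^esub> y)"
    "\<And>r x. x \<in> carrier M \<Longrightarrow> r \<odot>\<^bsub>N\<^esub> l x = l (r \<odot>\<^bsub>M\<^esub> x)"
    by (auto simp: N_def pl)
  interpret N: abelian_group N
  proof (rule abelian_groupI)
    fix u assume "u \<in> carrier N"
    then obtain x where x: "x \<in> carrier M" "u = l x" by (auto simp: N)
    have "l (\<ominus>\<^bsub>M\<^esub> x) \<oplus>\<^bsub>N\<^esub> u = \<zero>\<^bsub>N\<^esub>" using x by (simp add: N M.l_neg)
    then show "\<exists>v \<in> carrier N. v \<oplus>\<^bsub>N\<^esub> u = \<zero>\<^bsub>N\<^esub>" using x by (auto simp: N)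
  qed (auto simp: N M.a_ac)
  have NM: "right_module R N"
    by unfold_locales (auto simp: N M.smult_closed M.smult_add_ring M.smult_add_module
        M.smult_assoc M.smult_one)
  have fin: "l (\<Oplus>\<^bsub>M\<^esub>a\<in>B. g a) = (\<Oplus>\<^bsub>N\<^esub>a\<in>B. l (g a))" if "finite B" "g \<in> B \<rightarrow> carrier M" for B g
    using that
  proof (induction B rule: finite_induct)
    case empty
    then show ?case by (simp add: N)
  next
    case (insert b B)
    then have "g \<in> B \<rightarrow> carrier M" "g b \<in> carrier M" by auto
    moreover have "(\<lambda>a. l (g a)) \<in> B \<rightarrow> carrier N" "l (g b) \<in> carrier N"
      using insert.prems by (auto simp: N)
    ultimately show ?case using insert by (simp add: N(3)[symmetric])
  qed
  have "finitely_generated_module R N"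
    unfolding finitely_generated_module_def
  proof (intro exI[of _ "l ` A"] conjI ballI)
    show "finite (l ` A)" "l ` A \<subseteq> carrier N" using A by (auto simp: N)
    fix u assume "u \<in> carrier N"
    then obtain x where x: "x \<in> carrier M" "u = l x" by (auto simp: N)
    have g: "(\<lambda>a. e x a \<odot>\<^bsub>M\<^esub> a) \<in> A \<rightarrow> carrier M" using e(1)[OF x(1)] A(2) M.smult_closed by blast
    have "u = (\<Oplus>\<^bsub>N\<^esub>a\<in>A. l (e x a \<odot>\<^bsub>M\<^esub> a))" using fin[OF A(1) g] e(2) x by metis
    also have "\<dots> = (\<Oplus>\<^bsub>N\<^esub>a\<in>A. e x (p (l a)) \<odot>\<^bsub>N\<^esub> l a)"
    proof (rule N.finsum_cong')
      show "(\<lambda>a. e x (p (l a)) \<odot>\<^bsub>N\<^esub> l a) \<in> A \<rightarrow> carrier N"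
        using A(2) g by (auto simp: N pl subset_iff)
    qed (use A(2) in \<open>auto simp: N pl subset_iff\<close>)
    also have "\<dots> = (\<Oplus>\<^bsub>N\<^esub>b\<in>l ` A. e x (p b) \<odot>\<^bsub>N\<^esub> b)"
    proof (rule N.finsum_reindex[symmetric])
      show "(\<lambda>b. e x (p b) \<odot>\<^bsub>N\<^esub> b) \<in> l ` A \<rightarrow> carrier N"
        using A(2) g by (auto simp: N pl subset_iff)
      show "inj_on l A" using inj A(2) by (rule inj_on_subset)
    qed
    finally have "u = (\<Oplus>\<^bsub>N\<^esub>b\<in>l ` A. e x (p b) \<odot>\<^bsub>N\<^esub> b)" .
    moreover have "(\<lambda>b. e x (p b)) \<in> l ` A \<rightarrow> carrier R"
      using e(1)[OF x(1)] A(2) by (auto simp: pl subset_iff)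
    ultimately show "\<exists>c \<in> l ` A \<rightarrow> carrier R. u = (\<Oplus>\<^bsub>N\<^esub>b\<in>l ` A. c b \<odot>\<^bsub>N\<^esub> b)"
      by (intro bexI[of _ "\<lambda>b. e x (p b)"])
  qed
  moreover have "restrict l (carrier M) \<in> module_homs R M N"
    by (auto simp: module_homs_def N M.smult_closed)
  moreover have "bij_betw (restrict l (carrier M)) (carrier M) (carrier N)"
    using inj by (auto simp: bij_betw_def N inj_on_def)
  moreover have "N \<in> Obj (mod_cat R) \<longleftrightarrow> right_module R N \<and> finitely_generated_module R N"
    by (simp add: mod_cat_def)
  ultimately show ?thesis using NM by blast
qed

end

theory Submission
  imports Defs
begin

text \<open>
  Pulling back \<open>f : X \<rightarrow> Y\<close> along a strict epimorphism \<open>e : W \<rightarrow> Y\<close> gives a regular morphism onto \<open>f\<close>,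
  and a morphism of \<open>\<K>\<close> is regular only if it is a bijection of sheaves for the topology of strict
  epimorphisms. Hence a zigzag from \<open>f\<close> to \<open>f'\<close> acts on generalised elements \<open>W \<rightarrow> Cod f\<close> modulo \<open>f\<close> as a
  densely defined partial function, and it is determined by this function up to equality in the
  localization; no calculus of fractions is needed.

  If \<open>P\<close> is a strong projective generator, evaluation at \<open>P\<close> turns these partial functions into linear
  maps between the modules \<open>Hom(P, Cod f) / f Hom(P, Dom f)\<close>. In the noetherian case the submodules of
  \<open>Hom(P, X)\<close> are exactly the \<open>m Hom(P, _)\<close> for subobjects \<open>m\<close> of \<open>X\<close>, which yields the equivalence and
  the chain conditions on \<open>End(P)\<close>.

  Conversely, let \<open>f\<close> correspond to the module \<open>\<Lambda>\<close>. The epimorphism from \<open>0 \<rightarrow> Cod f\<close> to \<open>f\<close> splits by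
  projectivity, so \<open>f\<close> is isomorphic to \<open>0 \<rightarrow> P\<close> for a retract \<open>P\<close> of \<open>Cod f\<close>, and \<open>P\<close> is the generator
  sought. Every right ideal \<open>J\<close> is finitely generated because \<open>\<Lambda> / J\<close> is again in the image of the
  equivalence, so a right artinian \<open>\<Lambda>\<close> is right noetherian without appeal to Hopkins' theorem.
\<close>

section \<open>Equivalences of categories expressed by full, faithful and essentially surjective
  functors\<close>

section \<open>Fully faithful functors and equivalences\<close>

text \<open>The localization offers no normal form for its arrows, so each statement about it needs
  an invariant of zigzags (\<open>zz_rel_agree\<close>) and a proof that the invariant is complete
  (\<open>zigzag_eqI\<close>). Two zigzags that are equal in L need not define the same partial
  function: cancelling a backward step against the forward step after it enlarges the domain.
  Agreement can only be asked where both are defined, and the density of the domains makes up for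
  the rest.

  The given equivalence is one of plain categories, and the arrows of L carry no addition here. In
  the converse direction the structure of Hom(P, X) as a module must therefore be recovered from
  categorical data: sums from biproducts and the zero object, scalars from composition with
  endomorphisms of P.

  A strong projective generator provides covers by coproducts over arbitrary index sets, while
  finitely generated modules require finite ones. The noetherian condition bridges this gap: a
  maximal subobject among the images of finite sums of P is the whole object.\<close>

lemma Hom_iff: "f \<in> Hom C X Y \<longleftrightarrow> f \<in> Arr C \<and> Dom C f = X \<and> Cod C f = Y"
  by (simp add: Hom_def)

context category
begin

lemma comp_arr [simp]:
  assumes "f \<in> Arr C" "g \<in> Arr C" "Dom C g = Cod C f"
  shows "g \<cdot> f \<in> Arr C" "Dom C (g \<cdot> f) = Dom C f" "Cod C (g \<cdot> f) = Cod C g"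
  using comp_hom[of f "Dom C f" "Cod C f" g "Cod C g"] assms by (auto simp: Hom_def)

lemma dom_cod_obj [simp]: "f \<in> Arr C \<Longrightarrow> Dom C f \<in> Obj C" "f \<in> Arr C \<Longrightarrow> Cod C f \<in> Obj C"
  using dom_obj cod_obj by auto

lemma ident_arr [simp]:
  "X \<in> Obj C \<Longrightarrow> Ident C X \<in> Arr C" "X \<in> Obj C \<Longrightarrow> Dom C (Ident C X) = X"
  "X \<in> Obj C \<Longrightarrow> Cod C (Ident C X) = X"
  using ident_hom[of X] by (auto simp: Hom_def)

lemma comp_ident [simp]:
  "f \<in> Arr C \<Longrightarrow> Cod C f = Y \<Longrightarrow> Ident C Y \<cdot> f = f"
  "f \<in> Arr C \<Longrightarrow> Dom C f = X \<Longrightarrow> f \<cdot> Ident C X = f"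
  using comp_ident_left[of f "Dom C f" Y] comp_ident_right[of f X "Cod C f"] by (auto simp: Hom_def)

lemma assoc:
  "\<lbrakk>f \<in> Arr C; g \<in> Arr C; h \<in> Arr C; Dom C g = Cod C f; Dom C h = Cod C g\<rbrakk> \<Longrightarrow>
    (h \<cdot> g) \<cdot> f = h \<cdot> (g \<cdot> f)"
  using comp_assoc[of f "Dom C f" "Cod C f" g "Cod C g" h "Cod C h"] by (auto simp: Hom_def)

lemma assoc_reduce:
  "\<lbrakk>h \<cdot> g = k; f \<in> Arr C; g \<in> Arr C; h \<in> Arr C; Dom C g = Cod C f; Dom C h = Cod C g\<rbrakk> \<Longrightarrow>
    h \<cdot> (g \<cdot> f) = k \<cdot> f"
  using assoc[of f g h] by simp

end

definition fully_faithful ::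
  "('o, 'm, 'z) cat_scheme \<Rightarrow> ('p, 'n, 'y) cat_scheme \<Rightarrow> ('o \<Rightarrow> 'p) \<Rightarrow> ('m \<Rightarrow> 'n) \<Rightarrow> bool" where
  "fully_faithful C D Fo Fa \<longleftrightarrow> (\<forall>X \<in> Obj C. \<forall>Y \<in> Obj C.
     bij_betw Fa (Hom C X Y) (Hom D (Fo X) (Fo Y)))"

definition essentially_surjective ::
  "('o, 'm, 'z) cat_scheme \<Rightarrow> ('p, 'n, 'y) cat_scheme \<Rightarrow> ('o \<Rightarrow> 'p) \<Rightarrow> bool" where
  "essentially_surjective C D Fo \<longleftrightarrow> (\<forall>Y \<in> Obj D. \<exists>X \<in> Obj C. \<exists>e. e \<in> Hom D (Fo X) Y \<and> is_iso_arrow D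
      e)"

lemma functorD:
  assumes "is_functor C D Fo Fa"
  shows "X \<in> Obj C \<Longrightarrow> Fo X \<in> Obj D"
    "f \<in> Hom C X Y \<Longrightarrow> Fa f \<in> Hom D (Fo X) (Fo Y)"
    "X \<in> Obj C \<Longrightarrow> Fa (Ident C X) = Ident D (Fo X)"
    "f \<in> Hom C X Y \<Longrightarrow> g \<in> Hom C Y Z \<Longrightarrow> Fa (g \<cdot>\<^bsub>C\<^esub> f) = Fa g \<cdot>\<^bsub>D\<^esub> Fa f"
  using assms by (auto simp: is_functor_def Hom_def)

lemma isoE:
  assumes "is_iso_arrow C f" "f \<in> Hom C X Y"
  obtains g where "g \<in> Hom C Y X" "g \<cdot>\<^bsub>C\<^esub> f = Ident C X" "f \<cdot>\<^bsub>C\<^esub> g = Ident C Y"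
  using assms(1) that HomD(2,3)[OF assms(2)] unfolding is_iso_arrow_def by metis

lemma isoI:
  assumes "f \<in> Hom C X Y" "g \<in> Hom C Y X" "g \<cdot>\<^bsub>C\<^esub> f = Ident C X" "f \<cdot>\<^bsub>C\<^esub> g = Ident C Y"
  shows "is_iso_arrow C f"
  using assms(2-4) HomD[OF assms(1)] unfolding is_iso_arrow_def by metis

lemma (in category) iso_cancel:
  assumes "is_iso_arrow C e" "e \<in> Hom C Y Z" "f \<in> Hom C X Y" "g \<in> Hom C X Y" "e \<cdot> f = e \<cdot> g"
  shows "f = g"
proof -
  obtain d where d: "d \<in> Hom C Z Y" "d \<cdot> e = Ident C Y" using assms(1,2) by (rule isoE)
  have "h = d \<cdot> (e \<cdot> h)" if "h \<in> Hom C X Y" for h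
    using comp_assoc[OF that assms(2) d(1)] comp_ident_left[OF that] d(2) by metis
  then show ?thesis using assms(3-5) by metis
qed

lemma (in category) iso_cancel_right:
  assumes "is_iso_arrow C e" "e \<in> Hom C X Y" "f \<in> Hom C Y Z" "g \<in> Hom C Y Z" "f \<cdot> e = g \<cdot> e"
  shows "f = g"
proof -
  obtain d where d: "d \<in> Hom C Y X" "e \<cdot> d = Ident C Y" using assms(1,2) by (rule isoE)
  have "h = (h \<cdot> e) \<cdot> d" if "h \<in> Hom C Y Z" for h
    using comp_assoc[OF d(1) assms(2) that] comp_ident_right[OF that] d(2) by metis
  then show ?thesis using assms(3-5) by metis
qed

text \<open>The quasi-inverse is built from chosen isomorphisms \<open>ep Y\<close> from
  \<open>Fo (Go Y)\<close> to Y. On arrows it is then forced: \<open>Ga g\<close> is the unique h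
  for which \<open>Fa h\<close> completes the naturality square of \<open>ep\<close>. This
  uniqueness (\<open>Ga_eq\<close>) proves functoriality, and the unit is the preimage of the
  inverse of \<open>ep\<close>.\<close>

theorem equivalence_of_fully_faithful:
  fixes C :: "('o, 'm, 'z) cat_scheme" and D :: "('p, 'n, 'y) cat_scheme"
  assumes C: "category C" and D: "category D" and F: "is_functor C D Fo Fa"
    and ff: "fully_faithful C D Fo Fa" and es: "essentially_surjective C D Fo"
  shows "C \<approx>\<^sub>c D"
proof -
  interpret C: category C by fact
  interpret D: category D by fact
  \<comment> \<open>One choice yields the object and its isomorphism together, as the pair
    \<open>G Y\<close>.\<close>
  have "\<exists>G. \<forall>Y \<in> Obj D. fst (G Y) \<in> Obj C \<and> snd (G Y) \<in> Hom D (Fo (fst (G Y))) Y \<and> is_iso_arrow D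
      (snd (G Y))"
    by (rule bchoice) (use es in \<open>fastforce simp: essentially_surjective_def\<close>)
  then obtain G where G: "\<And>Y. Y \<in> Obj D \<Longrightarrow> fst (G Y) \<in> Obj C"
    "\<And>Y. Y \<in> Obj D \<Longrightarrow> snd (G Y) \<in> Hom D (Fo (fst (G Y))) Y"
    "\<And>Y. Y \<in> Obj D \<Longrightarrow> is_iso_arrow D (snd (G Y))" by blast
  define Go where "Go Y = fst (G Y)" for Y
  define ep where "ep Y = snd (G Y)" for Y
  note G = G[folded Go_def ep_def]
  have full: "\<exists>f \<in> Hom C X Y. Fa f = g" if "X \<in> Obj C" "Y \<in> Obj C" "g \<in> Hom D (Fo X) (Fo Y)" for X Y
      g
  proof -
    have "Fa ` Hom C X Y = Hom D (Fo X) (Fo Y)"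
      using ff that(1,2) by (simp add: fully_faithful_def bij_betw_def)
    then show ?thesis using that(3) by (metis imageE)
  qed
  have faithful: "f = f'" if "f \<in> Hom C X Y" "f' \<in> Hom C X Y" "Fa f = Fa f'" for f f' X Y
    using ff that C.Hom_objD[OF that(1)] unfolding fully_faithful_def bij_betw_def inj_on_def by
        blast
  have "\<exists>iv. \<forall>Y \<in> Obj D. iv Y \<in> Hom D Y (Fo (Go Y)) \<and> iv Y \<cdot>\<^bsub>D\<^esub> ep Y = Ident D (Fo (Go Y)) \<and>
      ep Y \<cdot>\<^bsub>D\<^esub> iv Y = Ident D Y"
  proof (rule bchoice, rule ballI)
    fix Y assume Y: "Y \<in> Obj D"
    obtain d where "d \<in> Hom D Y (Fo (Go Y))" "d \<cdot>\<^bsub>D\<^esub> ep Y = Ident D (Fo (Go Y))"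
      "ep Y \<cdot>\<^bsub>D\<^esub> d = Ident D Y" by (rule isoE[OF G(3)[OF Y] G(2)[OF Y]])
    then show "\<exists>d. d \<in> Hom D Y (Fo (Go Y)) \<and> d \<cdot>\<^bsub>D\<^esub> ep Y = Ident D (Fo (Go Y)) \<and>
        ep Y \<cdot>\<^bsub>D\<^esub> d = Ident D Y" by blast
  qed
  then obtain iv where iv: "\<And>Y. Y \<in> Obj D \<Longrightarrow> iv Y \<in> Hom D Y (Fo (Go Y))"
    "\<And>Y. Y \<in> Obj D \<Longrightarrow> iv Y \<cdot>\<^bsub>D\<^esub> ep Y = Ident D (Fo (Go Y))"
    "\<And>Y. Y \<in> Obj D \<Longrightarrow> ep Y \<cdot>\<^bsub>D\<^esub> iv Y = Ident D Y" by blast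
  have "\<exists>Ga. \<forall>g \<in> Arr D. Ga g \<in> Hom C (Go (Dom D g)) (Go (Cod D g)) \<and>
      Fa (Ga g) = iv (Cod D g) \<cdot>\<^bsub>D\<^esub> (g \<cdot>\<^bsub>D\<^esub> ep (Dom D g))"
  proof (rule bchoice, rule ballI)
    fix g assume g: "g \<in> Arr D"
    then have gH: "g \<in> Hom D (Dom D g) (Cod D g)" by (simp add: Hom_def)
    note o = D.dom_obj[OF g] D.cod_obj[OF g]
    from full[OF G(1)[OF o(1)] G(1)[OF o(2)] D.comp_hom[OF D.comp_hom[OF G(2)[OF o(1)] gH]
        iv(1)[OF o(2)]]]
    show "\<exists>h. h \<in> Hom C (Go (Dom D g)) (Go (Cod D g)) \<and>
        Fa h = iv (Cod D g) \<cdot>\<^bsub>D\<^esub> (g \<cdot>\<^bsub>D\<^esub> ep (Dom D g))" by blast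
  qed
  then obtain Ga where Ga: "\<And>g X Y. g \<in> Hom D X Y \<Longrightarrow> Ga g \<in> Hom C (Go X) (Go Y)"
    "\<And>g X Y. g \<in> Hom D X Y \<Longrightarrow> Fa (Ga g) = iv Y \<cdot>\<^bsub>D\<^esub> (g \<cdot>\<^bsub>D\<^esub> ep X)" by (auto simp: Hom_def)
  have nat: "ep Y \<cdot>\<^bsub>D\<^esub> Fa (Ga g) = g \<cdot>\<^bsub>D\<^esub> ep X" if g: "g \<in> Hom D X Y" for g X Y
  proof -
    have XY: "X \<in> Obj D" "Y \<in> Obj D" using D.Hom_objD[OF g] by auto
    have "ep Y \<cdot>\<^bsub>D\<^esub> (iv Y \<cdot>\<^bsub>D\<^esub> (g \<cdot>\<^bsub>D\<^esub> ep X)) = (ep Y \<cdot>\<^bsub>D\<^esub> iv Y) \<cdot>\<^bsub>D\<^esub> (g \<cdot>\<^bsub>D\<^esub> ep X)"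
      using D.comp_assoc[OF D.comp_hom[OF G(2) g] iv(1) G(2)] XY by simp
    then show ?thesis using Ga(2)[OF g] iv(3)[OF XY(2)] D.comp_ident_left[OF D.comp_hom[OF G(2) g]]
        XY by simp
  qed
  have Ga_eq: "Ga g = h" if g: "g \<in> Hom D X Y" and h: "h \<in> Hom C (Go X) (Go Y)"
    and eq: "ep Y \<cdot>\<^bsub>D\<^esub> Fa h = g \<cdot>\<^bsub>D\<^esub> ep X" for g h X Y
  proof (rule faithful[OF Ga(1)[OF g] h])
    have XY: "X \<in> Obj D" "Y \<in> Obj D" using D.Hom_objD[OF g] by auto
    show "Fa (Ga g) = Fa h"
      by (rule D.iso_cancel[OF G(3) G(2) functorD(2)[OF F Ga(1)[OF g]] functorD(2)[OF F h]])
        (use XY nat[OF g] eq in simp_all)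
  qed
  have GF: "is_functor D C Go Ga"
    unfolding is_functor_def
  proof (intro conjI ballI impI)
    fix g assume "g \<in> Arr D"
    then show "Ga g \<in> Hom C (Go (Dom D g)) (Go (Cod D g))" using Ga(1) by (simp add: Hom_def)
  next
    fix Y assume Y: "Y \<in> Obj D"
    show "Ga (Ident D Y) = Ident C (Go Y)"
      by (rule Ga_eq[OF D.ident_hom[OF Y] C.ident_hom[OF G(1)[OF Y]]])
        (use functorD(3)[OF F G(1)[OF Y]] D.comp_ident_left[OF G(2)[OF Y]]
            D.comp_ident_right[OF G(2)[OF Y]] in simp)
  next
    fix f g assume "f \<in> Arr D" "g \<in> Arr D" and d: "Dom D g = Cod D f"
    then have f: "f \<in> Hom D (Dom D f) (Cod D f)" and g: "g \<in> Hom D (Cod D f) (Cod D g)"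
      by (simp_all add: Hom_def)
    note o = D.Hom_objD[OF f] D.Hom_objD[OF g]
    have o': "Dom D f \<in> Obj D" "Cod D f \<in> Obj D" "Cod D g \<in> Obj D" using o by auto
    note Gf = functorD(2)[OF F Ga(1)[OF f]] and Gg = functorD(2)[OF F Ga(1)[OF g]]
    show "Ga (g \<cdot>\<^bsub>D\<^esub> f) = Ga g \<cdot>\<^bsub>C\<^esub> Ga f"
    proof (rule Ga_eq[OF D.comp_hom[OF f g] C.comp_hom[OF Ga(1)[OF f] Ga(1)[OF g]]])
      have "ep (Cod D g) \<cdot>\<^bsub>D\<^esub> Fa (Ga g \<cdot>\<^bsub>C\<^esub> Ga f) = (ep (Cod D g) \<cdot>\<^bsub>D\<^esub> Fa (Ga g)) \<cdot>\<^bsub>D\<^esub> Fa (Ga f)"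
        using functorD(4)[OF F Ga(1)[OF f] Ga(1)[OF g]] D.comp_assoc[OF Gf Gg G(2)[OF o'(3)]] by
            simp
      also have "\<dots> = g \<cdot>\<^bsub>D\<^esub> (ep (Cod D f) \<cdot>\<^bsub>D\<^esub> Fa (Ga f))"
        using nat[OF g] D.comp_assoc[OF Gf G(2)[OF o'(2)] g] by simp
      also have "\<dots> = (g \<cdot>\<^bsub>D\<^esub> f) \<cdot>\<^bsub>D\<^esub> ep (Dom D f)"
        using nat[OF f] D.comp_assoc[OF G(2)[OF o'(1)] f g] by simp
      finally show "ep (Cod D g) \<cdot>\<^bsub>D\<^esub> Fa (Ga g \<cdot>\<^bsub>C\<^esub> Ga f) = (g \<cdot>\<^bsub>D\<^esub> f) \<cdot>\<^bsub>D\<^esub> ep (Dom D f)" .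
    qed
  qed (use G(1) in simp)
  have "\<exists>et. \<forall>X \<in> Obj C. et X \<in> Hom C X (Go (Fo X)) \<and> Fa (et X) = iv (Fo X)"
    by (rule bchoice) (use full G(1) iv(1) functorD(1)[OF F] in blast)
  then obtain et where et: "\<And>X. X \<in> Obj C \<Longrightarrow> et X \<in> Hom C X (Go (Fo X))"
    "\<And>X. X \<in> Obj C \<Longrightarrow> Fa (et X) = iv (Fo X)" by blast
  have "\<exists>di. \<forall>X \<in> Obj C. di X \<in> Hom C (Go (Fo X)) X \<and> Fa (di X) = ep (Fo X)"
    by (rule bchoice) (use full G(1,2) functorD(1)[OF F] in blast)
  then obtain di where di: "\<And>X. X \<in> Obj C \<Longrightarrow> di X \<in> Hom C (Go (Fo X)) X"
    "\<And>X. X \<in> Obj C \<Longrightarrow> Fa (di X) = ep (Fo X)" by blast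
  have eta: "is_natural_iso C C (\<lambda>X. X) (\<lambda>f. f) (Go \<circ> Fo) (Ga \<circ> Fa) et"
    unfolding is_natural_iso_def o_def
  proof (intro conjI ballI)
    fix X assume X: "X \<in> Obj C"
    note FX = functorD(1)[OF F X]
    show "et X \<in> Hom C X (Go (Fo X))" using et(1)[OF X] .
    have 1: "di X \<cdot>\<^bsub>C\<^esub> et X = Ident C X"
      by (rule faithful[OF C.comp_hom[OF et(1) di(1)] C.ident_hom])
        (use X FX functorD(4)[OF F et(1) di(1)] et(2) di(2) iv(3) functorD(3)[OF F] in simp_all)
    have 2: "et X \<cdot>\<^bsub>C\<^esub> di X = Ident C (Go (Fo X))"
      by (rule faithful[OF C.comp_hom[OF di(1) et(1)] C.ident_hom])
        (use X FX functorD(4)[OF F di(1) et(1)] et(2) di(2) iv(2) functorD(3)[OF F] G(1) in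
            simp_all)
    show "is_iso_arrow C (et X)" by (rule isoI[OF et(1) di(1) 1 2]) (use X in simp_all)
  next
    fix f assume "f \<in> Arr C"
    then have f: "f \<in> Hom C (Dom C f) (Cod C f)" by (simp add: Hom_def)
    have XY: "Dom C f \<in> Obj C" "Cod C f \<in> Obj C" using C.Hom_objD[OF f] by auto
    note Ff = functorD(2)[OF F f]
    show "et (Cod C f) \<cdot>\<^bsub>C\<^esub> f = Ga (Fa f) \<cdot>\<^bsub>C\<^esub> et (Dom C f)"
    proof (rule faithful[OF C.comp_hom[OF f et(1)[OF XY(2)]]
        C.comp_hom[OF et(1)[OF XY(1)] Ga(1)[OF Ff]]])
      have o: "Fo (Dom C f) \<in> Obj D" "Fo (Cod C f) \<in> Obj D" using D.Hom_objD[OF Ff] by auto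
      have "Fa (Ga (Fa f) \<cdot>\<^bsub>C\<^esub> et (Dom C f))
          = (iv (Fo (Cod C f)) \<cdot>\<^bsub>D\<^esub> (Fa f \<cdot>\<^bsub>D\<^esub> ep (Fo (Dom C f)))) \<cdot>\<^bsub>D\<^esub> iv (Fo (Dom C f))"
        using functorD(4)[OF F et(1)[OF XY(1)] Ga(1)[OF Ff]] Ga(2)[OF Ff] et(2)[OF XY(1)] by simp
      also have "\<dots> = iv (Fo (Cod C f)) \<cdot>\<^bsub>D\<^esub> ((Fa f \<cdot>\<^bsub>D\<^esub> ep (Fo (Dom C f))) \<cdot>\<^bsub>D\<^esub> iv (Fo (Dom C f)))"
        by (rule D.comp_assoc[OF iv(1)[OF o(1)] D.comp_hom[OF G(2)[OF o(1)] Ff] iv(1)[OF o(2)]])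
      also have "(Fa f \<cdot>\<^bsub>D\<^esub> ep (Fo (Dom C f))) \<cdot>\<^bsub>D\<^esub> iv (Fo (Dom C f)) = Fa f"
        using D.comp_assoc[OF iv(1)[OF o(1)] G(2)[OF o(1)] Ff] iv(3)[OF o(1)]
            D.comp_ident_right[OF Ff] by simp
      finally show "Fa (et (Cod C f) \<cdot>\<^bsub>C\<^esub> f) = Fa (Ga (Fa f) \<cdot>\<^bsub>C\<^esub> et (Dom C f))"
        using functorD(4)[OF F f et(1)[OF XY(2)]] et(2)[OF XY(2)] by simp
    qed
  qed
  have eps: "is_natural_iso D D (Fo \<circ> Go) (Fa \<circ> Ga) (\<lambda>Y. Y) (\<lambda>g. g) ep"
    unfolding is_natural_iso_def o_def using G(2,3) nat by (auto simp: Hom_def)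
  show ?thesis unfolding equivalent_categories_def using F GF eta eps by blast
qed

text \<open>The unit makes F faithful and the counit makes G faithful. For fullness, an arrow g
  between images is carried back by G and conjugated with the unit; the resulting f satisfies
  \<open>Ga (Fa f) = Ga g\<close>, and faithfulness of G removes \<open>Ga\<close>.\<close>

theorem fully_faithful_of_equivalence:
  assumes C: "category C" and D: "category D" and eq: "C \<approx>\<^sub>c D"
  obtains Fo Fa where "is_functor C D Fo Fa" "fully_faithful C D Fo Fa"
      "essentially_surjective C D Fo"
proof -
  interpret C: category C by fact
  interpret D: category D by fact
  obtain Fo Fa Go Ga et ep where F: "is_functor C D Fo Fa" and G: "is_functor D C Go Ga"
    and et: "is_natural_iso C C (\<lambda>X. X) (\<lambda>f. f) (Go \<circ> Fo) (Ga \<circ> Fa) et"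
    and ep: "is_natural_iso D D (Fo \<circ> Go) (Fa \<circ> Ga) (\<lambda>Y. Y) (\<lambda>g. g) ep"
    using eq unfolding equivalent_categories_def by blast
  have etX: "et X \<in> Hom C X (Go (Fo X))" "is_iso_arrow C (et X)" if "X \<in> Obj C" for X
    using et that by (auto simp: is_natural_iso_def)
  have etn: "et Y \<cdot>\<^bsub>C\<^esub> f = Ga (Fa f) \<cdot>\<^bsub>C\<^esub> et X" if "f \<in> Hom C X Y" for f X Y
    using et that by (auto simp: is_natural_iso_def Hom_def)
  have epX: "ep X \<in> Hom D (Fo (Go X)) X" "is_iso_arrow D (ep X)" if "X \<in> Obj D" for X
    using ep that by (auto simp: is_natural_iso_def)
  have epn: "ep Y \<cdot>\<^bsub>D\<^esub> Fa (Ga f) = f \<cdot>\<^bsub>D\<^esub> ep X" if "f \<in> Hom D X Y" for f X Y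
    using ep that by (auto simp: is_natural_iso_def Hom_def)
  have Ffaith: "f = g" if f: "f \<in> Hom C X Y" and g: "g \<in> Hom C X Y" and fg: "Fa f = Fa g" for f g X
      Y
  proof -
    have Y: "Y \<in> Obj C" using C.Hom_objD[OF f] by simp
    show ?thesis
      by (rule C.iso_cancel[OF etX(2)[OF Y] etX(1)[OF Y] f g]) (use etn[OF f] etn[OF g] fg in simp)
  qed
  have Gfaith: "f = g" if f: "f \<in> Hom D X Y" and g: "g \<in> Hom D X Y" and fg: "Ga f = Ga g" for f g X
      Y
  proof -
    have X: "X \<in> Obj D" using D.Hom_objD[OF f] by simp
    show ?thesis
      by (rule D.iso_cancel_right[OF epX(2)[OF X] epX(1)[OF X] f g])
        (use epn[OF f] epn[OF g] fg in simp)
  qed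
  have "fully_faithful C D Fo Fa"
    unfolding fully_faithful_def
  proof (intro ballI bij_betwI')
    fix X Y f g assume "f \<in> Hom C X Y" "g \<in> Hom C X Y"
    then show "Fa f = Fa g \<longleftrightarrow> f = g" using Ffaith by blast
  next
    fix X Y f assume "f \<in> Hom C X Y"
    then show "Fa f \<in> Hom D (Fo X) (Fo Y)" by (rule functorD(2)[OF F])
  next
    fix X Y g assume X: "X \<in> Obj C" and Y: "Y \<in> Obj C" and g: "g \<in> Hom D (Fo X) (Fo Y)"
    obtain d where d: "d \<in> Hom C (Go (Fo Y)) Y" "d \<cdot>\<^bsub>C\<^esub> et Y = Ident C Y"
        "et Y \<cdot>\<^bsub>C\<^esub> d = Ident C (Go (Fo Y))"
      by (rule isoE[OF etX(2)[OF Y] etX(1)[OF Y]])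
    note Gg = functorD(2)[OF G g]
    note gX = C.comp_hom[OF etX(1)[OF X] Gg]
    define f where "f = d \<cdot>\<^bsub>C\<^esub> (Ga g \<cdot>\<^bsub>C\<^esub> et X)"
    have f: "f \<in> Hom C X Y" unfolding f_def by (rule C.comp_hom[OF gX d(1)])
    have "Ga (Fa f) \<cdot>\<^bsub>C\<^esub> et X = et Y \<cdot>\<^bsub>C\<^esub> f" using etn[OF f] by simp
    also have "\<dots> = (et Y \<cdot>\<^bsub>C\<^esub> d) \<cdot>\<^bsub>C\<^esub> (Ga g \<cdot>\<^bsub>C\<^esub> et X)"
      unfolding f_def using C.comp_assoc[OF gX d(1) etX(1)[OF Y]] by simp
    finally have "Ga (Fa f) \<cdot>\<^bsub>C\<^esub> et X = Ga g \<cdot>\<^bsub>C\<^esub> et X"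
      using d(3) C.comp_ident_left[OF gX] by simp
    from C.iso_cancel_right[OF etX(2)[OF X] etX(1)[OF X] functorD(2)[OF G functorD(2)[OF F f]] Gg
        this]
    have "Ga (Fa f) = Ga g" .
    from Gfaith[OF functorD(2)[OF F f] g this] show "\<exists>x \<in> Hom C X Y. g = Fa x" using f by blast
  qed
  moreover have "essentially_surjective C D Fo"
    unfolding essentially_surjective_def using epX functorD(1)[OF G] by blast
  ultimately show ?thesis using that F by blast
qed

section \<open>Right modules: generation, quotients, cokernels of module maps, and maps out of a
  free module of rank one\<close>

section \<open>Submodules, quotients and free modules of rank one\<close>

text \<open>Closure under negatives comes from the scalar -1
  (\<open>submodule_minus\<close>).\<close>

definition is_submodule :: "('r, 'z) ring_scheme \<Rightarrow> ('r, 'x, 'y) module_scheme \<Rightarrow> 'x set \<Rightarrow> bool" where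
  "is_submodule R M N \<longleftrightarrow> N \<subseteq> carrier M \<and> \<zero>\<^bsub>M\<^esub> \<in> N \<and>
     (\<forall>x \<in> N. \<forall>y \<in> N. x \<oplus>\<^bsub>M\<^esub> y \<in> N) \<and> (\<forall>r \<in> carrier R. \<forall>x \<in> N. r \<odot>\<^bsub>M\<^esub> x \<in> N)"

context right_module
begin

lemma smult_zero: "r \<in> carrier R \<Longrightarrow> r \<odot>\<^bsub>M\<^esub> \<zero>\<^bsub>M\<^esub> = \<zero>\<^bsub>M\<^esub>"
proof -
  assume r: "r \<in> carrier R"
  have "r \<odot>\<^bsub>M\<^esub> \<zero>\<^bsub>M\<^esub> \<oplus>\<^bsub>M\<^esub> r \<odot>\<^bsub>M\<^esub> \<zero>\<^bsub>M\<^esub> = r \<odot>\<^bsub>M\<^esub> \<zero>\<^bsub>M\<^esub>"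
    using smult_add_module[OF r, of "\<zero>\<^bsub>M\<^esub>" "\<zero>\<^bsub>M\<^esub>"] by simp
  then show ?thesis using smult_closed[OF r, of "\<zero>\<^bsub>M\<^esub>"] M.add.r_cancel_one by fastforce
qed

lemma zero_smult: "x \<in> carrier M \<Longrightarrow> \<zero> \<odot>\<^bsub>M\<^esub> x = \<zero>\<^bsub>M\<^esub>"
proof -
  assume x: "x \<in> carrier M"
  have "\<zero> \<odot>\<^bsub>M\<^esub> x \<oplus>\<^bsub>M\<^esub> \<zero> \<odot>\<^bsub>M\<^esub> x = \<zero> \<odot>\<^bsub>M\<^esub> x"
    using smult_add_ring[of \<zero> \<zero> x] x by simp
  then show ?thesis using smult_closed[of \<zero> x] x M.add.r_cancel_one by fastforce
qed

lemma minus_one_smult: "x \<in> carrier M \<Longrightarrow> (\<ominus> \<one>) \<odot>\<^bsub>M\<^esub> x = \<ominus>\<^bsub>M\<^esub> x"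
proof -
  assume x: "x \<in> carrier M"
  have "(\<ominus> \<one>) \<odot>\<^bsub>M\<^esub> x \<oplus>\<^bsub>M\<^esub> x = \<zero>\<^bsub>M\<^esub>"
    using smult_add_ring[of "\<ominus> \<one>" \<one> x] x smult_one[OF x] zero_smult[OF x] by (simp add: R.l_neg)
  then show ?thesis using x smult_closed[of "\<ominus> \<one>" x] by
      (metis M.minus_equality R.add.inv_closed R.one_closed)
qed

lemma submodule_minus: "is_submodule R M N \<Longrightarrow> x \<in> N \<Longrightarrow> \<ominus>\<^bsub>M\<^esub> x \<in> N"
  using minus_one_smult[of x] R.add.inv_closed[OF R.one_closed] unfolding is_submodule_def by
      (metis subsetD)

lemma finsum_in_submodule:
  assumes N: "is_submodule R M N" and "finite A" "A \<subseteq> N" "c \<in> A \<rightarrow> carrier R"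
  shows "(\<Oplus>\<^bsub>M\<^esub>a\<in>A. c a \<odot>\<^bsub>M\<^esub> a) \<in> N"
  using assms(2-4)
proof (induction A rule: finite_induct)
  case empty
  then show ?case using N by (simp add: is_submodule_def)
next
  case (insert a A)
  have 1: "(\<lambda>a. c a \<odot>\<^bsub>M\<^esub> a) \<in> A \<rightarrow> carrier M" "c a \<odot>\<^bsub>M\<^esub> a \<in> carrier M"
    using insert.prems N smult_closed unfolding is_submodule_def by blast+
  show ?case using insert 1 N by (simp add: is_submodule_def)
qed

lemma submodule_span:
  assumes A: "finite A" "A \<subseteq> carrier M"
  shows "is_submodule R M {\<Oplus>\<^bsub>M\<^esub>a\<in>A. c a \<odot>\<^bsub>M\<^esub> a | c. c \<in> A \<rightarrow> carrier R}" (is "is_submodule R M ?S")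
    "A \<subseteq> {\<Oplus>\<^bsub>M\<^esub>a\<in>A. c a \<odot>\<^bsub>M\<^esub> a | c. c \<in> A \<rightarrow> carrier R}"
proof -
  have sm: "(\<lambda>a. c a \<odot>\<^bsub>M\<^esub> a) \<in> A \<rightarrow> carrier M" if "c \<in> A \<rightarrow> carrier R" for c
    using that A smult_closed by blast
  show "is_submodule R M ?S"
    unfolding is_submodule_def
  proof (intro conjI ballI)
    show "?S \<subseteq> carrier M" using M.finsum_closed[OF sm] by auto
    have "(\<Oplus>\<^bsub>M\<^esub>a\<in>A. \<zero> \<odot>\<^bsub>M\<^esub> a) = (\<Oplus>\<^bsub>M\<^esub>a\<in>A. \<zero>\<^bsub>M\<^esub>)"
      by (rule M.finsum_cong') (use A zero_smult in auto)
    then have "\<zero>\<^bsub>M\<^esub> = (\<Oplus>\<^bsub>M\<^esub>a\<in>A. \<zero> \<odot>\<^bsub>M\<^esub> a)" by simp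
    then show "\<zero>\<^bsub>M\<^esub> \<in> ?S" by (auto intro!: exI[of _ "\<lambda>_. \<zero>"])
  next
    fix x y assume "x \<in> ?S" "y \<in> ?S"
    then obtain c d where c: "c \<in> A \<rightarrow> carrier R" "x = (\<Oplus>\<^bsub>M\<^esub>a\<in>A. c a \<odot>\<^bsub>M\<^esub> a)"
      and d: "d \<in> A \<rightarrow> carrier R" "y = (\<Oplus>\<^bsub>M\<^esub>a\<in>A. d a \<odot>\<^bsub>M\<^esub> a)" by blast
    have "x \<oplus>\<^bsub>M\<^esub> y = (\<Oplus>\<^bsub>M\<^esub>a\<in>A. c a \<odot>\<^bsub>M\<^esub> a \<oplus>\<^bsub>M\<^esub> d a \<odot>\<^bsub>M\<^esub> a)"
      unfolding c d using M.finsum_addf[OF sm[OF c(1)] sm[OF d(1)]] by simp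
    also have "\<dots> = (\<Oplus>\<^bsub>M\<^esub>a\<in>A. (c a \<oplus> d a) \<odot>\<^bsub>M\<^esub> a)"
    proof (rule M.finsum_cong')
      show "(\<lambda>a. (c a \<oplus> d a) \<odot>\<^bsub>M\<^esub> a) \<in> A \<rightarrow> carrier M"
        by (rule sm[of "\<lambda>a. c a \<oplus> d a"]) (use c d in auto)
      fix a assume "a \<in> A"
      then show "c a \<odot>\<^bsub>M\<^esub> a \<oplus>\<^bsub>M\<^esub> d a \<odot>\<^bsub>M\<^esub> a = (c a \<oplus> d a) \<odot>\<^bsub>M\<^esub> a"
        using c d A smult_add_ring[of "c a" "d a" a] by (auto simp: Pi_iff subset_iff)
    qed simp
    finally show "x \<oplus>\<^bsub>M\<^esub> y \<in> ?S" using c(1) d(1) by (auto intro!: exI[of _ "\<lambda>a. c a \<oplus> d a"])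
  next
    fix r x assume r: "r \<in> carrier R" and "x \<in> ?S"
    then obtain c where c: "c \<in> A \<rightarrow> carrier R" "x = (\<Oplus>\<^bsub>M\<^esub>a\<in>A. c a \<odot>\<^bsub>M\<^esub> a)" by blast
    \<comment> \<open>The new scalar stands to the right of the coefficient because
      \<open>r \<odot> x\<close> is the right action x r. The induction runs over subsets B of A so
      that c keeps its domain.\<close>
    have "r \<odot>\<^bsub>M\<^esub> (\<Oplus>\<^bsub>M\<^esub>a\<in>B. c a \<odot>\<^bsub>M\<^esub> a) = (\<Oplus>\<^bsub>M\<^esub>a\<in>B. (c a \<otimes> r) \<odot>\<^bsub>M\<^esub> a)" if "finite B" "B \<subseteq> A" for B
      using that
    proof (induction B rule: finite_induct)
      case empty
      then show ?case using smult_zero[OF r] by simp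
    next
      case (insert b B)
      have cb: "c b \<in> carrier R" "b \<in> carrier M" using insert.prems c(1) A by blast+
      have 1: "(\<lambda>a. c a \<odot>\<^bsub>M\<^esub> a) \<in> B \<rightarrow> carrier M" "(\<lambda>a. (c a \<otimes> r) \<odot>\<^bsub>M\<^esub> a) \<in> B \<rightarrow> carrier M"
        using insert.prems sm[OF c(1)] sm[of "\<lambda>a. c a \<otimes> r"] c(1) r by (auto simp: Pi_iff subset_iff)
      have 2: "c b \<odot>\<^bsub>M\<^esub> b \<in> carrier M" "(c b \<otimes> r) \<odot>\<^bsub>M\<^esub> b \<in> carrier M"
        using cb r smult_closed by auto
      have "r \<odot>\<^bsub>M\<^esub> (\<Oplus>\<^bsub>M\<^esub>a\<in>insert b B. c a \<odot>\<^bsub>M\<^esub> a)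
          = r \<odot>\<^bsub>M\<^esub> (c b \<odot>\<^bsub>M\<^esub> b) \<oplus>\<^bsub>M\<^esub> r \<odot>\<^bsub>M\<^esub> (\<Oplus>\<^bsub>M\<^esub>a\<in>B. c a \<odot>\<^bsub>M\<^esub> a)"
        using insert.hyps 1 2 smult_add_module[OF r 2(1) M.finsum_closed[OF 1(1)]] by simp
      then show ?case using insert 1 2 smult_assoc[OF cb(1) r cb(2)] by simp
    qed
    from this[OF A(1)] have "r \<odot>\<^bsub>M\<^esub> x = (\<Oplus>\<^bsub>M\<^esub>a\<in>A. (c a \<otimes> r) \<odot>\<^bsub>M\<^esub> a)" unfolding c by simp
    then show "r \<odot>\<^bsub>M\<^esub> x \<in> ?S" using c(1) r by (auto intro!: exI[of _ "\<lambda>a. c a \<otimes> r"])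
  qed
  show "A \<subseteq> ?S"
  proof
    fix b assume b: "b \<in> A"
    \<comment> \<open>The generator b is the combination with coefficient 1 at b and 0
      elsewhere.\<close>
    have "(\<Oplus>\<^bsub>M\<^esub>a\<in>A. (if a = b then \<one> else \<zero>) \<odot>\<^bsub>M\<^esub> a) = (\<Oplus>\<^bsub>M\<^esub>a\<in>A. if b = a then a else \<zero>\<^bsub>M\<^esub>)"
      by (rule M.finsum_cong') (use A zero_smult smult_one in auto)
    also have "\<dots> = b" by (rule M.finsum_singleton[OF b A(1)]) (use A in auto)
    finally show "b \<in> ?S" by (auto intro!: exI[of _ "\<lambda>a. if a = b then \<one> else \<zero>"])
  qed
qed

text \<open>Generation is restated through closure: the only submodule containing A is everything.
  In this form it passes along homomorphisms without any manipulation of finite sums. The span of A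
  is itself such a submodule, which gives back the linear combinations.\<close>

lemma finitely_generated_iff:
  "finitely_generated_module R M \<longleftrightarrow>
     (\<exists>A. finite A \<and> A \<subseteq> carrier M \<and> (\<forall>N. is_submodule R M N \<and> A \<subseteq> N \<longrightarrow> carrier M \<subseteq> N))"
  (is "?l \<longleftrightarrow> ?r")
proof
  assume ?l
  then obtain A where A: "finite A" "A \<subseteq> carrier M"
    "\<forall>x \<in> carrier M. \<exists>c \<in> A \<rightarrow> carrier R. x = (\<Oplus>\<^bsub>M\<^esub>a\<in>A. c a \<odot>\<^bsub>M\<^esub> a)"
    unfolding finitely_generated_module_def by blast
  have "carrier M \<subseteq> N" if "is_submodule R M N" "A \<subseteq> N" for N
  proof
    fix x assume "x \<in> carrier M"
    then obtain c where "c \<in> A \<rightarrow> carrier R" "x = (\<Oplus>\<^bsub>M\<^esub>a\<in>A. c a \<odot>\<^bsub>M\<^esub> a)" using A(3) by fastforce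
    then show "x \<in> N" using finsum_in_submodule[OF that(1) A(1) that(2)] by simp
  qed
  then show ?r using A by blast
next
  assume ?r
  then obtain A where A: "finite A" "A \<subseteq> carrier M"
    "\<And>N. is_submodule R M N \<Longrightarrow> A \<subseteq> N \<Longrightarrow> carrier M \<subseteq> N" by (elim exE conjE)
        (rule that, assumption, assumption, simp)
  show ?l
    unfolding finitely_generated_module_def
    using A(1,2) A(3)[OF submodule_span[OF A(1,2)]] by blast
qed

end

lemma module_homsD:
  assumes "f \<in> module_homs R M N"
  shows "x \<in> carrier M \<Longrightarrow> f x \<in> carrier N"
    "x \<in> carrier M \<Longrightarrow> y \<in> carrier M \<Longrightarrow> f (x \<oplus>\<^bsub>M\<^esub> y) = f x \<oplus>\<^bsub>N\<^esub> f y"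
    "r \<in> carrier R \<Longrightarrow> x \<in> carrier M \<Longrightarrow> f (r \<odot>\<^bsub>M\<^esub> x) = r \<odot>\<^bsub>N\<^esub> f x"
  using assms by (auto simp: module_homs_def)

lemma module_hom_zero:
  assumes "f \<in> module_homs R M N" "right_module R M" "right_module R N"
  shows "f \<zero>\<^bsub>M\<^esub> = \<zero>\<^bsub>N\<^esub>"
proof -
  interpret M: right_module R M by fact
  interpret N: right_module R N by fact
  have "f \<zero>\<^bsub>M\<^esub> = f (\<zero>\<^bsub>R\<^esub> \<odot>\<^bsub>M\<^esub> \<zero>\<^bsub>M\<^esub>)" by (simp add: M.smult_zero)
  also have "\<dots> = \<zero>\<^bsub>N\<^esub>"
    using module_homsD(1,3)[OF assms(1)] N.zero_smult by simp
  finally show ?thesis .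
qed

lemma preimage_submodule:
  assumes f: "f \<in> module_homs R M N" and M: "right_module R M" and N: "right_module R N"
    and L: "is_submodule R N L"
  shows "is_submodule R M {x \<in> carrier M. f x \<in> L}"
proof -
  interpret M: right_module R M by fact
  show ?thesis using L module_homsD[OF f] module_hom_zero[OF f M N] M.smult_closed
    unfolding is_submodule_def by auto
qed

lemma image_submodule:
  assumes f: "f \<in> module_homs R M N" and M: "right_module R M" and N: "right_module R N"
    and L: "is_submodule R M L"
  shows "is_submodule R N (f ` L)"
proof -
  interpret M: right_module R M by fact
  have LM: "x \<in> carrier M" if "x \<in> L" for x using L that by (auto simp: is_submodule_def)
  show ?thesis
    unfolding is_submodule_def
  proof (intro conjI ballI)
    show "f ` L \<subseteq> carrier N" using LM module_homsD(1)[OF f] by blast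
    show "\<zero>\<^bsub>N\<^esub> \<in> f ` L" using L module_hom_zero[OF f M N, symmetric] by
        (auto simp: is_submodule_def)
  next
    fix x y assume "x \<in> f ` L" "y \<in> f ` L"
    then obtain a b where "a \<in> L" "b \<in> L" "x = f a" "y = f b" by blast
    then show "x \<oplus>\<^bsub>N\<^esub> y \<in> f ` L" using L module_homsD(2)[OF f, of a b] LM
      by (auto simp: is_submodule_def intro!: image_eqI[of _ _ "a \<oplus>\<^bsub>M\<^esub> b"])
  next
    fix r x assume "r \<in> carrier R" "x \<in> f ` L"
    then obtain a where "a \<in> L" "x = f a" "r \<in> carrier R" by blast
    then show "r \<odot>\<^bsub>N\<^esub> x \<in> f ` L" using L module_homsD(3)[OF f, of r a] LM
      by (auto simp: is_submodule_def intro!: image_eqI[of _ _ "r \<odot>\<^bsub>M\<^esub> a"])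
  qed
qed

text \<open>A submodule of N containing the images of the generators has a preimage containing the
  generators, which is therefore all of M.\<close>

lemma finitely_generated_image:
  assumes f: "f \<in> module_homs R M N" and M: "right_module R M" and N: "right_module R N"
    and surj: "f ` carrier M = carrier N" and fg: "finitely_generated_module R M"
  shows "finitely_generated_module R N"
proof -
  interpret M: right_module R M by fact
  interpret N: right_module R N by fact
  obtain A where A: "finite A" "A \<subseteq> carrier M"
    "\<And>L. is_submodule R M L \<Longrightarrow> A \<subseteq> L \<Longrightarrow> carrier M \<subseteq> L"
    using fg unfolding M.finitely_generated_iff by (elim exE conjE)
        (rule that, assumption, assumption, simp)
  have "carrier N \<subseteq> L" if "is_submodule R N L" "f ` A \<subseteq> L" for L
  proof -
    have "A \<subseteq> {x \<in> carrier M. f x \<in> L}" using that(2) A(2) by auto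
    from A(3)[OF preimage_submodule[OF f M N that(1)] this] show ?thesis
      unfolding surj[symmetric] by auto
  qed
  then show ?thesis
    unfolding N.finitely_generated_iff using A(1,2) surj by (intro exI[of _ "f ` A"]) auto
qed

text \<open>The quotient is realised on a set of representatives, hence on the type of \<open>M\<close>.\<close>

theorem quotient_representable:
  fixes M :: "('r, 'x, 'y) module_scheme"
  assumes M: "right_module R M" and fg: "finitely_generated_module R M" and L: "is_submodule R M L"
  obtains N f where "N \<in> Obj (mod_cat R)" "f \<in> module_homs R M N" "f ` carrier M = carrier N"
    "\<And>x. x \<in> carrier M \<Longrightarrow> f x = \<zero>\<^bsub>N\<^esub> \<longleftrightarrow> x \<in> L"
    "\<And>x y. x \<in> carrier M \<Longrightarrow> y \<in> carrier M \<Longrightarrow> f x = f y \<longleftrightarrow> x \<ominus>\<^bsub>M\<^esub> y \<in> L"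
proof -
  interpret M: right_module R M by fact
  have LD: "L \<subseteq> carrier M" "\<zero>\<^bsub>M\<^esub> \<in> L" "\<And>x y. x \<in> L \<Longrightarrow> y \<in> L \<Longrightarrow> x \<oplus>\<^bsub>M\<^esub> y \<in> L"
    "\<And>r x. r \<in> carrier R \<Longrightarrow> x \<in> L \<Longrightarrow> r \<odot>\<^bsub>M\<^esub> x \<in> L"
    using L by (auto simp: is_submodule_def)
  define cl where "cl x = {y \<in> carrier M. y \<ominus>\<^bsub>M\<^esub> x \<in> L}" for x
  have cl_mem: "x \<in> cl x" if "x \<in> carrier M" for x
    using that LD(2) by (simp add: cl_def M.minus_eq M.r_neg)
  have cl_eq: "cl x = cl y" if xy: "x \<in> carrier M" "y \<in> carrier M" "x \<ominus>\<^bsub>M\<^esub> y \<in> L" for x y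
  proof -
    have sub: "cl x \<subseteq> cl y" if xy: "x \<in> carrier M" "y \<in> carrier M" "x \<ominus>\<^bsub>M\<^esub> y \<in> L" for x y
    proof
      fix z assume z: "z \<in> cl x"
      then have zM: "z \<in> carrier M" and zL: "z \<ominus>\<^bsub>M\<^esub> x \<in> L" by (auto simp: cl_def)
      have "z \<ominus>\<^bsub>M\<^esub> y = (z \<ominus>\<^bsub>M\<^esub> x) \<oplus>\<^bsub>M\<^esub> (x \<ominus>\<^bsub>M\<^esub> y)"
        using xy(1,2) zM by (simp add: M.minus_eq M.a_assoc M.r_neg1)
      then show "z \<in> cl y" using LD(3)[OF zL xy(3)] zM by (simp add: cl_def)
    qed
    have "y \<ominus>\<^bsub>M\<^esub> x = \<ominus>\<^bsub>M\<^esub> (x \<ominus>\<^bsub>M\<^esub> y)"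
      using xy(1,2) by (simp add: M.minus_eq M.minus_add M.minus_minus M.a_comm)
    then have "y \<ominus>\<^bsub>M\<^esub> x \<in> L" using M.submodule_minus[OF L xy(3)] by simp
    then show ?thesis using sub[OF xy] sub[OF xy(2,1)] by blast
  qed
  define r where "r x = (SOME y. y \<in> cl x)" for x
  have r: "r x \<in> carrier M" "r x \<ominus>\<^bsub>M\<^esub> x \<in> L" if "x \<in> carrier M" for x
    using someI[of "\<lambda>y. y \<in> cl x" x, folded r_def, OF cl_mem[OF that]] by (auto simp: cl_def)
  have r_eq: "r x = r y \<longleftrightarrow> x \<ominus>\<^bsub>M\<^esub> y \<in> L" if xy: "x \<in> carrier M" "y \<in> carrier M" for x y
  proof
    assume "x \<ominus>\<^bsub>M\<^esub> y \<in> L"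
    then show "r x = r y" using cl_eq[OF xy] by (simp add: r_def)
  next
    assume "r x = r y"
    then have 1: "r x \<ominus>\<^bsub>M\<^esub> y \<in> L" using r[OF xy(2)] by simp
    have "x \<ominus>\<^bsub>M\<^esub> y = \<ominus>\<^bsub>M\<^esub> (r x \<ominus>\<^bsub>M\<^esub> x) \<oplus>\<^bsub>M\<^esub> (r x \<ominus>\<^bsub>M\<^esub> y)"
      using xy r(1)[OF xy(1)] M.a_comm[of x "\<ominus>\<^bsub>M\<^esub> r x"]
      by (simp add: M.minus_eq M.minus_add M.minus_minus M.a_assoc M.r_neg1 M.r_neg2
          M.a_lcomm[of x])
    then show "x \<ominus>\<^bsub>M\<^esub> y \<in> L" using LD(3)[OF M.submodule_minus[OF L r(2)[OF xy(1)]] 1] by simp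
  qed
  have radd: "r (r x \<oplus>\<^bsub>M\<^esub> y) = r (x \<oplus>\<^bsub>M\<^esub> y)" "r (x \<oplus>\<^bsub>M\<^esub> r y) = r (x \<oplus>\<^bsub>M\<^esub> y)"
    if xy: "x \<in> carrier M" "y \<in> carrier M" for x y
  proof -
    have cancel: "(a \<oplus>\<^bsub>M\<^esub> c) \<ominus>\<^bsub>M\<^esub> (b \<oplus>\<^bsub>M\<^esub> c) = a \<ominus>\<^bsub>M\<^esub> b"
      if "a \<in> carrier M" "b \<in> carrier M" "c \<in> carrier M" for a b c
      using that M.a_lcomm[of c "\<ominus>\<^bsub>M\<^esub> b" "\<ominus>\<^bsub>M\<^esub> c"]
      by (simp add: M.minus_eq M.minus_add M.a_assoc M.r_neg)
    have 1: "r (r x \<oplus>\<^bsub>M\<^esub> y) = r (x \<oplus>\<^bsub>M\<^esub> y)" if "x \<in> carrier M" "y \<in> carrier M" for x y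
      using that r cancel by (simp add: r_eq)
    show "r (r x \<oplus>\<^bsub>M\<^esub> y) = r (x \<oplus>\<^bsub>M\<^esub> y)" by (rule 1[OF xy])
    show "r (x \<oplus>\<^bsub>M\<^esub> r y) = r (x \<oplus>\<^bsub>M\<^esub> y)"
      using 1[OF xy(2,1)] xy r M.a_comm by simp
  qed
  have rsm: "r (c \<odot>\<^bsub>M\<^esub> r x) = r (c \<odot>\<^bsub>M\<^esub> x)" if cx: "c \<in> carrier R" "x \<in> carrier M" for c x
  proof -
    have "\<ominus>\<^bsub>M\<^esub> (c \<odot>\<^bsub>M\<^esub> x) = c \<odot>\<^bsub>M\<^esub> (\<ominus>\<^bsub>M\<^esub> x)"
      using cx M.smult_closed M.smult_add_module[OF cx(1), of "\<ominus>\<^bsub>M\<^esub> x" x]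
      by (metis M.M.add.inv_closed M.M.l_neg M.M.minus_equality M.smult_zero)
    then have "c \<odot>\<^bsub>M\<^esub> r x \<ominus>\<^bsub>M\<^esub> c \<odot>\<^bsub>M\<^esub> x = c \<odot>\<^bsub>M\<^esub> (r x \<ominus>\<^bsub>M\<^esub> x)"
      using cx r(1)[OF cx(2)] M.smult_add_module by (simp add: M.minus_eq)
    then show ?thesis using r_eq cx r M.smult_closed LD(4) by simp
  qed
  define N :: "('r, 'x) module" where
    "N = \<lparr>carrier = r ` carrier M, mult = undefined, one = undefined, zero = r \<zero>\<^bsub>M\<^esub>,
       add = (\<lambda>u v. r (u \<oplus>\<^bsub>M\<^esub> v)), smult = (\<lambda>c u. r (c \<odot>\<^bsub>M\<^esub> u))\<rparr>"
  have N: "carrier N = r ` carrier M" "\<zero>\<^bsub>N\<^esub> = r \<zero>\<^bsub>M\<^esub>"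
    "\<And>x y. x \<in> carrier M \<Longrightarrow> y \<in> carrier M \<Longrightarrow> r x \<oplus>\<^bsub>N\<^esub> r y = r (x \<oplus>\<^bsub>M\<^esub> y)"
    "\<And>c x. c \<in> carrier R \<Longrightarrow> x \<in> carrier M \<Longrightarrow> c \<odot>\<^bsub>N\<^esub> r x = r (c \<odot>\<^bsub>M\<^esub> x)"
    by (auto simp: N_def r radd rsm)
  interpret N: abelian_group N
  proof (rule abelian_groupI)
    fix u assume "u \<in> carrier N"
    then obtain x where x: "x \<in> carrier M" "u = r x" by (auto simp: N)
    have "r (\<ominus>\<^bsub>M\<^esub> x) \<oplus>\<^bsub>N\<^esub> u = \<zero>\<^bsub>N\<^esub>" using x by (simp add: N M.l_neg)
    then show "\<exists>v \<in> carrier N. v \<oplus>\<^bsub>N\<^esub> u = \<zero>\<^bsub>N\<^esub>" using x by (auto simp: N)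
  qed (auto simp: N M.a_ac)
  have NM: "right_module R N"
    by unfold_locales (auto simp: N M.smult_closed M.smult_add_ring M.smult_add_module
        M.smult_assoc M.smult_one)
  have f: "restrict r (carrier M) \<in> module_homs R M N"
    by (auto simp: module_homs_def N M.smult_closed)
  have fgN: "finitely_generated_module R N"
    by (rule finitely_generated_image[OF f M NM _ fg]) (auto simp: N)
  \<comment> \<open>The quotient still lives on the type of M; here it is moved to lists over R,
    where the objects of \<open>mod_cat\<close> live.\<close>
  obtain K g where K: "K \<in> Obj (mod_cat R)" "g \<in> module_homs R N K"
      "bij_betw g (carrier N) (carrier K)"
    using fg_right_module_representable[OF NM fgN] by blast
  have KM: "right_module R K" using K(1) by (simp add: mod_cat_def)
  define h where "h = compose (carrier M) g (restrict r (carrier M))"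
  have hr: "h x = g (r x)" if "x \<in> carrier M" for x using that by (simp add: h_def compose_def)
  have h: "h \<in> module_homs R M K" unfolding h_def by (rule module_homs_compose[OF f K(2) M])
  have him: "h ` carrier M = carrier K"
    using K(3) hr by (auto simp: bij_betw_def N image_iff)
  have heq: "h x = h y \<longleftrightarrow> x \<ominus>\<^bsub>M\<^esub> y \<in> L" if xy: "x \<in> carrier M" "y \<in> carrier M" for x y
  proof -
    have "h x = h y \<longleftrightarrow> r x = r y"
      using K(3) xy by (auto simp: hr bij_betw_def inj_on_def N)
    then show ?thesis using r_eq[OF xy] by simp
  qed
  have "h x = \<zero>\<^bsub>K\<^esub> \<longleftrightarrow> x \<in> L" if "x \<in> carrier M" for x
    using heq[OF that M.zero_closed] module_hom_zero[OF h M KM] that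
      M.minus_equality[of "\<zero>\<^bsub>M\<^esub>" "\<zero>\<^bsub>M\<^esub>"] by (simp add: M.minus_eq)
  then show ?thesis using that[OF K(1) h him _ heq] by blast
qed

text \<open>The projection of N onto its quotient by the image of f and the zero map agree after f.
  An epimorphism forces them to coincide, so the quotient vanishes. The quotient belongs to
  \<open>mod_cat\<close> because N is finitely generated.\<close>

lemma mod_epic_surj:
  assumes epic: "is_epic (mod_cat R) F" and F: "F = (M, f, N)"
  shows "f ` carrier M = carrier N"
proof -
  have "F \<in> Arr (mod_cat R)" using epic by (simp add: is_epic_def)
  then have FH: "F \<in> Hom (mod_cat R) M N" by (auto simp: F Hom_def mod_cat_def)
  then have f: "f \<in> module_homs R M N" and M: "right_module R M" and N: "right_module R N"
    and fg: "finitely_generated_module R N" by (auto elim!: mod_HomE simp: F)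
  interpret M: right_module R M by fact
  interpret N: right_module R N by fact
  have "is_submodule R M (carrier M)" by (auto simp: is_submodule_def M.smult_closed)
  note L = image_submodule[OF f M N this]
  obtain K g where K: "K \<in> Obj (mod_cat R)" "g \<in> module_homs R N K"
    "\<And>x. x \<in> carrier N \<Longrightarrow> g x = \<zero>\<^bsub>K\<^esub> \<longleftrightarrow> x \<in> f ` carrier M"
    using quotient_representable[OF N fg L] by metis
  have KM: "right_module R K" "finitely_generated_module R K" using K(1) by (auto simp: mod_cat_def)
  interpret K: right_module R K by (rule KM)
  define z where "z = (\<lambda>x \<in> carrier N. \<zero>\<^bsub>K\<^esub>)"
  have z: "z \<in> module_homs R N K" by (auto simp: z_def module_homs_def N.smult_closed K.smult_zero)
  have "(N, g, K) \<cdot>\<^bsub>mod_cat R\<^esub> F = (N, z, K) \<cdot>\<^bsub>mod_cat R\<^esub> F"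
    using K(3) module_homsD(1)[OF f] by (auto simp: F mod_comp compose_def z_def fun_eq_iff)
  moreover have "(N, g, K) \<in> Hom (mod_cat R) N K" "(N, z, K) \<in> Hom (mod_cat R) N K"
    using K z N fg KM by (auto intro: mod_HomI)
  ultimately have "(N, g, K) = (N, z, K)"
    using epic HomD[OF FH] K(1) unfolding is_epic_def by metis
  then have "g x = \<zero>\<^bsub>K\<^esub>" if "x \<in> carrier N" for x using that by (simp add: z_def)
  then show ?thesis using K(3) module_homsD(1)[OF f] by blast
qed

text \<open>N is a copy of the regular module with basis u. A basis element is recorded instead of
  an isomorphism because homomorphisms out of N are then given by one value
  (\<open>free_generator_hom\<close>, \<open>free_generator_hom_eq\<close>).\<close>

definition free_generator :: "('r, 'z) ring_scheme \<Rightarrow> ('r, 'x, 'y) module_scheme \<Rightarrow> 'x \<Rightarrow> bool" where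
  "free_generator R N u \<longleftrightarrow> u \<in> carrier N \<and> (\<forall>x \<in> carrier N. \<exists>!r. r \<in> carrier R \<and> x = r \<odot>\<^bsub>N\<^esub> u)"

text \<open>The coordinate \<open>c x\<close> of x with respect to u is linear in x, so x can be
  sent to \<open>c x \<odot> m\<close>.\<close>

lemma free_generator_hom:
  assumes N: "right_module R N" and u: "free_generator R N u" and M: "right_module R M" and m:
      "m \<in> carrier M"
  shows "\<exists>f \<in> module_homs R N M. f u = m"
proof -
  interpret N: right_module R N by fact
  interpret M: right_module R M by fact
  have uN: "u \<in> carrier N" and ex1: "\<And>x. x \<in> carrier N \<Longrightarrow> \<exists>!r. r \<in> carrier R \<and> x = r \<odot>\<^bsub>N\<^esub> u"
    using u by (auto simp: free_generator_def)
  define c where "c x = (THE r. r \<in> carrier R \<and> x = r \<odot>\<^bsub>N\<^esub> u)" for x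
  have c: "c x \<in> carrier R" "x = c x \<odot>\<^bsub>N\<^esub> u" if "x \<in> carrier N" for x
    using theI'[OF ex1[OF that]] by (auto simp: c_def)
  have cu: "c x = r" if "x = r \<odot>\<^bsub>N\<^esub> u" "r \<in> carrier R" for x r
    using ex1[of x] c[of x] that N.smult_closed uN by blast
  have c_add: "c (x \<oplus>\<^bsub>N\<^esub> y) = c x \<oplus>\<^bsub>R\<^esub> c y" if "x \<in> carrier N" "y \<in> carrier N" for x y
    by (rule cu) (use c that uN N.smult_add_ring in auto)
  have c_sm: "c (r \<odot>\<^bsub>N\<^esub> x) = c x \<otimes>\<^bsub>R\<^esub> r" if "x \<in> carrier N" "r \<in> carrier R" for x r
    by (rule cu) (use c that uN N.smult_assoc[of "c x" r u] in auto)
  have c1: "c u = \<one>\<^bsub>R\<^esub>" by (rule cu) (use N.smult_one uN in auto)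
  define g where "g = (\<lambda>x \<in> carrier N. c x \<odot>\<^bsub>M\<^esub> m)"
  have "g \<in> module_homs R N M"
    using m by (auto simp: g_def module_homs_def c c_add c_sm M.smult_closed N.smult_closed
        M.smult_add_ring M.smult_assoc)
  moreover have "g u = m" using m uN by (simp add: g_def c1 M.smult_one)
  ultimately show ?thesis by blast
qed

lemma free_generator_hom_eq:
  assumes u: "free_generator R N u" and f: "f \<in> module_homs R N M" "g \<in> module_homs R N M" and eq:
      "f u = g u"
  shows "f = g"
proof
  fix x show "f x = g x"
  proof (cases "x \<in> carrier N")
    case True
    then obtain r where "r \<in> carrier R" "x = r \<odot>\<^bsub>N\<^esub> u" using u by (auto simp: free_generator_def)
    then show ?thesis using module_homsD(3)[OF f(1)] module_homsD(3)[OF f(2)] u eq by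
        (simp add: free_generator_def)
  next
    case False
    then show ?thesis using f by (auto simp: module_homs_def PiE_iff extensional_def)
  qed
qed

theorem regular_module_representable:
  fixes R :: "('r, 'z) ring_scheme"
  assumes R: "ring R"
  obtains N u where "N \<in> Obj (mod_cat R)" "free_generator R N u"
proof -
  interpret R: ring R by fact
  \<comment> \<open>The ring as a right module over itself, r acting on x by x r. It is generated by
    the identity, and the copy on lists inherits the basis.\<close>
  define S :: "('r, 'r) module" where "S = \<lparr>carrier = carrier R, mult = undefined, one = undefined,
      zero = \<zero>\<^bsub>R\<^esub>,
    add = add R, smult = (\<lambda>r x. x \<otimes>\<^bsub>R\<^esub> r)\<rparr>"
  have S: "carrier S = carrier R" "\<zero>\<^bsub>S\<^esub> = \<zero>\<^bsub>R\<^esub>" "add S = add R" "\<And>r x. r \<odot>\<^bsub>S\<^esub> x = x \<otimes>\<^bsub>R\<^esub> r"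
    by (simp_all add: S_def)
  interpret S: abelian_group S
    by (rule abelian_groupI) (auto simp: S R.a_ac intro: bexI[of _ "\<ominus>\<^bsub>R\<^esub> x" for x] R.l_neg)
  interpret S: right_module R S
    by unfold_locales (auto simp: S R.r_distr R.l_distr R.m_assoc)
  have "finitely_generated_module R S"
    unfolding S.finitely_generated_iff
  proof (intro exI[of _ "{\<one>\<^bsub>R\<^esub>}"] conjI allI impI subsetI)
    fix N x assume N: "is_submodule R S N \<and> {\<one>\<^bsub>R\<^esub>} \<subseteq> N" and x: "x \<in> carrier S"
    then have "x \<odot>\<^bsub>S\<^esub> \<one>\<^bsub>R\<^esub> \<in> N" by (auto simp: is_submodule_def S(1))
    then show "x \<in> N" using x by (simp add: S)
  qed (auto simp: S)
  then obtain N f where N: "N \<in> Obj (mod_cat R)" "f \<in> module_homs R S N"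
      "bij_betw f (carrier S) (carrier N)"
    using fg_right_module_representable[OF S.right_module_axioms] by blast
  have NM: "right_module R N" using N(1) by (simp add: mod_cat_def)
  interpret N: right_module R N by (rule NM)
  define u where "u = f \<one>\<^bsub>R\<^esub>"
  have u: "u \<in> carrier N" using module_homsD(1)[OF N(2)] by (simp add: u_def S)
  have fr: "f r = r \<odot>\<^bsub>N\<^esub> u" if "r \<in> carrier R" for r
    using module_homsD(3)[OF N(2) that, of "\<one>\<^bsub>R\<^esub>"] that by (simp add: u_def S)
  have ex1: "\<exists>!r. r \<in> carrier R \<and> x = r \<odot>\<^bsub>N\<^esub> u" if x: "x \<in> carrier N" for x
  proof -
    have "\<exists>!r. r \<in> carrier S \<and> x = f r" using N(3) x by (auto simp: bij_betw_def inj_on_def)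
    then show ?thesis using fr by (simp add: S) metis
  qed
  have "free_generator R N u" unfolding free_generator_def using u ex1 by (intro conjI ballI)
  then show ?thesis by (rule that[OF N(1)])
qed

section \<open>Additive calculus, strict epimorphisms, pullbacks and image factorizations\<close>

section \<open>Pre-abelian and quasi-abelian categories\<close>

context additive_category
begin

lemma zero_arr [simp]:
  assumes "X \<in> Obj C" "Y \<in> Obj C"
  shows "HZero C X Y \<in> Arr C" "Dom C (HZero C X Y) = X" "Cod C (HZero C X Y) = Y"
  using zero_hom[OF assms] by (auto simp: Hom_def)

lemma add_arr [simp]:
  assumes "f \<in> Arr C" "g \<in> Arr C" "Dom C g = Dom C f" "Cod C g = Cod C f"
  shows "f \<boxplus> g \<in> Arr C" "Dom C (f \<boxplus> g) = Dom C f" "Cod C (f \<boxplus> g) = Cod C f"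
  using add_hom[of f "Dom C f" "Cod C f" g] assms by (auto simp: Hom_def)

lemma plus_zero [simp]:
  "f \<in> Arr C \<Longrightarrow> Dom C f = X \<Longrightarrow> Cod C f = Y \<Longrightarrow> f \<boxplus> HZero C X Y = f"
  "f \<in> Arr C \<Longrightarrow> Dom C f = X \<Longrightarrow> Cod C f = Y \<Longrightarrow> HZero C X Y \<boxplus> f = f"
  using add_zero[of f X Y] add_zero_left[of f X Y] by (auto simp: Hom_def)

lemma plus_assoc:
  "\<lbrakk>f \<in> Arr C; g \<in> Arr C; h \<in> Arr C; Dom C g = Dom C f; Dom C h = Dom C f;
    Cod C g = Cod C f; Cod C h = Cod C f\<rbrakk> \<Longrightarrow> (f \<boxplus> g) \<boxplus> h = f \<boxplus> (g \<boxplus> h)"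
  using add_assoc[of f "Dom C f" "Cod C f" g h] by (auto simp: Hom_def)

lemma plus_comm:
  "\<lbrakk>f \<in> Arr C; g \<in> Arr C; Dom C g = Dom C f; Cod C g = Cod C f\<rbrakk> \<Longrightarrow> f \<boxplus> g = g \<boxplus> f"
  using add_comm[of f "Dom C f" "Cod C f" g] by (auto simp: Hom_def)

lemma plus_lcomm:
  "\<lbrakk>f \<in> Arr C; g \<in> Arr C; h \<in> Arr C; Dom C g = Dom C f; Dom C h = Dom C f;
    Cod C g = Cod C f; Cod C h = Cod C f\<rbrakk> \<Longrightarrow> f \<boxplus> (g \<boxplus> h) = g \<boxplus> (f \<boxplus> h)"
  using plus_assoc[of f g h] plus_assoc[of g f h] plus_comm[of f g] by simp

lemmas plus_ac = plus_assoc plus_comm plus_lcomm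

lemma comp_plus:
  "\<lbrakk>f \<in> Arr C; f' \<in> Arr C; g \<in> Arr C; Dom C f' = Dom C f; Cod C f' = Cod C f; Dom C g = Cod C f\<rbrakk> \<Longrightarrow>
    g \<cdot> (f \<boxplus> f') = (g \<cdot> f) \<boxplus> (g \<cdot> f')"
  "\<lbrakk>f \<in> Arr C; g \<in> Arr C; g' \<in> Arr C; Dom C g = Cod C f; Dom C g' = Cod C f; Cod C g' = Cod C g\<rbrakk> \<Longrightarrow>
    (g \<boxplus> g') \<cdot> f = (g \<cdot> f) \<boxplus> (g' \<cdot> f)"
  using comp_add_right[of f "Dom C f" "Cod C f" f' g "Cod C g"]
    comp_add_left[of f "Dom C f" "Cod C f" g "Cod C g" g'] by (auto simp: Hom_def)

lemma comp_null [simp]: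
  "f \<in> Arr C \<Longrightarrow> Y = Cod C f \<Longrightarrow> Z \<in> Obj C \<Longrightarrow> HZero C Y Z \<cdot> f = HZero C (Dom C f) Z"
  "f \<in> Arr C \<Longrightarrow> X = Dom C f \<Longrightarrow> Z \<in> Obj C \<Longrightarrow> f \<cdot> HZero C Z X = HZero C Z (Cod C f)"
  using comp_zero[of f "Dom C f" Y Z] zero_comp[of f X "Cod C f" Z] by (auto simp: Hom_def)

text \<open>The record has no field for negatives, so one is chosen by means of
  \<open>add_inv\<close>.\<close>

definition neg :: "'m \<Rightarrow> 'm" where
  "neg f = (SOME g. g \<in> Hom C (Dom C f) (Cod C f) \<and> f \<boxplus> g = HZero C (Dom C f) (Cod C f))"

lemma neg_arr [simp]:
  assumes "f \<in> Arr C"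
  shows "neg f \<in> Arr C" "Dom C (neg f) = Dom C f" "Cod C (neg f) = Cod C f"
    and r_neg [simp]: "f \<boxplus> neg f = HZero C (Dom C f) (Cod C f)"
proof -
  have "\<exists>g. g \<in> Hom C (Dom C f) (Cod C f) \<and> f \<boxplus> g = HZero C (Dom C f) (Cod C f)"
    using add_inv[of f "Dom C f" "Cod C f"] assms by (auto simp: Hom_def)
  from someI_ex[OF this] show "neg f \<in> Arr C" "Dom C (neg f) = Dom C f" "Cod C (neg f) = Cod C f"
    "f \<boxplus> neg f = HZero C (Dom C f) (Cod C f)"
    by (auto simp: neg_def Hom_def)
qed

lemma l_neg [simp]: "f \<in> Arr C \<Longrightarrow> neg f \<boxplus> f = HZero C (Dom C f) (Cod C f)"
  using plus_comm[of f "neg f"] by simp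

lemma neg_cancel [simp]:
  "\<lbrakk>f \<in> Arr C; g \<in> Arr C; Dom C g = Dom C f; Cod C g = Cod C f\<rbrakk> \<Longrightarrow> f \<boxplus> (neg f \<boxplus> g) = g"
  "\<lbrakk>f \<in> Arr C; g \<in> Arr C; Dom C g = Dom C f; Cod C g = Cod C f\<rbrakk> \<Longrightarrow> neg f \<boxplus> (f \<boxplus> g) = g"
  "\<lbrakk>f \<in> Arr C; g \<in> Arr C; Dom C g = Dom C f; Cod C g = Cod C f\<rbrakk> \<Longrightarrow> g \<boxplus> f \<boxplus> neg f = g"
  "\<lbrakk>f \<in> Arr C; g \<in> Arr C; Dom C g = Dom C f; Cod C g = Cod C f\<rbrakk> \<Longrightarrow> g \<boxplus> neg f \<boxplus> f = g"
  by (simp_all flip: plus_assoc) (simp_all add: plus_assoc)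

lemma neg_unique:
  "\<lbrakk>f \<in> Arr C; g \<in> Arr C; Dom C g = Dom C f; Cod C g = Cod C f;
    f \<boxplus> g = HZero C (Dom C f) (Cod C f)\<rbrakk> \<Longrightarrow> neg f = g"
  using neg_cancel(2)[of f g] plus_zero(1)[of "neg f"] by (simp del: neg_cancel r_neg)

lemma comp_neg:
  "\<lbrakk>f \<in> Arr C; g \<in> Arr C; Dom C g = Cod C f\<rbrakk> \<Longrightarrow> g \<cdot> neg f = neg (g \<cdot> f)"
  "\<lbrakk>f \<in> Arr C; g \<in> Arr C; Dom C g = Cod C f\<rbrakk> \<Longrightarrow> neg g \<cdot> f = neg (g \<cdot> f)"
  by (rule neg_unique[symmetric]; simp flip: comp_plus)+

lemma eq_if_diff_zero:
  assumes "f \<in> Arr C" "g \<in> Arr C" "Dom C g = Dom C f" "Cod C g = Cod C f"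
    "f \<boxplus> neg g = HZero C (Dom C f) (Cod C f)"
  shows "f = g"
  using neg_cancel(4)[of g f] assms by simp

definition null_obj :: 'o where
  "null_obj = (SOME Z. Z \<in> Obj C \<and> (\<forall>X \<in> Obj C. (\<exists>!f. f \<in> Hom C Z X) \<and> (\<exists>!f. f \<in> Hom C X Z)))"

lemma null_obj:
  "null_obj \<in> Obj C"
  "f \<in> Arr C \<Longrightarrow> Dom C f = null_obj \<Longrightarrow> f = HZero C null_obj (Cod C f)"
  "f \<in> Arr C \<Longrightarrow> Cod C f = null_obj \<Longrightarrow> f = HZero C (Dom C f) null_obj"
proof -
  have "\<exists>Z. Z \<in> Obj C \<and> (\<forall>X \<in> Obj C. (\<exists>!f. f \<in> Hom C Z X) \<and> (\<exists>!f. f \<in> Hom C X Z))"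
    using zero_object by auto
  note * = someI_ex[OF this, folded null_obj_def]
  show 1: "null_obj \<in> Obj C" using * by simp
  fix f assume f: "f \<in> Arr C"
  then have o: "Dom C f \<in> Obj C" "Cod C f \<in> Obj C" by simp_all
  { assume "Dom C f = null_obj"
    then have "f \<in> Hom C null_obj (Cod C f)" using f by (simp add: Hom_def)
    then show "f = HZero C null_obj (Cod C f)" using * o zero_hom[OF 1 o(2)] by blast }
  { assume "Cod C f = null_obj"
    then have "f \<in> Hom C (Dom C f) null_obj" using f by (simp add: Hom_def)
    then show "f = HZero C (Dom C f) null_obj" using * o zero_hom[OF o(1) 1] by blast }
qed

lemma monicD:
  assumes "is_monic C f" "f \<cdot> g = f \<cdot> h" "g \<in> Arr C" "h \<in> Arr C" "Cod C g = Dom C f"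
      "Cod C h = Dom C f"
    "Dom C g = Dom C h"
  shows "g = h"
proof -
  have "g \<in> Hom C (Dom C h) (Dom C f)" "h \<in> Hom C (Dom C h) (Dom C f)" using assms by
      (simp_all add: Hom_def)
  then show ?thesis using assms(1,2) dom_obj[OF assms(4)] unfolding is_monic_def by blast
qed

lemma monic_arr [simp]: "is_monic C f \<Longrightarrow> f \<in> Arr C"
  by (simp add: is_monic_def)

text \<open>Passing to the difference of two arrows reduces cancellation to arrows that f sends to
  zero.\<close>

lemma monicI:
  assumes f: "f \<in> Arr C"
    and z: "\<And>g. g \<in> Arr C \<Longrightarrow> Cod C g = Dom C f \<Longrightarrow> f \<cdot> g = HZero C (Dom C g) (Cod C f) \<Longrightarrow>
      g = HZero C (Dom C g) (Dom C f)"
  shows "is_monic C f"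
  unfolding is_monic_def
proof (intro conjI ballI impI f)
  fix W g h assume *: "W \<in> Obj C" "g \<in> Hom C W (Dom C f)" "h \<in> Hom C W (Dom C f)" "f \<cdot> g = f \<cdot> h"
  then have gh: "g \<in> Arr C" "h \<in> Arr C" "Dom C g = W" "Dom C h = W" "Cod C g = Dom C f"
      "Cod C h = Dom C f"
    by (auto simp: Hom_def)
  have "g \<boxplus> neg h = HZero C W (Dom C f)"
    using z[of "g \<boxplus> neg h"] gh *(4) f by (simp add: comp_plus comp_neg)
  then show "g = h" using eq_if_diff_zero[of g h] gh by simp
qed

lemma null_monic: "X \<in> Obj C \<Longrightarrow> is_monic C (HZero C null_obj X)"
  using null_obj by (intro monicI) auto

definition is_biproduct :: "'o \<Rightarrow> 'o \<Rightarrow> 'o \<Rightarrow> 'm \<Rightarrow> 'm \<Rightarrow> 'm \<Rightarrow> 'm \<Rightarrow> bool" where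
  "is_biproduct X Y S i j p q \<longleftrightarrow> X \<in> Obj C \<and> Y \<in> Obj C \<and> S \<in> Obj C \<and>
     i \<in> Arr C \<and> j \<in> Arr C \<and> p \<in> Arr C \<and> q \<in> Arr C \<and>
     Dom C i = X \<and> Cod C i = S \<and> Dom C j = Y \<and> Cod C j = S \<and>
     Dom C p = S \<and> Cod C p = X \<and> Dom C q = S \<and> Cod C q = Y \<and>
     p \<cdot> i = Ident C X \<and> q \<cdot> j = Ident C Y \<and>
     p \<cdot> j = HZero C Y X \<and> q \<cdot> i = HZero C X Y \<and> (i \<cdot> p) \<boxplus> (j \<cdot> q) = Ident C S"

lemma biproduct_exists:
  assumes "X \<in> Obj C" "Y \<in> Obj C"
  obtains S i j p q where "is_biproduct X Y S i j p q"
proof -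
  from biproducts[OF assms] obtain S i j p q where "S \<in> Obj C" "i \<in> Hom C X S" "j \<in> Hom C Y S"
    "p \<in> Hom C S X" "q \<in> Hom C S Y" "p \<cdot> i = Ident C X" "q \<cdot> j = Ident C Y"
    "p \<cdot> j = HZero C Y X" "q \<cdot> i = HZero C X Y" "(i \<cdot> p) \<boxplus> (j \<cdot> q) = Ident C S"
    by (elim bexE conjE) (rule that)
  then have "is_biproduct X Y S i j p q" using assms unfolding is_biproduct_def Hom_iff by auto
  then show ?thesis by (rule that)
qed

lemma biproduct_split:
  assumes "is_biproduct X Y S i j p q" "u \<in> Arr C" "Cod C u = S"
  shows "u = (i \<cdot> (p \<cdot> u)) \<boxplus> (j \<cdot> (q \<cdot> u))"
proof -
  have "u = (i \<cdot> p \<boxplus> j \<cdot> q) \<cdot> u" using assms by (simp add: is_biproduct_def)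
  also have "\<dots> = (i \<cdot> (p \<cdot> u)) \<boxplus> (j \<cdot> (q \<cdot> u))"
    using assms(2,3) assms(1)[unfolded is_biproduct_def] by (subst comp_plus) (simp_all add: assoc)
  finally show ?thesis .
qed

lemma biproduct_pair:
  assumes b: "is_biproduct X Y S i j p q" and u: "u \<in> Arr C" "v \<in> Arr C" "Dom C u = Dom C v"
      "Cod C u = X" "Cod C v = Y"
  shows "p \<cdot> (i \<cdot> u \<boxplus> j \<cdot> v) = u" "q \<cdot> (i \<cdot> u \<boxplus> j \<cdot> v) = v"
proof -
  note b = b[unfolded is_biproduct_def]
  have "p \<cdot> (i \<cdot> u) = u" "p \<cdot> (j \<cdot> v) = HZero C (Dom C v) X" "q \<cdot> (i \<cdot> u) = HZero C (Dom C v) Y"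
      "q \<cdot> (j \<cdot> v) = v"
    using b u assoc_reduce[of p i _ u] assoc_reduce[of p j _ v] assoc_reduce[of q i _ u]
        assoc_reduce[of q j _ v]
    by simp_all
  then show "p \<cdot> (i \<cdot> u \<boxplus> j \<cdot> v) = u" "q \<cdot> (i \<cdot> u \<boxplus> j \<cdot> v) = v"
    using b u by (simp_all add: comp_plus)
qed

lemma biproduct_copair:
  assumes b: "is_biproduct X Y S i j p q" and u: "u \<in> Arr C" "v \<in> Arr C" "Cod C u = Cod C v"
      "Dom C u = X" "Dom C v = Y"
  shows "(u \<cdot> p \<boxplus> v \<cdot> q) \<cdot> i = u" "(u \<cdot> p \<boxplus> v \<cdot> q) \<cdot> j = v"
  using b u unfolding is_biproduct_def by (simp_all add: comp_plus assoc)

lemma biproduct_hom_eq: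
  assumes b: "is_biproduct X Y S i j p q" and h: "h \<in> Arr C" "h' \<in> Arr C" "Dom C h = S"
      "Dom C h' = S" "Cod C h' = Cod C h"
    and eq: "h \<cdot> i = h' \<cdot> i" "h \<cdot> j = h' \<cdot> j"
  shows "h = h'"
proof -
  have *: "k = k \<cdot> i \<cdot> p \<boxplus> k \<cdot> j \<cdot> q" if "k \<in> Arr C" "Dom C k = S" for k
  proof -
    have "k = k \<cdot> (i \<cdot> p \<boxplus> j \<cdot> q)" using b that by (simp add: is_biproduct_def)
    also have "\<dots> = k \<cdot> i \<cdot> p \<boxplus> k \<cdot> j \<cdot> q"
      using that b[unfolded is_biproduct_def] by (subst comp_plus) (simp_all add: assoc)
    finally show ?thesis .
  qed
  show ?thesis using *[OF h(1,3)] *[OF h(2,4)] eq by simp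
qed

end

context pre_abelian_category
begin

lemma kernel_obtain:
  assumes "f \<in> Arr C"
  obtains k where "k \<in> Arr C" "Cod C k = Dom C f" "is_monic C k"
      "f \<cdot> k = HZero C (Dom C k) (Cod C f)"
    "\<And>g. g \<in> Arr C \<Longrightarrow> Cod C g = Dom C f \<Longrightarrow> f \<cdot> g = HZero C (Dom C g) (Cod C f) \<Longrightarrow>
      \<exists>h. h \<in> Arr C \<and> Dom C h = Dom C g \<and> Cod C h = Dom C k \<and> g = k \<cdot> h"
proof -
  obtain k where k: "is_kernel C f k" using has_kernel[OF assms] by blast
  then have k': "k \<in> Arr C" "Cod C k = Dom C f" "f \<cdot> k = HZero C (Dom C k) (Cod C f)"
    by (auto simp: is_kernel_def)
  have ex: "\<exists>!h. h \<in> Hom C (Dom C g) (Dom C k) \<and> k \<cdot> h = g"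
    if "g \<in> Arr C" "Cod C g = Dom C f" "f \<cdot> g = HZero C (Dom C g) (Cod C f)" for g
  proof -
    have "g \<in> Hom C (Dom C g) (Dom C f)" using that by (simp add: Hom_def)
    then show ?thesis using k that dom_obj[OF that(1)] unfolding is_kernel_def by metis
  qed
  have "is_monic C k"
  proof (rule monicI[OF k'(1)])
    fix g assume g: "g \<in> Arr C" "Cod C g = Dom C k" "k \<cdot> g = HZero C (Dom C g) (Cod C k)"
    have "\<exists>!h. h \<in> Hom C (Dom C (k \<cdot> g)) (Dom C k) \<and> k \<cdot> h = k \<cdot> g"
      by (rule ex) (use g k' assms in auto)
    moreover have "g \<in> Hom C (Dom C (k \<cdot> g)) (Dom C k)"
        "HZero C (Dom C g) (Dom C k) \<in> Hom C (Dom C (k \<cdot> g)) (Dom C k)"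
      "k \<cdot> HZero C (Dom C g) (Dom C k) = k \<cdot> g"
      using g k' assms by (simp_all add: Hom_def)
    ultimately show "g = HZero C (Dom C g) (Dom C k)" by blast
  qed
  moreover have "\<exists>h. h \<in> Arr C \<and> Dom C h = Dom C g \<and> Cod C h = Dom C k \<and> g = k \<cdot> h"
    if "g \<in> Arr C" "Cod C g = Dom C f" "f \<cdot> g = HZero C (Dom C g) (Cod C f)" for g
    using ex[OF that] by (auto simp: Hom_def)
  ultimately show ?thesis using that k' by blast
qed

text \<open>Strict epimorphisms, that is cokernels, are orthogonal to monomorphisms. If c is the
  cokernel of d and \<open>y \<cdot> c = m \<cdot> h\<close>, then m sends
  \<open>h \<cdot> d\<close> to zero; as m is monic, h kills d and factors through c.\<close>

lemma strict_epi:
  assumes "cokernel_arrow C c"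
  shows strict_arr [simp]: "c \<in> Arr C"
    and strict_epicD: "\<lbrakk>g \<in> Arr C; h \<in> Arr C; Dom C g = Cod C c; Dom C h = Cod C c; Cod C g = Cod C
        h; g \<cdot> c = h \<cdot> c\<rbrakk> \<Longrightarrow> g = h"
    and strict_lift: "\<lbrakk>is_monic C m; y \<in> Arr C; h \<in> Arr C; Dom C y = Cod C c; Cod C m = Cod C y; Dom
        C h = Dom C c;
      Cod C h = Dom C m; y \<cdot> c = m \<cdot> h\<rbrakk> \<Longrightarrow>
      \<exists>h'. h' \<in> Arr C \<and> Dom C h' = Cod C c \<and> Cod C h' = Dom C m \<and> h = h' \<cdot> c \<and> y = m \<cdot> h'"
proof -
  obtain d where d: "is_cokernel C d c" using assms by (auto simp: cokernel_arrow_def)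
  then have d': "d \<in> Arr C" "c \<in> Arr C" "Dom C c = Cod C d" "c \<cdot> d = HZero C (Dom C d) (Cod C c)"
    by (auto simp: is_cokernel_def)
  have ex: "\<exists>!h. h \<in> Hom C (Cod C c) (Cod C g) \<and> h \<cdot> c = g"
    if "g \<in> Arr C" "Dom C g = Cod C d" "g \<cdot> d = HZero C (Dom C d) (Cod C g)" for g
  proof -
    have "g \<in> Hom C (Cod C d) (Cod C g)" using that by (simp add: Hom_def)
    then show ?thesis using d that cod_obj[OF that(1)] unfolding is_cokernel_def by metis
  qed
  show "c \<in> Arr C" by fact
  show epic: "g = h" if gh: "g \<in> Arr C" "h \<in> Arr C" "Dom C g = Cod C c" "Dom C h = Cod C c"
      "Cod C g = Cod C h"
    "g \<cdot> c = h \<cdot> c" for g h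
  proof -
    have "\<exists>!k. k \<in> Hom C (Cod C c) (Cod C (g \<cdot> c)) \<and> k \<cdot> c = g \<cdot> c"
      by (rule ex) (use gh d' in \<open>simp_all add: assoc del: gh(6)\<close>)
    then show ?thesis using gh d' by (auto simp: Hom_def)
  qed
  assume m: "is_monic C m" and y: "y \<in> Arr C" "h \<in> Arr C" "Dom C y = Cod C c" "Cod C m = Cod C y"
    "Dom C h = Dom C c" "Cod C h = Dom C m" and eq: "y \<cdot> c = m \<cdot> h"
  have "m \<cdot> (h \<cdot> d) = (y \<cdot> c) \<cdot> d" using m y d' by (simp add: assoc eq)
  also have "\<dots> = HZero C (Dom C d) (Cod C m)" using y d' by (subst assoc) simp_all
  also have "\<dots> = m \<cdot> HZero C (Dom C d) (Dom C m)" using m d' by simp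
  finally have "h \<cdot> d = HZero C (Dom C d) (Dom C m)"
    by (rule monicD[OF m]) (use m y d' in simp_all)
  then obtain h' where h': "h' \<in> Hom C (Cod C c) (Cod C h)" "h' \<cdot> c = h"
    using ex[of h] y d' by auto
  have "y = m \<cdot> h'"
    by (rule epic) (use h' y m d' eq in \<open>auto simp: Hom_def assoc\<close>)
  then show "\<exists>h'. h' \<in> Arr C \<and> Dom C h' = Cod C c \<and> Cod C h' = Dom C m \<and> h = h' \<cdot> c \<and> y = m \<cdot> h'"
    using h' y by (auto simp: Hom_def)
qed

text \<open>The pullback of \<open>a\<close> and \<open>b\<close> is the kernel of \<open>a \<cdot> p - b \<cdot> q\<close> on the biproduct.\<close>

lemma pullback_exists:
  assumes a: "a \<in> Arr C" and b: "b \<in> Arr C" and ab: "Cod C a = Cod C b"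
  obtains p q where "is_pullback C a b p q"
proof -
  obtain S i j p q where bp: "is_biproduct (Dom C a) (Dom C b) S i j p q"
    using biproduct_exists[OF dom_obj[OF a] dom_obj[OF b]] .
  note bp' = bp[unfolded is_biproduct_def]
  define d where "d = a \<cdot> p \<boxplus> neg (b \<cdot> q)"
  have d: "d \<in> Arr C" "Dom C d = S" "Cod C d = Cod C a" using a b ab bp' by (simp_all add: d_def)
  obtain k where k: "k \<in> Arr C" "Cod C k = Dom C d" "is_monic C k"
      "d \<cdot> k = HZero C (Dom C k) (Cod C d)"
    "\<And>g. g \<in> Arr C \<Longrightarrow> Cod C g = Dom C d \<Longrightarrow> d \<cdot> g = HZero C (Dom C g) (Cod C d) \<Longrightarrow>
      \<exists>h. h \<in> Arr C \<and> Dom C h = Dom C g \<and> Cod C h = Dom C k \<and> g = k \<cdot> h"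
    using kernel_obtain[OF d(1)] by blast
  have dg: "d \<cdot> g = a \<cdot> (p \<cdot> g) \<boxplus> neg (b \<cdot> (q \<cdot> g))" if "g \<in> Arr C" "Cod C g = S" for g
    using that a b ab bp' by (simp add: d_def comp_plus comp_neg assoc)
  have "is_pullback C a b (p \<cdot> k) (q \<cdot> k)"
    unfolding is_pullback_def
  proof (intro conjI ballI impI)
    show "a \<cdot> (p \<cdot> k) = b \<cdot> (q \<cdot> k)"
      by (rule eq_if_diff_zero) (use dg[of k] k d a b ab bp' in simp_all)
    fix W u v assume W: "W \<in> Obj C" and uv: "u \<in> Hom C W (Dom C a)" "v \<in> Hom C W (Dom C b)"
        "a \<cdot> u = b \<cdot> v"
    then have uv': "u \<in> Arr C" "v \<in> Arr C" "Dom C u = W" "Dom C v = W" "Cod C u = Dom C a"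
        "Cod C v = Dom C b"
      by (auto simp: Hom_def)
    define g where "g = i \<cdot> u \<boxplus> j \<cdot> v"
    have g: "g \<in> Arr C" "Dom C g = W" "Cod C g = S" "p \<cdot> g = u" "q \<cdot> g = v"
      using uv' bp' biproduct_pair[OF bp, of u v] by (simp_all add: g_def)
    have "d \<cdot> g = HZero C (Dom C g) (Cod C d)"
      using dg[OF g(1,3)] g d uv(3) uv' a b ab by simp
    then obtain h where h: "h \<in> Arr C" "Dom C h = W" "Cod C h = Dom C k" "g = k \<cdot> h"
      using k(5)[of g] g d by auto
    show "\<exists>!h. h \<in> Hom C W (Dom C (p \<cdot> k)) \<and> (p \<cdot> k) \<cdot> h = u \<and> (q \<cdot> k) \<cdot> h = v"
    proof (rule ex1I[of _ h])
      show "h \<in> Hom C W (Dom C (p \<cdot> k)) \<and> (p \<cdot> k) \<cdot> h = u \<and> (q \<cdot> k) \<cdot> h = v"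
        using h g k d bp' by (simp add: Hom_def assoc)
    next
      fix h' assume h': "h' \<in> Hom C W (Dom C (p \<cdot> k)) \<and> (p \<cdot> k) \<cdot> h' = u \<and> (q \<cdot> k) \<cdot> h' = v"
      then have h'': "h' \<in> Arr C" "Dom C h' = W" "Cod C h' = Dom C k" using k d bp' by
          (auto simp: Hom_def)
      then have "p \<cdot> (k \<cdot> h') = u" "q \<cdot> (k \<cdot> h') = v" using h' k d bp' by (simp_all add: assoc)
      then have "k \<cdot> h' = g" using biproduct_split[OF bp, of "k \<cdot> h'"] k d h'' by (simp add: g_def)
      then show "h' = h" using monicD[OF k(3), of h' h] h h'' by simp
    qed
  qed (use a b ab k d bp' in simp_all)
  then show ?thesis using that by blast
qed

lemma pullback_monic:
  assumes m: "is_monic C m" and pb: "is_pullback C m b p q"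
  shows "is_monic C q"
proof -
  note pb = pb[unfolded is_pullback_def]
  show ?thesis
    unfolding is_monic_def
  proof (intro conjI ballI impI)
    fix W g h assume W: "W \<in> Obj C" and gh: "g \<in> Hom C W (Dom C q)" "h \<in> Hom C W (Dom C q)" and eq:
        "q \<cdot> g = q \<cdot> h"
    have gh': "g \<in> Arr C" "h \<in> Arr C" "Dom C g = W" "Dom C h = W" "Cod C g = Dom C q"
        "Cod C h = Dom C q"
      using gh by (auto simp: Hom_def)
    have mp: "m \<cdot> (p \<cdot> x) = b \<cdot> (q \<cdot> x)" if "x \<in> Arr C" "Cod C x = Dom C q" for x
      using pb that assoc[of x p m] assoc[of x q b] by simp
    have "p \<cdot> g = p \<cdot> h"
      by (rule monicD[OF m]) (use gh' pb eq mp[of g] mp[of h] in simp_all)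
    moreover have "p \<cdot> g \<in> Hom C W (Dom C m)" "q \<cdot> g \<in> Hom C W (Dom C b)" using gh' pb by
        (simp_all add: Hom_def)
    then have "\<exists>!x. x \<in> Hom C W (Dom C p) \<and> p \<cdot> x = p \<cdot> g \<and> q \<cdot> x = q \<cdot> g"
      using pb W mp[of g] gh' by blast
    ultimately show "g = h" using gh eq pb by metis
  qed (use pb in simp)
qed

end

context quasi_abelian_category
begin

text \<open>The form in which stability under pullback is used throughout: a generalised element b
  of the target of c lifts through c after composition with a strict epimorphism.\<close>

lemma strict_pullback:
  assumes c: "cokernel_arrow C c" and b: "b \<in> Arr C" "Cod C b = Cod C c"
  obtains e b' where "cokernel_arrow C e" "b' \<in> Arr C" "Cod C e = Dom C b" "Dom C b' = Dom C e"
      "Cod C b' = Dom C c"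
    "c \<cdot> b' = b \<cdot> e"
proof -
  obtain p q where pb: "is_pullback C c b p q" using pullback_exists[of c b] strict_arr[OF c] b by
      auto
  from cokernel_pullback[OF c this] pb show ?thesis using that[of q p] by
      (auto simp: is_pullback_def)
qed

text \<open>c is the cokernel of the kernel k of f. To see that m is monic, let m send w to zero and
  lift w through c to \<open>w'\<close> after a strict epimorphism e. Then f kills
  \<open>w'\<close>, so \<open>w'\<close> factors through k and
  \<open>w \<cdot> e = c \<cdot> w'\<close> is zero; finally e is epic.\<close>

lemma image_factorization:
  assumes f: "f \<in> Arr C"
  obtains m c where "is_monic C m" "cokernel_arrow C c" "Dom C c = Dom C f" "Cod C c = Dom C m"
      "Cod C m = Cod C f"
    "f = m \<cdot> c"
proof -
  obtain k where k: "k \<in> Arr C" "Cod C k = Dom C f" "is_monic C k"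
      "f \<cdot> k = HZero C (Dom C k) (Cod C f)"
    "\<And>g. g \<in> Arr C \<Longrightarrow> Cod C g = Dom C f \<Longrightarrow> f \<cdot> g = HZero C (Dom C g) (Cod C f) \<Longrightarrow>
      \<exists>h. h \<in> Arr C \<and> Dom C h = Dom C g \<and> Cod C h = Dom C k \<and> g = k \<cdot> h"
    using kernel_obtain[OF f] by blast
  obtain c where c: "is_cokernel C k c" using has_cokernel[OF k(1)] by blast
  then have c': "c \<in> Arr C" "Dom C c = Dom C f" "c \<cdot> k = HZero C (Dom C k) (Cod C c)" using k by
      (auto simp: is_cokernel_def)
  have "f \<in> Hom C (Cod C k) (Cod C f)" using f k by (simp add: Hom_def)
  then obtain m where m: "m \<in> Hom C (Cod C c) (Cod C f)" "m \<cdot> c = f"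
    using c k(4) cod_obj[OF f] unfolding is_cokernel_def by metis
  have m': "m \<in> Arr C" "Dom C m = Cod C c" "Cod C m = Cod C f" using m by (auto simp: Hom_def)
  have sc: "cokernel_arrow C c" using c by (auto simp: cokernel_arrow_def)
  have "is_monic C m"
  proof (rule monicI[OF m'(1)])
    fix w assume w: "w \<in> Arr C" "Cod C w = Dom C m" "m \<cdot> w = HZero C (Dom C w) (Cod C m)"
    obtain e w' where e: "cokernel_arrow C e" "w' \<in> Arr C" "Cod C e = Dom C w" "Dom C w' = Dom C e"
        "Cod C w' = Dom C c"
      "c \<cdot> w' = w \<cdot> e"
      using strict_pullback[OF sc w(1)] w(2) m' by auto
    note eA = strict_arr[OF e(1)]
    have "f \<cdot> w' = m \<cdot> (w \<cdot> e)" using m(2) m' c' e assoc[of w' c m] by simp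
    also have "\<dots> = HZero C (Dom C w') (Cod C f)" using assoc[of e w m] w m' e eA f by simp
    finally obtain h where h: "h \<in> Arr C" "Dom C h = Dom C w'" "Cod C h = Dom C k" "w' = k \<cdot> h"
      using k(5)[of w'] e c' by auto
    have "w \<cdot> e = HZero C (Dom C w') (Cod C c)" using e(6) h k c' assoc[of h k c] by simp
    also have "\<dots> = HZero C (Dom C w) (Dom C m) \<cdot> e" using e eA w m' c' by simp
    finally show "w = HZero C (Dom C w) (Dom C m)"
      by (rule strict_epicD[OF e(1), rotated 5]) (use w(1,2) m' e(3) c'(1) in simp_all)
  qed
  then show ?thesis by (rule that[OF _ sc c'(2) m'(2)[symmetric] m'(3) m(2)[symmetric]])
qed

text \<open>Applied to the image factorization of f, the hypothesis gives a section of the monic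
  part, which is then invertible; so f is a cokernel of the same arrow as the strict part c. The
  criterion speaks only of monomorphisms through which f factors.\<close>

lemma strictI:
  assumes f: "f \<in> Arr C"
    and orth: "\<And>m c. is_monic C m \<Longrightarrow> c \<in> Arr C \<Longrightarrow> Dom C c = Dom C f \<Longrightarrow> Cod C c = Dom C m \<Longrightarrow> Cod C m =
        Cod C f \<Longrightarrow>
      f = m \<cdot> c \<Longrightarrow> \<exists>h. h \<in> Arr C \<and> Dom C h = Cod C f \<and> Cod C h = Dom C m \<and> m \<cdot> h = Ident C (Cod C f)"
  shows "cokernel_arrow C f"
proof -
  obtain m c where mc: "is_monic C m" "cokernel_arrow C c" "Dom C c = Dom C f" "Cod C c = Dom C m"
      "Cod C m = Cod C f"
    and fm: "f = m \<cdot> c" using image_factorization[OF f] .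
  obtain h where h: "h \<in> Arr C" "Dom C h = Cod C f" "Cod C h = Dom C m" "m \<cdot> h = Ident C (Cod C f)"
    using orth[OF mc(1) strict_arr[OF mc(2)] mc(3-5) fm] by blast
  \<comment> \<open>A monomorphism with a section is invertible.\<close>
  have hm: "h \<cdot> m = Ident C (Dom C m)"
    by (rule monicD[OF mc(1)]) (use mc h assoc[of m h m] f in simp_all)
  obtain d where d: "is_cokernel C d c" using mc(2) by (auto simp: cokernel_arrow_def)
  note d' = d[unfolded is_cokernel_def]
  note mA = monic_arr[OF mc(1)] and cA = strict_arr[OF mc(2)]
  have "is_cokernel C d f"
    unfolding is_cokernel_def
  proof (intro conjI ballI impI)
    show "d \<in> Arr C" "f \<in> Arr C" "Dom C f = Cod C d" using d' f mc(3) by simp_all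
    show "f \<cdot> d = HZero C (Dom C d) (Cod C f)" using assoc[of d c m] d' mc mA cA by
        (simp add: fm[symmetric])
    fix W g assume g: "W \<in> Obj C" "g \<in> Hom C (Cod C d) W" "g \<cdot> d = HZero C (Dom C d) W"
    then obtain k where k: "k \<in> Hom C (Cod C c) W" "k \<cdot> c = g" using d' by blast
    have k': "k \<in> Arr C" "Dom C k = Dom C m" "Cod C k = W" using k mc by (auto simp: Hom_def)
    show "\<exists>!h. h \<in> Hom C (Cod C f) W \<and> h \<cdot> f = g"
    proof (rule ex1I[of _ "k \<cdot> h"])
      have "(k \<cdot> h) \<cdot> f = k \<cdot> ((h \<cdot> m) \<cdot> c)" using k' h mc mA cA f by
          (simp add: assoc fm[symmetric])
      then show "k \<cdot> h \<in> Hom C (Cod C f) W \<and> (k \<cdot> h) \<cdot> f = g" using k k' h hm mc cA by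
          (simp add: Hom_def)
    next
      fix l assume l: "l \<in> Hom C (Cod C f) W \<and> l \<cdot> f = g"
      then have l': "l \<in> Arr C" "Dom C l = Cod C f" "Cod C l = W" by (auto simp: Hom_def)
      have "(l \<cdot> m) \<cdot> c = k \<cdot> c" using l l' mc mA cA k by (simp add: assoc fm[symmetric])
      then have "l \<cdot> m = k" by (rule strict_epicD[OF mc(2), rotated 5])
          (use l' mc mA k' in simp_all)
      then have "k \<cdot> h = l \<cdot> (m \<cdot> h)" using l' mc mA h by (metis assoc)
      then show "l = k \<cdot> h" using h l' by simp
    qed
  qed
  then show ?thesis by (auto simp: cokernel_arrow_def)
qed

text \<open>If \<open>d \<cdot> c\<close> factors through a monomorphism m, orthogonality to c lifts
  d to m, and orthogonality to d then lifts the identity.\<close>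

lemma strict_comp:
  assumes c: "cokernel_arrow C c" and d: "cokernel_arrow C d" and cd: "Dom C d = Cod C c"
  shows "cokernel_arrow C (d \<cdot> c)"
proof (rule strictI)
  note A = strict_arr[OF c] strict_arr[OF d]
  show "d \<cdot> c \<in> Arr C" using A cd by simp
  fix m x assume m: "is_monic C m" and x: "x \<in> Arr C" "Dom C x = Dom C (d \<cdot> c)" "Cod C x = Dom C m"
    and md: "Cod C m = Cod C (d \<cdot> c)" and eq: "d \<cdot> c = m \<cdot> x"
  have x': "Dom C x = Dom C c" and md': "Cod C m = Cod C d" using x md A cd by simp_all
  obtain h where h: "h \<in> Arr C" "Dom C h = Cod C c" "Cod C h = Dom C m" "d = m \<cdot> h"
    using strict_lift[OF c m A(2) x(1) cd md' x' x(3) eq] by blast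
  obtain h' where h': "h' \<in> Arr C" "Dom C h' = Cod C d" "Cod C h' = Dom C m"
      "Ident C (Cod C d) = m \<cdot> h'"
    using strict_lift[OF d m, of "Ident C (Cod C d)" h] A h md' cd by auto
  then show "\<exists>h. h \<in> Arr C \<and> Dom C h = Cod C (d \<cdot> c) \<and> Cod C h = Dom C m \<and> m \<cdot> h = Ident C
      (Cod C (d \<cdot> c))"
    using A cd by auto
qed

lemma strict_split:
  assumes "f \<in> Arr C" "s \<in> Arr C" "Dom C s = Cod C f" "Cod C s = Dom C f"
      "f \<cdot> s = Ident C (Cod C f)"
  shows "cokernel_arrow C f"
proof (rule strictI[OF assms(1)])
  fix m c assume m: "is_monic C m" and c: "c \<in> Arr C" "Dom C c = Dom C f" "Cod C c = Dom C m"
      "Cod C m = Cod C f" and fm: "f = m \<cdot> c"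
  have "m \<cdot> (c \<cdot> s) = Ident C (Cod C f)" using assoc[of s c m] m c assms fm[symmetric] by simp
  then show "\<exists>h. h \<in> Arr C \<and> Dom C h = Cod C f \<and> Cod C h = Dom C m \<and> m \<cdot> h = Ident C (Cod C f)"
    using assms c by (intro exI[of _ "c \<cdot> s"]) simp
qed

end

section \<open>Chain maps up to homotopy as arrows modulo a monomorphism; monic, epic and regular
  arrows of K\<close>

section \<open>Arrows of the category K\<close>

lemma is_epicD:
  "\<lbrakk>is_epic C f; Cod C f = Y; Z \<in> Obj C; g \<in> Hom C Y Z; h \<in> Hom C Y Z; g \<cdot>\<^bsub>C\<^esub> f = h \<cdot>\<^bsub>C\<^esub> f\<rbrakk> \<Longrightarrow> g = h"
  unfolding is_epic_def by blast

lemma is_monicD: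
  "\<lbrakk>is_monic C f; Dom C f = X; W \<in> Obj C; g \<in> Hom C W X; h \<in> Hom C W X; f \<cdot>\<^bsub>C\<^esub> g = f \<cdot>\<^bsub>C\<^esub> h\<rbrakk> \<Longrightarrow> g =
      h"
  unfolding is_monic_def by blast

context additive_category
begin

definition eqm :: "'m \<Rightarrow> 'm \<Rightarrow> 'm \<Rightarrow> bool" where
  \<comment> \<open>\<open>y\<close> and \<open>y'\<close> represent the same generalised element of the cokernel of \<open>f\<close>\<close>
  "eqm f y y' \<longleftrightarrow> f \<in> Arr C \<and> y \<in> Arr C \<and> y' \<in> Arr C \<and> Cod C y = Cod C f \<and> Cod C y' = Cod C f \<and> Dom C
      y' = Dom C y \<and>
     (\<exists>h. h \<in> Arr C \<and> Dom C h = Dom C y \<and> Cod C h = Dom C f \<and> y = y' \<boxplus> f \<cdot> h)"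

lemma eqm_arr:
  assumes "eqm f y y'"
  shows "f \<in> Arr C" "y \<in> Arr C" "y' \<in> Arr C" "Cod C y = Cod C f" "Cod C y' = Cod C f"
      "Dom C y' = Dom C y"
  using assms unfolding eqm_def by blast+

lemma eqmI:
  assumes "f \<in> Arr C" "y' \<in> Arr C" "h \<in> Arr C" "Cod C y' = Cod C f" "Dom C h = Dom C y'"
      "Cod C h = Dom C f"
    "y = y' \<boxplus> f \<cdot> h"
  shows "eqm f y y'"
  using assms unfolding eqm_def by auto

lemma eqmE:
  assumes "eqm f y y'"
  obtains h where "h \<in> Arr C" "Dom C h = Dom C y" "Cod C h = Dom C f" "y = y' \<boxplus> f \<cdot> h"
  using assms unfolding eqm_def by blast

lemma eqm_refl: "\<lbrakk>f \<in> Arr C; y \<in> Arr C; Cod C y = Cod C f\<rbrakk> \<Longrightarrow> eqm f y y"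
  by (rule eqmI[where h = "HZero C (Dom C y) (Dom C f)"]) auto

lemma eqm_sym:
  assumes "eqm f y y'" shows "eqm f y' y"
proof -
  obtain h where h: "h \<in> Arr C" "Dom C h = Dom C y" "Cod C h = Dom C f" "y = y' \<boxplus> f \<cdot> h"
    using assms by (rule eqmE)
  note a = eqm_arr[OF assms]
  have eq: "y \<boxplus> f \<cdot> neg h = y'"
    unfolding h(4) using a h(1-3) by (simp add: comp_neg)
  show ?thesis by (rule eqmI[OF _ _ _ _ _ _ eq[symmetric]]) (use a h(1-3) in simp_all)
qed

lemma eqm_trans:
  assumes "eqm f x y" "eqm f y z" shows "eqm f x z"
proof -
  obtain h where h: "h \<in> Arr C" "Dom C h = Dom C x" "Cod C h = Dom C f" "x = y \<boxplus> f \<cdot> h"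
    using assms(1) by (rule eqmE)
  obtain k where k: "k \<in> Arr C" "Dom C k = Dom C y" "Cod C k = Dom C f" "y = z \<boxplus> f \<cdot> k"
    using assms(2) by (rule eqmE)
  note a = eqm_arr[OF assms(1)] eqm_arr[OF assms(2)]
  have eq: "x = z \<boxplus> f \<cdot> (k \<boxplus> h)"
    unfolding h(4) k(4) using a h(1-3) k(1-3) by (simp add: comp_plus plus_assoc)
  show ?thesis by (rule eqmI[OF _ _ _ _ _ _ eq]) (use a h(1-3) k(1-3) in simp_all)
qed

lemma eqm_comp:
  assumes "eqm f y y'" "x \<in> Arr C" "Cod C x = Dom C y"
  shows "eqm f (y \<cdot> x) (y' \<cdot> x)"
proof -
  obtain h where h: "h \<in> Arr C" "Dom C h = Dom C y" "Cod C h = Dom C f" "y = y' \<boxplus> f \<cdot> h"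
    using assms(1) by (rule eqmE)
  note a = eqm_arr[OF assms(1)]
  have eq: "y \<cdot> x = y' \<cdot> x \<boxplus> f \<cdot> (h \<cdot> x)"
    unfolding h(4) using a h(1-3) assms(2,3) by (simp add: comp_plus assoc)
  show ?thesis by (rule eqmI[OF _ _ _ _ _ _ eq]) (use a h(1-3) assms(2,3) in simp_all)
qed

lemma eqm_add:
  assumes "eqm f y y'" "eqm f z z'" "Dom C z = Dom C y"
  shows "eqm f (y \<boxplus> z) (y' \<boxplus> z')"
proof -
  obtain h where h: "h \<in> Arr C" "Dom C h = Dom C y" "Cod C h = Dom C f" "y = y' \<boxplus> f \<cdot> h"
    using assms(1) by (rule eqmE)
  obtain k where k: "k \<in> Arr C" "Dom C k = Dom C z" "Cod C k = Dom C f" "z = z' \<boxplus> f \<cdot> k"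
    using assms(2) by (rule eqmE)
  note a = eqm_arr[OF assms(1)] eqm_arr[OF assms(2)] assms(3)
  have eq: "y \<boxplus> z = (y' \<boxplus> z') \<boxplus> f \<cdot> (h \<boxplus> k)"
    unfolding h(4) k(4) using a h(1-3) k(1-3) by (simp add: comp_plus plus_ac)
  show ?thesis by (rule eqmI[OF _ _ _ _ _ _ eq]) (use a h(1-3) k(1-3) in simp_all)
qed

lemma eqm_null:
  assumes "Y \<in> Obj C" "eqm (HZero C null_obj Y) y y'"
  shows "y = y'"
proof -
  obtain h where h: "h \<in> Arr C" "Dom C h = Dom C y" "Cod C h = null_obj"
      "y = y' \<boxplus> HZero C null_obj Y \<cdot> h"
    using eqmE[OF assms(2)] assms(1) null_obj(1) by (metis zero_arr(2))
  have "HZero C null_obj Y \<cdot> h = HZero C (Dom C y') (Cod C y')"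
    using h(1-3) assms(1) eqm_arr[OF assms(2)] null_obj(1) by simp
  then have "y = y' \<boxplus> HZero C (Dom C y') (Cod C y')" using h(4) by metis
  also have "\<dots> = y'" using eqm_arr(3)[OF assms(2)] by simp
  finally show ?thesis .
qed

lemma eqm_zero_iff:
  assumes "f \<in> Arr C" "y \<in> Arr C" "Cod C y = Cod C f"
  shows "eqm f y (HZero C (Dom C y) (Cod C f)) \<longleftrightarrow> (\<exists>h. h \<in> Arr C \<and> Dom C h = Dom C y \<and> Cod C h = Dom
      C f \<and> y = f \<cdot> h)"
  using assms unfolding eqm_def by auto

lemma eqm_zeroI:
  assumes "f \<in> Arr C" "h \<in> Arr C" "Cod C h = Dom C f"
  shows "eqm f (f \<cdot> h) (HZero C (Dom C h) (Cod C f))"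
  using assms eqm_zero_iff[of f "f \<cdot> h"] by auto

lemma eqm_diff:
  assumes "f \<in> Arr C" "y \<in> Arr C" "y' \<in> Arr C" "Cod C y = Cod C f" "Cod C y' = Cod C f"
      "Dom C y' = Dom C y"
  shows "eqm f y y' \<longleftrightarrow> (\<exists>h. h \<in> Arr C \<and> Dom C h = Dom C y \<and> Cod C h = Dom C f \<and> y \<boxplus> neg y' = f \<cdot> h)"
proof
  assume "eqm f y y'"
  then obtain h where h: "h \<in> Arr C" "Dom C h = Dom C y" "Cod C h = Dom C f" "y = y' \<boxplus> f \<cdot> h" by
      (rule eqmE)
  have "y \<boxplus> neg y' = f \<cdot> h" unfolding h(4) using assms h(1-3) by
      (simp add: plus_comm[of y' "f \<cdot> h"])
  then show "\<exists>h. h \<in> Arr C \<and> Dom C h = Dom C y \<and> Cod C h = Dom C f \<and> y \<boxplus> neg y' = f \<cdot> h" using h by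
      blast
next
  assume "\<exists>h. h \<in> Arr C \<and> Dom C h = Dom C y \<and> Cod C h = Dom C f \<and> y \<boxplus> neg y' = f \<cdot> h"
  then obtain h where h: "h \<in> Arr C" "Dom C h = Dom C y" "Cod C h = Dom C f" "y \<boxplus> neg y' = f \<cdot> h" by
      blast
  have "y = y' \<boxplus> f \<cdot> h" unfolding h(4)[symmetric] using assms by
      (simp add: plus_comm[of y "neg y'"])
  from eqmI[OF _ _ _ _ _ _ this] show "eqm f y y'" using assms h(1-3) by simp
qed

text \<open>As \<open>f'\<close> is monic, a chain map \<open>f \<rightarrow> f'\<close> is determined by its second component \<open>b\<close>, and its
    homotopy
  class by \<open>b\<close> modulo \<open>f'\<close>.\<close>

definition kmap :: "'m \<Rightarrow> 'm \<Rightarrow> 'm \<Rightarrow> bool" where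
  "kmap f b f' \<longleftrightarrow> is_monic C f \<and> is_monic C f' \<and> b \<in> Arr C \<and> Dom C b = Cod C f \<and> Cod C b = Cod C f' \<and>
     (\<exists>a. a \<in> Arr C \<and> Dom C a = Dom C f \<and> Cod C a = Dom C f' \<and> b \<cdot> f = f' \<cdot> a)"

definition karr :: "'m \<Rightarrow> 'm \<Rightarrow> 'm \<Rightarrow> 'm K_arr" where
  "karr f b f' = (f, {v \<in> chain_maps C f f'. eqm f' b (snd v)}, f')"

lemma kmapD:
  assumes "kmap f b f'"
  shows "is_monic C f" "is_monic C f'" "f \<in> Arr C" "f' \<in> Arr C" "b \<in> Arr C" "Dom C b = Cod C f"
      "Cod C b = Cod C f'"
  using assms by (auto simp: kmap_def)

text \<open>Being a chain map becomes an equality of generalised elements. It can then be reflected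
  along regular arrows or tested on arrows from P.\<close>

lemma kmap_iff:
  assumes "is_monic C f" "is_monic C f'" "b \<in> Arr C" "Dom C b = Cod C f" "Cod C b = Cod C f'"
  shows "kmap f b f' \<longleftrightarrow> eqm f' (b \<cdot> f) (HZero C (Dom C f) (Cod C f'))"
  using assms eqm_zero_iff[of f' "b \<cdot> f"] by (auto simp: kmap_def)

lemma kmap_eqm:
  assumes b: "kmap f b f'" and y: "eqm f y y'"
  shows "eqm f' (b \<cdot> y) (b \<cdot> y')"
proof -
  obtain a where a: "a \<in> Arr C" "Dom C a = Dom C f" "Cod C a = Dom C f'" "b \<cdot> f = f' \<cdot> a" using b by
      (auto simp: kmap_def)
  obtain h where h: "h \<in> Arr C" "Dom C h = Dom C y" "Cod C h = Dom C f" "y = y' \<boxplus> f \<cdot> h"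
    using y by (rule eqmE)
  note d = kmapD[OF b] eqm_arr[OF y]
  have "b \<cdot> (f \<cdot> h) = f' \<cdot> (a \<cdot> h)" using assoc[of h f b] assoc[of h a f'] a d h(1-3) by simp
  then have eq: "b \<cdot> y = b \<cdot> y' \<boxplus> f' \<cdot> (a \<cdot> h)" unfolding h(4) using d h(1-3) by
      (simp add: comp_plus)
  show ?thesis by (rule eqmI[OF _ _ _ _ _ _ eq]) (use d h(1-3) a(1-3) in simp_all)
qed

lemma kmap_comp:
  assumes b: "kmap f b g" and c: "kmap g c h"
  shows "kmap f (c \<cdot> b) h"
proof -
  note d = kmapD[OF b] kmapD[OF c]
  have "eqm g (b \<cdot> f) (HZero C (Dom C f) (Cod C g))" using b kmap_iff[of f g b] d by simp
  from kmap_eqm[OF c this] show ?thesis using kmap_iff[of f h "c \<cdot> b"] d by (simp add: assoc)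
qed

lemma kmap_ident: "is_monic C f \<Longrightarrow> kmap f (Ident C (Cod C f)) f"
  unfolding kmap_def by (auto intro!: exI[of _ "Ident C (Dom C f)"])

lemma kmap_null:
  assumes "is_monic C f" "y \<in> Arr C" "Cod C y = Cod C f" "Dom C y = X"
  shows "kmap (HZero C null_obj X) y f"
  using assms null_obj(1) null_monic[of X] unfolding kmap_def
  by (auto intro!: exI[of _ "HZero C null_obj (Dom C f)"])

lemma kmap_of_eqm:
  assumes "kmap f b f'" "eqm f' b b'" shows "kmap f b' f'"
proof -
  note d = kmapD[OF assms(1)] eqm_arr[OF assms(2)]
  have "eqm f' (b \<cdot> f) (HZero C (Dom C f) (Cod C f'))" using assms(1) kmap_iff[of f f' b] d by simp
  moreover have "eqm f' (b \<cdot> f) (b' \<cdot> f)" by (rule eqm_comp[OF assms(2)]) (use d in simp_all)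
  ultimately have "eqm f' (b' \<cdot> f) (HZero C (Dom C f) (Cod C f'))" using eqm_sym eqm_trans by blast
  then show ?thesis using kmap_iff[of f f' b'] d by simp
qed

text \<open>The equation of second components is enough for h to be a homotopy: the one for first
  components follows by cancelling the monic \<open>f'\<close>.\<close>

lemma homotopic_iff_eqm:
  assumes "is_monic C f'" and fA: "f \<in> Arr C" and u: "u \<in> chain_maps C f f'" and v:
      "v \<in> chain_maps C f f'"
  shows "homotopic C f f' u v \<longleftrightarrow> eqm f' (snd u) (snd v)"
proof
  note f' = monic_arr[OF assms(1)]
  have d: "fst u \<in> Arr C" "snd u \<in> Arr C" "fst v \<in> Arr C" "snd v \<in> Arr C" "Dom C (fst u) = Dom C f"
      "Cod C (fst u) = Dom C f'"
    "Dom C (snd u) = Cod C f" "Cod C (snd u) = Cod C f'" "Dom C (fst v) = Dom C f"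
        "Cod C (fst v) = Dom C f'"
    "Dom C (snd v) = Cod C f" "Cod C (snd v) = Cod C f'" "snd u \<cdot> f = f' \<cdot> fst u"
        "snd v \<cdot> f = f' \<cdot> fst v"
    using chain_mapsD[OF u] chain_mapsD[OF v] by (auto simp: Hom_def)
  { assume "homotopic C f f' u v"
    then obtain h where h: "h \<in> Hom C (Cod C f) (Dom C f')" and eq: "snd u = snd v \<boxplus> f' \<cdot> h"
      unfolding homotopic_def by blast
    show "eqm f' (snd u) (snd v)" by (rule eqmI[OF _ _ _ _ _ _ eq])
        (use d f' h in \<open>simp_all add: Hom_def\<close>) }
  { assume "eqm f' (snd u) (snd v)"
    then obtain h where h: "h \<in> Arr C" "Dom C h = Dom C (snd u)" "Cod C h = Dom C f'"
        "snd u = snd v \<boxplus> f' \<cdot> h"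
      by (rule eqmE)
    have "f' \<cdot> fst u = (snd v \<boxplus> f' \<cdot> h) \<cdot> f" unfolding d(13)[symmetric] h(4)[symmetric] ..
    also have "\<dots> = f' \<cdot> (fst v \<boxplus> h \<cdot> f)" using d f' fA h(1-3) by (simp add: comp_plus assoc)
    finally have "fst u = fst v \<boxplus> h \<cdot> f" by (rule monicD[OF assms(1)]) (use d h(1-3) fA in simp_all)
    moreover have "h \<in> Hom C (Cod C f) (Dom C f')" using h(1-3) d by (simp add: Hom_def)
    ultimately show "homotopic C f f' u v" using h(4) unfolding homotopic_def by blast }
qed

lemma karr_class:
  assumes "is_monic C f'" and "f \<in> Arr C" and "u \<in> chain_maps C f f'"
  shows "(f, homotopy_class C f f' u, f') = karr f (snd u) f'"
  using homotopic_iff_eqm[OF assms] by (auto simp: karr_def homotopy_class_def)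

lemma kmap_chain:
  assumes "kmap f b f'"
  obtains a where "(a, b) \<in> chain_maps C f f'"
  using assms that by (auto simp: kmap_def chain_maps_def Hom_def)

lemma K_HomE':
  assumes "F \<in> Hom (K_cat C) f f'"
  obtains b where "kmap f b f'" "F = karr f b f'"
proof -
  obtain u where u: "u \<in> chain_maps C f f'" "F = (f, homotopy_class C f f' u, f')" "f \<in> Arr C"
      "f' \<in> Arr C"
    "is_monic C f" "is_monic C f'" using assms by (rule K_HomE)
  have "kmap f (snd u) f'" using chain_mapsD[OF u(1)] u(5,6) unfolding kmap_def Hom_def by auto
  moreover have "F = karr f (snd u) f'" using karr_class[OF u(6,3,1)] u(2) by simp
  ultimately show ?thesis by (rule that)
qed

lemma karr_hom:
  assumes "kmap f b f'"
  shows "karr f b f' \<in> Hom (K_cat C) f f'"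
proof -
  obtain a where "(a, b) \<in> chain_maps C f f'" using kmap_chain[OF assms] .
  then show ?thesis using K_HomI[of "(a, b)" f f'] karr_class[of f' f "(a, b)"] kmapD[OF assms] by
      simp
qed

lemma karr_dom_cod [simp]: "Dom (K_cat C) (karr f b f') = f" "Cod (K_cat C) (karr f b f') = f'"
  by (simp_all add: karr_def K_cat_def)

lemma karr_eq_iff:
  assumes b: "kmap f b f'" and c: "kmap f c f'"
  shows "karr f b f' = karr f c f' \<longleftrightarrow> eqm f' b c"
proof
  obtain a where a: "(a, c) \<in> chain_maps C f f'" using kmap_chain[OF c] .
  assume "karr f b f' = karr f c f'"
  then have S: "{v \<in> chain_maps C f f'. eqm f' b (snd v)} = {v \<in> chain_maps C f f'. eqm f' c
      (snd v)}"
    unfolding karr_def prod.inject by (elim conjE)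
  have "(a, c) \<in> {v \<in> chain_maps C f f'. eqm f' c (snd v)}" using a eqm_refl kmapD[OF c] by simp
  then have "(a, c) \<in> {v \<in> chain_maps C f f'. eqm f' b (snd v)}" unfolding S .
  then show "eqm f' b c" by simp
next
  assume "eqm f' b c"
  then have "eqm f' b x \<longleftrightarrow> eqm f' c x" for x using eqm_trans eqm_sym by metis
  then show "karr f b f' = karr f c f'" by (simp add: karr_def)
qed

lemma karr_comp:
  assumes b: "kmap f b g" and c: "kmap g c h"
  shows "karr g c h \<cdot>\<^bsub>K_cat C\<^esub> karr f b g = karr f (c \<cdot> b) h"
proof -
  obtain a where a: "(a, b) \<in> chain_maps C f g" using kmap_chain[OF b] .
  obtain a' where a': "(a', c) \<in> chain_maps C g h" using kmap_chain[OF c] .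
  note d = kmapD[OF b] kmapD[OF c]
  have k: "karr f b g = (f, homotopy_class C f g (a, b), g)"
      "karr g c h = (g, homotopy_class C g h (a', c), h)"
    using karr_class[of g f "(a, b)"] karr_class[of h g "(a', c)"] a a' d by simp_all
  show ?thesis
    unfolding k K_comp[OF a a' d(3,4) d(11)]
    using karr_class[OF _ _ chain_maps_comp[OF a a' d(3,4) d(11)]] d by simp
qed

lemma K_ident: "is_monic C f \<Longrightarrow> Ident (K_cat C) f = karr f (Ident C (Cod C f)) f"
  using karr_class[OF _ _ chain_maps_ident, of f] by (simp add: K_cat_def)

lemma K_obj [simp]: "f \<in> Obj (K_cat C) \<longleftrightarrow> is_monic C f"
  by (simp add: K_cat_def)

text \<open>Arrows of K from the complex 0 \<rightarrow> W to f are the generalised elements W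
  \<rightarrow> Cod f modulo f. Monicity is tested against these complexes.\<close>

lemma K_monic_reflect:
  assumes mon: "is_monic (K_cat C) (karr f b f')" and b: "kmap f b f'"
    and y: "y \<in> Arr C" "y' \<in> Arr C" "Cod C y = Cod C f" "Cod C y' = Cod C f" "Dom C y' = Dom C y"
    and eq: "eqm f' (b \<cdot> y) (b \<cdot> y')"
  shows "eqm f y y'"
proof -
  note d = kmapD[OF b]
  have k: "kmap (HZero C null_obj (Dom C y)) y f" "kmap (HZero C null_obj (Dom C y)) y' f"
    using kmap_null d y by auto
  have "karr f b f' \<cdot>\<^bsub>K_cat C\<^esub> karr (HZero C null_obj (Dom C y)) y f
      = karr f b f' \<cdot>\<^bsub>K_cat C\<^esub> karr (HZero C null_obj (Dom C y)) y' f"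
    using karr_comp[OF k(1) b] karr_comp[OF k(2) b] karr_eq_iff[OF kmap_comp[OF k(1) b]
        kmap_comp[OF k(2) b]] eq by simp
  from is_monicD[OF mon karr_dom_cod(1) _ karr_hom[OF k(1)] karr_hom[OF k(2)] this]
      kmapD(1)[OF k(1)]
  have "karr (HZero C null_obj (Dom C y)) y f = karr (HZero C null_obj (Dom C y)) y' f" by simp
  then show ?thesis using karr_eq_iff[OF k] by simp
qed

end

context quasi_abelian_category
begin

text \<open>Equality modulo f is local for strict epimorphisms: the factorization of the difference
  through the monic f descends along e by orthogonality.\<close>

lemma strict_reflect:
  assumes e: "cokernel_arrow C e" and f: "is_monic C f"
    and y: "y \<in> Arr C" "y' \<in> Arr C" "Cod C y = Cod C f" "Cod C y' = Cod C f" "Dom C y = Cod C e"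
        "Dom C y' = Cod C e"
    and eq: "eqm f (y \<cdot> e) (y' \<cdot> e)"
  shows "eqm f y y'"
proof -
  note A = strict_arr[OF e] monic_arr[OF f]
  obtain h where h: "h \<in> Arr C" "Dom C h = Dom C e" "Cod C h = Dom C f"
      "y \<cdot> e \<boxplus> neg (y' \<cdot> e) = f \<cdot> h"
    using eq eqm_diff[of f "y \<cdot> e" "y' \<cdot> e"] A y by auto
  have eq': "(y \<boxplus> neg y') \<cdot> e = f \<cdot> h" using h(4) A y by (simp add: comp_plus comp_neg)
  have 1: "y \<boxplus> neg y' \<in> Arr C" "Dom C (y \<boxplus> neg y') = Cod C e" "Cod C f = Cod C (y \<boxplus> neg y')"
    using y by simp_all
  obtain h' where "h' \<in> Arr C" "Dom C h' = Cod C e" "Cod C h' = Dom C f" "y \<boxplus> neg y' = f \<cdot> h'"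
    using strict_lift[OF e f 1(1) h(1) 1(2,3) h(2,3) eq'] by blast
  then show ?thesis using eqm_diff[of f y y'] A y by auto
qed

text \<open>If e sends the difference of x and \<open>x'\<close> into f, the universal property of
  the pullback factors that difference through g.\<close>

lemma pullback_reflect:
  assumes pb: "is_pullback C f e p g" and x: "x \<in> Arr C" "x' \<in> Arr C" "Cod C x = Cod C g"
      "Cod C x' = Cod C g" "Dom C x' = Dom C x"
    and eq: "eqm f (e \<cdot> x) (e \<cdot> x')"
  shows "eqm g x x'"
proof -
  note pb' = pb[unfolded is_pullback_def]
  obtain h where h: "h \<in> Arr C" "Dom C h = Dom C x" "Cod C h = Dom C f"
      "e \<cdot> x \<boxplus> neg (e \<cdot> x') = f \<cdot> h"
    using eq eqm_diff[of f "e \<cdot> x" "e \<cdot> x'"] pb' x by auto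
  have "f \<cdot> h = e \<cdot> (x \<boxplus> neg x')" using h(4) pb' x by (simp add: comp_plus comp_neg)
  moreover have "h \<in> Hom C (Dom C x) (Dom C f)" "x \<boxplus> neg x' \<in> Hom C (Dom C x) (Dom C e)"
      "Dom C x \<in> Obj C"
    using h x pb' by (auto simp: Hom_def)
  ultimately obtain k where "k \<in> Hom C (Dom C x) (Dom C p)" "g \<cdot> k = x \<boxplus> neg x'" using pb' by blast
  then show ?thesis using eqm_diff[of g x x'] pb' x by (auto simp: Hom_def)
qed

lemma pullback_kmap:
  assumes f: "is_monic C f" and pb: "is_pullback C f e p g"
  shows "kmap g e f"
  using f pullback_monic[OF f pb] pb unfolding is_pullback_def kmap_def by auto

text \<open>Monic by \<open>pullback_reflect\<close>, epic by \<open>strict_reflect\<close>. In the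
  localization f may thus be replaced by a complex whose second term is any strict cover of
  \<open>Cod C f\<close>.\<close>

lemma pullback_regular:
  assumes f: "is_monic C f" and e: "cokernel_arrow C e" and pb: "is_pullback C f e p g"
  shows "is_regular (K_cat C) (karr g e f)"
proof -
  note pb' = pb[unfolded is_pullback_def]
  note k = pullback_kmap[OF f pb]
  show ?thesis
    unfolding is_regular_def is_monic_def[of "K_cat C"] is_epic_def karr_dom_cod
  proof (intro conjI ballI impI)
    show "karr g e f \<in> Arr (K_cat C)" using karr_hom[OF k] by (simp add: Hom_def)
    then show "karr g e f \<in> Arr (K_cat C)" .
  next
    fix W F G assume FG: "F \<in> Hom (K_cat C) W g" "G \<in> Hom (K_cat C) W g"
      and eq: "karr g e f \<cdot>\<^bsub>K_cat C\<^esub> F = karr g e f \<cdot>\<^bsub>K_cat C\<^esub> G"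
    obtain x where x: "kmap W x g" "F = karr W x g" using FG(1) by (rule K_HomE')
    obtain x' where x': "kmap W x' g" "G = karr W x' g" using FG(2) by (rule K_HomE')
    have "eqm f (e \<cdot> x) (e \<cdot> x')"
      using eq karr_comp[OF x(1) k] karr_comp[OF x'(1) k] x x'
          karr_eq_iff[OF kmap_comp[OF x(1) k] kmap_comp[OF x'(1) k]] by simp
    then have "eqm g x x'"
      by (rule pullback_reflect[OF pb, rotated 5]) (use kmapD[OF x(1)] kmapD[OF x'(1)] in simp_all)
    then show "F = G" using karr_eq_iff[OF x(1) x'(1)] x x' by simp
  next
    fix Z F G assume FG: "F \<in> Hom (K_cat C) f Z" "G \<in> Hom (K_cat C) f Z"
      and eq: "F \<cdot>\<^bsub>K_cat C\<^esub> karr g e f = G \<cdot>\<^bsub>K_cat C\<^esub> karr g e f"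
    obtain x where x: "kmap f x Z" "F = karr f x Z" using FG(1) by (rule K_HomE')
    obtain x' where x': "kmap f x' Z" "G = karr f x' Z" using FG(2) by (rule K_HomE')
    have "eqm Z (x \<cdot> e) (x' \<cdot> e)"
      using eq karr_comp[OF k x(1)] karr_comp[OF k x'(1)] x x'
          karr_eq_iff[OF kmap_comp[OF k x(1)] kmap_comp[OF k x'(1)]] by simp
    then have "eqm Z x x'"
      by (rule strict_reflect[OF e, rotated 7]) (use kmapD[OF x(1)] kmapD[OF x'(1)] pb' in simp_all)
    then show "F = G" using karr_eq_iff[OF x(1) x'(1)] x x' by simp
  qed
qed

text \<open>If \<open>b\<close> is epic in \<open>\<K>\<close>, the image \<open>m\<close> of \<open>(f', b)\<close> is a split epimorphism: composing with
  the chain map \<open>(\<dots>, id) : f' \<rightarrow> m\<close> makes \<open>b\<close> null-homotopic.\<close>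

lemma K_epic_lift:
  assumes epi: "is_epic (K_cat C) (karr f b f')" and b: "kmap f b f'"
    and y: "y \<in> Arr C" "Cod C y = Cod C f'"
  obtains e w where "cokernel_arrow C e" "Cod C e = Dom C y" "w \<in> Arr C" "Dom C w = Dom C e"
      "Cod C w = Cod C f"
    "eqm f' (b \<cdot> w) (y \<cdot> e)"
proof -
  note d = kmapD[OF b]
  obtain S i j p q where bp: "is_biproduct (Dom C f') (Cod C f) S i j p q"
    using biproduct_exists[of "Dom C f'" "Cod C f"] dom_obj[OF d(4)] cod_obj[OF d(3)] by blast
  note bp' = bp[unfolded is_biproduct_def]
  \<comment> \<open>The row with entries \<open>f'\<close> and b; both entries factor through its
    image m.\<close>
  define t where "t = f' \<cdot> p \<boxplus> b \<cdot> q"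
  have t: "t \<in> Arr C" "Dom C t = S" "Cod C t = Cod C f'" using d bp' by (simp_all add: t_def)
  have ti: "t \<cdot> i = f'" "t \<cdot> j = b" using biproduct_copair[OF bp, of f' b] d by
      (simp_all add: t_def)
  obtain m c where m: "is_monic C m" and c: "cokernel_arrow C c" "Dom C c = S" "Cod C c = Dom C m"
    and mt: "Cod C m = Cod C f'" "m \<cdot> c = t" using image_factorization[OF t(1)] t by metis
  note mA = monic_arr[OF m] and cA = strict_arr[OF c(1)]
  have mi: "m \<cdot> (c \<cdot> i) = f'" "m \<cdot> (c \<cdot> j) = b"
    using ti mt(2) assoc[of i c m] assoc[of j c m] mA cA c bp' by simp_all
  have k1: "kmap f' (Ident C (Cod C f')) m"
    unfolding kmap_def
  proof (intro conjI exI[of _ "c \<cdot> i"])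
    show "Ident C (Cod C f') \<cdot> f' = m \<cdot> (c \<cdot> i)" using mi(1) d(4) by simp
  qed (use d cA c mt(1) m bp' in simp_all)
  have k0: "kmap f' (HZero C (Cod C f') (Cod C f')) m"
    unfolding kmap_def using d mA m mt(1) by (auto intro!: exI[of _ "HZero C (Dom C f') (Dom C m)"])
  have "eqm m b (HZero C (Cod C f) (Cod C f'))"
    using eqm_zeroI[of m "c \<cdot> j"] mA cA c bp' mt(1) mi(2) by simp
  then have "karr f' (Ident C (Cod C f')) m \<cdot>\<^bsub>K_cat C\<^esub> karr f b f'
      = karr f' (HZero C (Cod C f') (Cod C f')) m \<cdot>\<^bsub>K_cat C\<^esub> karr f b f'"
    unfolding karr_comp[OF b k1] karr_comp[OF b k0] karr_eq_iff[OF kmap_comp[OF b k1]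
        kmap_comp[OF b k0]]
    using d by simp
  from is_epicD[OF epi karr_dom_cod(2) _ karr_hom[OF k1] karr_hom[OF k0] this] m
  have "karr f' (Ident C (Cod C f')) m = karr f' (HZero C (Cod C f') (Cod C f')) m" by simp
  then have "eqm m (Ident C (Cod C f')) (HZero C (Cod C f') (Cod C f'))" using karr_eq_iff[OF k1 k0]
      by simp
  then have "\<exists>h. h \<in> Arr C \<and> Dom C h = Cod C f' \<and> Cod C h = Dom C m \<and> Ident C (Cod C f') = m \<cdot> h"
    using eqm_zero_iff[of m "Ident C (Cod C f')"] d(4) mA mt(1) by simp
  then obtain h where h: "h \<in> Arr C" "Dom C h = Cod C f'" "Cod C h = Dom C m"
      "m \<cdot> h = Ident C (Cod C f')"
    by metis
  \<comment> \<open>Since h is a section of m, y equals \<open>m \<cdot> (h \<cdot> y)\<close>, and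
    \<open>h \<cdot> y\<close> lifts through c after a strict epimorphism e.\<close>
  obtain e s where e: "cokernel_arrow C e" "s \<in> Arr C" "Cod C e = Dom C y" "Dom C s = Dom C e"
      "Cod C s = S"
    "c \<cdot> s = (h \<cdot> y) \<cdot> e"
    using strict_pullback[OF c(1), of "h \<cdot> y"] h y c by auto
  note eA = strict_arr[OF e(1)]
  have "y \<cdot> e = (m \<cdot> h) \<cdot> (y \<cdot> e)" using h y e eA d by simp
  also have "\<dots> = m \<cdot> ((h \<cdot> y) \<cdot> e)" using h(1-3) y e(1-5) eA mA mt(1) assoc[of "y \<cdot> e" h m]
      assoc[of e y h] by simp
  also have "\<dots> = t \<cdot> s" using e(6) assoc[of s c m] mt(2) mA cA c e(2,5) by simp
  \<comment> \<open>The components of s: \<open>q \<cdot> s\<close> is the required lift of y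
    through b, and \<open>f' \<cdot> (p \<cdot> s)\<close> is the error that equality modulo
    \<open>f'\<close> allows.\<close>
  also have "\<dots> = b \<cdot> (q \<cdot> s) \<boxplus> f' \<cdot> (p \<cdot> s)"
    using d bp' e(2,5) by (simp add: t_def comp_plus assoc plus_comm[of "f' \<cdot> (p \<cdot> s)"])
  finally have "y \<cdot> e = b \<cdot> (q \<cdot> s) \<boxplus> f' \<cdot> (p \<cdot> s)" .
  note eq = this
  have "eqm f' (y \<cdot> e) (b \<cdot> (q \<cdot> s))" by (rule eqmI[OF _ _ _ _ _ _ eq])
      (use d bp' e(2,4,5) in simp_all)
  then show ?thesis using that[of e "q \<cdot> s"] e bp' d eqm_sym by simp
qed

end

section \<open>The partial function of a zigzag: single-valued, additive, densely defined, and a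
  complete invariant\<close>

section \<open>Zigzags acting on generalised elements\<close>

context quasi_abelian_category
begin

abbreviation KC :: "('m, 'm K_arr) cat" where "KC \<equiv> K_cat C"
abbreviation KR :: "'m K_arr set" where "KR \<equiv> {f. is_regular (K_cat C) f}"

text \<open>A step of a zigzag acts on generalised elements \<open>y : W \<rightarrow> Cod f\<close>, taken modulo \<open>f\<close>, as a
  partial function: forwards by composition, backwards by lifting.\<close>

definition arr_rel :: "'m K_arr \<Rightarrow> 'm \<Rightarrow> 'm \<Rightarrow> bool" where
  "arr_rel F y z \<longleftrightarrow> (\<exists>f b f'. kmap f b f' \<and> F = karr f b f' \<and> y \<in> Arr C \<and> Cod C y = Cod C f \<and> eqm f'
      (b \<cdot> y) z)"

fun step_rel :: "'m K_arr step \<Rightarrow> 'm \<Rightarrow> 'm \<Rightarrow> bool" where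
  "step_rel (Fwd F) y z \<longleftrightarrow> arr_rel F y z"
| "step_rel (Bwd F) y z \<longleftrightarrow> arr_rel F z y"

fun zz_rel :: "'m \<Rightarrow> 'm K_arr step list \<Rightarrow> 'm \<Rightarrow> 'm \<Rightarrow> bool" where
  "zz_rel f [] y z \<longleftrightarrow> eqm f y z"
| "zz_rel f (a # w) y z \<longleftrightarrow> (\<exists>x. step_rel a y x \<and> zz_rel (step_tgt KC a) w x z)"

text \<open>Two representatives b of the same arrow of K agree modulo \<open>f'\<close>, so it does
  not matter which of them the definition picks.\<close>

lemma arr_rel_karr:
  assumes b: "kmap f b f'"
  shows "arr_rel (karr f b f') y z \<longleftrightarrow> y \<in> Arr C \<and> Cod C y = Cod C f \<and> eqm f' (b \<cdot> y) z"
proof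
  assume "arr_rel (karr f b f') y z"
  then obtain g c g' where c: "kmap g c g'" "karr f b f' = karr g c g'" and y: "y \<in> Arr C"
      "Cod C y = Cod C g" "eqm g' (c \<cdot> y) z"
    unfolding arr_rel_def by blast
  have gf: "g = f" "g' = f'" using c(2) by (simp_all add: karr_def)
  have "eqm f' b c" using c b karr_eq_iff[OF b, of c] unfolding gf by simp
  from eqm_comp[OF this y(1)] have "eqm f' (b \<cdot> y) (c \<cdot> y)" using y(2) kmapD(6)[OF b] unfolding gf
      by simp
  then show "y \<in> Arr C \<and> Cod C y = Cod C f \<and> eqm f' (b \<cdot> y) z" using y eqm_trans unfolding gf by
      blast
qed (use b in \<open>auto simp: arr_rel_def\<close>)

lemma step_okE:
  assumes "step_ok KC KR a"
  obtains (fwd) f b f' where "a = Fwd (karr f b f')" "kmap f b f'"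
    | (bwd) f b f' where "a = Bwd (karr f b f')" "kmap f b f'" "is_regular KC (karr f b f')"
proof (cases a)
  case (Fwd F)
  then have "F \<in> Hom KC (Dom KC F) (Cod KC F)" using assms by (simp add: Hom_def)
  then obtain b where "kmap (Dom KC F) b (Cod KC F)" "F = karr (Dom KC F) b (Cod KC F)" by
      (rule K_HomE')
  then show ?thesis using fwd Fwd by metis
next
  case (Bwd F)
  then have "F \<in> Hom KC (Dom KC F) (Cod KC F)" using assms by (simp add: Hom_def)
  then obtain b where "kmap (Dom KC F) b (Cod KC F)" "F = karr (Dom KC F) b (Cod KC F)" by
      (rule K_HomE')
  then show ?thesis using bwd Bwd assms by (metis step_ok.simps(2) mem_Collect_eq)
qed

lemma eqm_eucl: "eqm f x y \<Longrightarrow> eqm f x z \<Longrightarrow> eqm f y z"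
  using eqm_trans eqm_sym by blast

lemma eqm_eucl': "eqm f x z \<Longrightarrow> eqm f y z \<Longrightarrow> eqm f x y"
  using eqm_trans eqm_sym by blast

lemma regular_reflect:
  assumes "is_regular KC (karr f b f')" "kmap f b f'" "y \<in> Arr C" "y' \<in> Arr C" "Cod C y = Cod C f"
      "Cod C y' = Cod C f"
    "eqm f' (b \<cdot> y) (b \<cdot> y')"
  shows "eqm f y y'"
proof -
  have "Dom C y' = Dom C y" using eqm_arr(6)[OF assms(7)] kmapD[OF assms(2)] assms(3-6) by simp
  then show ?thesis using K_monic_reflect[OF _ assms(2-6) _ assms(7)] assms(1) by
      (simp add: is_regular_def)
qed

lemma step_rel_arr:
  assumes ok: "step_ok KC KR a" and r: "step_rel a y z"
  shows "y \<in> Arr C" "z \<in> Arr C" "Cod C y = Cod C (step_src KC a)" "Cod C z = Cod C (step_tgt KC a)"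
      "Dom C z = Dom C y"
proof -
  have "y \<in> Arr C \<and> z \<in> Arr C \<and> Cod C y = Cod C (step_src KC a) \<and> Cod C z = Cod C (step_tgt KC a) \<and>
      Dom C z = Dom C y"
    using ok
  proof (cases rule: step_okE)
    case (fwd f b f')
    then show ?thesis
      using r arr_rel_karr[OF fwd(2), of y z] eqm_arr[of f' "b \<cdot> y" z] kmapD[OF fwd(2)] by simp
  next
    case (bwd f b f')
    then show ?thesis
      using r arr_rel_karr[OF bwd(2), of z y] eqm_arr[of f' "b \<cdot> z" y] kmapD[OF bwd(2)] by simp
  qed
  then show "y \<in> Arr C" "z \<in> Arr C" "Cod C y = Cod C (step_src KC a)"
      "Cod C z = Cod C (step_tgt KC a)" "Dom C z = Dom C y"
    by simp_all
qed

lemma step_rel_cong: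
  assumes ok: "step_ok KC KR a" and r: "step_rel a y z" and y: "eqm (step_src KC a) y y'" and z:
      "eqm (step_tgt KC a) z z'"
  shows "step_rel a y' z'"
  using ok
proof (cases rule: step_okE)
  case (fwd f b f')
  then have "y \<in> Arr C" "Cod C y = Cod C f" "eqm f' (b \<cdot> y) z" "eqm f y y'" "eqm f' z z'"
    using r y z arr_rel_karr[OF fwd(2)] by auto
  moreover have "eqm f' (b \<cdot> y) (b \<cdot> y')" using kmap_eqm[OF fwd(2)] calculation by simp
  ultimately show ?thesis using fwd arr_rel_karr[OF fwd(2)] eqm_arr[of f y y'] eqm_trans eqm_sym by
      (metis step_rel.simps(1))
next
  case (bwd f b f')
  then have "z \<in> Arr C" "Cod C z = Cod C f" "eqm f' (b \<cdot> z) y" "eqm f z z'" "eqm f' y y'"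
    using r y z arr_rel_karr[OF bwd(2)] by auto
  moreover have "eqm f' (b \<cdot> z) (b \<cdot> z')" using kmap_eqm[OF bwd(2)] calculation by simp
  ultimately show ?thesis using bwd arr_rel_karr[OF bwd(2)] eqm_arr[of f z z'] eqm_trans eqm_sym by
      (metis step_rel.simps(2))
qed

text \<open>Forward steps are compositions. A backward step is single-valued because a regular arrow
  is monic.\<close>

lemma step_rel_fun:
  assumes ok: "step_ok KC KR a" and r: "step_rel a y z" and r': "step_rel a y z'"
  shows "eqm (step_tgt KC a) z z'"
  using ok
proof (cases rule: step_okE)
  case (fwd f b f')
  then have "eqm f' (b \<cdot> y) z" "eqm f' (b \<cdot> y) z'" using r r' arr_rel_karr[OF fwd(2)] by auto
  then show ?thesis using fwd(1) eqm_eucl[of f' "b \<cdot> y" z z'] by simp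
next
  case (bwd f b f')
  then have "z \<in> Arr C" "z' \<in> Arr C" "Cod C z = Cod C f" "Cod C z' = Cod C f" "eqm f' (b \<cdot> z) y"
      "eqm f' (b \<cdot> z') y"
    using r r' arr_rel_karr[OF bwd(2)] by auto
  then have "eqm f z z'" using regular_reflect[OF bwd(3,2)] eqm_eucl' by blast
  then show ?thesis using bwd(1) by simp
qed

lemma step_rel_comp:
  assumes ok: "step_ok KC KR a" and r: "step_rel a y z" and x: "x \<in> Arr C" "Cod C x = Dom C y"
  shows "step_rel a (y \<cdot> x) (z \<cdot> x)"
  using ok
proof (cases rule: step_okE)
  case (fwd f b f')
  then have y: "y \<in> Arr C" "Cod C y = Cod C f" "eqm f' (b \<cdot> y) z" using r arr_rel_karr[OF fwd(2)] by
      auto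
  have "eqm f' ((b \<cdot> y) \<cdot> x) (z \<cdot> x)" by (rule eqm_comp[OF y(3) x(1)])
      (use x y kmapD[OF fwd(2)] in simp)
  then show ?thesis using fwd x y kmapD[OF fwd(2)] by (simp add: arr_rel_karr assoc)
next
  case (bwd f b f')
  then have y: "z \<in> Arr C" "Cod C z = Cod C f" "eqm f' (b \<cdot> z) y" using r arr_rel_karr[OF bwd(2)] by
      auto
  have d: "Dom C y = Dom C z" using eqm_arr(6)[OF y(3)] y(1,2) kmapD[OF bwd(2)] by simp
  have "eqm f' ((b \<cdot> z) \<cdot> x) (y \<cdot> x)" by (rule eqm_comp[OF y(3) x(1)])
      (use x y d kmapD[OF bwd(2)] in simp)
  then show ?thesis using bwd x y d kmapD[OF bwd(2)] by (simp add: arr_rel_karr assoc)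
qed

lemma step_rel_add:
  assumes ok: "step_ok KC KR a" and r: "step_rel a y z" "step_rel a y' z'" and d:
      "Dom C y' = Dom C y"
  shows "step_rel a (y \<boxplus> y') (z \<boxplus> z')"
  using ok
proof (cases rule: step_okE)
  case (fwd f b f')
  then have y: "y \<in> Arr C" "Cod C y = Cod C f" "eqm f' (b \<cdot> y) z" "y' \<in> Arr C" "Cod C y' = Cod C f"
      "eqm f' (b \<cdot> y') z'"
    using r arr_rel_karr[OF fwd(2)] by auto
  have "eqm f' (b \<cdot> y \<boxplus> b \<cdot> y') (z \<boxplus> z')" by (rule eqm_add[OF y(3,6)])
      (use d y kmapD[OF fwd(2)] in simp)
  then show ?thesis using fwd d y kmapD[OF fwd(2)] by (simp add: arr_rel_karr comp_plus)
next
  case (bwd f b f')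
  then have y: "z \<in> Arr C" "Cod C z = Cod C f" "eqm f' (b \<cdot> z) y" "z' \<in> Arr C" "Cod C z' = Cod C f"
      "eqm f' (b \<cdot> z') y'"
    using r arr_rel_karr[OF bwd(2)] by auto
  have d': "Dom C z' = Dom C z" using d eqm_arr(6)[OF y(3)] eqm_arr(6)[OF y(6)] y(1,2,4,5)
      kmapD[OF bwd(2)] by simp
  have "eqm f' (b \<cdot> z \<boxplus> b \<cdot> z') (y \<boxplus> y')" by (rule eqm_add[OF y(3,6)])
      (use d' y kmapD[OF bwd(2)] in simp)
  then show ?thesis using bwd d' y kmapD[OF bwd(2)] by (simp add: arr_rel_karr comp_plus)
qed

text \<open>A forward step is defined everywhere. A backward step is defined after some strict
  epimorphism because a regular arrow is epic (\<open>K_epic_lift\<close>).\<close>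

lemma step_rel_dense:
  assumes ok: "step_ok KC KR a" and y: "y \<in> Arr C" "Cod C y = Cod C (step_src KC a)"
  shows "\<exists>e z. cokernel_arrow C e \<and> Cod C e = Dom C y \<and> step_rel a (y \<cdot> e) z"
  using ok
proof (cases rule: step_okE)
  case (fwd f b f')
  have "cokernel_arrow C (Ident C (Dom C y))" by (rule strict_split[where s = "Ident C (Dom C y)"])
      (use y in simp_all)
  moreover have "step_rel a (y \<cdot> Ident C (Dom C y)) (b \<cdot> y)"
    using fwd y kmapD[OF fwd(2)] by (simp add: arr_rel_karr eqm_refl)
  ultimately show ?thesis using y by (intro exI[of _ "Ident C (Dom C y)"] exI[of _ "b \<cdot> y"]) simp
next
  case (bwd f b f')
  have epi: "is_epic KC (karr f b f')" using bwd(3) by (simp add: is_regular_def)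
  have "Cod C y = Cod C f'" using y bwd(1) by simp
  from K_epic_lift[OF epi bwd(2) y(1) this]
  obtain e w where "cokernel_arrow C e" "Cod C e = Dom C y" "w \<in> Arr C" "Dom C w = Dom C e"
      "Cod C w = Cod C f"
    "eqm f' (b \<cdot> w) (y \<cdot> e)" by metis
  then show ?thesis using bwd(1) arr_rel_karr[OF bwd(2)] by (intro exI[of _ e] exI[of _ w]) simp
qed

lemma zz_consD:
  "zigzag KC KR f (a # w) g \<Longrightarrow> step_ok KC KR a" "zigzag KC KR f (a # w) g \<Longrightarrow> step_src KC a = f"
  "zigzag KC KR f (a # w) g \<Longrightarrow> zigzag KC KR (step_tgt KC a) w g"
  by simp_all

lemma zigzag_monic: "zigzag KC KR f w g \<Longrightarrow> is_monic C f \<and> is_monic C g"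
  using category.zigzag_obj[OF category_K_cat] K_obj by metis

lemma zz_rel_arr:
  assumes "zigzag KC KR f w g" "zz_rel f w y z"
  shows "y \<in> Arr C \<and> z \<in> Arr C \<and> Cod C y = Cod C f \<and> Cod C z = Cod C g \<and> Dom C z = Dom C y"
  using assms
proof (induction w arbitrary: f y)
  case Nil
  then show ?case using eqm_arr[of f y z] by simp
next
  case (Cons a w)
  then obtain x where x: "step_rel a y x" "zz_rel (step_tgt KC a) w x z" by auto
  show ?case using Cons.IH[OF zz_consD(3)[OF Cons.prems(1)] x(2)]
      step_rel_arr[OF zz_consD(1)[OF Cons.prems(1)] x(1)]
      zz_consD(2)[OF Cons.prems(1)] by simp
qed

lemma zz_rel_cong:
  assumes "zigzag KC KR f w g" "zz_rel f w y z" "eqm f y y'" "eqm g z z'"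
  shows "zz_rel f w y' z'"
  using assms
proof (induction w arbitrary: f y y')
  case Nil
  then have "eqm f y z" "eqm f y y'" "eqm f z z'" by simp_all
  then have "eqm f y' z'" using eqm_eucl eqm_trans by blast
  then show ?case by simp
next
  case (Cons a w)
  then obtain x where x: "step_rel a y x" "zz_rel (step_tgt KC a) w x z" by auto
  note c = zz_consD[OF Cons.prems(1)]
  have "is_monic C (step_tgt KC a)" using zigzag_monic[OF c(3)] by simp
  then have xx: "eqm (step_tgt KC a) x x" using eqm_refl step_rel_arr[OF c(1) x(1)] by simp
  have "step_rel a y' x" using step_rel_cong[OF c(1) x(1) _ xx] Cons.prems(3) c(2) by simp
  moreover have "zz_rel (step_tgt KC a) w x z'" by (rule Cons.IH[OF c(3) x(2) xx Cons.prems(4)])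
  ultimately show ?case by auto
qed

lemma zz_rel_fun:
  assumes "zigzag KC KR f w g" "zz_rel f w y z" "zz_rel f w y z'"
  shows "eqm g z z'"
  using assms
proof (induction w arbitrary: f y)
  case Nil
  then show ?case using eqm_eucl[of f y z z'] by simp
next
  case (Cons a w)
  then obtain x x' where x: "step_rel a y x" "zz_rel (step_tgt KC a) w x z" "step_rel a y x'"
      "zz_rel (step_tgt KC a) w x' z'"
    by auto
  note c = zz_consD[OF Cons.prems(1)]
  have xx: "eqm (step_tgt KC a) x' x" by (rule step_rel_fun[OF c(1) x(3,1)])
  have "is_monic C g" using zigzag_monic[OF c(3)] by simp
  then have "eqm g z' z'" using eqm_refl zz_rel_arr[OF c(3) x(4)] by simp
  from zz_rel_cong[OF c(3) x(4) xx this] show ?case using Cons.IH[OF c(3) x(2)] by simp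
qed

lemma zz_rel_comp:
  assumes "zigzag KC KR f w g" "zz_rel f w y z" and x: "x \<in> Arr C" "Cod C x = Dom C y"
  shows "zz_rel f w (y \<cdot> x) (z \<cdot> x)"
  using assms
proof (induction w arbitrary: f y)
  case Nil
  then show ?case using eqm_comp by simp
next
  case (Cons a w)
  then obtain u where u: "step_rel a y u" "zz_rel (step_tgt KC a) w u z" by auto
  note c = zz_consD[OF Cons.prems(1)]
  have "step_rel a (y \<cdot> x) (u \<cdot> x)" by (rule step_rel_comp[OF c(1) u(1) Cons.prems(3,4)])
  moreover have "zz_rel (step_tgt KC a) w (u \<cdot> x) (z \<cdot> x)"
    by (rule Cons.IH[OF c(3) u(2)]) (use Cons.prems step_rel_arr[OF c(1) u(1)] in simp_all)
  ultimately show ?case by auto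
qed

lemma zz_rel_add:
  assumes "zigzag KC KR f w g" "zz_rel f w y z" "zz_rel f w y' z'" "Dom C y' = Dom C y"
  shows "zz_rel f w (y \<boxplus> y') (z \<boxplus> z')"
  using assms
proof (induction w arbitrary: f y y')
  case Nil
  then show ?case using eqm_add by simp
next
  case (Cons a w)
  then obtain u u' where u: "step_rel a y u" "zz_rel (step_tgt KC a) w u z" "step_rel a y' u'"
      "zz_rel (step_tgt KC a) w u' z'"
    by auto
  note c = zz_consD[OF Cons.prems(1)]
  have "step_rel a (y \<boxplus> y') (u \<boxplus> u')" by (rule step_rel_add[OF c(1) u(1,3) Cons.prems(4)])
  moreover have "zz_rel (step_tgt KC a) w (u \<boxplus> u') (z \<boxplus> z')"
    by (rule Cons.IH[OF c(3) u(2,4)]) (use Cons.prems(4) step_rel_arr[OF c(1) u(1)]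
        step_rel_arr[OF c(1) u(3)] in simp)
  ultimately show ?case by auto
qed

text \<open>Each step may demand one more strict epimorphism, and these compose.\<close>

lemma zz_rel_dense:
  assumes "zigzag KC KR f w g" "y \<in> Arr C" "Cod C y = Cod C f"
  shows "\<exists>e z. cokernel_arrow C e \<and> Cod C e = Dom C y \<and> zz_rel f w (y \<cdot> e) z"
  using assms
proof (induction w arbitrary: f y)
  case Nil
  have e: "cokernel_arrow C (Ident C (Dom C y))" by (rule
      strict_split[where s = "Ident C (Dom C y)"]) (use Nil in simp_all)
  have "eqm f y y" using Nil zigzag_monic[OF Nil(1)] eqm_refl by simp
  then show ?case using e Nil by (intro exI[of _ "Ident C (Dom C y)"] exI[of _ y]) simp
next
  case (Cons a w)
  note c = zz_consD[OF Cons.prems(1)]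
  obtain e x where e: "cokernel_arrow C e" "Cod C e = Dom C y" "step_rel a (y \<cdot> e) x"
    using step_rel_dense[OF c(1) Cons.prems(2)] Cons.prems(3) c(2) by auto
  note eA = strict_arr[OF e(1)] and xA = step_rel_arr[OF c(1) e(3)]
  obtain d z where d: "cokernel_arrow C d" "Cod C d = Dom C x" "zz_rel (step_tgt KC a) w (x \<cdot> d) z"
    using Cons.IH[OF c(3) xA(2,4)] by auto
  note dA = strict_arr[OF d(1)]
  have de: "Cod C d = Dom C e" using d xA eA e(2) Cons.prems(2) by simp
  have "step_rel a ((y \<cdot> e) \<cdot> d) (x \<cdot> d)" by (rule step_rel_comp[OF c(1) e(3) dA])
      (use d xA in simp)
  then have "zz_rel f (a # w) (y \<cdot> (e \<cdot> d)) z" using d(3) Cons.prems(2) eA dA e(2) de by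
      (auto simp: assoc)
  moreover have "cokernel_arrow C (e \<cdot> d)" by (rule strict_comp[OF d(1) e(1) de[symmetric]])
  ultimately show ?case using e(2) eA dA de by (intro exI[of _ "e \<cdot> d"] exI[of _ z]) simp
qed

text \<open>The empty zigzag acts as equality modulo f and not as plain equality, so its backward
  direction needs the saturation of \<open>zz_rel\<close> (\<open>zz_rel_cong\<close>).\<close>

lemma zz_rel_append:
  assumes "zigzag KC KR f v g" "zigzag KC KR g w h"
  shows "zz_rel f (v @ w) y z \<longleftrightarrow> (\<exists>x. zz_rel f v y x \<and> zz_rel g w x z)"
  using assms(1)
proof (induction v arbitrary: f y)
  case Nil
  then have fg: "g = f" and f: "is_monic C f" using zigzag_monic by auto
  show ?case
  proof
    assume r: "zz_rel f ([] @ w) y z"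
    have "eqm f y y" using r zz_rel_arr[OF assms(2)] eqm_refl[of f y] f by (simp add: fg)
    then show "\<exists>x. zz_rel f [] y x \<and> zz_rel g w x z" using r fg by auto
  next
    assume "\<exists>x. zz_rel f [] y x \<and> zz_rel g w x z"
    then obtain x where x: "eqm g x y" "zz_rel g w x z" using fg eqm_sym by auto
    have "eqm h z z" using zz_rel_arr[OF assms(2) x(2)] zigzag_monic[OF assms(2)] eqm_refl by simp
    from zz_rel_cong[OF assms(2) x(2,1) this] show "zz_rel f ([] @ w) y z" by (simp add: fg)
  qed
next
  case (Cons a v)
  then show ?case using Cons.IH[OF zz_consD(3)[OF Cons.prems]] by auto
qed

lemma zz_rel_fwd:
  assumes b: "kmap f b f'"
  shows "zz_rel f [Fwd (karr f b f')] y z \<longleftrightarrow> y \<in> Arr C \<and> Cod C y = Cod C f \<and> eqm f' (b \<cdot> y) z"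
proof
  assume "zz_rel f [Fwd (karr f b f')] y z"
  then obtain x where x: "y \<in> Arr C" "Cod C y = Cod C f" "eqm f' (b \<cdot> y) x" "eqm f' x z"
    using arr_rel_karr[OF b] by auto
  then show "y \<in> Arr C \<and> Cod C y = Cod C f \<and> eqm f' (b \<cdot> y) z" using eqm_trans by blast
next
  assume y: "y \<in> Arr C \<and> Cod C y = Cod C f \<and> eqm f' (b \<cdot> y) z"
  then have "eqm f' z z" using eqm_eucl by blast
  then show "zz_rel f [Fwd (karr f b f')] y z" using y arr_rel_karr[OF b] by auto
qed

lemma zz_rel_bwd:
  assumes b: "kmap f b f'"
  shows "zz_rel f' [Bwd (karr f b f')] y z \<longleftrightarrow> z \<in> Arr C \<and> Cod C z = Cod C f \<and> eqm f' (b \<cdot> z) y"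
proof
  assume "zz_rel f' [Bwd (karr f b f')] y z"
  then obtain x where x: "x \<in> Arr C" "Cod C x = Cod C f" "eqm f' (b \<cdot> x) y" "eqm f x z" using
      arr_rel_karr[OF b] by auto
  have "eqm f' (b \<cdot> x) (b \<cdot> z)" by (rule kmap_eqm[OF b x(4)])
  then show "z \<in> Arr C \<and> Cod C z = Cod C f \<and> eqm f' (b \<cdot> z) y" using x eqm_arr[OF x(4)] eqm_trans
      eqm_sym by metis
next
  assume "z \<in> Arr C \<and> Cod C z = Cod C f \<and> eqm f' (b \<cdot> z) y"
  then show "zz_rel f' [Bwd (karr f b f')] y z" using arr_rel_karr[OF b] eqm_refl kmapD[OF b] by
      auto
qed

text \<open>Induction on the derivation of the congruence. Only points where both zigzags are
  defined are compared, since the domains may differ: a backward step followed by its forward step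
  can be undefined where the empty zigzag is defined.\<close>

theorem zz_rel_agree:
  assumes "zigzag_eq KC KR f g v w" "zz_rel f v y z" "zz_rel f w y z'"
  shows "eqm g z z'"
  using assms
proof (induction arbitrary: y z z' rule: zigzag_eq.induct)
  case (refl f w g)
  then show ?case using zz_rel_fun by blast
next
  case (sym f g v w)
  then show ?case using eqm_sym by blast
next
  case (trans f g u v w)
  have zu: "zigzag KC KR f u g" "zigzag KC KR f v g" "zigzag KC KR f w g"
    using category.zigzag_eq_zigzag[OF category_K_cat trans.hyps(1)]
        category.zigzag_eq_zigzag[OF category_K_cat trans.hyps(2)] by auto
  note y = zz_rel_arr[OF zu(1) trans.prems(1)] and y' = zz_rel_arr[OF zu(3) trans.prems(2)]
  \<comment> \<open>The middle zigzag v may be undefined at y. It is defined after a strict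
    epimorphism e; the two agreements are chained there, and \<open>strict_reflect\<close> removes
    e.\<close>
  obtain e x where e: "cokernel_arrow C e" "Cod C e = Dom C y" "zz_rel f v (y \<cdot> e) x"
    using zz_rel_dense[OF zu(2), of y] y by auto
  note eA = strict_arr[OF e(1)]
  have "eqm g (z \<cdot> e) x" by (rule trans.IH(1)[OF zz_rel_comp[OF zu(1) trans.prems(1) eA e(2)] e(3)])
  moreover have "eqm g x (z' \<cdot> e)" by (rule trans.IH(2)[OF e(3)
      zz_rel_comp[OF zu(3) trans.prems(2) eA e(2)]])
  ultimately have "eqm g (z \<cdot> e) (z' \<cdot> e)" by (rule eqm_trans)
  then show ?case by (rule strict_reflect[OF e(1), rotated 7])
      (use zigzag_monic[OF zu(1)] y y' e(2) in simp_all)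
next
  case (congr f a f' g' v w b g)
  have zv: "zigzag KC KR f' v g'" "zigzag KC KR f' w g'"
    using category.zigzag_eq_zigzag[OF category_K_cat congr.hyps(2)] by auto
  obtain x u where x: "zz_rel f a y x" "zz_rel f' v x u" "zz_rel g' b u z"
    using congr.prems(1) zz_rel_append[OF congr.hyps(1) zigzag_append[OF zv(1) congr.hyps(3)]]
        zz_rel_append[OF zv(1) congr.hyps(3)] by auto
  obtain x' u' where x': "zz_rel f a y x'" "zz_rel f' w x' u'" "zz_rel g' b u' z'"
    using congr.prems(2) zz_rel_append[OF congr.hyps(1) zigzag_append[OF zv(2) congr.hyps(3)]]
        zz_rel_append[OF zv(2) congr.hyps(3)] by auto
  \<comment> \<open>The induction hypothesis compares values at one point, so \<open>x'\<close> is
    first replaced by x.\<close>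
  have 1: "eqm f' x' x" by (rule zz_rel_fun[OF congr.hyps(1) x'(1) x(1)])
  have "eqm g' u' u'" using zz_rel_arr[OF zv(2) x'(2)] zigzag_monic[OF zv(1)] eqm_refl by simp
  from zz_rel_cong[OF zv(2) x'(2) 1 this] have "zz_rel f' w x u'" .
  then have 2: "eqm g' u' u" using congr.IH[OF x(2)] eqm_sym by blast
  have "eqm g z' z'" using zz_rel_arr[OF congr.hyps(3) x'(3)] zigzag_monic[OF congr.hyps(3)]
      eqm_refl by simp
  from zz_rel_cong[OF congr.hyps(3) x'(3) 2 this] show ?case using zz_rel_fun[OF congr.hyps(3) x(3)]
      by simp
next
  case (ident f)
  then have f: "is_monic C f" by simp
  have "eqm f y z"
    using iffD1[OF zz_rel_fwd[OF kmap_ident[OF f]] ident(2)[unfolded K_ident[OF f]]] by auto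
  then show ?case using ident(3) eqm_eucl[of f y z z'] by simp
next
  case (comp F f g G h)
  obtain b where b: "kmap f b g" "F = karr f b g" using comp(1) by (rule K_HomE')
  obtain c where c: "kmap g c h" "G = karr g c h" using comp(2) by (rule K_HomE')
  obtain x where x: "eqm g (b \<cdot> y) x" "eqm h (c \<cdot> x) z" "y \<in> Arr C" "Cod C y = Cod C f"
    using comp(3) zz_rel_fwd[OF c(1)] arr_rel_karr[OF b(1)] unfolding b(2) c(2) by auto
  have "eqm h (c \<cdot> (b \<cdot> y)) (c \<cdot> x)" by (rule kmap_eqm[OF c(1) x(1)])
  then have "eqm h (c \<cdot> (b \<cdot> y)) z" using x(2) by (rule eqm_trans)
  moreover have "eqm h ((c \<cdot> b) \<cdot> y) z'" using comp(4) zz_rel_fwd[OF kmap_comp[OF b(1) c(1)]]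
      karr_comp[OF b(1) c(1)] b(2) c(2) by simp
  moreover have "(c \<cdot> b) \<cdot> y = c \<cdot> (b \<cdot> y)" using x(3,4) kmapD[OF b(1)] kmapD[OF c(1)] by
      (simp add: assoc)
  ultimately show ?case using eqm_trans eqm_sym by metis
next
  case (fwd_bwd s f g)
  obtain b where b: "kmap f b g" "s = karr f b g" using fwd_bwd(2) by (rule K_HomE')
  obtain x where x: "eqm g (b \<cdot> y) x" "z \<in> Arr C" "Cod C z = Cod C f" "eqm g (b \<cdot> z) x" "y \<in> Arr C"
      "Cod C y = Cod C f"
    using fwd_bwd(3) zz_rel_bwd[OF b(1)] arr_rel_karr[OF b(1)] unfolding b(2) by auto
  have "eqm f y z"
    by (rule regular_reflect[OF _ b(1) x(5,2,6,3) eqm_eucl'[OF x(1,4)]])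
        (use fwd_bwd(1) b(2) in simp)
  then show ?case using fwd_bwd(4) eqm_eucl[of f y z z'] by simp
next
  case (bwd_fwd s f g)
  obtain b where b: "kmap f b g" "s = karr f b g" using bwd_fwd(2) by (rule K_HomE')
  obtain x where "eqm g (b \<cdot> x) y" "eqm g (b \<cdot> x) z" "eqm g y z'"
    using bwd_fwd(3,4) zz_rel_fwd[OF b(1)] arr_rel_karr[OF b(1)] unfolding b(2) by auto
  then show ?case using eqm_eucl eqm_trans by blast
qed

text \<open>Where a zigzag is defined it collapses to an arrow of K. For a backward step along d,
  the lift x of b is again a chain map because the regular arrow d reflects zero; then b is d after
  x, and d cancels against its formal inverse.\<close>

lemma zz_rel_chain:
  assumes z: "zigzag KC KR f w f'" and b: "kmap g b f" and r: "zz_rel f w b y"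
  shows "kmap g y f' \<and> zigzag_eq KC KR g f' (Fwd (karr g b f) # w) [Fwd (karr g y f')]"
  using z b r
proof (induction w arbitrary: f b)
  case Nil
  then have ff: "f' = f" and e: "eqm f b y" by auto
  have k: "kmap g y f" by (rule kmap_of_eqm[OF Nil.prems(2) e])
  have "karr g b f = karr g y f" using karr_eq_iff[OF Nil.prems(2) k] e by simp
  moreover have "zigzag KC KR g [Fwd (karr g y f)] f"
    using karr_hom[OF k] kmapD[OF k] by (simp add: Hom_def)
  ultimately show ?case using k ff by (simp add: zigzag_eq.refl)
next
  case (Cons a w)
  obtain x where x: "step_rel a b x" "zz_rel (step_tgt KC a) w x y" using Cons.prems(3) by auto
  note c = zz_consD[OF Cons.prems(1)]
  define h where "h = step_tgt KC a"
  have gO: "g \<in> Obj KC" using kmapD(1)[OF Cons.prems(2)] by simp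
  have "kmap g x h \<and> zigzag_eq KC KR g h [Fwd (karr g b f), a] [Fwd (karr g x h)]"
    using c(1)
  proof (cases rule: step_okE)
    case (fwd f1 d f2)
    then have f12: "f1 = f" "f2 = h" using c(2) by (auto simp: h_def)
    have d: "kmap f d h" "a = Fwd (karr f d h)" using fwd f12 by auto
    have e: "eqm h (d \<cdot> b) x" using x(1) arr_rel_karr[OF d(1)] d(2) by simp
    note k = kmap_comp[OF Cons.prems(2) d(1)]
    note k' = kmap_of_eqm[OF k e]
    have "karr f d h \<cdot>\<^bsub>KC\<^esub> karr g b f = karr g x h"
      using karr_comp[OF Cons.prems(2) d(1)] karr_eq_iff[OF k k'] e by simp
    then show ?thesis using k' zigzag_eq.comp[OF karr_hom[OF Cons.prems(2)] karr_hom[OF d(1)]] d(2)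
        by simp
  next
    case (bwd f1 d f2)
    then have f12: "f1 = h" "f2 = f" using c(2) by (auto simp: h_def)
    have d: "kmap h d f" "a = Bwd (karr h d f)" "is_regular KC (karr h d f)" using bwd f12 by auto
    have e: "eqm f (d \<cdot> x) b" "x \<in> Arr C" "Cod C x = Cod C h" using x(1) arr_rel_karr[OF d(1)] d(2)
        by auto
    note hd = kmapD[OF d(1)] and gb = kmapD[OF Cons.prems(2)]
    have xd: "Dom C x = Cod C g" using eqm_arr(6)[OF e(1)] e(2,3) hd gb by simp
    have 1: "eqm f (b \<cdot> g) (HZero C (Dom C g) (Cod C f))" using kmap_iff[of g f b] Cons.prems(2) gb
        by simp
    have "eqm f ((d \<cdot> x) \<cdot> g) (b \<cdot> g)" by (rule eqm_comp[OF e(1)]) (use gb hd e xd in simp_all)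
    from eqm_trans[OF this 1] have "eqm f (d \<cdot> (x \<cdot> g)) (d \<cdot> HZero C (Dom C g) (Cod C h))"
      using gb hd e(2,3) xd by (simp add: assoc)
    then have "eqm h (x \<cdot> g) (HZero C (Dom C g) (Cod C h))"
      by (rule regular_reflect[OF d(3,1), rotated 4]) (use gb hd e(2,3) xd in simp_all)
    then have k: "kmap g x h" using kmap_iff[of g h x] gb hd e(2,3) xd by simp
    note k' = kmap_comp[OF k d(1)]
    have eqk: "karr h d f \<cdot>\<^bsub>KC\<^esub> karr g x h = karr g b f"
      using karr_comp[OF k d(1)] karr_eq_iff[OF k' Cons.prems(2)] e(1) by simp
    note kh = karr_hom[OF k] and dh = karr_hom[OF d(1)]
    have zz: "zigzag KC KR f [a] h" "zigzag KC KR g [] g" "zigzag KC KR g [Fwd (karr g x h)] h"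
        "zigzag KC KR h [] h"
      using d gO kh dh hd by (auto simp: Hom_def)
    \<comment> \<open>The arrow b is expanded into x followed by d; after that d is cancelled
      against the step a.\<close>
    have "zigzag_eq KC KR g h ([] @ [Fwd (karr g x h), Fwd (karr h d f)] @ [a])
        ([] @ [Fwd (karr g b f)] @ [a])"
      by (rule zigzag_eq.congr[OF zz(2) _ zz(1)]) (use zigzag_eq.comp[OF kh dh] eqk in simp)
    moreover have "zigzag_eq KC KR g h ([Fwd (karr g x h)] @ [Fwd (karr h d f), a] @ [])
        ([Fwd (karr g x h)] @ [] @ [])"
      by (rule zigzag_eq.congr[OF zz(3) _ zz(4)]) (use zigzag_eq.fwd_bwd[of "karr h d f" KR KC h f]
          d dh in simp)
    ultimately show ?thesis using k by (auto intro: zigzag_eq.trans zigzag_eq.sym)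
  qed
  then have k: "kmap g x h" and z1: "zigzag_eq KC KR g h [Fwd (karr g b f), a] [Fwd (karr g x h)]"
      by auto
  have w: "zigzag KC KR h w f'" using c(3) by (simp add: h_def)
  have "kmap g y f'" and z2: "zigzag_eq KC KR g f' (Fwd (karr g x h) # w) [Fwd (karr g y f')]"
    using Cons.IH[OF w k] x(2) by (simp_all add: h_def)
  moreover have "zigzag_eq KC KR g f' ([] @ [Fwd (karr g b f), a] @ w)
      ([] @ [Fwd (karr g x h)] @ w)"
    by (rule zigzag_eq.congr[OF _ z1 w]) (use gO in simp)
  ultimately show ?case by (auto intro: zigzag_eq.trans)
qed

text \<open>The pullback of \<open>f\<close> along \<open>e\<close> gives a regular morphism onto \<open>f\<close>, with which both zigzags
    become
  arrows of \<open>\<K>\<close>.\<close>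

theorem zigzag_eqI:
  assumes z: "zigzag KC KR f v f'" "zigzag KC KR f w f'"
    and e: "cokernel_arrow C e" "Cod C e = Cod C f" and r: "zz_rel f v e y" "zz_rel f w e y'" and
        yy: "eqm f' y y'"
  shows "zigzag_eq KC KR f f' v w"
proof -
  have f: "is_monic C f" using zigzag_monic[OF z(1)] by simp
  note eA = strict_arr[OF e(1)] and fA = monic_arr[OF f]
  obtain p g where pb: "is_pullback C f e p g" using pullback_exists[OF fA eA] e(2) by metis
  note k = pullback_kmap[OF f pb] and reg = pullback_regular[OF f e(1) pb]
  define u where "u = karr g e f"
  have uH: "u \<in> Hom KC g f" unfolding u_def by (rule karr_hom[OF k])
  have uR: "u \<in> KR" using reg by (simp add: u_def)
  have 1: "kmap g y f'" "zigzag_eq KC KR g f' (Fwd u # v) [Fwd (karr g y f')]"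
    using zz_rel_chain[OF z(1) k r(1)] by (simp_all add: u_def)
  have 2: "kmap g y' f'" "zigzag_eq KC KR g f' (Fwd u # w) [Fwd (karr g y' f')]"
    using zz_rel_chain[OF z(2) k r(2)] by (simp_all add: u_def)
  have "karr g y f' = karr g y' f'" using karr_eq_iff[OF 1(1) 2(1)] yy by simp
  then have 3: "zigzag_eq KC KR g f' (Fwd u # v) (Fwd u # w)" using 1(2) 2(2) by
      (auto intro: zigzag_eq.trans zigzag_eq.sym)
  have zz: "zigzag KC KR f [Bwd u] g" "zigzag KC KR f' [] f'" "zigzag KC KR f [] f"
    using uH uR kmapD[OF k] zigzag_monic[OF z(1)] by (auto simp: Hom_def)
  \<comment> \<open>The zigzags agree after u. Putting \<open>Bwd u\<close> in front cancels u,
    which is regular.\<close>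
  have "zigzag_eq KC KR f f' ([Bwd u] @ (Fwd u # v) @ []) ([Bwd u] @ (Fwd u # w) @ [])"
    by (rule zigzag_eq.congr[OF zz(1) 3 zz(2)])
  moreover have "zigzag_eq KC KR f f' ([] @ [Bwd u, Fwd u] @ x) ([] @ [] @ x)" if
      "zigzag KC KR f x f'" for x
    by (rule zigzag_eq.congr[OF zz(3) zigzag_eq.bwd_fwd[OF uR uH] that])
  note this[OF z(1)] this[OF z(2)]
  ultimately show ?thesis by (auto intro: zigzag_eq.trans zigzag_eq.sym)
qed

end

section \<open>The embeddings of Q and K into the localization L, and epimorphisms of L that come
  from Q\<close>

section \<open>Arrows of the localization\<close>

context quasi_abelian_category
begin

abbreviation LQ where "LQ \<equiv> left_associated_abelian C"

definition zz_class :: "'m \<Rightarrow> 'm K_arr step list \<Rightarrow> 'm \<Rightarrow> ('m, 'm K_arr) loc_arr" where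
  "zz_class f w g = (f, {v. zigzag_eq KC KR f g w v}, g)"

text \<open>The embedding of \<open>Q\<close> sends \<open>X\<close> to the complex \<open>0 \<rightarrow> X\<close>.\<close>

definition iota :: "'o \<Rightarrow> 'm" where
  "iota X = HZero C null_obj X"

definition larr :: "'m \<Rightarrow> 'm \<Rightarrow> 'm \<Rightarrow> ('m, 'm K_arr) loc_arr" where
  "larr f b g = zz_class f [Fwd (karr f b g)] g"

lemma LQ_obj [simp]: "f \<in> Obj LQ \<longleftrightarrow> is_monic C f"
  by (simp add: left_associated_abelian_def localization_def)

lemma zz_class_hom: "zigzag KC KR f w g \<Longrightarrow> zz_class f w g \<in> Hom LQ f g"
  unfolding zz_class_def left_associated_abelian_def
  by (rule category.localization_HomI[OF category_K_cat])

lemma LQ_HomE: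
  assumes "F \<in> Hom LQ f g"
  obtains w where "zigzag KC KR f w g" "F = zz_class f w g"
  using category.localization_HomE[OF category_K_cat assms[unfolded left_associated_abelian_def]]
  unfolding zz_class_def by metis

lemma zz_class_eq_iff:
  assumes "zigzag KC KR f v g" "zigzag KC KR f w g"
  shows "zz_class f v g = zz_class f w g \<longleftrightarrow> zigzag_eq KC KR f g v w"
proof
  assume "zz_class f v g = zz_class f w g"
  moreover have "w \<in> {u. zigzag_eq KC KR f g w u}" using zigzag_eq.refl[OF assms(2)] by simp
  ultimately have "w \<in> {u. zigzag_eq KC KR f g v u}" by (simp add: zz_class_def)
  then show "zigzag_eq KC KR f g v w" by simp
next
  assume "zigzag_eq KC KR f g v w"
  then show "zz_class f v g = zz_class f w g"
    using category.zigzag_class_eq[OF category_K_cat] by (simp add: zz_class_def)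
qed

lemma zz_class_comp:
  assumes "zigzag KC KR f v g" "zigzag KC KR g w h"
  shows "zz_class g w h \<cdot>\<^bsub>LQ\<^esub> zz_class f v g = zz_class f (v @ w) h"
  unfolding zz_class_def left_associated_abelian_def
  by (rule category.localization_comp[OF category_K_cat assms])

lemma LQ_ident: "Ident LQ f = zz_class f [] f"
  by (simp add: zz_class_def left_associated_abelian_def localization_def)

lemma zigzag_fwd: "kmap f b g \<Longrightarrow> zigzag KC KR f [Fwd (karr f b g)] g"
  using karr_hom[of f b g] kmapD[of f b g] by (simp add: Hom_def)

lemma larr_hom: "kmap f b g \<Longrightarrow> larr f b g \<in> Hom LQ f g"
  unfolding larr_def by (intro zz_class_hom zigzag_fwd)

lemma larr_comp:
  assumes b: "kmap f b g" and c: "kmap g c h"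
  shows "larr g c h \<cdot>\<^bsub>LQ\<^esub> larr f b g = larr f (c \<cdot> b) h"
proof -
  have "zigzag_eq KC KR f h [Fwd (karr f b g), Fwd (karr g c h)] [Fwd (karr f (c \<cdot> b) h)]"
    using zigzag_eq.comp[OF karr_hom[OF b] karr_hom[OF c]] karr_comp[OF b c] by simp
  moreover have "zigzag KC KR f ([Fwd (karr f b g)] @ [Fwd (karr g c h)]) h"
    by (rule zigzag_append[OF zigzag_fwd[OF b] zigzag_fwd[OF c]])
  ultimately show ?thesis
    unfolding larr_def zz_class_comp[OF zigzag_fwd[OF b] zigzag_fwd[OF c]]
    using zz_class_eq_iff[OF _ zigzag_fwd[OF kmap_comp[OF b c]]] by simp
qed

lemma larr_ident:
  assumes "is_monic C f"
  shows "larr f (Ident C (Cod C f)) f = Ident LQ f"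
proof -
  have "zigzag_eq KC KR f f [Fwd (karr f (Ident C (Cod C f)) f)] []"
    using zigzag_eq.ident[of f KC KR] assms K_ident[OF assms] by simp
  moreover have "zigzag KC KR f [] f" using assms by simp
  ultimately show ?thesis
    unfolding larr_def LQ_ident using zz_class_eq_iff[OF zigzag_fwd[OF kmap_ident[OF assms]]] by
        simp
qed

text \<open>The localization identifies no further arrows of K: both zigzags are evaluated at the
  identity of \<open>Cod C f\<close>.\<close>

lemma larr_eq_iff:
  assumes b: "kmap f b g" and c: "kmap f c g"
  shows "larr f b g = larr f c g \<longleftrightarrow> eqm g b c"
proof
  note d = kmapD[OF b] kmapD[OF c]
  assume "larr f b g = larr f c g"
  then have e: "zigzag_eq KC KR f g [Fwd (karr f b g)] [Fwd (karr f c g)]"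
    using zz_class_eq_iff[OF zigzag_fwd[OF b] zigzag_fwd[OF c]] by (simp add: larr_def)
  have r: "zz_rel f [Fwd (karr f b g)] (Ident C (Cod C f)) b"
      "zz_rel f [Fwd (karr f c g)] (Ident C (Cod C f)) c"
    unfolding zz_rel_fwd[OF b] zz_rel_fwd[OF c] using d eqm_refl by simp_all
  show "eqm g b c" by (rule zz_rel_agree[OF e r])
next
  assume "eqm g b c"
  then show "larr f b g = larr f c g" using karr_eq_iff[OF b c] by (simp add: larr_def)
qed

lemma iota_simps [simp]:
  assumes "X \<in> Obj C"
  shows "iota X \<in> Arr C" "Dom C (iota X) = null_obj" "Cod C (iota X) = X" "is_monic C (iota X)"
  using assms null_obj(1) null_monic by (simp_all add: iota_def)

lemma eqm_iota: "X \<in> Obj C \<Longrightarrow> eqm (iota X) y y' \<Longrightarrow> y = y'"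
  unfolding iota_def by (rule eqm_null)

lemma kmap_iota:
  "is_monic C f \<Longrightarrow> y \<in> Arr C \<Longrightarrow> Cod C y = Cod C f \<Longrightarrow> Dom C y = X \<Longrightarrow> kmap (iota X) y f"
  unfolding iota_def by (rule kmap_null)

text \<open>The embedding of Q is full. Over a strict cover e of X the zigzag has a value y,
  determined exactly because \<open>iota Y\<close> imposes no relation. If e is the cokernel of d,
  the value at \<open>e \<cdot> d\<close>, which is zero, must be zero; so y descends along e to an
  arrow from X.\<close>

lemma iota_full:
  assumes F: "F \<in> Hom LQ (iota X) (iota Y)" and X: "X \<in> Obj C" and Y: "Y \<in> Obj C"
  obtains a where "a \<in> Arr C" "Dom C a = X" "Cod C a = Y" "F = larr (iota X) a (iota Y)"
proof -
  obtain w where w: "zigzag KC KR (iota X) w (iota Y)" "F = zz_class (iota X) w (iota Y)" using F by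
      (rule LQ_HomE)
  obtain e y where e: "cokernel_arrow C e" "Cod C e = X" "zz_rel (iota X) w (Ident C X \<cdot> e) y"
    using zz_rel_dense[OF w(1), of "Ident C X"] X by auto
  have eA: "e \<in> Arr C" using strict_arr[OF e(1)] .
  have er: "zz_rel (iota X) w e y" using e eA by simp
  have yA: "y \<in> Arr C" "Cod C y = Y" "Dom C y = Dom C e" using zz_rel_arr[OF w(1) er] Y by auto
  obtain d where d: "is_cokernel C d e" using e(1) by (auto simp: cokernel_arrow_def)
  then have d': "d \<in> Arr C" "Cod C d = Dom C e" "e \<cdot> d = HZero C (Dom C d) X" using e(2) by
      (auto simp: is_cokernel_def)
  have dO: "Dom C d \<in> Obj C" using d' by simp
  have z0: "zz_rel (iota X) w (HZero C (Dom C d) X) (y \<cdot> d)"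
    using zz_rel_comp[OF w(1) er d'(1)] d' e eA by simp
  \<comment> \<open>By additivity both \<open>y \<cdot> d\<close> and its double are values at zero.
    Single-valuedness makes them equal, so \<open>y \<cdot> d\<close> vanishes.\<close>
  have "zz_rel (iota X) w (HZero C (Dom C d) X \<boxplus> HZero C (Dom C d) X) (y \<cdot> d \<boxplus> y \<cdot> d)"
    by (rule zz_rel_add[OF w(1) z0 z0]) simp
  then have "zz_rel (iota X) w (HZero C (Dom C d) X) (y \<cdot> d \<boxplus> y \<cdot> d)" using dO X by simp
  from eqm_iota[OF Y zz_rel_fun[OF w(1) this z0]] have "y \<cdot> d \<boxplus> y \<cdot> d = y \<cdot> d" .
  then have "y \<cdot> d = HZero C (Dom C d) Y"
    using add_cancel[of "y \<cdot> d" "Dom C d" Y] yA d' by (simp add: Hom_def)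
  moreover have "y \<in> Hom C (Cod C d) Y" using yA d' by (simp add: Hom_def)
  ultimately obtain a where a: "a \<in> Hom C (Cod C e) Y" "a \<cdot> e = y" using d Y unfolding
      is_cokernel_def by blast
  then have a': "a \<in> Arr C" "Dom C a = X" "Cod C a = Y" using e(2) by (auto simp: Hom_def)
  have k: "kmap (iota X) a (iota Y)" using kmap_iota[of "iota Y" a X] a' Y by simp
  have "zigzag_eq KC KR (iota X) (iota Y) w [Fwd (karr (iota X) a (iota Y))]"
  proof (rule zigzag_eqI[OF w(1) zigzag_fwd[OF k] e(1) _ er])
    show "zz_rel (iota X) [Fwd (karr (iota X) a (iota Y))] e y"
      unfolding zz_rel_fwd[OF k] using a(2) eA e(2) X Y yA eqm_refl by simp
    show "eqm (iota Y) y y" using eqm_refl yA Y by simp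
  qed (use e(2) X in simp)
  then have "F = larr (iota X) a (iota Y)" using w zz_class_eq_iff[OF w(1) zigzag_fwd[OF k]] by
      (simp add: larr_def)
  then show ?thesis using that a' by blast
qed

lemma zz_rel_dense2:
  assumes v: "zigzag KC KR f v g" and w: "zigzag KC KR f w h"
  obtains e y z where "cokernel_arrow C e" "Cod C e = Cod C f" "zz_rel f v e y" "zz_rel f w e z"
proof -
  have f: "f \<in> Arr C" using zigzag_monic[OF v] by simp
  obtain e y where e: "cokernel_arrow C e" "Cod C e = Cod C f"
      "zz_rel f v (Ident C (Cod C f) \<cdot> e) y"
    using zz_rel_dense[OF v, of "Ident C (Cod C f)"] f by auto
  note eA = strict_arr[OF e(1)]
  have er: "zz_rel f v e y" using e eA by simp
  obtain d z where d: "cokernel_arrow C d" "Cod C d = Dom C e" "zz_rel f w (e \<cdot> d) z"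
    using zz_rel_dense[OF w eA] e(2) by auto
  note dA = strict_arr[OF d(1)]
  show ?thesis
    by (rule that[OF strict_comp[OF d(1) e(1) d(2)[symmetric]] _ zz_rel_comp[OF v er dA d(2)] d(3)])
      (use eA dA d(2) e(2) in simp)
qed

text \<open>Serves twice: with c an identity it makes the projection from
  \<open>iota (Cod C f)\<close> to f epic, and with f of the form \<open>iota Y\<close> it makes
  strict epimorphisms of Q epic in L. Two arrows out of f that agree after c are compared over a
  common cover e, and c is pulled back along e.\<close>

lemma strict_epic_LQ:
  assumes c: "cokernel_arrow C c" and f: "is_monic C f" and cf: "Cod C c = Cod C f"
  shows "is_epic LQ (larr (iota (Dom C c)) c f)"
proof -
  note cA = strict_arr[OF c] and fA = monic_arr[OF f]
  have k: "kmap (iota (Dom C c)) c f" by (rule kmap_iota[OF f cA cf HOL.refl])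
  note kz = zigzag_fwd[OF k]
  have hom: "larr (iota (Dom C c)) c f \<in> Hom LQ (iota (Dom C c)) f" by (rule larr_hom[OF k])
  show ?thesis
    unfolding is_epic_def HomD(3)[OF hom]
  proof (intro conjI ballI impI)
    show "larr (iota (Dom C c)) c f \<in> Arr LQ" using hom by (simp add: Hom_def)
    fix g F G assume F: "F \<in> Hom LQ f g" and G: "G \<in> Hom LQ f g"
      and eq: "F \<cdot>\<^bsub>LQ\<^esub> larr (iota (Dom C c)) c f = G \<cdot>\<^bsub>LQ\<^esub> larr (iota (Dom C c)) c f"
    obtain v where v: "zigzag KC KR f v g" "F = zz_class f v g" using F by (rule LQ_HomE)
    obtain w where w: "zigzag KC KR f w g" "G = zz_class f w g" using G by (rule LQ_HomE)
    let ?k = "[Fwd (karr (iota (Dom C c)) c f)]"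
    have ke: "zigzag_eq KC KR (iota (Dom C c)) g (?k @ v) (?k @ w)"
      using eq zz_class_comp[OF kz v(1)] zz_class_comp[OF kz w(1)]
        zz_class_eq_iff[OF zigzag_append[OF kz v(1)] zigzag_append[OF kz w(1)]] by
            (simp add: v w larr_def)
    obtain e y z where e: "cokernel_arrow C e" "Cod C e = Cod C f" "zz_rel f v e y" "zz_rel f w e z"
      using zz_rel_dense2[OF v(1) w(1)] .
    note eA = strict_arr[OF e(1)]
    note yz = zz_rel_arr[OF v(1) e(3)] zz_rel_arr[OF w(1) e(4)]
    \<comment> \<open>\<open>e'\<close> lifts the finer cover \<open>e \<cdot> c'\<close> through c,
      so the hypothesis about composites with c applies to it.\<close>
    obtain c' e' where c': "cokernel_arrow C c'" "e' \<in> Arr C" "Cod C c' = Dom C e"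
        "Dom C e' = Dom C c'" "Cod C e' = Dom C c"
      "c \<cdot> e' = e \<cdot> c'"
      using strict_pullback[OF c eA] e(2) cf by auto
    note c'A = strict_arr[OF c'(1)]
    have 1: "zz_rel (iota (Dom C c)) ?k e' (e \<cdot> c')"
      unfolding zz_rel_fwd[OF k] c'(6) using c'(1-5) eA e(2) c'A cA fA eqm_refl by simp
    have "eqm g (y \<cdot> c') (z \<cdot> c')"
      by (rule zz_rel_agree[OF ke])
        (use 1 zz_rel_append[OF kz v(1)] zz_rel_append[OF kz w(1)]
          zz_rel_comp[OF v(1) e(3) c'A c'(3)] zz_rel_comp[OF w(1) e(4) c'A c'(3)] in blast)+
    then have "eqm g y z"
      by (rule strict_reflect[OF c'(1), rotated 7]) (use zigzag_monic[OF v(1)] yz c'(3) in simp_all)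
    then show "F = G" using zigzag_eqI[OF v(1) w(1) e] zz_class_eq_iff[OF v(1) w(1)] by
        (simp add: v w)
  qed
qed

end

section \<open>Finite direct sums of P, the modules Hom(P, X), and detection of equality by
  P\<close>

section \<open>Finite free objects\<close>

context quasi_abelian_category
begin

text \<open>The End(P)-submodules of Hom(P, X), stated through arrows alone;
  \<open>is_submodule_hom_iff\<close> links this with \<open>is_submodule\<close>.\<close>

definition hom_submodule :: "'o \<Rightarrow> 'o \<Rightarrow> 'm set \<Rightarrow> bool" where
  "hom_submodule P X N \<longleftrightarrow> N \<subseteq> Hom C P X \<and> HZero C P X \<in> N \<and> (\<forall>x \<in> N. \<forall>y \<in> N. x \<boxplus> y \<in> N) \<and>
     (\<forall>x \<in> N. \<forall>r \<in> Hom C P P. x \<cdot> r \<in> N)"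

text \<open>The finite sums of P for every choice of biproducts. The inductive form lets freeness,
  finite generation and chain conditions be proved by adding one copy of P at a time.\<close>

inductive_set finite_free :: "'o \<Rightarrow> 'o set" for P where
  null: "null_obj \<in> finite_free P"
| plus: "\<lbrakk>S \<in> finite_free P; is_biproduct S P T i j p q\<rbrakk> \<Longrightarrow> T \<in> finite_free P"

lemma finite_free_obj: "S \<in> finite_free P \<Longrightarrow> S \<in> Obj C"
  by (induction rule: finite_free.induct) (auto simp: null_obj is_biproduct_def)

lemma biproductD:
  assumes "is_biproduct X Y S i j p q"
  shows "X \<in> Obj C" "Y \<in> Obj C" "S \<in> Obj C"
     "i \<in> Arr C" "j \<in> Arr C" "p \<in> Arr C" "q \<in> Arr C"
     "Dom C i = X" "Cod C i = S" "Dom C j = Y" "Cod C j = S"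
     "Dom C p = S" "Cod C p = X" "Dom C q = S" "Cod C q = Y"
     "p \<cdot> i = Ident C X" "q \<cdot> j = Ident C Y"
     "p \<cdot> j = HZero C Y X" "q \<cdot> i = HZero C X Y" "(i \<cdot> p) \<boxplus> (j \<cdot> q) = Ident C S"
  using assms by (auto simp: is_biproduct_def)

lemma biproduct_HomD:
  assumes "is_biproduct X Y S i j p q"
  shows "i \<in> Hom C X S" "j \<in> Hom C Y S" "p \<in> Hom C S X" "q \<in> Hom C S Y"
  using assms by (auto simp: is_biproduct_def Hom_def)

text \<open>This is the freeness of the \<open>End(P)\<close>-module \<open>Hom(P, S)\<close>.\<close>

lemma finite_free_lift:
  assumes P: "P \<in> Obj C" and S: "S \<in> finite_free P" and f: "is_monic C f"
    and hom: "\<And>u. u \<in> Hom C P S \<Longrightarrow> \<phi> u \<in> Hom C P (Cod C f)"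
    and add: "\<And>u v. u \<in> Hom C P S \<Longrightarrow> v \<in> Hom C P S \<Longrightarrow> eqm f (\<phi> (u \<boxplus> v)) (\<phi> u \<boxplus> \<phi> v)"
    and sm: "\<And>u r. u \<in> Hom C P S \<Longrightarrow> r \<in> Hom C P P \<Longrightarrow> eqm f (\<phi> (u \<cdot> r)) (\<phi> u \<cdot> r)"
  shows "\<exists>\<beta> \<in> Hom C S (Cod C f). \<forall>u \<in> Hom C P S. eqm f (\<phi> u) (\<beta> \<cdot> u)"
  using S hom add sm
proof (induction S arbitrary: \<phi> rule: finite_free.induct)
  case null
  note fA = monic_arr[OF f]
  show ?case
  proof (intro bexI[of _ "HZero C null_obj (Cod C f)"] ballI)
    show "HZero C null_obj (Cod C f) \<in> Hom C null_obj (Cod C f)" using zero_hom[OF null_obj(1)] fA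
        by simp
    fix u assume u: "u \<in> Hom C P null_obj"
    then have uu1: "u = HZero C P null_obj" "u \<boxplus> HZero C P null_obj = u" using null_obj(3)[of u] by
        (simp_all add: Hom_iff)
    then have uu: "u \<boxplus> u = u" by metis
    have ph: "\<phi> u \<in> Arr C" "Dom C (\<phi> u) = P" "Cod C (\<phi> u) = Cod C f" using null(1)[OF u] by
        (auto simp: Hom_iff)
    \<comment> \<open>The map is additive only modulo f; since u + u = u, its value at u is zero
      modulo f.\<close>
    have "eqm f (\<phi> u) (\<phi> u \<boxplus> \<phi> u)" using null(2)[OF u u] uu by simp
    moreover have "eqm f (neg (\<phi> u)) (neg (\<phi> u))" by (rule eqm_refl) (use fA ph in simp_all)
    ultimately have "eqm f (\<phi> u \<boxplus> neg (\<phi> u)) (\<phi> u \<boxplus> \<phi> u \<boxplus> neg (\<phi> u))" by (rule eqm_add)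
        (use ph in simp)
    then have "eqm f (HZero C P (Cod C f)) (\<phi> u)" using ph fA by simp
    moreover have "HZero C null_obj (Cod C f) \<cdot> u = HZero C P (Cod C f)"
      using comp_zero[OF u] fA by simp
    ultimately show "eqm f (\<phi> u) (HZero C null_obj (Cod C f) \<cdot> u)" using eqm_sym by simp
  qed
next
  case (plus S T i j p q)
  note fA = monic_arr[OF f]
  note bp = plus.hyps(2) and bpH = biproduct_HomD[OF plus.hyps(2)]
  have iu: "i \<cdot> u \<in> Hom C P T" if "u \<in> Hom C P S" for u using comp_hom[OF that bpH(1)] .
  have "\<exists>\<beta> \<in> Hom C S (Cod C f). \<forall>u \<in> Hom C P S. eqm f (\<phi> (i \<cdot> u)) (\<beta> \<cdot> u)"
  proof (rule plus.IH)
    fix u v assume uv: "u \<in> Hom C P S" "v \<in> Hom C P S"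
    show "\<phi> (i \<cdot> u) \<in> Hom C P (Cod C f)" by (rule plus.prems(1)[OF iu[OF uv(1)]])
    show "eqm f (\<phi> (i \<cdot> (u \<boxplus> v))) (\<phi> (i \<cdot> u) \<boxplus> \<phi> (i \<cdot> v))"
      using plus.prems(2)[OF iu[OF uv(1)] iu[OF uv(2)]] comp_add_right[OF uv bpH(1)] by simp
  next
    fix u r assume u: "u \<in> Hom C P S" "r \<in> Hom C P P"
    show "eqm f (\<phi> (i \<cdot> (u \<cdot> r))) (\<phi> (i \<cdot> u) \<cdot> r)"
      using plus.prems(3)[OF iu[OF u(1)] u(2)] comp_assoc[OF u(2,1) bpH(1)] by simp
  qed
  then obtain \<beta> where \<beta>: "\<beta> \<in> Hom C S (Cod C f)" "\<And>u. u \<in> Hom C P S \<Longrightarrow> eqm f (\<phi> (i \<cdot> u)) (\<beta> \<cdot> u)" by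
      blast
  have pj: "\<phi> j \<in> Hom C P (Cod C f)" by (rule plus.prems(1)[OF bpH(2)])
  \<comment> \<open>\<beta> on the summand S and \<open>\<phi> j\<close> on the new copy of P. The
    scalar rule carries the agreement from j to all \<open>j \<cdot> r\<close>.\<close>
  define \<gamma> where "\<gamma> = \<beta> \<cdot> p \<boxplus> \<phi> j \<cdot> q"
  have \<gamma>: "\<gamma> \<in> Hom C T (Cod C f)" unfolding \<gamma>_def by
      (rule add_hom[OF comp_hom[OF bpH(3) \<beta>(1)] comp_hom[OF bpH(4) pj]])
  have "eqm f (\<phi> u) (\<gamma> \<cdot> u)" if u: "u \<in> Hom C P T" for u
  proof -
    have pu: "p \<cdot> u \<in> Hom C P S" "q \<cdot> u \<in> Hom C P P" using comp_hom[OF u bpH(3)]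
        comp_hom[OF u bpH(4)] by auto
    have "u = i \<cdot> (p \<cdot> u) \<boxplus> j \<cdot> (q \<cdot> u)" using biproduct_split[OF bp] u by (simp add: Hom_iff)
    then have 1: "eqm f (\<phi> u) (\<phi> (i \<cdot> (p \<cdot> u)) \<boxplus> \<phi> (j \<cdot> (q \<cdot> u)))"
      using plus.prems(2)[OF iu[OF pu(1)] comp_hom[OF pu(2) bpH(2)]] by simp
    have 2: "eqm f (\<phi> (i \<cdot> (p \<cdot> u)) \<boxplus> \<phi> (j \<cdot> (q \<cdot> u))) (\<beta> \<cdot> (p \<cdot> u) \<boxplus> \<phi> j \<cdot> (q \<cdot> u))"
      by (rule eqm_add[OF \<beta>(2)[OF pu(1)] plus.prems(3)[OF bpH(2) pu(2)]])
        (use plus.prems(1)[OF iu[OF pu(1)]] plus.prems(1)[OF comp_hom[OF pu(2) bpH(2)]] in \<open>simp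
            add: Hom_iff\<close>)
    have "\<beta> \<cdot> (p \<cdot> u) \<boxplus> \<phi> j \<cdot> (q \<cdot> u) = \<gamma> \<cdot> u"
      unfolding \<gamma>_def comp_add_left[OF u comp_hom[OF bpH(3) \<beta>(1)] comp_hom[OF bpH(4) pj]]
      using comp_assoc[OF u bpH(3) \<beta>(1)] comp_assoc[OF u bpH(4) pj] by simp
    then show ?thesis using eqm_trans[OF 1 2] by simp
  qed
  then show ?case using \<gamma> by blast
qed

text \<open>The injections of the copies of P generate: the new injection j joins the old generators
  moved along i.\<close>

lemma finite_free_generated:
  assumes P: "P \<in> Obj C" and S: "S \<in> finite_free P"
  shows "\<exists>A. finite A \<and> A \<subseteq> Hom C P S \<and> (\<forall>N. hom_submodule P S N \<and> A \<subseteq> N \<longrightarrow> Hom C P S \<subseteq> N)"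
  using S
proof (induction rule: finite_free.induct)
  case null
  have "u = HZero C P null_obj" if "u \<in> Hom C P null_obj" for u using that null_obj(3)[of u] by
      (simp add: Hom_iff)
  then show ?case by (intro exI[of _ "{}"]) (auto simp: hom_submodule_def)
next
  case (plus S T i j p q)
  note bp = plus.hyps(2) and bpH = biproduct_HomD[OF plus.hyps(2)]
  obtain A where A: "finite A" "A \<subseteq> Hom C P S" "\<forall>N. hom_submodule P S N \<and> A \<subseteq> N \<longrightarrow> Hom C P S \<subseteq> N"
    using plus.IH by metis
  have iA: "i \<cdot> u \<in> Hom C P T" if "u \<in> Hom C P S" for u using comp_hom[OF that bpH(1)] .
  have "Hom C P T \<subseteq> N" if N: "hom_submodule P T N" and AN: "insert j ((\<cdot>) i ` A) \<subseteq> N" for N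
  proof
    fix u assume u: "u \<in> Hom C P T"
    have "hom_submodule P S {x \<in> Hom C P S. i \<cdot> x \<in> N}"
      unfolding hom_submodule_def
    proof (intro conjI ballI)
      show "HZero C P S \<in> {x \<in> Hom C P S. i \<cdot> x \<in> N}"
        using N zero_hom[OF P] zero_comp[OF bpH(1) P] finite_free_obj[OF plus.hyps(1)] by
            (simp add: hom_submodule_def)
    next
      fix x y assume "x \<in> {x \<in> Hom C P S. i \<cdot> x \<in> N}" "y \<in> {x \<in> Hom C P S. i \<cdot> x \<in> N}"
      then show "x \<boxplus> y \<in> {x \<in> Hom C P S. i \<cdot> x \<in> N}"
        using N comp_add_right[of x P S y i T] bpH(1) by (auto simp: hom_submodule_def add_hom)
    next
      fix x r assume x: "x \<in> {x \<in> Hom C P S. i \<cdot> x \<in> N}" and r: "r \<in> Hom C P P"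
      then have "(i \<cdot> x) \<cdot> r \<in> N" using N unfolding hom_submodule_def by blast
      then show "x \<cdot> r \<in> {x \<in> Hom C P S. i \<cdot> x \<in> N}"
        using x comp_assoc[OF r _ bpH(1), of x] comp_hom[OF r, of x S] by simp
    qed auto
    moreover have "A \<subseteq> {x \<in> Hom C P S. i \<cdot> x \<in> N}" using A(2) AN by auto
    ultimately have "p \<cdot> u \<in> {x \<in> Hom C P S. i \<cdot> x \<in> N}" using A(3) comp_hom[OF u bpH(3)] by auto
    moreover have "j \<cdot> (q \<cdot> u) \<in> N" using N AN comp_hom[OF u bpH(4)] by
        (simp add: hom_submodule_def)
    ultimately have "i \<cdot> (p \<cdot> u) \<boxplus> j \<cdot> (q \<cdot> u) \<in> N" using N by (simp add: hom_submodule_def)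
    then show "u \<in> N" using biproduct_split[OF bp, of u] u by (simp add: Hom_iff)
  qed
  then show ?case using A(1,2) iA bpH(2) by (intro exI[of _ "insert j ((\<cdot>) i ` A)"]) auto
qed

lemma copowerI_null:
  assumes P: "P \<in> Obj C" and S: "S \<in> Obj C" and null: "Ident C S = HZero C S S"
  shows "is_copower C P {} S \<iota>"
  unfolding is_copower_def
proof (intro conjI ballI allI impI)
  fix Y g assume Y: "Y \<in> Obj C"
  have "h = HZero C S Y" if h: "h \<in> Hom C S Y" for h
    using comp_ident_right[OF h] zero_comp[OF h S] null by simp
  then show "\<exists>!h. h \<in> Hom C S Y \<and> (\<forall>i \<in> {}. h \<cdot> \<iota> i = g i)" using zero_hom[OF S Y] by auto
qed (use S in auto)

text \<open>A copower in a strong projective generator is indexed by a set of arrows, so the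
  injections can index themselves and the family becomes the identity function.\<close>

lemma finite_free_copower:
  assumes P: "P \<in> Obj C" and S: "S \<in> finite_free P"
  shows "\<exists>I. is_copower C P I S (\<lambda>x. x)"
  using S
proof (induction rule: finite_free.induct)
  case null
  show ?case using copowerI_null[OF P null_obj(1)] null_obj(2)[of "Ident C null_obj"] null_obj(1) by
      auto
next
  case (plus S T i j p q)
  note bp = plus.hyps(2) and bpH = biproduct_HomD[OF plus.hyps(2)]
  note bp' = biproductD[OF bp]
  obtain I where I: "is_copower C P I S (\<lambda>x. x)" using plus.IH by blast
  have IH: "x \<in> Hom C P S" if "x \<in> I" for x using I that by (simp add: is_copower_def)
  have "is_copower C P (insert j ((\<cdot>) i ` I)) T (\<lambda>x. x)"
    unfolding is_copower_def
  proof (intro conjI ballI allI impI)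
    show "T \<in> Obj C" using bp' by simp
    fix x assume "x \<in> insert j ((\<cdot>) i ` I)"
    then show "x \<in> Hom C P T" using bpH IH comp_hom by blast
  next
    fix Y g assume Y: "Y \<in> Obj C" and g: "\<forall>x \<in> insert j ((\<cdot>) i ` I). g x \<in> Hom C P Y"
    have "\<exists>!h. h \<in> Hom C S Y \<and> (\<forall>x \<in> I. h \<cdot> x = g (i \<cdot> x))"
      using I[unfolded is_copower_def] Y g by simp
    then obtain h where h: "h \<in> Hom C S Y" "\<And>x. x \<in> I \<Longrightarrow> h \<cdot> x = g (i \<cdot> x)"
      "\<And>h'. h' \<in> Hom C S Y \<Longrightarrow> (\<forall>x \<in> I. h' \<cdot> x = g (i \<cdot> x)) \<Longrightarrow> h' = h" by (elim ex1E) auto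
    have gj: "g j \<in> Hom C P Y" using g by simp
    define k where "k = h \<cdot> p \<boxplus> g j \<cdot> q"
    have k: "k \<in> Hom C T Y" unfolding k_def by (rule add_hom[OF comp_hom[OF bpH(3) h(1)]
        comp_hom[OF bpH(4) gj]])
    have ki: "k \<cdot> i = h" "k \<cdot> j = g j" using biproduct_copair[OF bp, of h "g j"] h(1) gj by
        (simp_all add: k_def Hom_iff)
    show "\<exists>!h. h \<in> Hom C T Y \<and> (\<forall>x \<in> insert j ((\<cdot>) i ` I). h \<cdot> x = g x)"
    proof (rule ex1I[of _ k])
      show "k \<in> Hom C T Y \<and> (\<forall>x \<in> insert j ((\<cdot>) i ` I). k \<cdot> x = g x)"
        using k ki h(2) comp_assoc[OF IH bpH(1) k] by auto
    next
      fix k' assume k': "k' \<in> Hom C T Y \<and> (\<forall>x \<in> insert j ((\<cdot>) i ` I). k' \<cdot> x = g x)"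
      have "(k' \<cdot> i) \<cdot> x = g (i \<cdot> x)" if "x \<in> I" for x using
          comp_assoc[OF IH[OF that] bpH(1), of k' Y] k' that by simp
      then have "k' \<cdot> i = h" using h(3) comp_hom[OF bpH(1)] k' by blast
      moreover have "k' \<cdot> j = g j" using k' by simp
      ultimately show "k' = k"
        using biproduct_hom_eq[OF bp, of k' k] HomD[OF k] HomD[of k' C T Y] k' ki by simp
    qed
  qed
  then show ?case by blast
qed

lemma hom_submodule_image:
  assumes P: "P \<in> Obj C" and m: "m \<in> Hom C I X"
  shows "hom_submodule P X ((\<cdot>) m ` Hom C P I)"
  unfolding hom_submodule_def
proof (intro conjI ballI)
  have IX: "I \<in> Obj C" "X \<in> Obj C" using Hom_objD[OF m] by auto
  show "(\<cdot>) m ` Hom C P I \<subseteq> Hom C P X" using comp_hom[OF _ m] by blast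
  show "HZero C P X \<in> (\<cdot>) m ` Hom C P I"
    using zero_comp[OF m P] zero_hom[OF P IX(1)] by (intro image_eqI[of _ _ "HZero C P I"]) simp_all
next
  fix x y assume "x \<in> (\<cdot>) m ` Hom C P I" "y \<in> (\<cdot>) m ` Hom C P I"
  then obtain a b where "a \<in> Hom C P I" "b \<in> Hom C P I" "x = m \<cdot> a" "y = m \<cdot> b" by blast
  then show "x \<boxplus> y \<in> (\<cdot>) m ` Hom C P I"
    using comp_add_right[of a P I b m X] m add_hom by (intro image_eqI[of _ _ "a \<boxplus> b"]) simp_all
next
  fix x r assume "x \<in> (\<cdot>) m ` Hom C P I" and r: "r \<in> Hom C P P"
  then obtain a where "a \<in> Hom C P I" "x = m \<cdot> a" by blast
  then show "x \<cdot> r \<in> (\<cdot>) m ` Hom C P I"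
    using comp_assoc[OF r _ m, of a] comp_hom[OF r, of a I] by (intro image_eqI[of _ _ "a \<cdot> r"])
        simp_all
qed

lemma projectiveD:
  assumes "is_projective C P" "cokernel_arrow C c" "u \<in> Hom C P (Cod C c)"
  obtains v where "v \<in> Hom C P (Dom C c)" "c \<cdot> v = u"
  using assms unfolding is_projective_def by blast

lemma projective_obj: "is_projective C P \<Longrightarrow> P \<in> Obj C"
  by (simp add: is_projective_def)

text \<open>On \<open>Hom(P, _)\<close> the partial function of a zigzag is total, as strict epimorphisms onto \<open>P\<close>
    split.\<close>

lemma zz_rel_total:
  assumes P: "is_projective C P" and w: "zigzag KC KR f w g" and y: "y \<in> Hom C P (Cod C f)"
  obtains z where "z \<in> Hom C P (Cod C g)" "zz_rel f w y z"
proof -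
  have y': "y \<in> Arr C" "Dom C y = P" "Cod C y = Cod C f" using y by (auto simp: Hom_iff)
  obtain e z where e: "cokernel_arrow C e" "Cod C e = P" "zz_rel f w (y \<cdot> e) z"
    using zz_rel_dense[OF w y'(1,3)] y' by auto
  note eA = strict_arr[OF e(1)]
  have "Ident C P \<in> Hom C P (Cod C e)" using ident_hom[OF projective_obj[OF P]] e(2) by simp
  then obtain s where s: "s \<in> Hom C P (Dom C e)" "e \<cdot> s = Ident C P" using projectiveD[OF P e(1)] by
      metis
  then have s': "s \<in> Arr C" "Dom C s = P" "Cod C s = Dom C e" by (auto simp: Hom_iff)
  have "zz_rel f w ((y \<cdot> e) \<cdot> s) (z \<cdot> s)" by (rule zz_rel_comp[OF w e(3) s'(1)])
      (use s' y' eA e(2) in simp)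
  then have "zz_rel f w y (z \<cdot> s)" using s(2) s' y' eA e(2) by (simp add: assoc)
  then show ?thesis using that zz_rel_arr[OF w] y' by (metis Hom_iff)
qed

text \<open>Take a cokernel c from a copower of P to X. On every copy of P the difference d of the
  composites with c factors through m; the universal property assembles these factors into one arrow
  k with \<open>d = m \<cdot> k\<close>, and \<open>strict_reflect\<close> removes c.\<close>

lemma generator_reflect:
  assumes P: "strong_projective_generator C P" and m: "is_monic C m"
    and y: "y \<in> Hom C X (Cod C m)" "y' \<in> Hom C X (Cod C m)"
    and eq: "\<And>u. u \<in> Hom C P X \<Longrightarrow> eqm m (y \<cdot> u) (y' \<cdot> u)"
  shows "eqm m y y'"
proof -
  note mA = monic_arr[OF m]
  have X: "X \<in> Obj C" using Hom_objD[OF y(1)] by simp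
  obtain I S \<iota> c where S: "is_copower C P (I :: 'm set) S \<iota>" and c: "cokernel_arrow C c"
      "c \<in> Hom C S X"
    using P X unfolding strong_projective_generator_def by metis
  have y': "y \<in> Arr C" "y' \<in> Arr C" "Dom C y = X" "Dom C y' = X" "Cod C y = Cod C m"
      "Cod C y' = Cod C m"
    using y by (auto simp: Hom_iff)
  have c': "c \<in> Arr C" "Dom C c = S" "Cod C c = X" using c(2) by (auto simp: Hom_iff)
  have io: "\<iota> i \<in> Arr C" "Dom C (\<iota> i) = P" "Cod C (\<iota> i) = S" if "i \<in> I" for i
    using S that by (auto simp: is_copower_def Hom_iff)
  define d where "d = y \<cdot> c \<boxplus> neg (y' \<cdot> c)"
  have d: "d \<in> Arr C" "Dom C d = S" "Cod C d = Cod C m" using y' c' by (simp_all add: d_def)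
  have "\<exists>h. \<forall>i \<in> I. h i \<in> Hom C P (Dom C m) \<and> d \<cdot> \<iota> i = m \<cdot> h i"
  proof (rule bchoice, rule ballI)
    fix i assume i: "i \<in> I"
    note io = io[OF i]
    have "c \<cdot> \<iota> i \<in> Hom C P X" using io c' by (simp add: Hom_iff)
    from eq[OF this] obtain h where h: "h \<in> Arr C" "Dom C h = P" "Cod C h = Dom C m"
      "y \<cdot> (c \<cdot> \<iota> i) \<boxplus> neg (y' \<cdot> (c \<cdot> \<iota> i)) = m \<cdot> h"
      using eqm_diff[of m "y \<cdot> (c \<cdot> \<iota> i)" "y' \<cdot> (c \<cdot> \<iota> i)"] mA y' c' io by auto
    have "d \<cdot> \<iota> i = m \<cdot> h" unfolding h(4)[symmetric] using y' c' io by
        (simp add: d_def comp_plus comp_neg assoc)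
    then show "\<exists>h. h \<in> Hom C P (Dom C m) \<and> d \<cdot> \<iota> i = m \<cdot> h" using h by (auto simp: Hom_iff)
  qed
  then obtain h where h: "\<And>i. i \<in> I \<Longrightarrow> h i \<in> Hom C P (Dom C m)" "\<And>i. i \<in> I \<Longrightarrow> d \<cdot> \<iota> i = m \<cdot> h i" by
      blast
  have uni: "\<exists>!k. k \<in> Hom C S Y \<and> (\<forall>i \<in> I. k \<cdot> \<iota> i = g i)"
    if "Y \<in> Obj C" "\<And>i. i \<in> I \<Longrightarrow> g i \<in> Hom C P Y" for Y g
    using S that by (simp add: is_copower_def)
  obtain k where k: "k \<in> Hom C S (Dom C m)" "\<And>i. i \<in> I \<Longrightarrow> k \<cdot> \<iota> i = h i"
    using uni[of "Dom C m" h] h(1) dom_obj[OF mA] by blast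
  have k': "k \<in> Arr C" "Dom C k = S" "Cod C k = Dom C m" using k by (auto simp: Hom_iff)
  have mk: "m \<cdot> k \<in> Hom C S (Cod C m)" "d \<in> Hom C S (Cod C m)" using k' mA d by
      (simp_all add: Hom_iff)
  have "(m \<cdot> k) \<cdot> \<iota> i = d \<cdot> \<iota> i" if "i \<in> I" for i using k h(2) that io[OF that] k' mA by
      (simp add: assoc)
  moreover have "d \<cdot> \<iota> i \<in> Hom C P (Cod C m)" if "i \<in> I" for i using io[OF that] d by
      (simp add: Hom_iff)
  moreover have "Cod C m \<in> Obj C" using mA by simp
  \<comment> \<open>Both \<open>m \<cdot> k\<close> and d restrict to
    \<open>d \<cdot> \<iota> i\<close> on each copy, so uniqueness for the copower identifies
    them.\<close>
  ultimately have dk: "d = m \<cdot> k" using uni[of "Cod C m" "\<lambda>i. d \<cdot> \<iota> i"] mk by blast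
  have "\<exists>h. h \<in> Arr C \<and> Dom C h = S \<and> Cod C h = Dom C m \<and> y \<cdot> c \<boxplus> neg (y' \<cdot> c) = m \<cdot> h"
    using k' dk[unfolded d_def] by blast
  then have "eqm m (y \<cdot> c) (y' \<cdot> c)" using eqm_diff[of m "y \<cdot> c" "y' \<cdot> c"] mA y' c' by simp
  then show ?thesis by (rule strict_reflect[OF c(1) m, rotated 6]) (use y' c' in simp_all)
qed

end

section \<open>The dictionary between subobjects of X and submodules of Hom(P, X), and finite
  covers\<close>

section \<open>Submodules of Hom(P, X) and subobjects\<close>

text \<open>Without a maximal member, dependent choice would produce a strictly ascending chain.
  Maximality refers to the preorder, as monomorphisms represent subobjects only up to
  \<open>subobject_eq\<close>.\<close>

lemma noetherian_maximal:
  assumes noeth: "noetherian_subobjects C" and X: "X \<in> Obj C"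
    and M: "\<And>m. m \<in> M \<Longrightarrow> is_subobject C X m" and ne: "M \<noteq> {}"
  shows "\<exists>m \<in> M. \<forall>m' \<in> M. subobject_le C m m' \<longrightarrow> subobject_le C m' m"
proof (rule ccontr)
  assume "\<not> ?thesis"
  then have step: "\<forall>m \<in> M. \<exists>m' \<in> M. subobject_le C m m' \<and> \<not> subobject_le C m' m" by blast
  obtain s where s: "\<And>n::nat. s n \<in> M \<and> (subobject_le C (s n) (s (Suc n)) \<and> \<not> subobject_le C
      (s (Suc n)) (s n))"
  proof -
    have "\<exists>s. \<forall>n::nat. s n \<in> M \<and> (subobject_le C (s n) (s (Suc n)) \<and> \<not> subobject_le C (s (Suc n))
        (s n))"
      by (rule dependent_nat_choice[where P = "\<lambda>_ m. m \<in> M" and Q =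
          "\<lambda>_ m m'. subobject_le C m m' \<and> \<not> subobject_le C m' m"])
        (use ne step in auto)
    then show ?thesis using that by blast
  qed
  then have "(\<forall>n. is_subobject C X (s n)) \<and> (\<forall>n. subobject_le C (s n) (s (Suc n)))" using M by blast
  then obtain N where "\<forall>n \<ge> N. subobject_eq C (s n) (s N)" using noeth X unfolding
      noetherian_subobjects_def by blast
  then have "subobject_eq C (s (Suc N)) (s N)" by simp
  then show False using s[of N] by (simp add: subobject_eq_def)
qed

lemma mod_iso_of_bij:
  assumes F: "(M, f, N) \<in> Hom (mod_cat R) M N" and bij: "bij_betw f (carrier M) (carrier N)"
  shows "is_iso_arrow (mod_cat R) (M, f, N)"
proof -
  have f: "f \<in> module_homs R M N" and M: "right_module R M" "right_module R N"
      "finitely_generated_module R M" "finitely_generated_module R N"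
    using F by (auto elim!: mod_HomE)
  interpret M: right_module R M by fact
  interpret N: right_module R N by fact
  define g where "g = restrict (inv_into (carrier M) f) (carrier N)"
  have gN: "g x \<in> carrier M" "f (g x) = x" if "x \<in> carrier N" for x
    using bij that by (auto simp: g_def bij_betw_def inv_into_into f_inv_into_f)
  have gf: "g (f x) = x" if "x \<in> carrier M" for x
    using bij that module_homsD(1)[OF f that] by (simp add: g_def bij_betw_def)
  have inj: "x = y" if "x \<in> carrier M" "y \<in> carrier M" "f x = f y" for x y
    using bij that by (auto simp: bij_betw_def inj_on_def)
  have g: "g \<in> module_homs R N M"
    unfolding module_homs_def
  proof (intro CollectI conjI ballI)
    show "g \<in> carrier N \<rightarrow>\<^sub>E carrier M" using gN by (auto simp: g_def)
    fix x y assume xy: "x \<in> carrier N" "y \<in> carrier N"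
    show "g (x \<oplus>\<^bsub>N\<^esub> y) = g x \<oplus>\<^bsub>M\<^esub> g y"
      by (rule inj) (use xy gN module_homsD(2)[OF f] in simp_all)
  next
    fix r x assume rx: "r \<in> carrier R" "x \<in> carrier N"
    show "g (r \<odot>\<^bsub>N\<^esub> x) = r \<odot>\<^bsub>M\<^esub> g x"
      by (rule inj) (use rx gN module_homsD(3)[OF f] M.smult_closed N.smult_closed in simp_all)
  qed
  have id: "Ident (mod_cat R) L = (L, (\<lambda>x \<in> carrier L. x), L)" for L by (simp add: mod_cat_def)
  show ?thesis
  proof (rule isoI[OF F mod_HomI[OF g M(2,1,4,3)]])
    show "(N, g, M) \<cdot>\<^bsub>mod_cat R\<^esub> (M, f, N) = Ident (mod_cat R) M"
      using gf by (auto simp: id mod_comp compose_def)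
    show "(M, f, N) \<cdot>\<^bsub>mod_cat R\<^esub> (N, g, M) = Ident (mod_cat R) N"
      using gN(2) by (auto simp: id mod_comp compose_def)
  qed
qed

context additive_category
begin

lemma End_ring_simps [simp]: "carrier (End_ring C P) = Hom C P P" "mult (End_ring C P) = Comp C"
  "one (End_ring C P) = Ident C P" "zero (End_ring C P) = HZero C P P" "add (End_ring C P) = HAdd C"
  by (simp_all add: End_ring_def)

definition hom_module :: "'o \<Rightarrow> 'o \<Rightarrow> ('m, 'm) module" where
  "hom_module P X = \<lparr>carrier = Hom C P X, mult = undefined, one = undefined, zero = HZero C P X,
     add = HAdd C, smult = (\<lambda>r x. x \<cdot> r)\<rparr>"

lemma hom_module_simps [simp]: "carrier (hom_module P X) = Hom C P X"
    "zero (hom_module P X) = HZero C P X"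
  "add (hom_module P X) = HAdd C" "r \<odot>\<^bsub>hom_module P X\<^esub> x = x \<cdot> r"
  by (simp_all add: hom_module_def)

lemma right_module_hom:
  assumes P: "P \<in> Obj C" and X: "X \<in> Obj C"
  shows "right_module (End_ring C P) (hom_module P X)"
proof -
  interpret R: ring "End_ring C P" by (rule ring_End_ring[OF P])
  interpret M: abelian_group "hom_module P X"
  proof (rule abelian_groupI, unfold hom_module_simps)
    fix x assume x: "x \<in> Hom C P X"
    then obtain y where "y \<in> Hom C P X" "x \<boxplus> y = HZero C P X" using add_inv by blast
    then show "\<exists>y \<in> Hom C P X. y \<boxplus> x = HZero C P X" using add_comm[OF x] by metis
  qed (fact add_hom zero_hom[OF P X] add_assoc add_comm add_zero_left)+
  show ?thesis
  proof unfold_locales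
    fix r x assume "r \<in> carrier (End_ring C P)" "x \<in> carrier (hom_module P X)"
    then show "r \<odot>\<^bsub>hom_module P X\<^esub> x \<in> carrier (hom_module P X)" using comp_hom by simp
  next
    fix r s x assume "r \<in> carrier (End_ring C P)" "s \<in> carrier (End_ring C P)"
        "x \<in> carrier (hom_module P X)"
    then have *: "r \<in> Hom C P P" "s \<in> Hom C P P" "x \<in> Hom C P X" by simp_all
    show "(r \<oplus>\<^bsub>End_ring C P\<^esub> s) \<odot>\<^bsub>hom_module P X\<^esub> x = r \<odot>\<^bsub>hom_module P X\<^esub> x \<oplus>\<^bsub>hom_module P X\<^esub> s
        \<odot>\<^bsub>hom_module P X\<^esub> x"
      using comp_add_right[OF *] by simp
    show "(r \<otimes>\<^bsub>End_ring C P\<^esub> s) \<odot>\<^bsub>hom_module P X\<^esub> x = s \<odot>\<^bsub>hom_module P X\<^esub> (r \<odot>\<^bsub>hom_module P X\<^esub> x)"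
      using comp_assoc[OF *(2,1,3)] by simp
  next
    fix r x y assume "r \<in> carrier (End_ring C P)" "x \<in> carrier (hom_module P X)"
        "y \<in> carrier (hom_module P X)"
    then have *: "r \<in> Hom C P P" "x \<in> Hom C P X" "y \<in> Hom C P X" by simp_all
    show "r \<odot>\<^bsub>hom_module P X\<^esub> (x \<oplus>\<^bsub>hom_module P X\<^esub> y) = r \<odot>\<^bsub>hom_module P X\<^esub> x \<oplus>\<^bsub>hom_module P X\<^esub> r
        \<odot>\<^bsub>hom_module P X\<^esub> y"
      using comp_add_left[OF *] by simp
  next
    fix x assume "x \<in> carrier (hom_module P X)"
    then show "\<one>\<^bsub>End_ring C P\<^esub> \<odot>\<^bsub>hom_module P X\<^esub> x = x" using comp_ident_right by simp
  qed
qed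

end

context quasi_abelian_category
begin

lemma is_submodule_hom_iff: "is_submodule (End_ring C P) (hom_module P X) N \<longleftrightarrow> hom_submodule P X N"
  by (auto simp: is_submodule_def hom_submodule_def)

lemma hom_submodule_neg:
  assumes P: "P \<in> Obj C" and N: "hom_submodule P X N" and x: "x \<in> N"
  shows "neg x \<in> N"
proof -
  have xH: "x \<in> Hom C P X" using N x by (auto simp: hom_submodule_def)
  have "neg x = x \<cdot> neg (Ident C P)" using xH P by (simp add: comp_neg Hom_iff)
  moreover have "neg (Ident C P) \<in> Hom C P P" using P by (simp add: Hom_iff)
  ultimately show ?thesis using N x unfolding hom_submodule_def by metis
qed

lemma right_ideal_iff:
  assumes P: "P \<in> Obj C"
  shows "right_ideal (End_ring C P) J \<longleftrightarrow> hom_submodule P P J"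
proof
  assume J: "right_ideal (End_ring C P) J"
  then have "additive_subgroup J (End_ring C P)" by (simp add: right_ideal_def)
  then interpret additive_subgroup J "End_ring C P" .
  show "hom_submodule P P J"
    unfolding hom_submodule_def
    using J a_subset zero_closed a_closed by (simp add: right_ideal_def)
next
  assume J: "hom_submodule P P J"
  interpret R: ring "End_ring C P" by (rule ring_End_ring[OF P])
  have "subgroup J (add_monoid (End_ring C P))"
  proof (rule group.subgroupI[OF R.a_group])
    show "J \<subseteq> carrier (add_monoid (End_ring C P))" "J \<noteq> {}" using J by
        (auto simp: hom_submodule_def)
    fix x assume x: "x \<in> J"
    then have xH: "x \<in> Hom C P P" using J by (auto simp: hom_submodule_def)
    have "neg x \<oplus>\<^bsub>End_ring C P\<^esub> x = \<zero>\<^bsub>End_ring C P\<^esub>" "neg x \<in> carrier (End_ring C P)" using xH by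
        (auto simp: Hom_iff)
    then have "\<ominus>\<^bsub>End_ring C P\<^esub> x = neg x" using R.minus_equality xH by simp
    then show "inv\<^bsub>add_monoid (End_ring C P)\<^esub> x \<in> J" using hom_submodule_neg[OF P J x] by
        (simp add: a_inv_def)
    fix y assume "y \<in> J"
    then show "x \<otimes>\<^bsub>add_monoid (End_ring C P)\<^esub> y \<in> J" using J x by (simp add: hom_submodule_def)
  qed
  then show "right_ideal (End_ring C P) J" using J by
      (simp add: right_ideal_def additive_subgroup_def hom_submodule_def)
qed

text \<open>m factors through \<open>m'\<close> as soon as m is zero modulo \<open>m'\<close>, and
  by \<open>generator_reflect\<close> this can be tested on arrows from P.\<close>

lemma subobject_leI:
  assumes P: "strong_projective_generator C P" and m: "is_subobject C X m" "is_subobject C X m'"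
    and sub: "(\<cdot>) m ` Hom C P (Dom C m) \<subseteq> (\<cdot>) m' ` Hom C P (Dom C m')"
  shows "subobject_le C m m'"
proof -
  have m': "is_monic C m" "is_monic C m'" "Cod C m = X" "Cod C m' = X" using m by
      (auto simp: is_subobject_def)
  note A = monic_arr[OF m'(1)] monic_arr[OF m'(2)]
  have "eqm m' m (HZero C (Dom C m) X)"
  proof (rule generator_reflect[OF P m'(2)])
    show "m \<in> Hom C (Dom C m) (Cod C m')" "HZero C (Dom C m) X \<in> Hom C (Dom C m) (Cod C m')"
      using A m'(3,4) zero_hom[of "Dom C m" X] dom_obj[OF A(1)] cod_obj[OF A(1)] by
          (simp_all add: Hom_iff)
    fix u assume u: "u \<in> Hom C P (Dom C m)"
    then obtain v where v: "v \<in> Hom C P (Dom C m')" "m \<cdot> u = m' \<cdot> v" using sub by blast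
    show "eqm m' (m \<cdot> u) (HZero C (Dom C m) X \<cdot> u)"
      using eqm_zeroI[of m' v] v u A m'(3,4) cod_obj[OF A(1)] by (simp add: Hom_iff)
  qed
  then obtain h where "h \<in> Arr C" "Dom C h = Dom C m" "Cod C h = Dom C m'" "m = m' \<cdot> h"
    using eqm_zero_iff[of m' m] A m'(3,4) by auto
  then show ?thesis unfolding subobject_le_def by (auto simp: Hom_iff)
qed

lemma subobject_leD:
  assumes "subobject_le C m m'" "m' \<in> Arr C"
  shows "(\<cdot>) m ` Hom C P (Dom C m) \<subseteq> (\<cdot>) m' ` Hom C P (Dom C m')"
proof
  obtain h where h: "h \<in> Hom C (Dom C m) (Dom C m')" "m = m' \<cdot> h" using assms(1) by
      (auto simp: subobject_le_def)
  fix x assume "x \<in> (\<cdot>) m ` Hom C P (Dom C m)"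
  then obtain u where u: "u \<in> Hom C P (Dom C m)" "x = m \<cdot> u" by blast
  have "x = (m' \<cdot> h) \<cdot> u" unfolding u(2) h(2)[symmetric] ..
  also have "\<dots> = m' \<cdot> (h \<cdot> u)" by (rule assoc) (use u(1) h(1) assms(2) in \<open>simp_all add: Hom_iff\<close>)
  finally have "x = m' \<cdot> (h \<cdot> u)" .
  then show "x \<in> (\<cdot>) m' ` Hom C P (Dom C m')" using comp_hom[OF u(1) h(1)] by blast
qed

text \<open>Among the subobjects \<open>m\<close> with \<open>m \<cdot> Hom(P, _) \<subseteq> N\<close> take a maximal one.\<close>

lemma submodule_subobject:
  assumes P: "is_projective C P" and noeth: "noetherian_subobjects C" and X: "X \<in> Obj C" and N:
      "hom_submodule P X N"
  obtains m where "is_subobject C X m" "N = (\<cdot>) m ` Hom C P (Dom C m)"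
proof -
  note PO = projective_obj[OF P]
  define M where "M = {m. is_subobject C X m \<and> (\<cdot>) m ` Hom C P (Dom C m) \<subseteq> N}"
  have NH: "x \<in> Hom C P X" if "x \<in> N" for x using N that by (auto simp: hom_submodule_def)
  \<comment> \<open>The zero subobject makes the family nonempty.\<close>
  have "iota X \<in> M"
  proof -
    have "iota X \<cdot> u = HZero C P X" if "u \<in> Hom C P null_obj" for u
      using that null_obj(3)[of u] null_obj(1) X by (simp add: Hom_iff iota_def)
    then show ?thesis using N X by (auto simp: M_def is_subobject_def hom_submodule_def)
  qed
  then obtain m where m: "m \<in> M" "\<And>m'. m' \<in> M \<Longrightarrow> subobject_le C m m' \<Longrightarrow> subobject_le C m' m"
    using noetherian_maximal[OF noeth X, of M] by (auto simp: M_def)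
  have m': "is_monic C m" "Cod C m = X" "(\<cdot>) m ` Hom C P (Dom C m) \<subseteq> N" using m(1) by
      (auto simp: M_def is_subobject_def)
  note mA = monic_arr[OF m'(1)]
  have "N \<subseteq> (\<cdot>) m ` Hom C P (Dom C m)"
  proof
    fix u assume u: "u \<in> N"
    have u': "u \<in> Arr C" "Dom C u = P" "Cod C u = X" using NH[OF u] by (auto simp: Hom_iff)
    obtain S i j p q where bp: "is_biproduct (Dom C m) P S i j p q" using
        biproduct_exists[OF dom_obj[OF mA] PO] .
    note bp' = biproductD[OF bp] and bpH = biproduct_HomD[OF bp]
    \<comment> \<open>Both m and u factor through the image n of the row (m, u). As P is projective,
      an arrow from P into the image lifts to the biproduct, so n still takes Hom(P, _) into N and
      competes with m.\<close>
    define t where "t = m \<cdot> p \<boxplus> u \<cdot> q"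
    have t: "t \<in> Arr C" "Dom C t = S" "Cod C t = X" using mA m'(2) u' bp' by (simp_all add: t_def)
    have ti: "t \<cdot> i = m" "t \<cdot> j = u" using biproduct_copair[OF bp, of m u] mA m'(2) u' by
        (simp_all add: t_def)
    obtain n c where n: "is_monic C n" "cokernel_arrow C c" "Dom C c = Dom C t" "Cod C c = Dom C n"
        "Cod C n = Cod C t"
      "t = n \<cdot> c" using image_factorization[OF t(1)] .
    note nA = monic_arr[OF n(1)] and cA = strict_arr[OF n(2)]
    have ci: "c \<cdot> i \<in> Hom C (Dom C m) (Dom C n)" "c \<cdot> j \<in> Hom C P (Dom C n)" using cA n(3,4) t(2)
        bp' by (simp_all add: Hom_iff)
    have "(n \<cdot> c) \<cdot> i = n \<cdot> (c \<cdot> i)" "(n \<cdot> c) \<cdot> j = n \<cdot> (c \<cdot> j)"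
      by (rule assoc; use nA cA n(3,4) t(2) bp' in simp)+
    then have nci: "n \<cdot> (c \<cdot> i) = m" "n \<cdot> (c \<cdot> j) = u" using ti n(6) by metis+
    have "n \<cdot> v \<in> N" if v: "v \<in> Hom C P (Dom C n)" for v
    proof -
      obtain s where s: "s \<in> Hom C P S" "c \<cdot> s = v" using projectiveD[OF P n(2), of v] v n(3,4) t(2)
          by auto
      have ps: "p \<cdot> s \<in> Hom C P (Dom C m)" "q \<cdot> s \<in> Hom C P P" using comp_hom[OF s(1)] bpH by auto
      have "n \<cdot> v = t \<cdot> s" using s n(3,4,6) assoc[of s c n] nA cA t(2) by (simp add: Hom_iff)
      also have "\<dots> = m \<cdot> (p \<cdot> s) \<boxplus> u \<cdot> (q \<cdot> s)" using s mA m'(2) u' bp' by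
          (simp add: t_def comp_plus assoc Hom_iff)
      finally show ?thesis using N m'(3) ps u unfolding hom_submodule_def by auto
    qed
    then have "n \<in> M" using n t by (auto simp: M_def is_subobject_def)
    moreover have "subobject_le C m n" unfolding subobject_le_def using ci(1) nci(1) by metis
    ultimately have "subobject_le C n m" by (rule m(2))
    from subobject_leD[OF this mA] have "n \<cdot> (c \<cdot> j) \<in> (\<cdot>) m ` Hom C P (Dom C m)" using ci(2) by
        blast
    then show "u \<in> (\<cdot>) m ` Hom C P (Dom C m)" using nci by simp
  qed
  then show ?thesis using that[of m] m' m(1) by (auto simp: M_def)
qed

text \<open>Right ideals of End(P) are submodules of Hom(P, P) and so come from subobjects of P,
  with inclusion corresponding to the order of subobjects. Descending chains are translated by the
  same correspondence, which itself rests on the noetherian condition.\<close>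

lemma right_noetherian_End:
  assumes P: "strong_projective_generator C P" and noeth: "noetherian_subobjects C"
  shows "right_noetherian_ring (End_ring C P)"
    and "artinian_subobjects C \<Longrightarrow> right_artinian_ring (End_ring C P)"
proof -
  have Pp: "is_projective C P" using P by (simp add: strong_projective_generator_def)
  note PO = projective_obj[OF Pp]
  \<comment> \<open>The representing subobjects are fixed for the whole sequence of ideals, whatever
    its direction, so that both chain conditions can use them.\<close>
  have chain: "\<exists>s. (\<forall>n. is_subobject C P (s n) \<and> I n = (\<cdot>) (s n) ` Hom C P (Dom C (s n))) \<and>
      (\<forall>n k. I n \<subseteq> I k \<longleftrightarrow> subobject_le C (s n) (s k))"
    if I: "\<forall>n. right_ideal (End_ring C P) (I n)" for I :: "nat \<Rightarrow> 'm set"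
  proof -
    have "\<forall>n. \<exists>m. is_subobject C P m \<and> I n = (\<cdot>) m ` Hom C P (Dom C m)"
    proof
      fix n
      have "hom_submodule P P (I n)" using I right_ideal_iff[OF PO] by blast
      then obtain m where "is_subobject C P m" "I n = (\<cdot>) m ` Hom C P (Dom C m)"
        using submodule_subobject[OF Pp noeth PO] by blast
      then show "\<exists>m. is_subobject C P m \<and> I n = (\<cdot>) m ` Hom C P (Dom C m)" by blast
    qed
    then obtain s where s: "\<And>n. is_subobject C P (s n)" "\<And>n. I n = (\<cdot>) (s n) ` Hom C P
        (Dom C (s n))" by metis
    have "I n \<subseteq> I k \<longleftrightarrow> subobject_le C (s n) (s k)" for n k
    proof
      assume "I n \<subseteq> I k"
      then show "subobject_le C (s n) (s k)" using subobject_leI[OF P s(1) s(1)] s(2) by simp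
    next
      have "s k \<in> Arr C" using s(1)[of k] by (simp add: is_subobject_def)
      moreover assume "subobject_le C (s n) (s k)"
      ultimately show "I n \<subseteq> I k" using subobject_leD[of "s n" "s k" P] s(2) by simp
    qed
    then show ?thesis using s by (intro exI[of _ s] conjI allI)
  qed
  show "right_noetherian_ring (End_ring C P)"
    unfolding right_noetherian_ring_def
  proof (intro conjI allI impI ring_End_ring[OF PO])
    fix I :: "nat \<Rightarrow> 'm set" assume I: "(\<forall>n. right_ideal (End_ring C P) (I n)) \<and>
        (\<forall>n. I n \<subseteq> I (Suc n))"
    then obtain s where s: "\<And>n. is_subobject C P (s n)" "\<And>n k. I n \<subseteq> I k \<longleftrightarrow> subobject_le C (s n)
        (s k)"
      using chain[of I] by metis
    have "subobject_le C (s n) (s (Suc n))" for n using s(2)[of n "Suc n"] I by simp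
    then have "(\<forall>n. is_subobject C P (s n)) \<and> (\<forall>n. subobject_le C (s n) (s (Suc n)))" using s(1) by
        simp
    then have "\<exists>N. \<forall>n \<ge> N. subobject_eq C (s n) (s N)"
      using noeth PO unfolding noetherian_subobjects_def by blast
    then show "\<exists>N. \<forall>n \<ge> N. I n = I N" using s(2) unfolding subobject_eq_def by blast
  qed
  assume art: "artinian_subobjects C"
  show "right_artinian_ring (End_ring C P)"
    unfolding right_artinian_ring_def
  proof (intro conjI allI impI ring_End_ring[OF PO])
    fix I :: "nat \<Rightarrow> 'm set" assume I: "(\<forall>n. right_ideal (End_ring C P) (I n)) \<and>
        (\<forall>n. I (Suc n) \<subseteq> I n)"
    then obtain s where s: "\<And>n. is_subobject C P (s n)" "\<And>n k. I n \<subseteq> I k \<longleftrightarrow> subobject_le C (s n)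
        (s k)"
      using chain[of I] by metis
    have "subobject_le C (s (Suc n)) (s n)" for n using s(2)[of "Suc n" n] I by simp
    then have "(\<forall>n. is_subobject C P (s n)) \<and> (\<forall>n. subobject_le C (s (Suc n)) (s n))" using s(1) by
        simp
    then have "\<exists>N. \<forall>n \<ge> N. subobject_eq C (s n) (s N)"
      using art PO unfolding artinian_subobjects_def by blast
    then show "\<exists>N. \<forall>n \<ge> N. I n = I N" using s(2) unfolding subobject_eq_def by blast
  qed
qed

text \<open>A maximal subobject among the images of finite free objects is everything.\<close>

lemma finite_free_cover:
  assumes P: "strong_projective_generator C P" and noeth: "noetherian_subobjects C" and X:
      "X \<in> Obj C"
  obtains S c where "S \<in> finite_free P" "cokernel_arrow C c" "c \<in> Hom C S X"
proof -
  have Pp: "is_projective C P" using P by (simp add: strong_projective_generator_def)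
  note PO = projective_obj[OF Pp]
  define M where "M = {m. is_subobject C X m \<and> (\<exists>S c. S \<in> finite_free P \<and> cokernel_arrow C c \<and> c \<in>
      Hom C S (Dom C m))}"
  have im: "\<exists>m c. m \<in> M \<and> c \<in> Hom C S (Dom C m) \<and> a = m \<cdot> c" if a: "a \<in> Hom C S X" and S:
      "S \<in> finite_free P" for a S
  proof -
    have a': "a \<in> Arr C" "Dom C a = S" "Cod C a = X" using a by (auto simp: Hom_iff)
    obtain m c where "is_monic C m" "cokernel_arrow C c" "Dom C c = Dom C a" "Cod C c = Dom C m"
        "Cod C m = Cod C a"
      "a = m \<cdot> c" using image_factorization[OF a'(1)] .
    then have mc: "is_subobject C X m" "cokernel_arrow C c" "c \<in> Hom C S (Dom C m)" "a = m \<cdot> c"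
      using a' strict_arr[of c] by (simp_all add: is_subobject_def Hom_iff)
    then have "m \<in> M" using S unfolding M_def by blast
    then show ?thesis using mc by blast
  qed
  have "M \<noteq> {}" using im[OF zero_hom[OF null_obj(1) X] finite_free.null] by blast
  then obtain m where m: "m \<in> M" "\<And>m'. m' \<in> M \<Longrightarrow> subobject_le C m m' \<Longrightarrow> subobject_le C m' m"
    using noetherian_maximal[OF noeth X, of M] by (auto simp: M_def)
  obtain S c where S: "S \<in> finite_free P" "cokernel_arrow C c" "c \<in> Hom C S (Dom C m)" using m(1) by
      (auto simp: M_def)
  have m': "is_monic C m" "Cod C m = X" "is_subobject C X m" using m(1) by
      (auto simp: M_def is_subobject_def)
  note mA = monic_arr[OF m'(1)]
  have mH: "m \<in> Hom C (Dom C m) X" using mA m'(2) by (simp add: Hom_iff)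
  have "u \<in> (\<cdot>) m ` Hom C P (Dom C m)" if u: "u \<in> Hom C P X" for u
  proof -
    \<comment> \<open>One more copy of P accommodates u: the image n of the row (m c, u) is again a
      member of M.\<close>
    obtain T i j p q where bp: "is_biproduct S P T i j p q" using
        biproduct_exists[OF finite_free_obj[OF S(1)] PO] .
    note bp' = biproductD[OF bp] and bpH = biproduct_HomD[OF bp]
    have T: "T \<in> finite_free P" by (rule finite_free.plus[OF S(1) bp])
    have mc: "m \<cdot> c \<in> Hom C S X" by (rule comp_hom[OF S(3) mH])
    have tH: "(m \<cdot> c) \<cdot> p \<boxplus> u \<cdot> q \<in> Hom C T X" by
        (rule add_hom[OF comp_hom[OF bpH(3) mc] comp_hom[OF bpH(4) u]])
    have ti: "((m \<cdot> c) \<cdot> p \<boxplus> u \<cdot> q) \<cdot> i = m \<cdot> c" "((m \<cdot> c) \<cdot> p \<boxplus> u \<cdot> q) \<cdot> j = u"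
      using biproduct_copair[OF bp, of "m \<cdot> c" u] mc u by (simp_all add: Hom_iff)
    obtain n d where n: "n \<in> M" "d \<in> Hom C T (Dom C n)" "(m \<cdot> c) \<cdot> p \<boxplus> u \<cdot> q = n \<cdot> d" using
        im[OF tH T] by metis
    have nm: "is_monic C n" "Cod C n = X" using n(1) by (auto simp: M_def is_subobject_def)
    note nA = monic_arr[OF nm(1)]
    have d: "d \<in> Arr C" "Dom C d = T" "Cod C d = Dom C n" using n(2) by (auto simp: Hom_iff)
    have nd: "n \<cdot> (d \<cdot> i) = m \<cdot> c" "n \<cdot> (d \<cdot> j) = u" using ti[unfolded n(3)] d nA bp' by
        (simp_all add: assoc)
    have c': "Dom C c = S" "Cod C c = Dom C m" using S(3) by (auto simp: Hom_iff)
    \<comment> \<open>Only \<open>m \<cdot> c\<close> is known to factor through n; since c is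
      strict, the factorization descends to m.\<close>
    obtain h where h: "h \<in> Arr C" "Dom C h = Cod C c" "Cod C h = Dom C n" "m = n \<cdot> h"
      using strict_lift[OF S(2) nm(1) mA, of "d \<cdot> i"] c' nd(1) d bp' nm(2) m'(2) by auto
    have "subobject_le C m n" unfolding subobject_le_def using h c' by (auto simp: Hom_iff)
    then have "subobject_le C n m" by (rule m(2)[OF n(1)])
    from subobject_leD[OF this mA] show ?thesis using nd(2) comp_hom[OF bpH(2) n(2)] by blast
  qed
  then have sub: "(\<cdot>) (Ident C X) ` Hom C P (Dom C (Ident C X)) \<subseteq> (\<cdot>) m ` Hom C P (Dom C m)"
    using comp_ident_left X by fastforce
  have "is_subobject C X (Ident C X)"
    unfolding is_subobject_def using X by (intro conjI monicI) (auto simp del: comp_null)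
  from subobject_leI[OF P this m'(3) sub] obtain h where h: "h \<in> Hom C X (Dom C m)"
      "m \<cdot> h = Ident C X"
    unfolding subobject_le_def using X by auto
  \<comment> \<open>A section makes m strict, so that \<open>m \<cdot> c\<close> is the required
    cover.\<close>
  then have ms: "cokernel_arrow C m" using strict_split[OF mA, of h] m'(2) by (simp add: Hom_iff)
  have "cokernel_arrow C (m \<cdot> c)" by (rule strict_comp[OF S(2) ms])
      (use S(3) in \<open>simp add: Hom_iff\<close>)
  then show ?thesis using that[OF S(1) _ comp_hom[OF S(3) mH]] by simp
qed

end

section \<open>Evaluation at P as a functor from L to modules: fully faithful and essentially
  surjective\<close>

section \<open>From a generator to an equivalence\<close>

context quasi_abelian_category
begin

definition hom_linear :: "'o \<Rightarrow> 'o \<Rightarrow> ('m, 'x, 'y) module_scheme \<Rightarrow> ('m \<Rightarrow> 'x) \<Rightarrow> bool" where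
  "hom_linear P X M \<phi> \<longleftrightarrow> (\<forall>u \<in> Hom C P X. \<phi> u \<in> carrier M) \<and>
     (\<forall>u \<in> Hom C P X. \<forall>v \<in> Hom C P X. \<phi> (u \<boxplus> v) = \<phi> u \<oplus>\<^bsub>M\<^esub> \<phi> v) \<and>
     (\<forall>u \<in> Hom C P X. \<forall>r \<in> Hom C P P. \<phi> (u \<cdot> r) = r \<odot>\<^bsub>M\<^esub> \<phi> u)"

lemma hom_linearD:
  assumes "hom_linear P X M \<phi>"
  shows "u \<in> Hom C P X \<Longrightarrow> \<phi> u \<in> carrier M"
    "u \<in> Hom C P X \<Longrightarrow> v \<in> Hom C P X \<Longrightarrow> \<phi> (u \<boxplus> v) = \<phi> u \<oplus>\<^bsub>M\<^esub> \<phi> v"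
    "u \<in> Hom C P X \<Longrightarrow> r \<in> Hom C P P \<Longrightarrow> \<phi> (u \<cdot> r) = r \<odot>\<^bsub>M\<^esub> \<phi> u"
  using assms by (simp_all add: hom_linear_def)

lemma hom_linear_zero:
  assumes M: "right_module (End_ring C P) M" and P: "P \<in> Obj C" and X: "X \<in> Obj C" and \<phi>:
      "hom_linear P X M \<phi>"
  shows "\<phi> (HZero C P X) = \<zero>\<^bsub>M\<^esub>"
proof -
  interpret M: right_module "End_ring C P" M by fact
  have z: "HZero C P X \<in> Hom C P X" "HZero C P P \<in> Hom C P P" using zero_hom P X by auto
  have "\<phi> (HZero C P X) = \<phi> (HZero C P X \<cdot> HZero C P P)" using P X by simp
  also have "\<dots> = \<zero>\<^bsub>End_ring C P\<^esub> \<odot>\<^bsub>M\<^esub> \<phi> (HZero C P X)" using hom_linearD(3)[OF \<phi> z] by simp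
  also have "\<dots> = \<zero>\<^bsub>M\<^esub>" by (rule M.zero_smult[OF hom_linearD(1)[OF \<phi> z(1)]])
  finally show ?thesis .
qed

text \<open>A linear map on Hom(P, S) can take prescribed values on the injections. Each element a
  of A costs one more copy of P, whose injection j is sent to a.\<close>

lemma finite_free_onto:
  assumes M: "right_module (End_ring C P) M" and P: "P \<in> Obj C" and A: "finite A" "A \<subseteq> carrier M"
  shows "\<exists>S \<in> finite_free P. \<exists>\<phi>. hom_linear P S M \<phi> \<and> A \<subseteq> \<phi> ` Hom C P S"
  using A
proof (induction A rule: finite_induct)
  case empty
  interpret M: right_module "End_ring C P" M by fact
  have "hom_linear P null_obj M (\<lambda>_. \<zero>\<^bsub>M\<^esub>)" using M.smult_zero by (simp add: hom_linear_def)
  then show ?case using finite_free.null by blast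
next
  case (insert a A)
  interpret M: right_module "End_ring C P" M by fact
  obtain S \<phi> where S: "S \<in> finite_free P" and \<phi>: "hom_linear P S M \<phi>" and A: "A \<subseteq> \<phi> ` Hom C P S"
      using insert by auto
  have a: "a \<in> carrier M" using insert by simp
  note SO = finite_free_obj[OF S]
  obtain T i j p q where bp: "is_biproduct S P T i j p q" using biproduct_exists[OF SO P] .
  note bp' = biproductD[OF bp] and bpH = biproduct_HomD[OF bp]
  define \<psi> where "\<psi> u = \<phi> (p \<cdot> u) \<oplus>\<^bsub>M\<^esub> (q \<cdot> u) \<odot>\<^bsub>M\<^esub> a" for u
  have pq: "p \<cdot> u \<in> Hom C P S" "q \<cdot> u \<in> Hom C P P" if "u \<in> Hom C P T" for u using comp_hom[OF that]
      bpH by auto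
  have c: "\<phi> (p \<cdot> u) \<in> carrier M" "(q \<cdot> u) \<odot>\<^bsub>M\<^esub> a \<in> carrier M" if "u \<in> Hom C P T" for u
    using hom_linearD(1)[OF \<phi> pq(1)[OF that]] M.smult_closed[of "q \<cdot> u" a] pq(2)[OF that] a by
        simp_all
  have "hom_linear P T M \<psi>"
    unfolding hom_linear_def
  proof (intro conjI ballI)
    fix u assume u: "u \<in> Hom C P T"
    show "\<psi> u \<in> carrier M" using c[OF u] by (simp add: \<psi>_def)
    fix v assume v: "v \<in> Hom C P T"
    have "(q \<cdot> u \<boxplus> q \<cdot> v) \<odot>\<^bsub>M\<^esub> a = (q \<cdot> u) \<odot>\<^bsub>M\<^esub> a \<oplus>\<^bsub>M\<^esub> (q \<cdot> v) \<odot>\<^bsub>M\<^esub> a"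
      using M.smult_add_ring[of "q \<cdot> u" "q \<cdot> v" a] pq u v a by simp
    then have "\<psi> (u \<boxplus> v) = (\<phi> (p \<cdot> u) \<oplus>\<^bsub>M\<^esub> \<phi> (p \<cdot> v)) \<oplus>\<^bsub>M\<^esub> ((q \<cdot> u) \<odot>\<^bsub>M\<^esub> a \<oplus>\<^bsub>M\<^esub> (q \<cdot> v) \<odot>\<^bsub>M\<^esub> a)"
      unfolding \<psi>_def comp_add_right[OF u v bpH(3)] comp_add_right[OF u v bpH(4)]
      using hom_linearD(2)[OF \<phi> pq(1)[OF u] pq(1)[OF v]] by simp
    then show "\<psi> (u \<boxplus> v) = \<psi> u \<oplus>\<^bsub>M\<^esub> \<psi> v" unfolding \<psi>_def using c[OF u] c[OF v] by (simp add: M.a_ac)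
  next
    fix u r assume u: "u \<in> Hom C P T" and r: "r \<in> Hom C P P"
    have "((q \<cdot> u) \<cdot> r) \<odot>\<^bsub>M\<^esub> a = r \<odot>\<^bsub>M\<^esub> ((q \<cdot> u) \<odot>\<^bsub>M\<^esub> a)"
      using M.smult_assoc[of "q \<cdot> u" r a] pq(2)[OF u] r a by simp
    moreover have "\<phi> ((p \<cdot> u) \<cdot> r) = r \<odot>\<^bsub>M\<^esub> \<phi> (p \<cdot> u)" by (rule hom_linearD(3)[OF \<phi> pq(1)[OF u] r])
    ultimately show "\<psi> (u \<cdot> r) = r \<odot>\<^bsub>M\<^esub> \<psi> u"
      unfolding \<psi>_def using comp_assoc[OF r u bpH(3)] comp_assoc[OF r u bpH(4)]
        M.smult_add_module[of r "\<phi> (p \<cdot> u)" "(q \<cdot> u) \<odot>\<^bsub>M\<^esub> a"] c[OF u] r by simp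
  qed
  moreover have "a \<in> \<psi> ` Hom C P T"
  proof (rule image_eqI[OF _ bpH(2)])
    show "a = \<psi> j" unfolding \<psi>_def bp'(17,18) hom_linear_zero[OF M P SO \<phi>]
      using M.smult_one[OF a] a by simp
  qed
  moreover have "A \<subseteq> \<psi> ` Hom C P T"
  proof
    fix x assume "x \<in> A"
    then obtain u where u: "u \<in> Hom C P S" "x = \<phi> u" using A by blast
    have iu: "i \<cdot> u \<in> Hom C P T" by (rule comp_hom[OF u(1) bpH(1)])
    have "p \<cdot> (i \<cdot> u) = u" "q \<cdot> (i \<cdot> u) = HZero C P P"
      using u bp' assoc_reduce[of p i _ u] assoc_reduce[of q i _ u] by (auto simp: Hom_iff)
    then have "\<psi> (i \<cdot> u) = x" using M.zero_smult[OF a] hom_linearD(1)[OF \<phi> u(1)] u(2) by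
        (simp add: \<psi>_def)
    then show "x \<in> \<psi> ` Hom C P T" using iu by blast
  qed
  ultimately show ?case using finite_free.plus[OF S bp] by blast
qed

text \<open>As P is projective, c induces a surjection from Hom(P, S) onto Hom(P, X).\<close>

lemma finitely_generated_hom:
  assumes P: "is_projective C P" and S: "S \<in> finite_free P" and c: "cokernel_arrow C c"
      "c \<in> Hom C S X"
  shows "finitely_generated_module (End_ring C P) (hom_module P X)"
proof -
  note PO = projective_obj[OF P]
  have X: "X \<in> Obj C" using Hom_objD[OF c(2)] by simp
  interpret M: right_module "End_ring C P" "hom_module P X" by (rule right_module_hom[OF PO X])
  interpret MS: right_module "End_ring C P" "hom_module P S" by
      (rule right_module_hom[OF PO finite_free_obj[OF S]])
  have "finitely_generated_module (End_ring C P) (hom_module P S)"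
    unfolding MS.finitely_generated_iff is_submodule_hom_iff using finite_free_generated[OF PO S] by
        simp
  moreover have "restrict ((\<cdot>) c) (Hom C P S) \<in> module_homs (End_ring C P) (hom_module P S)
      (hom_module P X)"
    using comp_hom[OF _ c(2)] comp_add_right[OF _ _ c(2)] comp_assoc[OF _ _ c(2)] add_hom comp_hom
    by (auto simp: module_homs_def)
  moreover have "restrict ((\<cdot>) c) (Hom C P S) ` carrier (hom_module P S) = carrier (hom_module P X)"
  proof
    show "carrier (hom_module P X) \<subseteq> restrict ((\<cdot>) c) (Hom C P S) ` carrier (hom_module P S)"
    proof
      fix u assume "u \<in> carrier (hom_module P X)"
      then obtain v where "v \<in> Hom C P S" "c \<cdot> v = u" using projectiveD[OF P c(1), of u] c(2) by
          (auto simp: Hom_iff)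
      then show "u \<in> restrict ((\<cdot>) c) (Hom C P S) ` carrier (hom_module P S)" by
          (auto intro!: image_eqI[of _ _ v])
    qed
  qed (use comp_hom[OF _ c(2)] in auto)
  ultimately show ?thesis by (intro finitely_generated_image[OF _ MS.right_module_axioms
      M.right_module_axioms])
qed

end

text \<open>The equivalence sends \<open>f\<close> to \<open>N f = Hom(P, Cod f) / f \<cdot> Hom(P, Dom f)\<close>; \<open>\<pi>\<close> is the
    projection.\<close>

locale module_realization = quasi_abelian_category C
  for C :: "('o, 'm, 'z) precat_scheme" (structure) +
  fixes P :: 'o and N :: "'m \<Rightarrow> 'm list_module" and \<pi> :: "'m \<Rightarrow> 'm \<Rightarrow> 'm list"
  assumes gen: "strong_projective_generator C P"
    and noeth: "noetherian_subobjects C"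
    and N_obj: "is_monic C f \<Longrightarrow> N f \<in> Obj (mod_cat (End_ring C P))"
    and pi_surj: "is_monic C f \<Longrightarrow> \<pi> f ` Hom C P (Cod C f) = carrier (N f)"
    and pi_linear: "is_monic C f \<Longrightarrow> hom_linear P (Cod C f) (N f) (\<pi> f)"
    and pi_eq: "\<lbrakk>is_monic C f; y \<in> Hom C P (Cod C f); y' \<in> Hom C P (Cod C f)\<rbrakk> \<Longrightarrow> \<pi> f y = \<pi> f y' \<longleftrightarrow> eqm
        f y y'"
begin

abbreviation R where "R \<equiv> End_ring C P"

lemma P_projective: "is_projective C P"
  using gen by (simp add: strong_projective_generator_def)

lemma P_obj: "P \<in> Obj C"
  by (rule projective_obj[OF P_projective])

lemma N_module: "is_monic C f \<Longrightarrow> right_module R (N f)" "is_monic C f \<Longrightarrow> finitely_generated_module R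
    (N f)"
  using N_obj by (auto simp: mod_cat_def)

lemma hom_ext:
  assumes f: "is_monic C f" and \<psi>: "\<psi> \<in> module_homs R (N f) M" "\<psi>' \<in> module_homs R (N f) M"
    and eq: "\<And>y. y \<in> Hom C P (Cod C f) \<Longrightarrow> \<psi> (\<pi> f y) = \<psi>' (\<pi> f y)"
  shows "\<psi> = \<psi>'"
proof
  fix x show "\<psi> x = \<psi>' x"
  proof (cases "x \<in> carrier (N f)")
    case True
    then show ?thesis using pi_surj[OF f] eq by (metis imageE)
  next
    case False
    then show ?thesis using \<psi> by (auto simp: module_homs_def PiE_iff extensional_def)
  qed
qed

text \<open>The universal property of the quotient \<open>N f\<close>. In the proof s chooses
  preimages under \<open>\<pi> f\<close>.\<close>

lemma hom_factor:
  assumes f: "is_monic C f" and \<phi>: "hom_linear P (Cod C f) M \<phi>"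
    and eq: "\<And>y y'. y \<in> Hom C P (Cod C f) \<Longrightarrow> y' \<in> Hom C P (Cod C f) \<Longrightarrow> eqm f y y' \<Longrightarrow> \<phi> y = \<phi> y'"
  obtains \<psi> where "\<psi> \<in> module_homs R (N f) M" "\<And>y. y \<in> Hom C P (Cod C f) \<Longrightarrow> \<psi> (\<pi> f y) = \<phi> y"
proof -
  interpret N: right_module R "N f" by (rule N_module[OF f])
  define s where "s x = (SOME y. y \<in> Hom C P (Cod C f) \<and> \<pi> f y = x)" for x
  have s: "s x \<in> Hom C P (Cod C f)" "\<pi> f (s x) = x" if "x \<in> carrier (N f)" for x
  proof -
    have "\<exists>y. y \<in> Hom C P (Cod C f) \<and> \<pi> f y = x" using pi_surj[OF f] that by (metis imageE)
    from someI_ex[OF this] show "s x \<in> Hom C P (Cod C f)" "\<pi> f (s x) = x" by (auto simp: s_def)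
  qed
  define \<psi> where "\<psi> = (\<lambda>x \<in> carrier (N f). \<phi> (s x))"
  have pi: "\<pi> f y \<in> carrier (N f)" if "y \<in> Hom C P (Cod C f)" for y using
      hom_linearD(1)[OF pi_linear[OF f] that] .
  have \<psi>pi: "\<psi> (\<pi> f y) = \<phi> y" if y: "y \<in> Hom C P (Cod C f)" for y
    using eq[OF s(1)[OF pi[OF y]] y] pi_eq[OF f s(1)[OF pi[OF y]] y] s(2)[OF pi[OF y]] pi[OF y] by
        (simp add: \<psi>_def)
  have "\<psi> \<in> module_homs R (N f) M"
    unfolding module_homs_def
  proof (intro CollectI conjI ballI)
    show "\<psi> \<in> carrier (N f) \<rightarrow>\<^sub>E carrier M" using hom_linearD(1)[OF \<phi>] s(1) by (auto simp: \<psi>_def)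
    fix x y assume xy: "x \<in> carrier (N f)" "y \<in> carrier (N f)"
    have "\<pi> f (s x \<boxplus> s y) = x \<oplus>\<^bsub>N f\<^esub> y" using
        hom_linearD(2)[OF pi_linear[OF f] s(1)[OF xy(1)] s(1)[OF xy(2)]] s(2) xy by simp
    then have "\<psi> (x \<oplus>\<^bsub>N f\<^esub> y) = \<phi> (s x \<boxplus> s y)" using
        \<psi>pi[OF add_hom[OF s(1)[OF xy(1)] s(1)[OF xy(2)]]] by simp
    then show "\<psi> (x \<oplus>\<^bsub>N f\<^esub> y) = \<psi> x \<oplus>\<^bsub>M\<^esub> \<psi> y" using
        hom_linearD(2)[OF \<phi> s(1)[OF xy(1)] s(1)[OF xy(2)]] xy by (simp add: \<psi>_def)
  next
    fix r x assume rx: "r \<in> carrier R" "x \<in> carrier (N f)"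
    then have r: "r \<in> Hom C P P" by simp
    have "\<pi> f (s x \<cdot> r) = r \<odot>\<^bsub>N f\<^esub> x" using hom_linearD(3)[OF pi_linear[OF f] s(1)[OF rx(2)] r] s(2)
        rx by simp
    then have "\<psi> (r \<odot>\<^bsub>N f\<^esub> x) = \<phi> (s x \<cdot> r)" using \<psi>pi[OF comp_hom[OF r s(1)[OF rx(2)]]] by simp
    then show "\<psi> (r \<odot>\<^bsub>N f\<^esub> x) = r \<odot>\<^bsub>M\<^esub> \<psi> x" using hom_linearD(3)[OF \<phi> s(1)[OF rx(2)] r] rx by
        (simp add: \<psi>_def)
  qed
  then show ?thesis using that \<psi>pi by blast
qed

text \<open>Quantified over all zigzags that represent F, so that a computation may use whichever
  representative is at hand.\<close>

definition acts :: "('m, 'm K_arr) loc_arr \<Rightarrow> 'm \<Rightarrow> 'm \<Rightarrow> ('m list \<Rightarrow> 'm list) \<Rightarrow> bool" where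
  "acts F f g \<psi> \<longleftrightarrow> \<psi> \<in> module_homs R (N f) (N g) \<and>
     (\<forall>w y z. zigzag KC KR f w g \<longrightarrow> F = zz_class f w g \<longrightarrow> y \<in> Hom C P (Cod C f) \<longrightarrow> zz_rel f w y z \<longrightarrow>
        \<psi> (\<pi> f y) = \<pi> g z)"

lemma zz_rel_hom:
  "zigzag KC KR f w g \<Longrightarrow> zz_rel f w y z \<Longrightarrow> y \<in> Hom C P (Cod C f) \<Longrightarrow> z \<in> Hom C P (Cod C g)"
  using zz_rel_arr[of f w g y z] by (simp add: Hom_iff)

text \<open>One zigzag w and one choice s of its values define the map. The function s is additive
  only modulo g, which becomes exact after \<open>\<pi> g\<close>. For the other zigzags in the
  class \<open>zz_rel_agree\<close> gives the same values.\<close>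

lemma acts_exists:
  assumes F: "F \<in> Hom LQ f g"
  shows "\<exists>\<psi>. acts F f g \<psi>"
proof -
  obtain w where w: "zigzag KC KR f w g" "F = zz_class f w g" using F by (rule LQ_HomE)
  have fg: "is_monic C f" "is_monic C g" using zigzag_monic[OF w(1)] by auto
  define s where "s y = (SOME z. z \<in> Hom C P (Cod C g) \<and> zz_rel f w y z)" for y
  have s: "s y \<in> Hom C P (Cod C g)" "zz_rel f w y (s y)" if "y \<in> Hom C P (Cod C f)" for y
  proof -
    have "\<exists>z. z \<in> Hom C P (Cod C g) \<and> zz_rel f w y z" using zz_rel_total[OF P_projective w(1) that]
        by metis
    from someI_ex[OF this] show "s y \<in> Hom C P (Cod C g)" "zz_rel f w y (s y)" by (auto simp: s_def)
  qed
  have single: "\<pi> g z = \<pi> g z'" if "zz_rel f w y z" "zz_rel f w y z'" "y \<in> Hom C P (Cod C f)" for y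
      z z'
    using pi_eq[OF fg(2) zz_rel_hom[OF w(1) that(1,3)] zz_rel_hom[OF w(1) that(2,3)]]
        zz_rel_fun[OF w(1) that(1,2)] by simp
  have lin: "hom_linear P (Cod C f) (N g) (\<lambda>y. \<pi> g (s y))"
    unfolding hom_linear_def
  proof (intro conjI ballI)
    fix y assume y: "y \<in> Hom C P (Cod C f)"
    show "\<pi> g (s y) \<in> carrier (N g)" by (rule hom_linearD(1)[OF pi_linear[OF fg(2)] s(1)[OF y]])
    fix y' assume y': "y' \<in> Hom C P (Cod C f)"
    have "zz_rel f w (y \<boxplus> y') (s y \<boxplus> s y')"
      by (rule zz_rel_add[OF w(1) s(2)[OF y] s(2)[OF y']]) (use y y' in \<open>simp add: Hom_iff\<close>)
    from single[OF s(2)[OF add_hom[OF y y']] this add_hom[OF y y']]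
    show "\<pi> g (s (y \<boxplus> y')) = \<pi> g (s y) \<oplus>\<^bsub>N g\<^esub> \<pi> g (s y')"
      using hom_linearD(2)[OF pi_linear[OF fg(2)] s(1)[OF y] s(1)[OF y']] by simp
  next
    fix y r assume y: "y \<in> Hom C P (Cod C f)" and r: "r \<in> Hom C P P"
    have "zz_rel f w (y \<cdot> r) (s y \<cdot> r)"
      by (rule zz_rel_comp[OF w(1) s(2)[OF y]]) (use y r in \<open>simp_all add: Hom_iff\<close>)
    from single[OF s(2)[OF comp_hom[OF r y]] this comp_hom[OF r y]]
    show "\<pi> g (s (y \<cdot> r)) = r \<odot>\<^bsub>N g\<^esub> \<pi> g (s y)"
      using hom_linearD(3)[OF pi_linear[OF fg(2)] s(1)[OF y] r] by simp
  qed
  have cong: "\<pi> g (s y) = \<pi> g (s y')" if y: "y \<in> Hom C P (Cod C f)" "y' \<in> Hom C P (Cod C f)"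
      "eqm f y y'" for y y'
  proof -
    have "eqm g (s y) (s y)" using eqm_refl[of g "s y"] fg(2) s(1)[OF y(1)] by (simp add: Hom_iff)
    from zz_rel_cong[OF w(1) s(2)[OF y(1)] y(3) this] show ?thesis using
        single[OF _ s(2)[OF y(2)] y(2)] by simp
  qed
  obtain \<psi> where \<psi>: "\<psi> \<in> module_homs R (N f) (N g)" "\<And>y. y \<in> Hom C P (Cod C f) \<Longrightarrow> \<psi> (\<pi> f y) = \<pi> g
      (s y)"
    using hom_factor[OF fg(1) lin cong] by blast
  have "acts F f g \<psi>"
    unfolding acts_def
  proof (intro conjI allI impI)
    show "\<psi> \<in> module_homs R (N f) (N g)" by fact
    fix v y z assume v: "zigzag KC KR f v g" "F = zz_class f v g" and y: "y \<in> Hom C P (Cod C f)" and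
        z: "zz_rel f v y z"
    have "zigzag_eq KC KR f g w v" using zz_class_eq_iff[OF w(1) v(1)] w(2) v(2) by simp
    from zz_rel_agree[OF this s(2)[OF y] z] show "\<psi> (\<pi> f y) = \<pi> g z"
      using pi_eq[OF fg(2) s(1)[OF y] zz_rel_hom[OF v(1) z y]] \<psi>(2)[OF y] by simp
  qed
  then show ?thesis by blast
qed

text \<open>A choice among the maps that satisfy \<open>acts\<close>; \<open>acts_witness\<close>
  shows that the choice is determined.\<close>

definition Fa :: "('m, 'm K_arr) loc_arr \<Rightarrow> 'm list_module \<times> ('m list \<Rightarrow> 'm list) \<times> 'm list_module"
    where
  "Fa F = (N (Dom LQ F), SOME \<psi>. acts F (Dom LQ F) (Cod LQ F) \<psi>, N (Cod LQ F))"

lemma Fa_acts: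
  assumes "F \<in> Hom LQ f g"
  obtains \<psi> where "Fa F = (N f, \<psi>, N g)" "acts F f g \<psi>"
  using someI_ex[OF acts_exists[OF assms]] that HomD(2,3)[OF assms] by (simp add: Fa_def)

lemma acts_zz:
  assumes "acts F f g \<psi>" "zigzag KC KR f w g" "F = zz_class f w g" "y \<in> Hom C P (Cod C f)"
      "zz_rel f w y z"
  shows "\<psi> (\<pi> f y) = \<pi> g z"
  using assms unfolding acts_def by blast

lemma LQ_monic: "F \<in> Hom LQ f g \<Longrightarrow> is_monic C f \<and> is_monic C g"
  by (elim LQ_HomE) (rule zigzag_monic)

text \<open>A module map out of \<open>N f\<close> is determined on the classes
  \<open>\<pi> f y\<close>, and \<open>zz_rel\<close> is single-valued modulo g. Hence one zigzag
  and one value for each y identify the image of its class.\<close>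

lemma acts_witness:
  assumes w: "zigzag KC KR f w g" and \<psi>: "\<psi> \<in> module_homs R (N f) (N g)"
    and act: "\<And>y. y \<in> Hom C P (Cod C f) \<Longrightarrow> \<exists>z. zz_rel f w y z \<and> \<psi> (\<pi> f y) = \<pi> g z"
  shows "Fa (zz_class f w g) = (N f, \<psi>, N g)"
proof -
  note F = zz_class_hom[OF w]
  obtain \<psi>' where \<psi>': "Fa (zz_class f w g) = (N f, \<psi>', N g)" "acts (zz_class f w g) f g \<psi>'" using
      Fa_acts[OF F] .
  have "\<psi>' = \<psi>"
  proof (rule hom_ext)
    show "is_monic C f" using zigzag_monic[OF w] by simp
    show "\<psi>' \<in> module_homs R (N f) (N g)" using \<psi>'(2) by (simp add: acts_def)
    fix y assume y: "y \<in> Hom C P (Cod C f)"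
    then obtain z where "zz_rel f w y z" "\<psi> (\<pi> f y) = \<pi> g z" using act by blast
    then show "\<psi>' (\<pi> f y) = \<psi> (\<pi> f y)" using acts_zz[OF \<psi>'(2) w HOL.refl y] by simp
  qed (rule \<psi>)
  then show ?thesis using \<psi>'(1) by simp
qed

lemma Fa_functor: "is_functor LQ (mod_cat R) N Fa"
  unfolding is_functor_def
proof (intro conjI ballI impI)
  fix f assume "f \<in> Obj LQ"
  then have f: "is_monic C f" by simp
  show "N f \<in> Obj (mod_cat R)" by (rule N_obj[OF f])
  interpret N: right_module R "N f" by (rule N_module[OF f])
  have "Fa (zz_class f [] f) = (N f, (\<lambda>x \<in> carrier (N f). x), N f)"
  proof (rule acts_witness)
    show "zigzag KC KR f [] f" using f by simp
    show "(\<lambda>x \<in> carrier (N f). x) \<in> module_homs R (N f) (N f)" by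
        (auto simp: module_homs_def N.smult_closed)
    fix y assume y: "y \<in> Hom C P (Cod C f)"
    have "zz_rel f [] y y" using y f eqm_refl by (simp add: Hom_iff)
    then show "\<exists>z. zz_rel f [] y z \<and> (\<lambda>x \<in> carrier (N f). x) (\<pi> f y) = \<pi> f z"
      using hom_linearD(1)[OF pi_linear[OF f] y] by (intro exI[of _ y]) simp
  qed
  then show "Fa (Ident LQ f) = Ident (mod_cat R) (N f)" by (simp add: LQ_ident mod_cat_def)
next
  fix F assume "F \<in> Arr LQ"
  then have F: "F \<in> Hom LQ (Dom LQ F) (Cod LQ F)" by (simp add: Hom_def)
  obtain \<psi> where \<psi>: "Fa F = (N (Dom LQ F), \<psi>, N (Cod LQ F))" "acts F (Dom LQ F) (Cod LQ F) \<psi>" using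
      Fa_acts[OF F] .
  show "Fa F \<in> Hom (mod_cat R) (N (Dom LQ F)) (N (Cod LQ F))"
    unfolding \<psi>(1) by (rule mod_HomI) (use \<psi>(2) N_module LQ_monic[OF F] in \<open>auto simp: acts_def\<close>)
next
  fix F G assume "F \<in> Arr LQ" "G \<in> Arr LQ" "Dom LQ G = Cod LQ F"
  then obtain f g h where F: "F \<in> Hom LQ f g" and G: "G \<in> Hom LQ g h" by (auto simp: Hom_def)
  obtain v where v: "zigzag KC KR f v g" "F = zz_class f v g" using F by (rule LQ_HomE)
  obtain w where w: "zigzag KC KR g w h" "G = zz_class g w h" using G by (rule LQ_HomE)
  obtain \<psi> where \<psi>: "Fa F = (N f, \<psi>, N g)" "acts F f g \<psi>" using Fa_acts[OF F] .
  obtain \<chi> where \<chi>: "Fa G = (N g, \<chi>, N h)" "acts G g h \<chi>" using Fa_acts[OF G] .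
  have f: "is_monic C f" using LQ_monic[OF F] by simp
  have "Fa (zz_class f (v @ w) h) = (N f, compose (carrier (N f)) \<chi> \<psi>, N h)"
  proof (rule acts_witness[OF zigzag_append[OF v(1) w(1)]])
    show "compose (carrier (N f)) \<chi> \<psi> \<in> module_homs R (N f) (N h)"
      by (rule module_homs_compose[OF _ _ N_module(1)[OF f]])
          (use \<psi>(2) \<chi>(2) in \<open>auto simp: acts_def\<close>)
    fix y assume y: "y \<in> Hom C P (Cod C f)"
    obtain x where x: "x \<in> Hom C P (Cod C g)" "zz_rel f v y x" using
        zz_rel_total[OF P_projective v(1) y] .
    obtain z where z: "z \<in> Hom C P (Cod C h)" "zz_rel g w x z" using
        zz_rel_total[OF P_projective w(1) x(1)] .
    have "compose (carrier (N f)) \<chi> \<psi> (\<pi> f y) = \<pi> h z"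
      using acts_zz[OF \<psi>(2) v y x(2)] acts_zz[OF \<chi>(2) w x(1) z(2)]
          hom_linearD(1)[OF pi_linear[OF f] y]
      by (simp add: compose_def)
    then show "\<exists>z. zz_rel f (v @ w) y z \<and> compose (carrier (N f)) \<chi> \<psi> (\<pi> f y) = \<pi> h z"
      using zz_rel_append[OF v(1) w(1)] x(2) z(2) by blast
  qed
  then show "Fa (G \<cdot>\<^bsub>LQ\<^esub> F) = Fa G \<cdot>\<^bsub>mod_cat R\<^esub> Fa F"
    by (simp add: v(2) w(2) zz_class_comp[OF v(1) w(1)] \<psi>(1)[unfolded v(2)] \<chi>(1)[unfolded w(2)]
        mod_comp)
qed

text \<open>Over a common cover e the two zigzags have values y and z. Equal actions make y and z
  agree on all arrows from P, hence modulo g by \<open>generator_reflect\<close>, and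
  \<open>zigzag_eqI\<close> applies.\<close>

lemma Fa_faithful:
  assumes F: "F \<in> Hom LQ f g" and G: "G \<in> Hom LQ f g" and eq: "Fa F = Fa G"
  shows "F = G"
proof -
  obtain v where v: "zigzag KC KR f v g" "F = zz_class f v g" using F by (rule LQ_HomE)
  obtain w where w: "zigzag KC KR f w g" "G = zz_class f w g" using G by (rule LQ_HomE)
  have fg: "is_monic C f" "is_monic C g" using LQ_monic[OF F] by auto
  obtain \<psi> where \<psi>: "Fa F = (N f, \<psi>, N g)" "acts F f g \<psi>" using Fa_acts[OF F] .
  obtain \<psi>' where \<psi>': "Fa G = (N f, \<psi>', N g)" "acts G f g \<psi>'" using Fa_acts[OF G] .
  have a: "acts G f g \<psi>" using \<psi> \<psi>' eq by simp
  obtain e y z where e: "cokernel_arrow C e" "Cod C e = Cod C f" "zz_rel f v e y" "zz_rel f w e z"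
    using zz_rel_dense2[OF v(1) w(1)] .
  note eA = strict_arr[OF e(1)] and yz = zz_rel_arr[OF v(1) e(3)] zz_rel_arr[OF w(1) e(4)]
  have "eqm g y z"
  proof (rule generator_reflect[OF gen fg(2)])
    show "y \<in> Hom C (Dom C e) (Cod C g)" "z \<in> Hom C (Dom C e) (Cod C g)" using yz by
        (simp_all add: Hom_iff)
    fix u assume "u \<in> Hom C P (Dom C e)"
    then have u: "u \<in> Arr C" "Dom C u = P" "Cod C u = Dom C e" by (auto simp: Hom_iff)
    have eu: "e \<cdot> u \<in> Hom C P (Cod C f)" using u eA e(2) by (simp add: Hom_iff)
    note 1 = zz_rel_comp[OF v(1) e(3) u(1,3)] and 2 = zz_rel_comp[OF w(1) e(4) u(1,3)]
    have "\<pi> g (y \<cdot> u) = \<pi> g (z \<cdot> u)" using acts_zz[OF \<psi>(2) v eu 1] acts_zz[OF a w eu 2] by simp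
    then show "eqm g (y \<cdot> u) (z \<cdot> u)" using pi_eq[OF fg(2) zz_rel_hom[OF v(1) 1 eu]
        zz_rel_hom[OF w(1) 2 eu]] by simp
  qed
  then show ?thesis using zigzag_eqI[OF v(1) w(1) e] zz_class_eq_iff[OF v(1) w(1)] v(2) w(2) by simp
qed

text \<open>The map \<phi> is realised by a roof. Over a finite free cover c of Cod f it is given by
  an arrow \<beta>, since Hom(P, S) is free. The pullback h of f along c is the source on which
  \<beta> becomes a chain map, and the backward leg from h to f is regular.\<close>

lemma Fa_full:
  assumes f: "is_monic C f" and g: "is_monic C g" and \<phi>: "\<phi> \<in> module_homs R (N f) (N g)"
  shows "\<exists>F \<in> Hom LQ f g. Fa F = (N f, \<phi>, N g)"
proof -
  note fA = monic_arr[OF f] and gA = monic_arr[OF g]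
  obtain S c where S: "S \<in> finite_free P" and c: "cokernel_arrow C c" "c \<in> Hom C S (Cod C f)"
    using finite_free_cover[OF gen noeth cod_obj[OF fA]] .
  have c': "c \<in> Arr C" "Dom C c = S" "Cod C c = Cod C f" using c(2) by (auto simp: Hom_iff)
  have cu: "c \<cdot> u \<in> Hom C P (Cod C f)" if "u \<in> Hom C P S" for u using comp_hom[OF that c(2)] .
  \<comment> \<open>Lifts to Hom(P, Cod g), additive only modulo g; this is all that
    \<open>finite_free_lift\<close> asks.\<close>
  define s where "s u = (SOME z. z \<in> Hom C P (Cod C g) \<and> \<pi> g z = \<phi> (\<pi> f (c \<cdot> u)))" for u
  have s: "s u \<in> Hom C P (Cod C g)" "\<pi> g (s u) = \<phi> (\<pi> f (c \<cdot> u))" if u: "u \<in> Hom C P S" for u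
  proof -
    have "\<phi> (\<pi> f (c \<cdot> u)) \<in> carrier (N g)" using module_homsD(1)[OF \<phi>]
        hom_linearD(1)[OF pi_linear[OF f] cu[OF u]] by simp
    then have "\<exists>z. z \<in> Hom C P (Cod C g) \<and> \<pi> g z = \<phi> (\<pi> f (c \<cdot> u))" using pi_surj[OF g] by
        (metis imageE)
    from someI_ex[OF this] show "s u \<in> Hom C P (Cod C g)" "\<pi> g (s u) = \<phi> (\<pi> f (c \<cdot> u))" by
        (auto simp: s_def)
  qed
  have pif: "\<pi> f y \<in> carrier (N f)" if "y \<in> Hom C P (Cod C f)" for y by
      (rule hom_linearD(1)[OF pi_linear[OF f] that])
  have "\<exists>\<beta> \<in> Hom C S (Cod C g). \<forall>u \<in> Hom C P S. eqm g (s u) (\<beta> \<cdot> u)"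
  proof (rule finite_free_lift[OF P_obj S g s(1)])
    fix u v assume u: "u \<in> Hom C P S" and v: "v \<in> Hom C P S"
    have "\<pi> g (s (u \<boxplus> v)) = \<pi> g (s u \<boxplus> s v)"
      unfolding s(2)[OF add_hom[OF u v]] comp_add_right[OF u v c(2)]
          hom_linearD(2)[OF pi_linear[OF f] cu[OF u] cu[OF v]]
        hom_linearD(2)[OF pi_linear[OF g] s(1)[OF u] s(1)[OF v]] s(2)[OF u] s(2)[OF v]
      by (rule module_homsD(2)[OF \<phi> pif[OF cu[OF u]] pif[OF cu[OF v]]])
    then show "eqm g (s (u \<boxplus> v)) (s u \<boxplus> s v)" using
        pi_eq[OF g s(1)[OF add_hom[OF u v]] add_hom[OF s(1)[OF u] s(1)[OF v]]] by simp
  next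
    fix u r assume u: "u \<in> Hom C P S" and r: "r \<in> Hom C P P"
    have rR: "r \<in> carrier R" using r by simp
    have "\<pi> g (s (u \<cdot> r)) = \<pi> g (s u \<cdot> r)"
      unfolding s(2)[OF comp_hom[OF r u]] comp_assoc[OF r u c(2), symmetric]
          hom_linearD(3)[OF pi_linear[OF f] cu[OF u] r]
        hom_linearD(3)[OF pi_linear[OF g] s(1)[OF u] r] s(2)[OF u]
      by (rule module_homsD(3)[OF \<phi> rR pif[OF cu[OF u]]])
    then show "eqm g (s (u \<cdot> r)) (s u \<cdot> r)" using pi_eq[OF g s(1)[OF comp_hom[OF r u]]
        comp_hom[OF r s(1)[OF u]]] by simp
  qed
  then obtain \<beta> where \<beta>: "\<beta> \<in> Hom C S (Cod C g)" "\<And>u. u \<in> Hom C P S \<Longrightarrow> eqm g (s u) (\<beta> \<cdot> u)" by blast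
  have \<beta>': "\<beta> \<in> Arr C" "Dom C \<beta> = S" "Cod C \<beta> = Cod C g" using \<beta>(1) by (auto simp: Hom_iff)
  have \<beta>\<phi>: "\<pi> g (\<beta> \<cdot> u) = \<phi> (\<pi> f (c \<cdot> u))" if u: "u \<in> Hom C P S" for u
    using pi_eq[OF g s(1)[OF u] comp_hom[OF u \<beta>(1)]] \<beta>(2)[OF u] s(2)[OF u] by simp
  obtain p h where pb: "is_pullback C f c p h" using pullback_exists[OF fA c'(1)] c'(3) by metis
  note k = pullback_kmap[OF f pb] and reg = pullback_regular[OF f c(1) pb]
  have h: "is_monic C h" by (rule pullback_monic[OF f pb])
  note hA = monic_arr[OF h]
  note pb' = pb[unfolded is_pullback_def]
  have ph: "p \<in> Arr C" "Dom C p = Dom C h" "Cod C p = Dom C f" "Cod C h = S" "f \<cdot> p = c \<cdot> h" using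
      pb' c' by auto
  have SO: "S \<in> Obj C" using finite_free_obj[OF S] .
  \<comment> \<open>\<beta> carries h into g: for an arrow u from P,
    \<open>c \<cdot> (h \<cdot> u)\<close> is zero modulo f, so \<phi> sends its class to
    zero.\<close>
  have "eqm g (\<beta> \<cdot> h) (HZero C (Dom C h) (Cod C g))"
  proof (rule generator_reflect[OF gen g])
    show "\<beta> \<cdot> h \<in> Hom C (Dom C h) (Cod C g)" "HZero C (Dom C h) (Cod C g) \<in> Hom C (Dom C h)
        (Cod C g)"
      using \<beta>' hA gA ph zero_hom[of "Dom C h" "Cod C g"] by (simp_all add: Hom_iff)
    fix u assume "u \<in> Hom C P (Dom C h)"
    then have u: "u \<in> Arr C" "Dom C u = P" "Cod C u = Dom C h" by (auto simp: Hom_iff)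
    have hu: "h \<cdot> u \<in> Hom C P S" "HZero C P S \<in> Hom C P S" using u hA ph zero_hom[OF P_obj SO] by
        (simp_all add: Hom_iff)
    have "c \<cdot> (h \<cdot> u) = f \<cdot> (p \<cdot> u)" using ph u hA fA c' assoc[of u h c] assoc[of u p f] by simp
    then have "eqm f (c \<cdot> (h \<cdot> u)) (HZero C P (Cod C f))" using eqm_zeroI[of f "p \<cdot> u"] ph u fA by
        simp
    also have "HZero C P (Cod C f) = c \<cdot> HZero C P S" using c' P_obj by simp
    finally have "\<pi> f (c \<cdot> (h \<cdot> u)) = \<pi> f (c \<cdot> HZero C P S)" using
        pi_eq[OF f cu[OF hu(1)] cu[OF hu(2)]] by simp
    then have "\<pi> g (\<beta> \<cdot> (h \<cdot> u)) = \<pi> g (\<beta> \<cdot> HZero C P S)" using \<beta>\<phi> hu by simp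
    then have "eqm g (\<beta> \<cdot> (h \<cdot> u)) (\<beta> \<cdot> HZero C P S)"
      using pi_eq[OF g comp_hom[OF hu(1) \<beta>(1)] comp_hom[OF hu(2) \<beta>(1)]] by simp
    then show "eqm g ((\<beta> \<cdot> h) \<cdot> u) (HZero C (Dom C h) (Cod C g) \<cdot> u)"
      using \<beta>' hA u ph gA P_obj by (simp add: assoc)
  qed
  then have kb: "kmap h \<beta> g" using kmap_iff[OF h g, of \<beta>] \<beta>' ph by simp
  let ?v = "[Bwd (karr h c f)]" and ?w = "[Fwd (karr h \<beta> g)]"
  have v: "zigzag KC KR f ?v h" using karr_hom[OF k] reg h by (auto simp: Hom_def)
  note w = zigzag_fwd[OF kb]
  have "Fa (zz_class f (?v @ ?w) g) = (N f, \<phi>, N g)"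
  proof (rule acts_witness[OF zigzag_append[OF v w] \<phi>])
    fix y assume y: "y \<in> Hom C P (Cod C f)"
    then obtain u where u: "u \<in> Hom C P S" "c \<cdot> u = y" using projectiveD[OF P_projective c(1), of y]
        c' by auto
    have "zz_rel f ?v y u" unfolding zz_rel_bwd[OF k] using u y fA ph eqm_refl by
        (auto simp: Hom_iff)
    moreover have "zz_rel h ?w u (\<beta> \<cdot> u)" unfolding zz_rel_fwd[OF kb] using u \<beta>' gA ph eqm_refl by
        (simp add: Hom_iff)
    ultimately have "zz_rel f (?v @ ?w) y (\<beta> \<cdot> u)" using zz_rel_append[OF v w] by blast
    then show "\<exists>z. zz_rel f (?v @ ?w) y z \<and> \<phi> (\<pi> f y) = \<pi> g z" using \<beta>\<phi>[OF u(1)] u(2) by metis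
  qed
  then show ?thesis using zz_class_hom[OF zigzag_append[OF v w]] by blast
qed

text \<open>M is a quotient of Hom(P, S) with S finite free. The kernel is a submodule, hence m
  Hom(P, _) for a subobject m of S, and the complex m is the required preimage of M.\<close>

lemma Fa_essentially_surjective: "essentially_surjective LQ (mod_cat R) N"
  unfolding essentially_surjective_def
proof
  fix M assume MO: "M \<in> Obj (mod_cat R)"
  then have M: "right_module R M" "finitely_generated_module R M" by (auto simp: mod_cat_def)
  interpret M: right_module R M by (rule M(1))
  obtain A where A: "finite A" "A \<subseteq> carrier M" "\<forall>L. is_submodule R M L \<and> A \<subseteq> L \<longrightarrow> carrier M \<subseteq> L"
    using M(2) unfolding M.finitely_generated_iff by metis
  obtain S \<phi> where S: "S \<in> finite_free P" and \<phi>: "hom_linear P S M \<phi>" "A \<subseteq> \<phi> ` Hom C P S"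
    using finite_free_onto[OF M(1) P_obj A(1,2)] by metis
  note SO = finite_free_obj[OF S]
  interpret H: right_module R "hom_module P S" by (rule right_module_hom[OF P_obj SO])
  have \<phi>H: "restrict \<phi> (Hom C P S) \<in> module_homs R (hom_module P S) M"
    using hom_linearD[OF \<phi>(1)] add_hom comp_hom by (auto simp: module_homs_def)
  have im: "\<phi> ` Hom C P S = carrier M"
  proof -
    have "is_submodule R (hom_module P S) (carrier (hom_module P S))" by
        (auto simp: is_submodule_def H.smult_closed add_hom zero_hom[OF P_obj SO] comp_hom)
    from image_submodule[OF \<phi>H H.right_module_axioms M(1) this]
    have "is_submodule R M (\<phi> ` Hom C P S)" by simp
    then show ?thesis using A(3) \<phi>(2) hom_linearD(1)[OF \<phi>(1)] by blast
  qed
  have "is_submodule R M {\<zero>\<^bsub>M\<^esub>}" by (simp add: is_submodule_def M.smult_zero)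
  from preimage_submodule[OF \<phi>H H.right_module_axioms M(1) this]
  have "is_submodule R (hom_module P S) {u \<in> Hom C P S. \<phi> u = \<zero>\<^bsub>M\<^esub>}" by (simp cong: conj_cong)
  then have sub: "hom_submodule P S {u \<in> Hom C P S. \<phi> u = \<zero>\<^bsub>M\<^esub>}" by (simp add: is_submodule_hom_iff)
  obtain m where m: "is_subobject C S m" "{u \<in> Hom C P S. \<phi> u = \<zero>\<^bsub>M\<^esub>} = (\<cdot>) m ` Hom C P (Dom C m)"
    by (rule submodule_subobject[OF P_projective noeth SO sub])
  have m': "is_monic C m" "Cod C m = S" using m(1) by (auto simp: is_subobject_def)
  note mA = monic_arr[OF m'(1)]
  have ker: "\<phi> u = \<phi> v \<longleftrightarrow> eqm m u v" if u: "u \<in> Hom C P S" and v: "v \<in> Hom C P S" for u v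
  proof -
    have u': "u \<in> Arr C" "v \<in> Arr C" "Dom C u = P" "Dom C v = P" "Cod C u = S" "Cod C v = S" using u
        v by (auto simp: Hom_iff)
    have d: "u \<boxplus> neg v \<in> Hom C P S" "u \<boxplus> neg v \<boxplus> v = u" using u' by (simp_all add: Hom_iff)
    have "\<phi> u = \<phi> (u \<boxplus> neg v) \<oplus>\<^bsub>M\<^esub> \<phi> v" using hom_linearD(2)[OF \<phi>(1) d(1) v] d(2) by simp
    then have "\<phi> u = \<phi> v \<longleftrightarrow> \<phi> (u \<boxplus> neg v) = \<zero>\<^bsub>M\<^esub>"
      using hom_linearD(1)[OF \<phi>(1)] d(1) v by (simp add: M.add.r_cancel_one)
    also have "\<dots> \<longleftrightarrow> u \<boxplus> neg v \<in> (\<cdot>) m ` Hom C P (Dom C m)" using m(2) d(1) by blast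
    also have "\<dots> \<longleftrightarrow> eqm m u v" unfolding eqm_diff[OF mA u'(1,2) HOL.trans[OF u'(5) m'(2)[symmetric]]
        HOL.trans[OF u'(6) m'(2)[symmetric]] HOL.trans[OF u'(4) u'(3)[symmetric]]]
      using u' by (auto simp: Hom_iff)
    finally show ?thesis .
  qed
  have \<phi>m: "hom_linear P (Cod C m) M \<phi>" using \<phi>(1) m'(2) by simp
  obtain \<psi> where \<psi>: "\<psi> \<in> module_homs R (N m) M" "\<And>y. y \<in> Hom C P (Cod C m) \<Longrightarrow> \<psi> (\<pi> m y) = \<phi> y"
  proof (rule hom_factor[OF m'(1) \<phi>m])
    fix y y' assume "y \<in> Hom C P (Cod C m)" "y' \<in> Hom C P (Cod C m)" "eqm m y y'"
    then show "\<phi> y = \<phi> y'" using ker m'(2) by simp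
  qed (rule that)
  have bij: "bij_betw \<psi> (carrier (N m)) (carrier M)"
    unfolding bij_betw_def
  proof
    show "inj_on \<psi> (carrier (N m))"
    proof (rule inj_onI)
      fix a b assume ab: "a \<in> carrier (N m)" "b \<in> carrier (N m)" "\<psi> a = \<psi> b"
      obtain u where u: "u \<in> Hom C P (Cod C m)" "a = \<pi> m u" using ab(1) unfolding
          pi_surj[OF m'(1), symmetric] by blast
      obtain v where v: "v \<in> Hom C P (Cod C m)" "b = \<pi> m v" using ab(2) unfolding
          pi_surj[OF m'(1), symmetric] by blast
      show "a = b" using ab(3) u v \<psi>(2) ker pi_eq[OF m'(1) u(1) v(1)] m'(2) by simp
    qed
    have "\<psi> ` carrier (N m) = (\<lambda>y. \<psi> (\<pi> m y)) ` Hom C P (Cod C m)" unfolding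
        pi_surj[OF m'(1), symmetric] by (simp add: image_image)
    also have "\<dots> = \<phi> ` Hom C P S" using \<psi>(2) m'(2) by (intro image_cong) simp_all
    finally show "\<psi> ` carrier (N m) = carrier M" using im by simp
  qed
  have H: "(N m, \<psi>, M) \<in> Hom (mod_cat R) (N m) M" by (rule
      mod_HomI[OF \<psi>(1) N_module(1)[OF m'(1)] M(1) N_module(2)[OF m'(1)] M(2)])
  show "\<exists>f \<in> Obj LQ. \<exists>e. e \<in> Hom (mod_cat R) (N f) M \<and> is_iso_arrow (mod_cat R) e"
    using H mod_iso_of_bij[OF H bij] m'(1) by (intro bexI[of _ m]) auto
qed

theorem LQ_equivalent: "LQ \<approx>\<^sub>c mod_cat R"
proof (rule equivalence_of_fully_faithful[OF category_left_associated_abelian category_mod_cat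
    Fa_functor _ Fa_essentially_surjective])
  show "fully_faithful LQ (mod_cat R) N Fa"
    unfolding fully_faithful_def
  proof (intro ballI bij_betwI')
    fix f g F G assume "F \<in> Hom LQ f g" "G \<in> Hom LQ f g"
    then show "Fa F = Fa G \<longleftrightarrow> F = G" using Fa_faithful by blast
  next
    fix f g F assume "F \<in> Hom LQ f g"
    then show "Fa F \<in> Hom (mod_cat R) (N f) (N g)" by (rule functorD(2)[OF Fa_functor])
  next
    fix f g G assume fg: "f \<in> Obj LQ" "g \<in> Obj LQ" and G: "G \<in> Hom (mod_cat R) (N f) (N g)"
    obtain \<phi> where \<phi>: "G = (N f, \<phi>, N g)" "\<phi> \<in> module_homs R (N f) (N g)" using G by (rule mod_HomE)
    show "\<exists>F \<in> Hom LQ f g. G = Fa F" using Fa_full[of f g \<phi>] fg \<phi> by (metis LQ_obj)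
  qed
qed

end

context quasi_abelian_category
begin

theorem LQ_equivalent_mod_End:
  assumes P: "strong_projective_generator C P" and noeth: "noetherian_subobjects C"
  shows "LQ \<approx>\<^sub>c mod_cat (End_ring C P)"
proof -
  let ?R = "End_ring C P"
  have Pp: "is_projective C P" using P by (simp add: strong_projective_generator_def)
  note PO = projective_obj[OF Pp]
  have "\<exists>N \<pi>. N \<in> Obj (mod_cat ?R) \<and> \<pi> ` Hom C P (Cod C f) = carrier N \<and> hom_linear P (Cod C f) N \<pi>
      \<and>
      (\<forall>y \<in> Hom C P (Cod C f). \<forall>y' \<in> Hom C P (Cod C f). \<pi> y = \<pi> y' \<longleftrightarrow> eqm f y y')"
    if f: "is_monic C f" for f
  proof -
    note fA = monic_arr[OF f]
    have X: "Cod C f \<in> Obj C" using fA by simp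
    obtain S c where "S \<in> finite_free P" "cokernel_arrow C c" "c \<in> Hom C S (Cod C f)" using
        finite_free_cover[OF P noeth X] .
    then have fg: "finitely_generated_module ?R (hom_module P (Cod C f))" by
        (rule finitely_generated_hom[OF Pp])
    interpret M: right_module ?R "hom_module P (Cod C f)" by (rule right_module_hom[OF PO X])
    have "f \<in> Hom C (Dom C f) (Cod C f)" using fA by (simp add: Hom_iff)
    then have sub: "is_submodule ?R (hom_module P (Cod C f)) ((\<cdot>) f ` Hom C P (Dom C f))"
      unfolding is_submodule_hom_iff by (rule hom_submodule_image[OF PO])
    obtain N \<pi> where N: "N \<in> Obj (mod_cat ?R)" "\<pi> \<in> module_homs ?R (hom_module P (Cod C f)) N"
      "\<pi> ` carrier (hom_module P (Cod C f)) = carrier N"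
      "\<And>x. x \<in> carrier (hom_module P (Cod C f)) \<Longrightarrow> \<pi> x = \<zero>\<^bsub>N\<^esub> \<longleftrightarrow> x \<in> (\<cdot>) f ` Hom C P (Dom C f)"
      "\<And>x y. x \<in> carrier (hom_module P (Cod C f)) \<Longrightarrow> y \<in> carrier (hom_module P (Cod C f)) \<Longrightarrow>
        \<pi> x = \<pi> y \<longleftrightarrow> x \<ominus>\<^bsub>hom_module P (Cod C f)\<^esub> y \<in> (\<cdot>) f ` Hom C P (Dom C f)"
      by (rule quotient_representable[OF M.right_module_axioms fg sub]) (rule that)
    have lin: "hom_linear P (Cod C f) N \<pi>" using module_homsD[OF N(2)] unfolding hom_linear_def by
        simp
    have "\<pi> y = \<pi> y' \<longleftrightarrow> eqm f y y'" if y: "y \<in> Hom C P (Cod C f)" "y' \<in> Hom C P (Cod C f)" for y y'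
    proof -
      have y': "y \<in> Arr C" "y' \<in> Arr C" "Cod C y = Cod C f" "Cod C y' = Cod C f"
          "Dom C y' = Dom C y" "Dom C y = P"
        using y by (auto simp: Hom_iff)
      have "neg y' \<oplus>\<^bsub>hom_module P (Cod C f)\<^esub> y' = \<zero>\<^bsub>hom_module P (Cod C f)\<^esub>"
          "neg y' \<in> carrier (hom_module P (Cod C f))"
        using y' by (simp_all add: Hom_iff)
      then have "\<ominus>\<^bsub>hom_module P (Cod C f)\<^esub> y' = neg y'" using M.minus_equality[of "neg y'" y'] y by
          simp
      then have "y \<ominus>\<^bsub>hom_module P (Cod C f)\<^esub> y' = y \<boxplus> neg y'" by (simp add: a_minus_def)
      then show ?thesis using N(5)[of y y'] y eqm_diff[OF fA y'(1-5)] y'(6) by (auto simp: Hom_iff)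
    qed
    then show ?thesis using N(1,3) lin by auto
  qed
  \<comment> \<open>Module and projection are paired, so that one choice over all monomorphisms
    provides both.\<close>
  then have "\<forall>f \<in> Collect (is_monic C). \<exists>N\<pi>. fst N\<pi> \<in> Obj (mod_cat ?R) \<and> snd N\<pi> ` Hom C P (Cod C f)
      = carrier (fst N\<pi>) \<and>
      hom_linear P (Cod C f) (fst N\<pi>) (snd N\<pi>) \<and>
      (\<forall>y \<in> Hom C P (Cod C f). \<forall>y' \<in> Hom C P (Cod C f). snd N\<pi> y = snd N\<pi> y' \<longleftrightarrow> eqm f y
          y')" by fastforce
  from bchoice[OF this] obtain N\<pi> where "\<forall>f \<in> Collect (is_monic C). fst (N\<pi> f) \<in> Obj (mod_cat ?R) \<and>
      snd (N\<pi> f) ` Hom C P (Cod C f) = carrier (fst (N\<pi> f)) \<and> hom_linear P (Cod C f) (fst (N\<pi> f))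
          (snd (N\<pi> f)) \<and>
      (\<forall>y \<in> Hom C P (Cod C f). \<forall>y' \<in> Hom C P (Cod C f). snd (N\<pi> f) y = snd (N\<pi> f) y' \<longleftrightarrow> eqm f y
          y')" by blast
  then interpret module_realization C P "\<lambda>f. fst (N\<pi> f)" "\<lambda>f. snd (N\<pi> f)"
    by unfold_locales (use P noeth in auto)
  show ?thesis by (rule LQ_equivalent)
qed

end

section \<open>Transport along equivalences, splitting of idempotents, and passage of chain
  conditions from P to all objects\<close>

section \<open>Chain conditions over finite free objects\<close>

lemma free_generator_iso:
  assumes iso: "is_iso_arrow (mod_cat R) (N, d, M)" and H: "(N, d, M) \<in> Hom (mod_cat R) N M" and u:
      "free_generator R N u"
  shows "free_generator R M (d u)"
proof -
  obtain E where E: "E \<in> Hom (mod_cat R) M N" "E \<cdot>\<^bsub>mod_cat R\<^esub> (N, d, M) = Ident (mod_cat R) N"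
    "(N, d, M) \<cdot>\<^bsub>mod_cat R\<^esub> E = Ident (mod_cat R) M" using iso H by (rule isoE)
  obtain e where e: "E = (M, e, N)" "e \<in> module_homs R M N" using E(1) by (rule mod_HomE)
  have d: "d \<in> module_homs R N M" using H by (auto elim!: mod_HomE)
  have "compose (carrier N) e d = (\<lambda>x \<in> carrier N. x)" "compose (carrier M) d e =
      (\<lambda>x \<in> carrier M. x)"
    using E(2,3) by (simp_all add: e(1) mod_comp) (simp_all add: mod_cat_def)
  then have ed: "e (d x) = x" if "x \<in> carrier N" for x using that by
      (metis compose_eq restrict_apply')
  have de: "d (e y) = y" if "y \<in> carrier M" for y
    using that \<open>compose (carrier M) d e = _\<close> by (metis compose_eq restrict_apply')
  have uN: "u \<in> carrier N" using u by (simp add: free_generator_def)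
  have N: "right_module R N" using H by (auto elim!: mod_HomE)
  interpret N: right_module R N by fact
  show ?thesis
    unfolding free_generator_def
  proof (intro conjI ballI)
    show "d u \<in> carrier M" using module_homsD(1)[OF d uN] .
    fix y assume y: "y \<in> carrier M"
    have "y = r \<odot>\<^bsub>M\<^esub> d u \<longleftrightarrow> e y = r \<odot>\<^bsub>N\<^esub> u" if r: "r \<in> carrier R" for r
    proof -
      have "r \<odot>\<^bsub>M\<^esub> d u = d (r \<odot>\<^bsub>N\<^esub> u)" using module_homsD(3)[OF d r uN] by simp
      then show ?thesis using ed[of "r \<odot>\<^bsub>N\<^esub> u"] de[OF y] N.smult_closed[OF r uN] by metis
    qed
    moreover have "\<exists>!r. r \<in> carrier R \<and> e y = r \<odot>\<^bsub>N\<^esub> u"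
      using u module_homsD(1)[OF e(2) y] by (simp add: free_generator_def)
    ultimately show "\<exists>!r. r \<in> carrier R \<and> y = r \<odot>\<^bsub>M\<^esub> d u" by metis
  qed
qed

text \<open>A test object Z is isomorphic to some \<open>Fo X\<close>. Once transported to
  \<open>Fo X\<close>, the two arrows lift along the full functor and are compared in C.\<close>

lemma epic_preserved:
  assumes C: "category C" and D: "category D" and F: "is_functor C D Fo Fa" and ff:
      "fully_faithful C D Fo Fa"
    and es: "essentially_surjective C D Fo" and e: "is_epic C e"
  shows "is_epic D (Fa e)"
proof -
  interpret C: category C by fact
  interpret D: category D by fact
  have eH: "e \<in> Hom C (Dom C e) (Cod C e)" using e by (simp add: is_epic_def Hom_def)
  note FeH = functorD(2)[OF F eH]
  have oY: "Cod C e \<in> Obj C" using C.Hom_objD[OF eH] by simp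
  show ?thesis
    unfolding is_epic_def HomD(3)[OF FeH]
  proof (intro conjI ballI impI)
    show "Fa e \<in> Arr D" using FeH by (rule HomD)
    fix Z g h assume Z: "Z \<in> Obj D" and g: "g \<in> Hom D (Fo (Cod C e)) Z" and h:
        "h \<in> Hom D (Fo (Cod C e)) Z"
      and eq: "g \<cdot>\<^bsub>D\<^esub> Fa e = h \<cdot>\<^bsub>D\<^esub> Fa e"
    obtain X i where X: "X \<in> Obj C" "i \<in> Hom D (Fo X) Z" "is_iso_arrow D i"
      using es Z unfolding essentially_surjective_def by blast
    obtain j where j: "j \<in> Hom D Z (Fo X)" "j \<cdot>\<^bsub>D\<^esub> i = Ident D (Fo X)" "i \<cdot>\<^bsub>D\<^esub> j = Ident D Z" using
        X(3,2) by (rule isoE)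
    have jiso: "is_iso_arrow D j" by (rule isoI[OF j(1) X(2) j(3,2)])
    have sur: "Fa ` Hom C (Cod C e) X = Hom D (Fo (Cod C e)) (Fo X)" and inj:
        "inj_on Fa (Hom C (Dom C e) X)"
      using ff oY X(1) C.dom_obj e by (simp_all add: fully_faithful_def bij_betw_def is_epic_def)
    obtain g' where g': "g' \<in> Hom C (Cod C e) X" "Fa g' = j \<cdot>\<^bsub>D\<^esub> g" using sur D.comp_hom[OF g j(1)]
        by (metis imageE)
    obtain h' where h': "h' \<in> Hom C (Cod C e) X" "Fa h' = j \<cdot>\<^bsub>D\<^esub> h" using sur D.comp_hom[OF h j(1)]
        by (metis imageE)
    have "Fa (g' \<cdot>\<^bsub>C\<^esub> e) = Fa (h' \<cdot>\<^bsub>C\<^esub> e)"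
      using functorD(4)[OF F eH g'(1)] functorD(4)[OF F eH h'(1)] g'(2) h'(2)
        D.comp_assoc[OF FeH g j(1)] D.comp_assoc[OF FeH h j(1)] eq by simp
    then have "g' \<cdot>\<^bsub>C\<^esub> e = h' \<cdot>\<^bsub>C\<^esub> e" using inj C.comp_hom[OF eH g'(1)] C.comp_hom[OF eH h'(1)] by
        (auto simp: inj_on_def)
    then have "g' = h'" using e g'(1) h'(1) X(1) unfolding is_epic_def by blast
    then show "g = h" using D.iso_cancel[OF jiso j(1) g h] g'(2) h'(2) by simp
  qed
qed

context quasi_abelian_category
begin

text \<open>The image of a is the kernel of 1 - a: as (1 - a) a = 0, a factors through that kernel,
  which gives the retraction r.\<close>

lemma idempotent_split:
  assumes a: "a \<in> Arr C" "Dom C a = Y" "Cod C a = Y" "a \<cdot> a = a"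
  obtains P k r where "P \<in> Obj C" "k \<in> Hom C P Y" "r \<in> Hom C Y P" "k \<cdot> r = a" "r \<cdot> k = Ident C P"
proof -
  have Y: "Y \<in> Obj C" using a by auto
  define d where "d = Ident C Y \<boxplus> neg a"
  have d: "d \<in> Arr C" "Dom C d = Y" "Cod C d = Y" using a Y by (simp_all add: d_def)
  have dg: "d \<cdot> g = g \<boxplus> neg (a \<cdot> g)" if "g \<in> Arr C" "Cod C g = Y" for g
    using that a(1-3) Y by (simp add: d_def comp_plus comp_neg)
  obtain k where k: "k \<in> Arr C" "Cod C k = Dom C d" "is_monic C k"
      "d \<cdot> k = HZero C (Dom C k) (Cod C d)"
    "\<And>g. g \<in> Arr C \<Longrightarrow> Cod C g = Dom C d \<Longrightarrow> d \<cdot> g = HZero C (Dom C g) (Cod C d) \<Longrightarrow>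
      \<exists>h. h \<in> Arr C \<and> Dom C h = Dom C g \<and> Cod C h = Dom C k \<and> g = k \<cdot> h"
    using kernel_obtain[OF d(1)] by blast
  have "d \<cdot> a = HZero C (Dom C a) (Cod C d)" using dg[of a] a d by simp
  then obtain r where r: "r \<in> Arr C" "Dom C r = Y" "Cod C r = Dom C k" "a = k \<cdot> r" using k(5)[of a]
      a d by auto
  have ak: "k = a \<cdot> k"
    by (rule eq_if_diff_zero) (use k(1,2,4) a(1-3) d dg[of k] in simp_all)
  have "k \<cdot> (r \<cdot> k) = (k \<cdot> r) \<cdot> k" using k(1,2) r(1-3) d by (simp add: assoc)
  also have "\<dots> = k \<cdot> Ident C (Dom C k)" using ak r(4) k(1) by simp
  finally have "r \<cdot> k = Ident C (Dom C k)" by (rule monicD[OF k(3)])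
      (use k(1,2) r(1-3) d in simp_all)
  then show ?thesis using that[of "Dom C k" k r] k(1,2) r d by (simp add: Hom_iff)
qed

text \<open>The arrow c has the elements of A as its components, one copy of P for each.\<close>

lemma finite_free_arrow:
  assumes P: "P \<in> Obj C" and X: "X \<in> Obj C" and A: "finite A" "A \<subseteq> Hom C P X"
  shows "\<exists>S \<in> finite_free P. \<exists>c \<in> Hom C S X. A \<subseteq> (\<cdot>) c ` Hom C P S"
  using A
proof (induction A rule: finite_induct)
  case empty
  then show ?case using finite_free.null zero_hom[OF null_obj(1) X] by blast
next
  case (insert a A)
  obtain S c where S: "S \<in> finite_free P" and c: "c \<in> Hom C S X" "A \<subseteq> (\<cdot>) c ` Hom C P S" using
      insert by auto
  have a: "a \<in> Hom C P X" using insert by simp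
  obtain T i j p q where bp: "is_biproduct S P T i j p q" using
      biproduct_exists[OF finite_free_obj[OF S] P] .
  note bpH = biproduct_HomD[OF bp]
  define t where "t = c \<cdot> p \<boxplus> a \<cdot> q"
  have t: "t \<in> Hom C T X" unfolding t_def by (rule add_hom[OF comp_hom[OF bpH(3) c(1)]
      comp_hom[OF bpH(4) a]])
  have ti: "t \<cdot> i = c" "t \<cdot> j = a" using biproduct_copair[OF bp, of c a] c(1) a by
      (simp_all add: t_def Hom_iff)
  have "x \<in> (\<cdot>) t ` Hom C P T" if x: "x \<in> A" for x
  proof -
    obtain v where v: "v \<in> Hom C P S" "x = c \<cdot> v" using c(2) x by blast
    have "x = t \<cdot> (i \<cdot> v)" using comp_assoc[OF v(1) bpH(1) t] v(2) ti(1) by simp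
    then show ?thesis using comp_hom[OF v(1) bpH(1)] by blast
  qed
  moreover have "a \<in> (\<cdot>) t ` Hom C P T" using ti(2) bpH(2) by blast
  ultimately show ?case using finite_free.plus[OF S bp] t by blast
qed

text \<open>\<open>incl\<close> stands for inclusion or reverse inclusion, so that ascending and
  descending chains share one argument.\<close>

definition chain_condition :: "('m set \<Rightarrow> 'm set \<Rightarrow> bool) \<Rightarrow> 'o \<Rightarrow> 'o \<Rightarrow> bool" where
  "chain_condition incl P X \<longleftrightarrow> (\<forall>N :: nat \<Rightarrow> 'm set. (\<forall>k. hom_submodule P X (N k)) \<and>
      (\<forall>k. incl (N k) (N (Suc k))) \<longrightarrow>
     (\<exists>K. \<forall>k \<ge> K. N k = N K))"

lemma hom_submodule_vimage:
  assumes P: "P \<in> Obj C" and i: "i \<in> Hom C S T" and N: "hom_submodule P T N"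
  shows "hom_submodule P S {u \<in> Hom C P S. i \<cdot> u \<in> N}"
  unfolding hom_submodule_def
proof (intro conjI ballI)
  have S: "S \<in> Obj C" using Hom_objD[OF i] by simp
  show "HZero C P S \<in> {u \<in> Hom C P S. i \<cdot> u \<in> N}"
    using N zero_hom[OF P S] zero_comp[OF i P] by (simp add: hom_submodule_def)
next
  fix x y assume "x \<in> {u \<in> Hom C P S. i \<cdot> u \<in> N}" "y \<in> {u \<in> Hom C P S. i \<cdot> u \<in> N}"
  then show "x \<boxplus> y \<in> {u \<in> Hom C P S. i \<cdot> u \<in> N}"
    using N comp_add_right[of x P S y i T] i by (auto simp: hom_submodule_def add_hom)
next
  fix x r assume x: "x \<in> {u \<in> Hom C P S. i \<cdot> u \<in> N}" and r: "r \<in> Hom C P P"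
  then have "(i \<cdot> x) \<cdot> r \<in> N" using N unfolding hom_submodule_def by blast
  then show "x \<cdot> r \<in> {u \<in> Hom C P S. i \<cdot> u \<in> N}"
    using x comp_assoc[OF r _ i, of x] comp_hom[OF r, of x S] by simp
qed auto

lemma hom_submodule_push:
  assumes P: "P \<in> Obj C" and q: "q \<in> Hom C T S" and N: "hom_submodule P T N"
  shows "hom_submodule P S ((\<cdot>) q ` N)"
proof -
  have NH: "x \<in> Hom C P T" if "x \<in> N" for x using N that by (auto simp: hom_submodule_def)
  have T: "T \<in> Obj C" using Hom_objD[OF q] by simp
  show ?thesis
    unfolding hom_submodule_def
  proof (intro conjI ballI)
    show "(\<cdot>) q ` N \<subseteq> Hom C P S" using NH comp_hom[OF _ q] by blast
    show "HZero C P S \<in> (\<cdot>) q ` N"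
      using N zero_comp[OF q P] by (intro image_eqI[of _ _ "HZero C P T"])
          (simp_all add: hom_submodule_def)
  next
    fix x y assume "x \<in> (\<cdot>) q ` N" "y \<in> (\<cdot>) q ` N"
    then obtain a b where ab: "a \<in> N" "b \<in> N" "x = q \<cdot> a" "y = q \<cdot> b" by blast
    then show "x \<boxplus> y \<in> (\<cdot>) q ` N"
      using comp_add_right[OF NH[OF ab(1)] NH[OF ab(2)] q] N
      by (intro image_eqI[of _ _ "a \<boxplus> b"]) (simp_all add: hom_submodule_def)
  next
    fix x r assume "x \<in> (\<cdot>) q ` N" and r: "r \<in> Hom C P P"
    then obtain a where a: "a \<in> N" "x = q \<cdot> a" by blast
    then show "x \<cdot> r \<in> (\<cdot>) q ` N"
      using comp_assoc[OF r NH[OF a(1)] q] N r by (intro image_eqI[of _ _ "a \<cdot> r"])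
          (simp_all add: hom_submodule_def)
  qed
qed

text \<open>For x in B choose y in A with the same image under q. Their difference lies in B and
  comes from S through i, hence lies in A, and so does x.\<close>

lemma hom_submodule_eqI:
  assumes P: "P \<in> Obj C" and bp: "is_biproduct S P T i j p q" and A: "hom_submodule P T A" and B:
      "hom_submodule P T B"
    and AB: "A \<subseteq> B" and eq: "{u \<in> Hom C P S. i \<cdot> u \<in> A} = {u \<in> Hom C P S. i \<cdot> u \<in> B}"
        "(\<cdot>) q ` A = (\<cdot>) q ` B"
  shows "A = B"
proof
  note bpH = biproduct_HomD[OF bp]
  show "B \<subseteq> A"
  proof
    fix x assume x: "x \<in> B"
    then obtain y where y: "y \<in> A" "q \<cdot> x = q \<cdot> y" using eq(2) by (metis imageE imageI)
    have xH: "x \<in> Hom C P T" "y \<in> Hom C P T" using x y A B by (auto simp: hom_submodule_def)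
    then have x': "x \<in> Arr C" "y \<in> Arr C" "Dom C x = P" "Dom C y = P" "Cod C x = T" "Cod C y = T" by
        (auto simp: Hom_iff)
    note bp' = biproductD[OF bp]
    have ny: "neg y \<in> A" by (rule hom_submodule_neg[OF P A y(1)])
    define d where "d = x \<boxplus> neg y"
    have dB: "d \<in> B" using B x ny AB unfolding d_def hom_submodule_def by blast
    have dH: "d \<in> Hom C P T" using dB B by (auto simp: hom_submodule_def)
    have "q \<cdot> d = HZero C P P" using x' bp' y(2) P by (simp add: d_def comp_plus comp_neg)
    then have "d = i \<cdot> (p \<cdot> d) \<boxplus> j \<cdot> HZero C P P" using biproduct_split[OF bp, of d] dH by
        (simp add: Hom_iff)
    then have d: "d = i \<cdot> (p \<cdot> d)" using bp' dH P by (simp add: Hom_iff)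
    then have "p \<cdot> d \<in> {u \<in> Hom C P S. i \<cdot> u \<in> B}" using dB comp_hom[OF dH bpH(3)] by auto
    then have "d \<in> A" using d unfolding eq(1)[symmetric] by auto
    then have "d \<boxplus> y \<in> A" using A y(1) by (simp add: hom_submodule_def)
    moreover have "d \<boxplus> y = x" using x' by (simp add: d_def)
    ultimately show "x \<in> A" by simp
  qed
qed (rule AB)

text \<open>Extension argument for S \<rightarrow> T \<rightarrow> P: a chain in Hom(P, T) is
  stationary once its traces on Hom(P, S) and its images in Hom(P, P) are.\<close>

lemma chain_condition_finite_free:
  assumes P: "P \<in> Obj C" and incl: "incl = (\<subseteq>) \<or> incl = (\<supseteq>)" and cc: "chain_condition incl P P" and
      S: "S \<in> finite_free P"
  shows "chain_condition incl P S"
  using S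
proof (induction rule: finite_free.induct)
  case null
  have 1: "u = HZero C P null_obj" if "u \<in> Hom C P null_obj" for u using that null_obj(3)[of u] by
      (simp add: Hom_iff)
  have "N = {HZero C P null_obj}" if "hom_submodule P null_obj N" for N using that 1 unfolding
      hom_submodule_def by blast
  then show ?case unfolding chain_condition_def by metis
next
  case (plus S T i j p q)
  note bp = plus.hyps(2) and bpH = biproduct_HomD[OF plus.hyps(2)]
  show ?case
    unfolding chain_condition_def
  proof (intro allI impI)
    fix N :: "nat \<Rightarrow> 'm set" assume N: "(\<forall>k. hom_submodule P T (N k)) \<and> (\<forall>k. incl (N k) (N (Suc k)))"
    define A where "A k = {u \<in> Hom C P S. i \<cdot> u \<in> N k}" for k
    define B where "B k = (\<cdot>) q ` N k" for k
    have "(\<forall>k. hom_submodule P S (A k)) \<and> (\<forall>k. incl (A k) (A (Suc k)))"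
      using hom_submodule_vimage[OF P bpH(1)] N incl by (auto simp: A_def)
    then obtain K1 where K1: "\<And>k. k \<ge> K1 \<Longrightarrow> A k = A K1" using plus.IH unfolding chain_condition_def
        by blast
    have "(\<forall>k. hom_submodule P P (B k)) \<and> (\<forall>k. incl (B k) (B (Suc k)))"
      using hom_submodule_push[OF P bpH(4)] N incl by (elim disjE) (simp_all add: B_def image_mono)
    then obtain K2 where K2: "\<And>k. k \<ge> K2 \<Longrightarrow> B k = B K2" using cc unfolding chain_condition_def by
        blast
    define K where "K = max K1 K2"
    have "N k = N K" if k: "k \<ge> K" for k
    proof -
      have eq: "A k = A K" "B k = B K" using K1[of k] K1[of K] K2[of k] K2[of K] k by
          (simp_all add: K_def)
      have mono: "N K \<subseteq> N k \<or> N k \<subseteq> N K"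
        using incl
      proof
        assume "incl = (\<subseteq>)"
        then have "N n \<subseteq> N (Suc n)" for n using N by simp
        then show ?thesis using lift_Suc_mono_le[of N K k] k by blast
      next
        assume "incl = (\<supseteq>)"
        then have "N (Suc n) \<subseteq> N n" for n using N by simp
        then show ?thesis using lift_Suc_antimono_le[of N K k] k by blast
      qed
      then show ?thesis using hom_submodule_eqI[OF P bp, of "N K" "N k"]
          hom_submodule_eqI[OF P bp, of "N k" "N K"] N eq
        by (auto simp: A_def B_def)
    qed
    then show "\<exists>K. \<forall>k \<ge> K. N k = N K" by blast
  qed
qed

text \<open>Every arrow from P lifts along c, so each submodule is the image of its preimage, and
  the preimages form a chain in Hom(P, S).\<close>

lemma chain_condition_cover:
  assumes P: "is_projective C P" and incl: "incl = (\<subseteq>) \<or> incl = (\<supseteq>)" and cc: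
      "chain_condition incl P S"
    and c: "cokernel_arrow C c" "c \<in> Hom C S X"
  shows "chain_condition incl P X"
  unfolding chain_condition_def
proof (intro allI impI)
  fix N :: "nat \<Rightarrow> 'm set" assume N: "(\<forall>k. hom_submodule P X (N k)) \<and> (\<forall>k. incl (N k) (N (Suc k)))"
  define A where "A k = {u \<in> Hom C P S. c \<cdot> u \<in> N k}" for k
  have "(\<forall>k. hom_submodule P S (A k)) \<and> (\<forall>k. incl (A k) (A (Suc k)))"
    using hom_submodule_vimage[OF projective_obj[OF P] c(2)] N incl by (auto simp: A_def)
  then obtain K where K: "\<And>k. k \<ge> K \<Longrightarrow> A k = A K" using cc unfolding chain_condition_def by blast
  have "N k = (\<cdot>) c ` A k" for k
  proof
    show "N k \<subseteq> (\<cdot>) c ` A k"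
    proof
      fix x assume x: "x \<in> N k"
      then have "x \<in> Hom C P X" using N by (auto simp: hom_submodule_def)
      then have "x \<in> Hom C P (Cod C c)" using c(2) by (simp add: Hom_iff)
      then obtain v where "v \<in> Hom C P (Dom C c)" "c \<cdot> v = x" using projectiveD[OF P c(1)] by metis
      then show "x \<in> (\<cdot>) c ` A k" using x c(2) by (auto simp: A_def Hom_iff)
    qed
  qed (auto simp: A_def)
  then show "\<exists>K. \<forall>k \<ge> K. N k = N K" using K by metis
qed

lemma subobject_eqI:
  assumes P: "strong_projective_generator C P" and s: "is_subobject C X s" "is_subobject C X t"
    and eq: "(\<cdot>) s ` Hom C P (Dom C s) = (\<cdot>) t ` Hom C P (Dom C t)"
  shows "subobject_eq C s t"
  using subobject_leI[OF P s(1,2)] subobject_leI[OF P s(2,1)] eq by (simp add: subobject_eq_def)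

lemma chain_condition_subobjects:
  assumes P: "strong_projective_generator C P"
  shows "(\<And>X. X \<in> Obj C \<Longrightarrow> chain_condition (\<subseteq>) P X) \<Longrightarrow> noetherian_subobjects C"
    and "(\<And>X. X \<in> Obj C \<Longrightarrow> chain_condition (\<supseteq>) P X) \<Longrightarrow> artinian_subobjects C"
proof -
  have PO: "P \<in> Obj C" using P by (simp add: strong_projective_generator_def is_projective_def)
  have sub: "hom_submodule P X ((\<cdot>) m ` Hom C P (Dom C m))" if "is_subobject C X m" for X m
    by (rule hom_submodule_image[OF PO]) (use that in \<open>simp add: is_subobject_def Hom_iff\<close>)
  have arr: "m \<in> Arr C" if "is_subobject C X m" for X m using that by (simp add: is_subobject_def)
  { assume cc: "\<And>X. X \<in> Obj C \<Longrightarrow> chain_condition (\<subseteq>) P X"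
    show "noetherian_subobjects C"
      unfolding noetherian_subobjects_def
    proof (intro ballI allI impI)
      fix X and s :: "nat \<Rightarrow> 'm" assume X: "X \<in> Obj C" and
          "(\<forall>n. is_subobject C X (s n)) \<and> (\<forall>n. subobject_le C (s n) (s (Suc n)))"
      then have s: "\<And>n. is_subobject C X (s n)" "\<And>n. subobject_le C (s n) (s (Suc n))" by auto
      define N where "N n = (\<cdot>) (s n) ` Hom C P (Dom C (s n))" for n
      have "(\<forall>k. hom_submodule P X (N k)) \<and> (\<forall>k. N k \<subseteq> N (Suc k))"
        using sub[OF s(1)] subobject_leD[OF s(2) arr[OF s(1)]] by (simp add: N_def)
      then obtain K where K: "\<And>k. k \<ge> K \<Longrightarrow> N k = N K" using cc[OF X] unfolding chain_condition_def by
          blast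
      show "\<exists>N. \<forall>n \<ge> N. subobject_eq C (s n) (s N)"
        using subobject_eqI[OF P s(1) s(1) K[unfolded N_def]] by (intro exI[of _ K] allI impI)
    qed }
  { assume cc: "\<And>X. X \<in> Obj C \<Longrightarrow> chain_condition (\<supseteq>) P X"
    show "artinian_subobjects C"
      unfolding artinian_subobjects_def
    proof (intro ballI allI impI)
      fix X and s :: "nat \<Rightarrow> 'm" assume X: "X \<in> Obj C" and
          "(\<forall>n. is_subobject C X (s n)) \<and> (\<forall>n. subobject_le C (s (Suc n)) (s n))"
      then have s: "\<And>n. is_subobject C X (s n)" "\<And>n. subobject_le C (s (Suc n)) (s n)" by auto
      define N where "N n = (\<cdot>) (s n) ` Hom C P (Dom C (s n))" for n
      have "(\<forall>k. hom_submodule P X (N k)) \<and> (\<forall>k. N (Suc k) \<subseteq> N k)"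
        using sub[OF s(1)] subobject_leD[OF s(2) arr[OF s(1)]] by (simp add: N_def)
      then obtain K where K: "\<And>k. k \<ge> K \<Longrightarrow> N k = N K" using cc[OF X] unfolding chain_condition_def by
          blast
      show "\<exists>N. \<forall>n \<ge> N. subobject_eq C (s n) (s N)"
        using subobject_eqI[OF P s(1) s(1) K[unfolded N_def]] by (intro exI[of _ K] allI impI)
    qed }
qed

end

section \<open>Reconstruction of the generator, its endomorphism ring and the chain conditions from
  an equivalence\<close>

section \<open>From an equivalence to a generator\<close>

text \<open>The basis u records that the regular module corresponds to the image of an object P of
  Q. \<open>equivalence_realized\<close> produces such data from any equivalence.\<close>

locale equivalence_realization = quasi_abelian_category C
  for C :: "('o, 'm, 'z) precat_scheme" (structure) +
  fixes \<Lambda> :: "('r, 'y) ring_scheme" and Fo :: "'m \<Rightarrow> 'r list_module"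
    and Fa :: "('m, 'm K_arr) loc_arr \<Rightarrow> 'r list_module \<times> ('r list \<Rightarrow> 'r list) \<times> 'r list_module" and P
        :: 'o and u :: "'r list"
  assumes ring: "ring \<Lambda>" and func: "is_functor LQ (mod_cat \<Lambda>) Fo Fa" and ff:
      "fully_faithful LQ (mod_cat \<Lambda>) Fo Fa"
    and es: "essentially_surjective LQ (mod_cat \<Lambda>) Fo"
    and P_obj: "P \<in> Obj C" and gen: "free_generator \<Lambda> (Fo (iota P)) u"
begin

definition ap :: "('m, 'm K_arr) loc_arr \<Rightarrow> 'r list \<Rightarrow> 'r list" where
  "ap F = fst (snd (Fa F))"

lemma Fo_module: "is_monic C f \<Longrightarrow> right_module \<Lambda> (Fo f)" "is_monic C f \<Longrightarrow> finitely_generated_module \<Lambda>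
    (Fo f)"
  "is_monic C f \<Longrightarrow> Fo f \<in> Obj (mod_cat \<Lambda>)"
  using functorD(1)[OF func, of f] by (auto simp: mod_cat_def)

lemma Fa_ap:
  assumes "F \<in> Hom LQ f g"
  shows "Fa F = (Fo f, ap F, Fo g)" "ap F \<in> module_homs \<Lambda> (Fo f) (Fo g)"
  using functorD(2)[OF func assms] by (auto elim!: mod_HomE simp: ap_def)

lemma LQ_monic: "F \<in> Hom LQ f g \<Longrightarrow> is_monic C f" "F \<in> Hom LQ f g \<Longrightarrow> is_monic C g"
  using category.Hom_objD[OF category_left_associated_abelian, of F f g] LQ_obj by blast+

lemma ap_carrier: "F \<in> Hom LQ f g \<Longrightarrow> x \<in> carrier (Fo f) \<Longrightarrow> ap F x \<in> carrier (Fo g)"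
  using module_homsD(1)[OF Fa_ap(2)] by blast

lemma ap_comp:
  assumes F: "F \<in> Hom LQ f g" and G: "G \<in> Hom LQ g h" and x: "x \<in> carrier (Fo f)"
  shows "ap (G \<cdot>\<^bsub>LQ\<^esub> F) x = ap G (ap F x)"
proof -
  have "Fa (G \<cdot>\<^bsub>LQ\<^esub> F) = (Fo f, compose (carrier (Fo f)) (ap G) (ap F), Fo h)"
    using functorD(4)[OF func F G] Fa_ap(1)[OF F] Fa_ap(1)[OF G] by (simp add: mod_comp)
  then show ?thesis using x by (simp add: ap_def compose_def)
qed

lemma Fa_inj:
  assumes F: "F \<in> Hom LQ f g" and G: "G \<in> Hom LQ f g" and eq: "ap F = ap G"
  shows "F = G"
proof -
  have "inj_on Fa (Hom LQ f g)"
    using ff category.Hom_objD[OF category_left_associated_abelian F] by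
        (simp add: fully_faithful_def bij_betw_def)
  moreover have "Fa F = Fa G" using Fa_ap(1)[OF F] Fa_ap(1)[OF G] eq by metis
  ultimately show ?thesis using F G by (rule inj_onD)
qed

lemma Fa_onto:
  assumes f: "is_monic C f" and g: "is_monic C g" and \<psi>: "\<psi> \<in> module_homs \<Lambda> (Fo f) (Fo g)"
  obtains F where "F \<in> Hom LQ f g" "ap F = \<psi>"
proof -
  have "(Fo f, \<psi>, Fo g) \<in> Hom (mod_cat \<Lambda>) (Fo f) (Fo g)"
    using \<psi> Fo_module f g by (intro mod_HomI) auto
  moreover have "Fa ` Hom LQ f g = Hom (mod_cat \<Lambda>) (Fo f) (Fo g)"
    using ff f g by (simp add: fully_faithful_def bij_betw_def)
  ultimately have "(Fo f, \<psi>, Fo g) \<in> Fa ` Hom LQ f g" by simp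
  then obtain F where F: "(Fo f, \<psi>, Fo g) = Fa F" "F \<in> Hom LQ f g" by (rule imageE)
  show ?thesis by (rule that[OF F(2)]) (simp add: ap_def F(1)[symmetric])
qed

lemma ap_epic:
  assumes F: "F \<in> Hom LQ f g" and e: "is_epic LQ F"
  shows "ap F ` carrier (Fo f) = carrier (Fo g)"
proof (rule mod_epic_surj)
  show "is_epic (mod_cat \<Lambda>) (Fa F)"
    by (rule epic_preserved[OF category_left_associated_abelian category_mod_cat func ff es e])
  show "Fa F = (Fo f, ap F, Fo g)" by (rule Fa_ap(1)[OF F])
qed

lemma iP_monic: "is_monic C (iota P)"
  using P_obj by simp

lemma u_carrier: "u \<in> carrier (Fo (iota P))"
  using gen by (simp add: free_generator_def)

lemma ap_u_inj:
  assumes F: "F \<in> Hom LQ (iota P) g" and G: "G \<in> Hom LQ (iota P) g" and eq: "ap F u = ap G u"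
  shows "F = G"
  by (rule Fa_inj[OF F G free_generator_hom_eq[OF gen Fa_ap(2)[OF F] Fa_ap(2)[OF G] eq]])

text \<open>Together with \<open>ap_u_inj\<close>, evaluation at u identifies the arrows from
  \<open>iota P\<close> to g with the elements of \<open>Fo g\<close>.\<close>

lemma ap_u_surj:
  assumes g: "is_monic C g" and m: "m \<in> carrier (Fo g)"
  obtains F where "F \<in> Hom LQ (iota P) g" "ap F u = m"
proof -
  obtain \<psi> where "\<psi> \<in> module_homs \<Lambda> (Fo (iota P)) (Fo g)" "\<psi> u = m"
    using free_generator_hom[OF Fo_module(1)[OF iP_monic] gen Fo_module(1)[OF g] m] by blast
  then show ?thesis using Fa_onto[OF iP_monic g] that by metis
qed

text \<open>\<open>elt f\<close> is the map \<open>Hom(P, Cod f) \<rightarrow> Hom(iota P, f) \<cong> Fo f\<close>.\<close>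

definition elt :: "'m \<Rightarrow> 'm \<Rightarrow> 'r list" where
  "elt f y = ap (larr (iota P) y f) u"

lemma kmap_P: "is_monic C f \<Longrightarrow> y \<in> Hom C P (Cod C f) \<Longrightarrow> kmap (iota P) y f"
  by (rule kmap_iota) (auto simp: Hom_iff)

lemma elt_carrier: "is_monic C f \<Longrightarrow> y \<in> Hom C P (Cod C f) \<Longrightarrow> elt f y \<in> carrier (Fo f)"
  unfolding elt_def by (rule ap_carrier[OF larr_hom[OF kmap_P] u_carrier])

lemma elt_eq_iff:
  assumes f: "is_monic C f" and y: "y \<in> Hom C P (Cod C f)" "y' \<in> Hom C P (Cod C f)"
  shows "elt f y = elt f y' \<longleftrightarrow> eqm f y y'"
proof -
  note k = kmap_P[OF f y(1)] kmap_P[OF f y(2)]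
  have "elt f y = elt f y' \<longleftrightarrow> larr (iota P) y f = larr (iota P) y' f"
    unfolding elt_def using ap_u_inj[OF larr_hom[OF k(1)] larr_hom[OF k(2)]] by auto
  then show ?thesis using larr_eq_iff[OF k] by simp
qed

lemma elt_map:
  assumes b: "kmap f b g" and y: "y \<in> Hom C P (Cod C f)"
  shows "elt g (b \<cdot> y) = ap (larr f b g) (elt f y)"
proof -
  have f: "is_monic C f" by (rule kmapD(1)[OF b])
  note k = kmap_P[OF f y]
  show ?thesis unfolding elt_def larr_comp[OF k b, symmetric] by
      (rule ap_comp[OF larr_hom[OF k] larr_hom[OF b] u_carrier])
qed

lemma iota_inj: "X \<in> Obj C \<Longrightarrow> y \<in> Hom C P X \<Longrightarrow> y' \<in> Hom C P X \<Longrightarrow> elt (iota X) y = elt (iota X) y' \<Longrightarrow> y =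
    y'"
  using elt_eq_iff[of "iota X" y y'] eqm_iota[of X y y'] by simp

text \<open>Elements of \<open>Fo (iota X)\<close> are arrows from \<open>iota P\<close> to
  \<open>iota X\<close> in L, and these come from Q because the embedding is full.\<close>

lemma iota_surj:
  assumes X: "X \<in> Obj C" and m: "m \<in> carrier (Fo (iota X))"
  obtains y where "y \<in> Hom C P X" "elt (iota X) y = m"
proof -
  have iX: "is_monic C (iota X)" using X by simp
  obtain F where F: "F \<in> Hom LQ (iota P) (iota X)" "ap F u = m" using ap_u_surj[OF iX m] .
  obtain a where "a \<in> Arr C" "Dom C a = P" "Cod C a = X" "F = larr (iota P) a (iota X)" using
      iota_full[OF F(1) P_obj X] .
  then show ?thesis using that[of a] F(2) by (simp add: elt_def Hom_iff)
qed

lemma quotient_map: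
  assumes f: "is_monic C f"
  shows "kmap (iota (Cod C f)) (Ident C (Cod C f)) f"
    "ap (larr (iota (Cod C f)) (Ident C (Cod C f)) f) ` carrier (Fo (iota (Cod C f))) = carrier
        (Fo f)"
proof -
  note fA = monic_arr[OF f]
  show k: "kmap (iota (Cod C f)) (Ident C (Cod C f)) f" by (rule kmap_iota) (use f fA in simp_all)
  have "cokernel_arrow C (Ident C (Cod C f))" by (rule strict_split[where s = "Ident C (Cod C f)"])
      (use fA in simp_all)
  from strict_epic_LQ[OF this f] have "is_epic LQ (larr (iota (Cod C f)) (Ident C (Cod C f)) f)"
      using fA by simp
  then show "ap (larr (iota (Cod C f)) (Ident C (Cod C f)) f) ` carrier (Fo (iota (Cod C f))) =
      carrier (Fo f)"
    by (rule ap_epic[OF larr_hom[OF k]])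
qed

lemma elt_quotient:
  assumes f: "is_monic C f" and y: "y \<in> Hom C P (Cod C f)"
  shows "elt f y = ap (larr (iota (Cod C f)) (Ident C (Cod C f)) f) (elt (iota (Cod C f)) y)"
proof -
  have "Cod C (iota (Cod C f)) = Cod C f" using monic_arr[OF f] by simp
  moreover have "Ident C (Cod C f) \<cdot> y = y" using y by (simp add: Hom_iff)
  ultimately show ?thesis using elt_map[OF quotient_map(1)[OF f], of y] y by simp
qed

text \<open>The projection from \<open>iota (Cod C f)\<close> to f is epic in L, hence surjective on
  modules; this reduces the claim to \<open>iota_surj\<close>.\<close>

lemma elt_surj:
  assumes f: "is_monic C f" and m: "m \<in> carrier (Fo f)"
  obtains y where "y \<in> Hom C P (Cod C f)" "elt f y = m"
proof -
  have Y: "Cod C f \<in> Obj C" using monic_arr[OF f] by simp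
  obtain x where x: "x \<in> carrier (Fo (iota (Cod C f)))"
      "ap (larr (iota (Cod C f)) (Ident C (Cod C f)) f) x = m"
    using m unfolding quotient_map(2)[OF f, symmetric] by blast
  obtain y where "y \<in> Hom C P (Cod C f)" "elt (iota (Cod C f)) y = x" using iota_surj[OF Y x(1)] .
  then show ?thesis using that[of y] elt_quotient[OF f] x(2) by simp
qed

text \<open>\<open>Fa\<close> is not assumed to preserve zero arrows. But the zero of
  \<open>Fo (iota null_obj)\<close> is the value of some y from P to the null object, and composing
  y with a map out of the null object gives a zero arrow.\<close>

lemma elt_zero:
  assumes f: "is_monic C f"
  shows "elt f (HZero C P (Cod C f)) = \<zero>\<^bsub>Fo f\<^esub>"
proof -
  note fA = monic_arr[OF f]
  have Z: "is_monic C (iota null_obj)" using null_obj(1) by simp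
  interpret Z: right_module \<Lambda> "Fo (iota null_obj)" by (rule Fo_module(1)[OF Z])
  obtain y where y: "y \<in> Hom C P null_obj" "elt (iota null_obj) y = \<zero>\<^bsub>Fo (iota null_obj)\<^esub>"
    using iota_surj[OF null_obj(1) Z.zero_closed] by metis
  have k: "kmap (iota null_obj) (HZero C null_obj (Cod C f)) f"
    by (rule kmap_iota) (use f fA null_obj(1) in simp_all)
  have "HZero C null_obj (Cod C f) \<cdot> y = HZero C P (Cod C f)" using y(1) fA comp_zero[OF y(1)] by
      simp
  then have "elt f (HZero C P (Cod C f)) = ap (larr (iota null_obj) (HZero C null_obj (Cod C f)) f)
      \<zero>\<^bsub>Fo (iota null_obj)\<^esub>"
    using elt_map[OF k, of y] y null_obj(1) by simp
  also have "\<dots> = \<zero>\<^bsub>Fo f\<^esub>" by (rule module_hom_zero[OF Fa_ap(2)[OF larr_hom[OF k]] Fo_module(1)[OF Z]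
      Fo_module(1)[OF f]])
  finally show ?thesis .
qed

text \<open>An equivalence preserves biproducts, hence addition: \<open>y + y'\<close> is the codiagonal after \<open>i y + j
    y'\<close>.\<close>

lemma elt_add_iota:
  assumes X: "X \<in> Obj C" and y: "y \<in> Hom C P X" "y' \<in> Hom C P X"
  shows "elt (iota X) (y \<boxplus> y') = elt (iota X) y \<oplus>\<^bsub>Fo (iota X)\<^esub> elt (iota X) y'"
proof -
  obtain S i j p q where bp: "is_biproduct X X S i j p q" using biproduct_exists[OF X X] .
  note bp' = biproductD[OF bp] and bpH = biproduct_HomD[OF bp]
  have iX: "is_monic C (iota X)" "is_monic C (iota S)" using X bp' by auto
  interpret MX: right_module \<Lambda> "Fo (iota X)" by (rule Fo_module(1)[OF iX(1)])
  interpret MS: right_module \<Lambda> "Fo (iota S)" by (rule Fo_module(1)[OF iX(2)])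
  have y': "y \<in> Arr C" "y' \<in> Arr C" "Dom C y = P" "Dom C y' = P" "Cod C y = X" "Cod C y' = X" using
      y by (auto simp: Hom_iff)
  have el: "elt (iota B) (a \<cdot> x) = ap (larr (iota A) a (iota B)) (elt (iota A) x)"
    if "a \<in> Hom C A B" "x \<in> Hom C P A" for a x A B
  proof -
    have AB: "A \<in> Obj C" "B \<in> Obj C" using Hom_objD[OF that(1)] by auto
    have "kmap (iota A) a (iota B)" by (rule kmap_iota) (use AB that in \<open>simp_all add: Hom_iff\<close>)
    then show ?thesis using elt_map[of "iota A" a "iota B" x] that(2) AB by simp
  qed
  have eX: "elt (iota X) z \<in> carrier (Fo (iota X))" if "z \<in> Hom C P X" for z using
      elt_carrier[OF iX(1), of z] that X by simp
  have zX: "elt (iota X) (HZero C P X) = \<zero>\<^bsub>Fo (iota X)\<^esub>" using elt_zero[OF iX(1)] X by simp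
  define s where "s = i \<cdot> y \<boxplus> j \<cdot> y'"
  have iy: "i \<cdot> y \<in> Hom C P S" "j \<cdot> y' \<in> Hom C P S" using comp_hom[OF y(1) bpH(1)]
      comp_hom[OF y(2) bpH(2)] by auto
  have s: "s \<in> Hom C P S" unfolding s_def by (rule add_hom[OF iy])
  have eS: "elt (iota S) z \<in> carrier (Fo (iota S))" if "z \<in> Hom C P S" for z using
      elt_carrier[OF iX(2), of z] that bp' by simp
  \<comment> \<open>t stands for the sum formed in the module of S. Since p and q act linearly
    there, the components of t turn out to be y and \<open>y'\<close>.\<close>
  obtain t where t: "t \<in> Hom C P S" "elt (iota S) t = elt (iota S) (i \<cdot> y) \<oplus>\<^bsub>Fo (iota S)\<^esub> elt
      (iota S) (j \<cdot> y')"
    using iota_surj[OF bp'(3), of "elt (iota S) (i \<cdot> y) \<oplus>\<^bsub>Fo (iota S)\<^esub> elt (iota S) (j \<cdot> y')"]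
        eS[OF iy(1)] eS[OF iy(2)] by auto
  have et: "elt (iota X) (a \<cdot> t) = elt (iota X) (a \<cdot> (i \<cdot> y)) \<oplus>\<^bsub>Fo (iota X)\<^esub> elt (iota X)
      (a \<cdot> (j \<cdot> y'))" if a: "a \<in> Hom C S X" for a
  proof -
    have k: "kmap (iota S) a (iota X)" by (rule kmap_iota) (use a X bp' in \<open>simp_all add: Hom_iff\<close>)
    show ?thesis
      unfolding el[OF a t(1)] el[OF a iy(1)] el[OF a iy(2)] t(2)
      by (rule module_homsD(2)[OF Fa_ap(2)[OF larr_hom[OF k]] eS[OF iy(1)] eS[OF iy(2)]])
  qed
  have pi: "p \<cdot> (i \<cdot> y) = y" "p \<cdot> (j \<cdot> y') = HZero C P X" "q \<cdot> (i \<cdot> y) = HZero C P X"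
      "q \<cdot> (j \<cdot> y') = y'"
    using y' bp' assoc_reduce[of p i _ y] assoc_reduce[of p j _ y'] assoc_reduce[of q i _ y]
        assoc_reduce[of q j _ y'] by auto
  have "elt (iota X) (p \<cdot> t) = elt (iota X) y" using et[OF bpH(3)] pi zX eX[OF y(1)] by simp
  then have pt: "p \<cdot> t = y" by (rule iota_inj[OF X comp_hom[OF t(1) bpH(3)] y(1)])
  have "elt (iota X) (q \<cdot> t) = elt (iota X) y'" using et[OF bpH(4)] pi zX eX[OF y(2)] by simp
  then have qt: "q \<cdot> t = y'" by (rule iota_inj[OF X comp_hom[OF t(1) bpH(4)] y(2)])
  have ts: "t = i \<cdot> y \<boxplus> j \<cdot> y'" using biproduct_split[OF bp, of t] t(1) pt qt by (simp add: Hom_iff)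
  define c where "c = p \<boxplus> q"
  have c: "c \<in> Hom C S X" unfolding c_def by (rule add_hom[OF bpH(3,4)])
  have "c \<cdot> (i \<cdot> y) = p \<cdot> (i \<cdot> y) \<boxplus> q \<cdot> (i \<cdot> y)" unfolding c_def by
      (rule comp_add_left[OF iy(1) bpH(3,4)])
  then have ci: "c \<cdot> (i \<cdot> y) = y" using pi y' by simp
  have "c \<cdot> (j \<cdot> y') = p \<cdot> (j \<cdot> y') \<boxplus> q \<cdot> (j \<cdot> y')" unfolding c_def by
      (rule comp_add_left[OF iy(2) bpH(3,4)])
  then have cj: "c \<cdot> (j \<cdot> y') = y'" using pi y' by simp
  have "c \<cdot> t = y \<boxplus> y'" unfolding ts comp_add_right[OF iy c] ci cj ..
  then show ?thesis using et[OF c] ci cj by simp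
qed

lemma elt_add:
  assumes f: "is_monic C f" and y: "y \<in> Hom C P (Cod C f)" "y' \<in> Hom C P (Cod C f)"
  shows "elt f (y \<boxplus> y') = elt f y \<oplus>\<^bsub>Fo f\<^esub> elt f y'"
proof -
  have Y: "Cod C f \<in> Obj C" using monic_arr[OF f] by simp
  have e: "elt (iota (Cod C f)) z \<in> carrier (Fo (iota (Cod C f)))" if "z \<in> Hom C P (Cod C f)" for z
    using elt_carrier[of "iota (Cod C f)" z] that Y by simp
  show ?thesis
    unfolding elt_quotient[OF f add_hom[OF y]] elt_quotient[OF f y(1)] elt_quotient[OF f y(2)]
        elt_add_iota[OF Y y]
    by (rule module_homsD(2)[OF Fa_ap(2)[OF larr_hom[OF quotient_map(1)[OF f]]] e[OF y(1)]
        e[OF y(2)]])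
qed

text \<open>The coordinate of \<open>elt (iota P) r\<close> with respect to the basis u.\<close>

definition scal :: "'m \<Rightarrow> 'r" where
  "scal r = (THE a. a \<in> carrier \<Lambda> \<and> elt (iota P) r = a \<odot>\<^bsub>Fo (iota P)\<^esub> u)"

lemma eP: "r \<in> Hom C P P \<Longrightarrow> elt (iota P) r \<in> carrier (Fo (iota P))"
  using elt_carrier[OF iP_monic, of r] P_obj by simp

lemma scal:
  assumes "r \<in> Hom C P P"
  shows "scal r \<in> carrier \<Lambda>" "elt (iota P) r = scal r \<odot>\<^bsub>Fo (iota P)\<^esub> u"
  using theI'[of "\<lambda>a. a \<in> carrier \<Lambda> \<and> elt (iota P) r = a \<odot>\<^bsub>Fo (iota P)\<^esub> u"] gen eP[OF assms]
  by (auto simp: scal_def free_generator_def)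

lemma scal_eqI:
  assumes "r \<in> Hom C P P" "a \<in> carrier \<Lambda>" "elt (iota P) r = a \<odot>\<^bsub>Fo (iota P)\<^esub> u"
  shows "scal r = a"
proof -
  have "\<exists>!a. a \<in> carrier \<Lambda> \<and> elt (iota P) r = a \<odot>\<^bsub>Fo (iota P)\<^esub> u" using gen eP[OF assms(1)] by
      (simp add: free_generator_def)
  then show ?thesis using scal[OF assms(1)] assms(2,3) by blast
qed

lemma elt_smult:
  assumes f: "is_monic C f" and y: "y \<in> Hom C P (Cod C f)" and r: "r \<in> Hom C P P"
  shows "elt f (y \<cdot> r) = scal r \<odot>\<^bsub>Fo f\<^esub> elt f y"
proof -
  note k = kmap_P[OF f y]
  have "elt f (y \<cdot> r) = ap (larr (iota P) y f) (scal r \<odot>\<^bsub>Fo (iota P)\<^esub> u)"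
    using elt_map[OF k, of r] r P_obj scal(2)[OF r] by simp
  also have "\<dots> = scal r \<odot>\<^bsub>Fo f\<^esub> elt f y"
    unfolding elt_def by (rule module_homsD(3)[OF Fa_ap(2)[OF larr_hom[OF k]] scal(1)[OF r]
        u_carrier])
  finally show ?thesis .
qed

lemma elt_ident: "elt (iota P) (Ident C P) = u"
proof -
  have "larr (iota P) (Ident C P) (iota P) = Ident LQ (iota P)" using larr_ident[OF iP_monic] P_obj
      by simp
  moreover have "Fa (Ident LQ (iota P)) = Ident (mod_cat \<Lambda>) (Fo (iota P))" using
      functorD(3)[OF func, of "iota P"] iP_monic by simp
  ultimately show ?thesis using u_carrier by (simp add: elt_def ap_def mod_cat_def)
qed

text \<open>For x after y, u is acted on by \<open>scal x\<close> first and by \<open>scal y\<close>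
  second. In a right module this is the product \<open>scal x \<otimes> scal y\<close> in the same
  order, so \<Lambda> appears and not its opposite.\<close>

lemma scal_iso: "scal \<in> ring_iso (End_ring C P) \<Lambda>"
proof (rule ring_iso_memI)
  interpret \<Lambda>: ring \<Lambda> by (rule ring)
  interpret M: right_module \<Lambda> "Fo (iota P)" by (rule Fo_module(1)[OF iP_monic])
  note uc = u_carrier
  have PC: "Cod C (iota P) = P" using P_obj by simp
  fix x y assume "x \<in> carrier (End_ring C P)" "y \<in> carrier (End_ring C P)"
  then have xy: "x \<in> Hom C P P" "y \<in> Hom C P P" by simp_all
  show "scal x \<in> carrier \<Lambda>" by (rule scal(1)[OF xy(1)])
  have "scal (x \<cdot> y) = scal x \<otimes>\<^bsub>\<Lambda>\<^esub> scal y"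
  proof (rule scal_eqI[OF comp_hom[OF xy(2,1)]])
    show "elt (iota P) (x \<cdot> y) = (scal x \<otimes>\<^bsub>\<Lambda>\<^esub> scal y) \<odot>\<^bsub>Fo (iota P)\<^esub> u"
      using elt_smult[OF iP_monic _ xy(2), of x] xy(1) PC scal[OF xy(1)] scal[OF xy(2)]
          M.smult_assoc[OF scal(1)[OF xy(1)] scal(1)[OF xy(2)] uc] by simp
  qed (use scal(1)[OF xy(1)] scal(1)[OF xy(2)] in simp)
  then show "scal (x \<otimes>\<^bsub>End_ring C P\<^esub> y) = scal x \<otimes>\<^bsub>\<Lambda>\<^esub> scal y" by simp
  have "scal (x \<boxplus> y) = scal x \<oplus>\<^bsub>\<Lambda>\<^esub> scal y"
  proof (rule scal_eqI[OF add_hom[OF xy]])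
    show "elt (iota P) (x \<boxplus> y) = (scal x \<oplus>\<^bsub>\<Lambda>\<^esub> scal y) \<odot>\<^bsub>Fo (iota P)\<^esub> u"
      using elt_add[OF iP_monic, of x y] xy PC scal(2)[OF xy(1)] scal(2)[OF xy(2)]
          M.smult_add_ring[OF scal(1)[OF xy(1)] scal(1)[OF xy(2)] uc] by simp
  qed (use scal(1)[OF xy(1)] scal(1)[OF xy(2)] in simp)
  then show "scal (x \<oplus>\<^bsub>End_ring C P\<^esub> y) = scal x \<oplus>\<^bsub>\<Lambda>\<^esub> scal y" by simp
next
  interpret \<Lambda>: ring \<Lambda> by (rule ring)
  interpret M: right_module \<Lambda> "Fo (iota P)" by (rule Fo_module(1)[OF iP_monic])
  have "scal (Ident C P) = \<one>\<^bsub>\<Lambda>\<^esub>"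
    by (rule scal_eqI[OF ident_hom[OF P_obj]]) (use elt_ident M.smult_one[OF u_carrier] in simp_all)
  then show "scal \<one>\<^bsub>End_ring C P\<^esub> = \<one>\<^bsub>\<Lambda>\<^esub>" by simp
  show "bij_betw scal (carrier (End_ring C P)) (carrier \<Lambda>)"
  proof (rule bij_betwI')
    fix x y assume "x \<in> carrier (End_ring C P)" "y \<in> carrier (End_ring C P)"
    then have xy: "x \<in> Hom C P P" "y \<in> Hom C P P" by simp_all
    show "scal x = scal y \<longleftrightarrow> x = y"
    proof
      assume "scal x = scal y"
      then have "elt (iota P) x = elt (iota P) y" using scal(2)[OF xy(1)] scal(2)[OF xy(2)] by simp
      then show "x = y" by (rule iota_inj[OF P_obj xy])
    qed simp
  next
    fix x assume "x \<in> carrier (End_ring C P)"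
    then show "scal x \<in> carrier \<Lambda>" using scal(1) by simp
  next
    fix a assume a: "a \<in> carrier \<Lambda>"
    obtain r where r: "r \<in> Hom C P P" "elt (iota P) r = a \<odot>\<^bsub>Fo (iota P)\<^esub> u"
      using iota_surj[OF P_obj M.smult_closed[OF a u_carrier]] by metis
    then show "\<exists>x \<in> carrier (End_ring C P). a = scal x" using scal_eqI[OF r(1) a r(2)] by auto
  qed
qed

text \<open>A strict epimorphism of Q is epic in L and hence a surjection of modules. A preimage of
  the element given by g is again an arrow from P, by \<open>iota_surj\<close>.\<close>

lemma P_projective: "is_projective C P"
  unfolding is_projective_def
proof (intro conjI allI impI ballI P_obj)
  fix c g assume c: "cokernel_arrow C c" and g: "g \<in> Hom C P (Cod C c)"
  note cA = strict_arr[OF c]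
  define X Y where "X = Dom C c" and "Y = Cod C c"
  have XY: "X \<in> Obj C" "Y \<in> Obj C" using cA by (auto simp: X_def Y_def)
  have m: "is_monic C (iota X)" "is_monic C (iota Y)" using XY by auto
  have k: "kmap (iota X) c (iota Y)" by (rule kmap_iota) (use XY cA in \<open>simp_all add: X_def Y_def\<close>)
  have "is_epic LQ (larr (iota X) c (iota Y))" using strict_epic_LQ[OF c m(2)] XY by
      (simp add: X_def Y_def)
  note onto = ap_epic[OF larr_hom[OF k] this]
  have gY: "g \<in> Hom C P Y" using g by (simp add: Y_def)
  have "elt (iota Y) g \<in> carrier (Fo (iota Y))" using elt_carrier[OF m(2), of g] gY XY(2) by simp
  then have "elt (iota Y) g \<in> ap (larr (iota X) c (iota Y)) ` carrier (Fo (iota X))" by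
      (simp only: onto)
  then obtain x where x: "elt (iota Y) g = ap (larr (iota X) c (iota Y)) x"
      "x \<in> carrier (Fo (iota X))" by (rule imageE)
  obtain h where h: "h \<in> Hom C P X" "elt (iota X) h = x" using iota_surj[OF XY(1) x(2)] .
  have "elt (iota Y) (c \<cdot> h) = elt (iota Y) g" using elt_map[OF k, of h] h x(1) XY by simp
  moreover have "c \<cdot> h \<in> Hom C P Y" using h(1) cA by (simp add: Hom_iff X_def Y_def)
  ultimately have "c \<cdot> h = g" using iota_inj[OF XY(2)] gY by blast
  then show "\<exists>h \<in> Hom C P (Dom C c). c \<cdot> h = g" using h(1) by (auto simp: X_def)
qed

text \<open>Finitely many generators of \<open>Fo (iota X)\<close> are arrows from P to X and become
  the components of c. Surjectivity on Hom(P, _) yields strictness: if c factors through a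
  monomorphism m, then \<open>Fo m\<close> is zero, so the identity of X is zero modulo m, and this
  is a section of m.\<close>

lemma cover:
  assumes X: "X \<in> Obj C"
  obtains S c where "S \<in> finite_free P" "cokernel_arrow C c" "c \<in> Hom C S X"
proof -
  have iX: "is_monic C (iota X)" using X by simp
  interpret M: right_module \<Lambda> "Fo (iota X)" by (rule Fo_module(1)[OF iX])
  obtain A where A: "finite A" "A \<subseteq> carrier (Fo (iota X))" "\<forall>N. is_submodule \<Lambda> (Fo (iota X)) N \<and> A \<subseteq>
      N \<longrightarrow> carrier (Fo (iota X)) \<subseteq> N"
    using Fo_module(2)[OF iX] unfolding M.finitely_generated_iff by metis
  have "A \<subseteq> elt (iota X) ` Hom C P X"
  proof
    fix a assume "a \<in> A"
    then have "a \<in> carrier (Fo (iota X))" using A(2) by blast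
    then obtain y where "y \<in> Hom C P X" "elt (iota X) y = a" by (rule iota_surj[OF X])
    then show "a \<in> elt (iota X) ` Hom C P X" by blast
  qed
  from finite_subset_image[OF A(1) this] have "\<exists>B. B \<subseteq> Hom C P X \<and> finite B \<and> A = elt (iota X) ` B"
      by blast
  then obtain B where B: "B \<subseteq> Hom C P X" "finite B" "A = elt (iota X) ` B" by blast
  obtain S c where S: "S \<in> finite_free P" and c: "c \<in> Hom C S X" "B \<subseteq> (\<cdot>) c ` Hom C P S"
    using finite_free_arrow[OF P_obj X B(2,1)] by metis
  have SO: "S \<in> Obj C" by (rule finite_free_obj[OF S])
  have iS: "is_monic C (iota S)" using SO by simp
  have c': "c \<in> Arr C" "Dom C c = S" "Cod C c = X" using c(1) by (auto simp: Hom_iff)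
  have k: "kmap (iota S) c (iota X)" by (rule kmap_iota) (use c' SO X in simp_all)
  note ah = Fa_ap(2)[OF larr_hom[OF k]]
  interpret MS: right_module \<Lambda> "Fo (iota S)" by (rule Fo_module(1)[OF iS])
  have "is_submodule \<Lambda> (Fo (iota S)) (carrier (Fo (iota S)))" by
      (auto simp: is_submodule_def MS.smult_closed)
  note sub = image_submodule[OF ah MS.right_module_axioms M.right_module_axioms this]
  have "A \<subseteq> ap (larr (iota S) c (iota X)) ` carrier (Fo (iota S))"
  proof
    fix a assume "a \<in> A"
    then obtain v where v: "v \<in> Hom C P S" "a = elt (iota X) (c \<cdot> v)" using B(3) c(2) by blast
    then have "a = ap (larr (iota S) c (iota X)) (elt (iota S) v)" using elt_map[OF k, of v] SO by
        simp
    then show "a \<in> ap (larr (iota S) c (iota X)) ` carrier (Fo (iota S))" using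
        elt_carrier[OF iS, of v] v(1) SO by simp
  qed
  with sub A(3) have all: "carrier (Fo (iota X)) \<subseteq> ap (larr (iota S) c (iota X)) ` carrier
      (Fo (iota S))" by blast
  have onto: "\<exists>w \<in> Hom C P S. c \<cdot> w = y" if y: "y \<in> Hom C P X" for y
  proof -
    have "elt (iota X) y \<in> carrier (Fo (iota X))" using elt_carrier[OF iX, of y] y X by simp
    then obtain x where x: "x \<in> carrier (Fo (iota S))"
        "elt (iota X) y = ap (larr (iota S) c (iota X)) x" using all by blast
    obtain w where w: "w \<in> Hom C P S" "elt (iota S) w = x" using iota_surj[OF SO x(1)] .
    have "elt (iota X) (c \<cdot> w) = elt (iota X) y" using elt_map[OF k, of w] w x(2) SO by simp
    then have "c \<cdot> w = y" by (rule iota_inj[OF X comp_hom[OF w(1) c(1)] y])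
    then show ?thesis using w(1) by blast
  qed
  have "cokernel_arrow C c"
  proof (rule strictI[OF c'(1)])
    fix m d assume m: "is_monic C m" and d: "d \<in> Arr C" "Dom C d = Dom C c" "Cod C d = Dom C m"
        "Cod C m = Cod C c" and cmd: "c = m \<cdot> d"
    note mA = monic_arr[OF m]
    have Cm: "Cod C m = X" using d(4) c'(3) by simp
    interpret Mm: right_module \<Lambda> "Fo m" by (rule Fo_module(1)[OF m])
    \<comment> \<open>An element of \<open>Fo m\<close> is given by some y from P to X. As y factors
      through c, it factors through m and is zero modulo m.\<close>
    have zero: "x = \<zero>\<^bsub>Fo m\<^esub>" if x: "x \<in> carrier (Fo m)" for x
    proof -
      obtain y where y: "y \<in> Hom C P X" "elt m y = x" using elt_surj[OF m x] Cm by metis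
      obtain w where w: "w \<in> Hom C P S" "c \<cdot> w = y" using onto[OF y(1)] by blast
      have "y = (m \<cdot> d) \<cdot> w" unfolding w(2)[symmetric] cmd[symmetric] ..
      also have "\<dots> = m \<cdot> (d \<cdot> w)" by (rule assoc)
          (use w(1) d(1-3) c'(2) mA in \<open>simp_all add: Hom_iff\<close>)
      finally have ym: "y = m \<cdot> (d \<cdot> w)" .
      have "eqm m (m \<cdot> (d \<cdot> w)) (HZero C (Dom C (d \<cdot> w)) (Cod C m))"
        by (rule eqm_zeroI) (use w(1) d(1-3) c'(2) mA in \<open>simp_all add: Hom_iff\<close>)
      then have "eqm m y (HZero C P X)" using ym w(1) d(1-3) c'(2) Cm by (simp add: Hom_iff)
      then have "elt m y = elt m (HZero C P X)" using elt_eq_iff[OF m, of y "HZero C P X"] y(1)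
          zero_hom[OF P_obj X] Cm by simp
      then show ?thesis using elt_zero[OF m] y(2) Cm by simp
    qed
    have k1: "kmap (iota X) (Ident C X) m" and k0: "kmap (iota X) (HZero C X X) m"
      by (rule kmap_iota; use m X Cm in simp)+
    \<comment> \<open>All maps into a zero module agree; faithfulness then identifies the two arrows
      of L.\<close>
    have "ap (larr (iota X) (Ident C X) m) = ap (larr (iota X) (HZero C X X) m)"
    proof
      fix x
      show "ap (larr (iota X) (Ident C X) m) x = ap (larr (iota X) (HZero C X X) m) x"
      proof (cases "x \<in> carrier (Fo (iota X))")
        case True
        then show ?thesis using zero[OF ap_carrier[OF larr_hom[OF k1]]]
            zero[OF ap_carrier[OF larr_hom[OF k0]]] by simp
      next
        case False
        then show ?thesis using Fa_ap(2)[OF larr_hom[OF k1]] Fa_ap(2)[OF larr_hom[OF k0]]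
          by (auto simp: module_homs_def PiE_iff extensional_def)
      qed
    qed
    from Fa_inj[OF larr_hom[OF k1] larr_hom[OF k0] this] have "eqm m (Ident C X) (HZero C X X)"
        using larr_eq_iff[OF k1 k0] by simp
    then have "\<exists>h. h \<in> Arr C \<and> Dom C h = X \<and> Cod C h = Dom C m \<and> Ident C X = m \<cdot> h"
      using eqm_zero_iff[of m "Ident C X"] mA Cm X by simp
    then show "\<exists>h. h \<in> Arr C \<and> Dom C h = Cod C c \<and> Cod C h = Dom C m \<and> m \<cdot> h = Ident C (Cod C c)"
        using c'(3) by metis
  qed
  then show ?thesis using that S c(1) by blast
qed

lemma P_generator: "strong_projective_generator C P"
  unfolding strong_projective_generator_def
proof (intro conjI ballI P_projective)
  fix X assume "X \<in> Obj C"
  then obtain S c where S: "S \<in> finite_free P" "cokernel_arrow C c" "c \<in> Hom C S X" by (rule cover)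
  then show "\<exists>(I :: 'm set) S \<iota> c. is_copower C P I S \<iota> \<and> cokernel_arrow C c \<and> c \<in> Hom C S X"
    using finite_free_copower[OF P_obj S(1)] by blast
qed

text \<open>Since the finitely generated module \<open>\<Lambda> / J\<close> is in the image of the equivalence, the right
    ideal \<open>J\<close>
  is given by a subobject of \<open>P\<close>. This makes \<open>\<Lambda>\<close> right noetherian without any further assumption.\<close>

lemma right_ideal_subobject:
  assumes J: "hom_submodule P P J"
  obtains n where "n \<in> Arr C" "Cod C n = P" "J = (\<cdot>) n ` Hom C P (Dom C n)"
proof -
  have JH: "x \<in> Hom C P P" if "x \<in> J" for x using J that by (auto simp: hom_submodule_def)
  interpret M: right_module \<Lambda> "Fo (iota P)" by (rule Fo_module(1)[OF iP_monic])
  have PC: "Cod C (iota P) = P" using P_obj by simp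
  have "is_submodule \<Lambda> (Fo (iota P)) (elt (iota P) ` J)"
    unfolding is_submodule_def
  proof (intro conjI ballI)
    show "elt (iota P) ` J \<subseteq> carrier (Fo (iota P))" using JH eP by blast
    show "\<zero>\<^bsub>Fo (iota P)\<^esub> \<in> elt (iota P) ` J" using elt_zero[OF iP_monic] J PC by
        (metis hom_submodule_def imageI)
  next
    fix x y assume "x \<in> elt (iota P) ` J" "y \<in> elt (iota P) ` J"
    then obtain a b where ab: "a \<in> J" "b \<in> J" "x = elt (iota P) a" "y = elt (iota P) b" by blast
    then show "x \<oplus>\<^bsub>Fo (iota P)\<^esub> y \<in> elt (iota P) ` J"
      using elt_add[OF iP_monic, of a b] JH PC J by (intro image_eqI[of _ _ "a \<boxplus> b"])
          (simp_all add: hom_submodule_def)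
  next
    fix l x assume l: "l \<in> carrier \<Lambda>" and "x \<in> elt (iota P) ` J"
    then obtain a where a: "a \<in> J" "x = elt (iota P) a" by blast
    obtain r where r: "r \<in> Hom C P P" "elt (iota P) r = l \<odot>\<^bsub>Fo (iota P)\<^esub> u"
      using iota_surj[OF P_obj M.smult_closed[OF l u_carrier]] by metis
    have "scal r = l" by (rule scal_eqI[OF r(1) l r(2)])
    then have "l \<odot>\<^bsub>Fo (iota P)\<^esub> x = elt (iota P) (a \<cdot> r)" using elt_smult[OF iP_monic _ r(1), of a]
        JH[OF a(1)] PC a(2) by simp
    then show "l \<odot>\<^bsub>Fo (iota P)\<^esub> x \<in> elt (iota P) ` J" using J a(1) r(1) by
        (simp add: hom_submodule_def)
  qed
  note sub = this
  obtain K \<psi> where K: "K \<in> Obj (mod_cat \<Lambda>)" "\<psi> \<in> module_homs \<Lambda> (Fo (iota P)) K"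
      "\<psi> ` carrier (Fo (iota P)) = carrier K"
    "\<And>x. x \<in> carrier (Fo (iota P)) \<Longrightarrow> \<psi> x = \<zero>\<^bsub>K\<^esub> \<longleftrightarrow> x \<in> elt (iota P) ` J"
    "\<And>x y. x \<in> carrier (Fo (iota P)) \<Longrightarrow> y \<in> carrier (Fo (iota P)) \<Longrightarrow> \<psi> x = \<psi> y \<longleftrightarrow> x \<ominus>\<^bsub>Fo (iota P)\<^esub> y \<in>
        elt (iota P) ` J"
    by (rule quotient_representable[OF Fo_module(1)[OF iP_monic] Fo_module(2)[OF iP_monic] sub])
        (rule that)
  obtain f e where f: "f \<in> Obj LQ" "e \<in> Hom (mod_cat \<Lambda>) (Fo f) K" "is_iso_arrow (mod_cat \<Lambda>) e"
    using es K(1) unfolding essentially_surjective_def by blast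
  have fm: "is_monic C f" using f(1) by simp
  note fA = monic_arr[OF fm]
  obtain \<epsilon> where \<epsilon>: "e = (Fo f, \<epsilon>, K)" "\<epsilon> \<in> module_homs \<Lambda> (Fo f) K" "right_module \<Lambda> K" using f(2) by
      (rule mod_HomE)
  obtain d where d: "d \<in> Hom (mod_cat \<Lambda>) K (Fo f)" "d \<cdot>\<^bsub>mod_cat \<Lambda>\<^esub> e = Ident (mod_cat \<Lambda>) (Fo f)"
    "e \<cdot>\<^bsub>mod_cat \<Lambda>\<^esub> d = Ident (mod_cat \<Lambda>) K" using f(3,2) by (rule isoE)
  obtain \<delta> where \<delta>: "d = (K, \<delta>, Fo f)" "\<delta> \<in> module_homs \<Lambda> K (Fo f)" using d(1) by (rule mod_HomE)
  have "compose (carrier K) \<epsilon> \<delta> = (\<lambda>x \<in> carrier K. x)"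
    using d(3) by (simp add: \<epsilon>(1) \<delta>(1) mod_comp) (simp add: mod_cat_def)
  then have \<epsilon>\<delta>: "\<epsilon> (\<delta> x) = x" if "x \<in> carrier K" for x using that by
      (metis compose_eq restrict_apply')
  have \<delta>0: "\<delta> x = \<zero>\<^bsub>Fo f\<^esub> \<longleftrightarrow> x = \<zero>\<^bsub>K\<^esub>" if x: "x \<in> carrier K" for x
    using \<epsilon>\<delta>[OF x] module_hom_zero[OF \<delta>(2) \<epsilon>(3) Fo_module(1)[OF fm]]
        module_hom_zero[OF \<epsilon>(2) Fo_module(1)[OF fm] \<epsilon>(3)] by metis
  \<comment> \<open>The projection onto \<Lambda> / J, read in L as an arrow from
    \<open>iota P\<close> to f; it will be represented by an arrow y of Q from P to Cod f.\<close>
  obtain F where F: "F \<in> Hom LQ (iota P) f" "ap F = compose (carrier (Fo (iota P))) \<delta> \<psi>"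
    using Fa_onto[OF iP_monic fm module_homs_compose[OF K(2) \<delta>(2) Fo_module(1)[OF iP_monic]]] .
  obtain y where y: "y \<in> Hom C P (Cod C f)" "elt f y = ap F u" using
      elt_surj[OF fm ap_carrier[OF F(1) u_carrier]] .
  note ky = kmap_P[OF fm y(1)]
  have Fy: "F = larr (iota P) y f" by (rule ap_u_inj[OF F(1) larr_hom[OF ky]])
      (use y(2) in \<open>simp add: elt_def\<close>)
  have mem: "a \<in> J \<longleftrightarrow> eqm f (y \<cdot> a) (HZero C P (Cod C f))" if a: "a \<in> Hom C P P" for a
  proof -
    have "elt f (y \<cdot> a) = \<delta> (\<psi> (elt (iota P) a))"
      using elt_map[OF ky, of a] a PC F(2) eP[OF a] by (simp add: Fy compose_def)
    then have "elt f (y \<cdot> a) = \<zero>\<^bsub>Fo f\<^esub> \<longleftrightarrow> elt (iota P) a \<in> elt (iota P) ` J"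
      using \<delta>0[OF module_homsD(1)[OF K(2) eP[OF a]]] K(4)[OF eP[OF a]] by simp
    also have "\<dots> \<longleftrightarrow> a \<in> J" using iota_inj[OF P_obj a] JH by blast
    finally show ?thesis
      using elt_eq_iff[OF fm comp_hom[OF a y(1)] zero_hom[OF P_obj cod_obj[OF fA]]] elt_zero[OF fm]
          by simp
  qed
  have y': "y \<in> Arr C" "Dom C y = P" "Cod C y = Cod C f" using y(1) by (auto simp: Hom_iff)
  \<comment> \<open>An arrow a of P lies in J exactly when y sends it into f, that is, when it
    factors through the pullback n of f along y.\<close>
  obtain p n where pb: "is_pullback C f y p n" using pullback_exists[OF fA y'(1)] y'(3) by metis
  note pb' = pb[unfolded is_pullback_def]
  have n: "n \<in> Arr C" "Cod C n = P" "Dom C p = Dom C n" "p \<in> Arr C" "Cod C p = Dom C f"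
      "f \<cdot> p = y \<cdot> n" using pb' y' by auto
  have univ: "\<forall>W \<in> Obj C. \<forall>u \<in> Hom C W (Dom C f). \<forall>v \<in> Hom C W (Dom C y). f \<cdot> u = y \<cdot> v \<longrightarrow>
      (\<exists>!h. h \<in> Hom C W (Dom C p) \<and> p \<cdot> h = u \<and> n \<cdot> h = v)" using pb' by blast
  have "J = (\<cdot>) n ` Hom C P (Dom C n)"
  proof
    show "J \<subseteq> (\<cdot>) n ` Hom C P (Dom C n)"
    proof
      fix a assume a: "a \<in> J"
      have aH: "a \<in> Hom C P P" by (rule JH[OF a])
      have a': "a \<in> Arr C" "Dom C a = P" "Cod C a = P" using aH by (auto simp: Hom_iff)
      have "\<exists>h. h \<in> Arr C \<and> Dom C h = P \<and> Cod C h = Dom C f \<and> y \<cdot> a = f \<cdot> h"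
        using mem[OF aH] a eqm_zero_iff[of f "y \<cdot> a"] fA y' a' by simp
      then obtain h where "h \<in> Hom C P (Dom C f)" "f \<cdot> h = y \<cdot> a" by (auto simp: Hom_iff)
      moreover have "a \<in> Hom C P (Dom C y)" using aH y' by simp
      ultimately obtain k where "k \<in> Hom C P (Dom C p)" "n \<cdot> k = a" using univ P_obj by blast
      then show "a \<in> (\<cdot>) n ` Hom C P (Dom C n)" using n(3) by auto
    qed
    show "(\<cdot>) n ` Hom C P (Dom C n) \<subseteq> J"
    proof
      fix a assume "a \<in> (\<cdot>) n ` Hom C P (Dom C n)"
      then obtain v where v: "v \<in> Hom C P (Dom C n)" "a = n \<cdot> v" by blast
      have v': "v \<in> Arr C" "Dom C v = P" "Cod C v = Dom C n" using v(1) by (auto simp: Hom_iff)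
      have aH: "a \<in> Hom C P P" using v' v(2) n by (simp add: Hom_iff)
      have "y \<cdot> a = (y \<cdot> n) \<cdot> v" unfolding v(2) by (rule assoc[symmetric]) (use v' n y' in simp_all)
      also have "\<dots> = f \<cdot> (p \<cdot> v)" unfolding n(6)[symmetric] by (rule assoc)
          (use v' n fA in simp_all)
      finally have ya: "y \<cdot> a = f \<cdot> (p \<cdot> v)" .
      have "eqm f (f \<cdot> (p \<cdot> v)) (HZero C (Dom C (p \<cdot> v)) (Cod C f))" by (rule eqm_zeroI)
          (use v' n fA in simp_all)
      then show "a \<in> J" using mem[OF aH] ya v' n by simp
    qed
  qed
  then show ?thesis using that n by blast
qed

text \<open>The union J of the chain is again n Hom(P, _). A finite free cover of
  \<open>Dom C n\<close> makes J finitely generated, and its generators lie in a single term of the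
  chain.\<close>

lemma chain_condition_P: "chain_condition (\<subseteq>) P P"
  unfolding chain_condition_def
proof (intro allI impI)
  fix N :: "nat \<Rightarrow> 'm set" assume "(\<forall>k. hom_submodule P P (N k)) \<and> (\<forall>k. N k \<subseteq> N (Suc k))"
  then have N: "\<And>k. hom_submodule P P (N k)" and mono: "\<And>k l. k \<le> l \<Longrightarrow> N k \<subseteq> N l" using
      lift_Suc_mono_le[of N] by auto
  define J where "J = (\<Union>k. N k)"
  have J: "hom_submodule P P J"
    unfolding hom_submodule_def
  proof (intro conjI ballI)
    show "J \<subseteq> Hom C P P" using N unfolding J_def hom_submodule_def by blast
    show "HZero C P P \<in> J" using N by (auto simp: J_def hom_submodule_def)
  next
    fix x y assume "x \<in> J" "y \<in> J"
    then obtain k l where "x \<in> N k" "y \<in> N l" by (auto simp: J_def)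
    then have "x \<in> N (max k l)" "y \<in> N (max k l)" using mono[of k "max k l"] mono[of l "max k l"] by
        auto
    then show "x \<boxplus> y \<in> J" using N[of "max k l"] by (auto simp: J_def hom_submodule_def)
  next
    fix x r assume "x \<in> J" "r \<in> Hom C P P"
    then show "x \<cdot> r \<in> J" using N unfolding J_def hom_submodule_def by blast
  qed
  obtain n where n: "n \<in> Arr C" "Cod C n = P" "J = (\<cdot>) n ` Hom C P (Dom C n)" using
      right_ideal_subobject[OF J] .
  obtain S c where S: "S \<in> finite_free P" "cokernel_arrow C c" "c \<in> Hom C S (Dom C n)" using
      cover[OF dom_obj[OF n(1)]] .
  have nH: "n \<in> Hom C (Dom C n) P" using n by (simp add: Hom_iff)
  note nc = comp_hom[OF S(3) nH]
  obtain A where A: "finite A" "A \<subseteq> Hom C P S" "\<forall>M. hom_submodule P S M \<and> A \<subseteq> M \<longrightarrow> Hom C P S \<subseteq> M"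
    using finite_free_generated[OF P_obj S(1)] by metis
  have ncJ: "(n \<cdot> c) \<cdot> v \<in> J" if "v \<in> Hom C P S" for v
    unfolding n(3) comp_assoc[OF that S(3) nH] using comp_hom[OF that S(3)] by blast
  have "\<exists>K. (\<cdot>) (n \<cdot> c) ` A \<subseteq> N K"
  proof -
    have "\<forall>v \<in> A. \<exists>k. (n \<cdot> c) \<cdot> v \<in> N k" using ncJ A(2) unfolding J_def by blast
    then obtain k where k: "\<And>v. v \<in> A \<Longrightarrow> (n \<cdot> c) \<cdot> v \<in> N (k v)" by metis
    \<comment> \<open>For empty A the maximum has no specified value, but then the image is empty as
      well.\<close>
    have "(\<cdot>) (n \<cdot> c) ` A \<subseteq> N (Max (k ` A))" using k mono[OF Max_ge[of "k ` A"]] A(1) by fastforce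
    then show ?thesis by blast
  qed
  then obtain K where K: "(\<cdot>) (n \<cdot> c) ` A \<subseteq> N K" by blast
  have "A \<subseteq> {v \<in> Hom C P S. (n \<cdot> c) \<cdot> v \<in> N K}" using K A(2) by auto
  with hom_submodule_vimage[OF P_obj nc N] A(3) have all: "Hom C P S \<subseteq> {v \<in> Hom C P S. (n \<cdot> c) \<cdot> v \<in>
      N K}" by blast
  have "J \<subseteq> N K"
  proof
    fix a assume "a \<in> J"
    then obtain w where w: "w \<in> Hom C P (Dom C n)" "a = n \<cdot> w" using n(3) by blast
    have "w \<in> Hom C P (Cod C c)" using w(1) S(3) by (simp add: Hom_iff)
    then obtain v where v: "v \<in> Hom C P (Dom C c)" "c \<cdot> v = w" using
        projectiveD[OF P_projective S(2)] by metis
    have vS: "v \<in> Hom C P S" using v(1) S(3) by (simp add: Hom_iff)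
    have "(n \<cdot> c) \<cdot> v = a" unfolding comp_assoc[OF vS S(3) nH] using v(2) w(2) by simp
    then show "a \<in> N K" using all vS by auto
  qed
  then have "N k = N K" if "k \<ge> K" for k using mono[OF that] by (auto simp: J_def)
  then show "\<exists>K. \<forall>k \<ge> K. N k = N K" by blast
qed

lemma chain_condition_all:
  assumes "incl = (\<subseteq>) \<or> incl = (\<supseteq>)" "chain_condition incl P P" "X \<in> Obj C"
  shows "chain_condition incl P X"
proof -
  obtain S c where S: "S \<in> finite_free P" "cokernel_arrow C c" "c \<in> Hom C S X" using
      cover[OF assms(3)] .
  show ?thesis by (rule chain_condition_cover[OF P_projective assms(1)
      chain_condition_finite_free[OF P_obj assms(1,2) S(1)] S(2,3)])
qed

lemma noetherian: "noetherian_subobjects C"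
  using chain_condition_subobjects(1)[OF P_generator] chain_condition_all[OF _ chain_condition_P] by
      blast

text \<open>A descending chain of submodules of Hom(P, P) becomes a chain of right ideals of
  \<Lambda> under \<open>scal\<close>, and injectivity carries stationarity back. From P the
  condition passes to all objects.\<close>

lemma artinian:
  assumes art: "right_artinian_ring \<Lambda>"
  shows "artinian_subobjects C"
proof -
  interpret \<Lambda>: ring \<Lambda> by (rule ring)
  have h: "scal \<in> ring_hom (End_ring C P) \<Lambda>" and bij: "bij_betw scal (Hom C P P) (carrier \<Lambda>)"
    using scal_iso by (auto simp: ring_iso_def)
  have hadd: "scal (x \<boxplus> y) = scal x \<oplus>\<^bsub>\<Lambda>\<^esub> scal y" "scal (x \<cdot> y) = scal x \<otimes>\<^bsub>\<Lambda>\<^esub> scal y" if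
      "x \<in> Hom C P P" "y \<in> Hom C P P" for x y
    using ring_hom_add[OF h, of x y] ring_hom_mult[OF h, of x y] that by simp_all
  have ideal: "right_ideal \<Lambda> (scal ` J)" if J: "hom_submodule P P J" for J
  proof -
    have JH: "x \<in> Hom C P P" if "x \<in> J" for x using J that by (auto simp: hom_submodule_def)
    have sc: "scal ` J \<subseteq> carrier \<Lambda>" using JH scal(1) by blast
    have mult: "x \<otimes>\<^bsub>\<Lambda>\<^esub> r \<in> scal ` J" if x: "x \<in> scal ` J" and r: "r \<in> carrier \<Lambda>" for x r
    proof -
      obtain a where a: "a \<in> J" "x = scal a" using x by blast
      obtain b where b: "b \<in> Hom C P P" "r = scal b" using r bij unfolding bij_betw_def by blast
      have "x \<otimes>\<^bsub>\<Lambda>\<^esub> r = scal (a \<cdot> b)" using hadd(2)[OF JH[OF a(1)] b(1)] a(2) b(2) by simp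
      then show ?thesis using J a(1) b(1) by (simp add: hom_submodule_def)
    qed
    have "subgroup (scal ` J) (add_monoid \<Lambda>)"
    proof (rule group.subgroupI[OF \<Lambda>.a_group])
      show "scal ` J \<subseteq> carrier (add_monoid \<Lambda>)" "scal ` J \<noteq> {}" using sc J by
          (auto simp: hom_submodule_def)
      fix x assume x: "x \<in> scal ` J"
      have "x \<otimes>\<^bsub>\<Lambda>\<^esub> (\<ominus>\<^bsub>\<Lambda>\<^esub> \<one>\<^bsub>\<Lambda>\<^esub>) = \<ominus>\<^bsub>\<Lambda>\<^esub> x" using x sc by (simp add: \<Lambda>.r_minus subset_iff)
      then show "inv\<^bsub>add_monoid \<Lambda>\<^esub> x \<in> scal ` J" using mult[OF x, of "\<ominus>\<^bsub>\<Lambda>\<^esub> \<one>\<^bsub>\<Lambda>\<^esub>"] by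
          (simp add: a_inv_def)
      fix y assume "y \<in> scal ` J"
      then obtain a b where "a \<in> J" "x = scal a" "b \<in> J" "y = scal b" using x by blast
      then show "x \<otimes>\<^bsub>add_monoid \<Lambda>\<^esub> y \<in> scal ` J"
        using hadd(1)[of a b] JH J by (intro image_eqI[of _ _ "a \<boxplus> b"])
            (simp_all add: hom_submodule_def)
    qed
    then show ?thesis using mult by (simp add: right_ideal_def additive_subgroup_def)
  qed
  have "chain_condition (\<supseteq>) P P"
    unfolding chain_condition_def
  proof (intro allI impI)
    fix N :: "nat \<Rightarrow> 'm set" assume N: "(\<forall>k. hom_submodule P P (N k)) \<and> (\<forall>k. N (Suc k) \<subseteq> N k)"
    have NH: "N k \<subseteq> Hom C P P" for k using N by (simp add: hom_submodule_def)
    have "(\<forall>n. right_ideal \<Lambda> (scal ` N n)) \<and> (\<forall>n. scal ` N (Suc n) \<subseteq> scal ` N n)" using N ideal by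
        (simp add: image_mono)
    then obtain K where K: "\<And>n. n \<ge> K \<Longrightarrow> scal ` N n = scal ` N K" using art unfolding
        right_artinian_ring_def by meson
    have "inj_on scal (Hom C P P)" using bij by (simp add: bij_betw_def)
    then have "N n = N K" if "n \<ge> K" for n using K[OF that] inj_on_image_eq_iff[OF _ NH NH] by blast
    then show "\<exists>K. \<forall>k \<ge> K. N k = N K" by blast
  qed
  then show ?thesis using chain_condition_subobjects(2)[OF P_generator] chain_condition_all by blast
qed

end

context quasi_abelian_category
begin

text \<open>The object \<open>f\<close> of \<open>L\<close> corresponding to \<open>\<Lambda>\<close> is projective, so the epimorphism \<open>iota (Cod f) \<rightarrow>
    f\<close> splits,
  and \<open>f\<close> is the image of an idempotent of \<open>Cod f\<close>.\<close>

theorem equivalence_realized: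
  fixes \<Lambda> :: "('r, 'y) ring_scheme"
  assumes \<Lambda>: "ring \<Lambda>" and eq: "LQ \<approx>\<^sub>c mod_cat \<Lambda>"
  obtains Fo Fa P u where "equivalence_realization C \<Lambda> Fo Fa P u"
proof -
  interpret L: category LQ by (rule category_left_associated_abelian)
  interpret D: category "mod_cat \<Lambda>" by (rule category_mod_cat)
  obtain Fo Fa where F: "is_functor LQ (mod_cat \<Lambda>) Fo Fa" and ff:
      "fully_faithful LQ (mod_cat \<Lambda>) Fo Fa"
    and es: "essentially_surjective LQ (mod_cat \<Lambda>) Fo"
    using fully_faithful_of_equivalence[OF category_left_associated_abelian category_mod_cat eq] .
  obtain R1 u1 where R1: "R1 \<in> Obj (mod_cat \<Lambda>)" "free_generator \<Lambda> R1 u1" using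
      regular_module_representable[OF \<Lambda>] .
  obtain f e where f: "f \<in> Obj LQ" "e \<in> Hom (mod_cat \<Lambda>) (Fo f) R1" "is_iso_arrow (mod_cat \<Lambda>) e"
    using es R1(1) unfolding essentially_surjective_def by blast
  obtain d where d: "d \<in> Hom (mod_cat \<Lambda>) R1 (Fo f)" "d \<cdot>\<^bsub>mod_cat \<Lambda>\<^esub> e = Ident (mod_cat \<Lambda>) (Fo f)"
    "e \<cdot>\<^bsub>mod_cat \<Lambda>\<^esub> d = Ident (mod_cat \<Lambda>) R1" using f(3,2) by (rule isoE)
  have di: "is_iso_arrow (mod_cat \<Lambda>) d" by (rule isoI[OF d(1) f(2) d(3,2)])
  obtain \<delta> where \<delta>: "d = (R1, \<delta>, Fo f)" using d(1) by (rule mod_HomE)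
  \<comment> \<open>The basis of the regular module, transported to \<open>Fo f\<close>.\<close>
  define u0 where "u0 = \<delta> u1"
  have u0: "free_generator \<Lambda> (Fo f) u0" unfolding u0_def using
      free_generator_iso[OF di[unfolded \<delta>] d(1)[unfolded \<delta>] R1(2)] .
  have fm: "is_monic C f" using f(1) by simp
  note fA = monic_arr[OF fm]
  define Y where "Y = Cod C f"
  have Y: "Y \<in> Obj C" using fA by (simp add: Y_def)
  have iY: "is_monic C (iota Y)" using Y by simp
  have k: "kmap (iota Y) (Ident C Y) f" by (rule kmap_iota) (use fm Y in \<open>simp_all add: Y_def\<close>)
  define \<pi> where "\<pi> = larr (iota Y) (Ident C Y) f"
  have piH: "\<pi> \<in> Hom LQ (iota Y) f" unfolding \<pi>_def by (rule larr_hom[OF k])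
  have "cokernel_arrow C (Ident C Y)" by (rule strict_split[where s = "Ident C Y"])
      (use Y in simp_all)
  from strict_epic_LQ[OF this fm] have "is_epic LQ \<pi>" using Y by (simp add: \<pi>_def Y_def)
  then have epi: "is_epic (mod_cat \<Lambda>) (Fa \<pi>)"
    by (rule epic_preserved[OF category_left_associated_abelian category_mod_cat F ff es])
  obtain p where p: "Fa \<pi> = (Fo (iota Y), p, Fo f)" "p \<in> module_homs \<Lambda> (Fo (iota Y)) (Fo f)"
    "right_module \<Lambda> (Fo (iota Y))" "right_module \<Lambda> (Fo f)"
        "finitely_generated_module \<Lambda> (Fo (iota Y))" "finitely_generated_module \<Lambda> (Fo f)"
    using functorD(2)[OF F piH] by (rule mod_HomE)
  have onto: "p ` carrier (Fo (iota Y)) = carrier (Fo f)" by (rule mod_epic_surj[OF epi p(1)])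
  have u0c: "u0 \<in> carrier (Fo f)" using u0 by (simp add: free_generator_def)
  then have "u0 \<in> p ` carrier (Fo (iota Y))" by (simp only: onto)
  \<comment> \<open>x is a preimage of the basis element under the surjection p; the module map s
    with \<open>s u0 = x\<close> is then a section of p.\<close>
  then obtain x where x': "u0 = p x" and x1: "x \<in> carrier (Fo (iota Y))" by (rule imageE)
  note x = x1 x'[symmetric]
  obtain s where s: "s \<in> module_homs \<Lambda> (Fo f) (Fo (iota Y))" "s u0 = x" using
      free_generator_hom[OF p(4) u0 p(3) x(1)] by blast
  have "(Fo f, s, Fo (iota Y)) \<in> Hom (mod_cat \<Lambda>) (Fo f) (Fo (iota Y))" by
      (rule mod_HomI[OF s(1) p(4,3,6,5)])
  moreover have "Fa ` Hom LQ f (iota Y) = Hom (mod_cat \<Lambda>) (Fo f) (Fo (iota Y))" and inj: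
      "inj_on Fa (Hom LQ f f)"
    using ff fm iY by (simp_all add: fully_faithful_def bij_betw_def)
  ultimately have "(Fo f, s, Fo (iota Y)) \<in> Fa ` Hom LQ f (iota Y)" by simp
  then obtain \<sigma> where \<sigma>': "(Fo f, s, Fo (iota Y)) = Fa \<sigma>" and \<sigma>1: "\<sigma> \<in> Hom LQ f (iota Y)" by
      (rule imageE)
  note \<sigma> = \<sigma>1 \<sigma>'[symmetric]
  interpret Mf: right_module \<Lambda> "Fo f" by (rule p(4))
  have "compose (carrier (Fo f)) p s = (\<lambda>x \<in> carrier (Fo f). x)"
  proof (rule free_generator_hom_eq[OF u0])
    show "compose (carrier (Fo f)) p s \<in> module_homs \<Lambda> (Fo f) (Fo f)" by
        (rule module_homs_compose[OF s(1) p(2,4)])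
    show "(\<lambda>x \<in> carrier (Fo f). x) \<in> module_homs \<Lambda> (Fo f) (Fo f)" by
        (auto simp: module_homs_def Mf.smult_closed)
  qed (use u0c s(2) x(2) in \<open>simp add: compose_def\<close>)
  then have "Fa (\<pi> \<cdot>\<^bsub>LQ\<^esub> \<sigma>) = Fa (Ident LQ f)"
    using functorD(4)[OF F \<sigma>(1) piH] functorD(3)[OF F f(1)] \<sigma>(2) p(1) by (simp add: mod_comp)
        (simp add: mod_cat_def)
  then have ps: "\<pi> \<cdot>\<^bsub>LQ\<^esub> \<sigma> = Ident LQ f"
    using inj L.comp_hom[OF \<sigma>(1) piH] L.ident_hom[OF f(1)] by (auto simp: inj_on_def)
  \<comment> \<open>The idempotent \<sigma> after \<pi> on \<open>iota Y\<close> comes from an arrow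
    a of Q because the embedding is full.\<close>
  obtain a where a: "a \<in> Arr C" "Dom C a = Y" "Cod C a = Y" "\<sigma> \<cdot>\<^bsub>LQ\<^esub> \<pi> = larr (iota Y) a (iota Y)"
    using iota_full[OF L.comp_hom[OF piH \<sigma>(1)] Y Y] .
  have ka: "kmap (iota Y) a (iota Y)" by (rule kmap_iota) (use a iY Y in simp_all)
  have "(\<sigma> \<cdot>\<^bsub>LQ\<^esub> \<pi>) \<cdot>\<^bsub>LQ\<^esub> (\<sigma> \<cdot>\<^bsub>LQ\<^esub> \<pi>) = \<sigma> \<cdot>\<^bsub>LQ\<^esub> (\<pi> \<cdot>\<^bsub>LQ\<^esub> (\<sigma> \<cdot>\<^bsub>LQ\<^esub> \<pi>))"
    by (rule L.comp_assoc[OF L.comp_hom[OF piH \<sigma>(1)] piH \<sigma>(1)])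
  also have "\<pi> \<cdot>\<^bsub>LQ\<^esub> (\<sigma> \<cdot>\<^bsub>LQ\<^esub> \<pi>) = \<pi>"
    using L.comp_assoc[OF piH \<sigma>(1) piH] ps L.comp_ident_left[OF piH] by simp
  finally have "larr (iota Y) (a \<cdot> a) (iota Y) = larr (iota Y) a (iota Y)" unfolding a(4)
      larr_comp[OF ka ka] .
  then have aa: "a \<cdot> a = a" using larr_eq_iff[OF kmap_comp[OF ka ka] ka] eqm_iota[OF Y] by simp
  obtain P i r where P: "P \<in> Obj C" "i \<in> Hom C P Y" "r \<in> Hom C Y P" "i \<cdot> r = a" "r \<cdot> i = Ident C P"
    using idempotent_split[OF a(1-3) aa] .
  have iP: "is_monic C (iota P)" using P(1) by simp
  have ir: "i \<in> Arr C" "Dom C i = P" "Cod C i = Y" "r \<in> Arr C" "Dom C r = Y" "Cod C r = P" using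
      P(2,3) by (auto simp: Hom_iff)
  have ki: "kmap (iota P) i (iota Y)" "kmap (iota Y) r (iota P)" using kmap_iota[of "iota Y" i P]
      kmap_iota[of "iota P" r Y] ir iY iP Y P(1) by simp_all
  \<comment> \<open>Both f and \<open>iota P\<close> split the idempotent a, so \<theta> and \<rho>
    are mutually inverse.\<close>
  define \<theta> where "\<theta> = \<pi> \<cdot>\<^bsub>LQ\<^esub> larr (iota P) i (iota Y)"
  define \<rho> where "\<rho> = larr (iota Y) r (iota P) \<cdot>\<^bsub>LQ\<^esub> \<sigma>"
  note iH = larr_hom[OF ki(1)] and rH = larr_hom[OF ki(2)]
  have \<theta>: "\<theta> \<in> Hom LQ (iota P) f" and \<rho>: "\<rho> \<in> Hom LQ f (iota P)"
    unfolding \<theta>_def \<rho>_def using L.comp_hom[OF iH piH] L.comp_hom[OF \<sigma>(1) rH] by auto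
  have "\<rho> \<cdot>\<^bsub>LQ\<^esub> \<theta> = larr (iota Y) r (iota P) \<cdot>\<^bsub>LQ\<^esub> (\<sigma> \<cdot>\<^bsub>LQ\<^esub> \<theta>)" unfolding \<rho>_def by
      (rule L.comp_assoc[OF \<theta> \<sigma>(1) rH])
  also have "\<sigma> \<cdot>\<^bsub>LQ\<^esub> \<theta> = (\<sigma> \<cdot>\<^bsub>LQ\<^esub> \<pi>) \<cdot>\<^bsub>LQ\<^esub> larr (iota P) i (iota Y)" unfolding \<theta>_def by
      (rule L.comp_assoc[OF iH piH \<sigma>(1), symmetric])
  also have "\<dots> = larr (iota P) (a \<cdot> i) (iota Y)" unfolding a(4) by (rule larr_comp[OF ki(1) ka])
  also have "larr (iota Y) r (iota P) \<cdot>\<^bsub>LQ\<^esub> \<dots> = larr (iota P) (r \<cdot> (a \<cdot> i)) (iota P)" by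
      (rule larr_comp[OF kmap_comp[OF ki(1) ka] ki(2)])
  also have "r \<cdot> (a \<cdot> i) = Ident C P"
  proof -
    have "a \<cdot> i = i \<cdot> (r \<cdot> i)" unfolding P(4)[symmetric] using ir by (simp add: assoc)
    then show ?thesis using P(5) ir by simp
  qed
  also have "larr (iota P) (Ident C P) (iota P) = Ident LQ (iota P)" using larr_ident[OF iP] P(1) by
      simp
  finally have 1: "\<rho> \<cdot>\<^bsub>LQ\<^esub> \<theta> = Ident LQ (iota P)" .
  have "\<theta> \<cdot>\<^bsub>LQ\<^esub> \<rho> = \<pi> \<cdot>\<^bsub>LQ\<^esub> (larr (iota P) i (iota Y) \<cdot>\<^bsub>LQ\<^esub> \<rho>)" unfolding \<theta>_def by
      (rule L.comp_assoc[OF \<rho> iH piH])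
  also have "larr (iota P) i (iota Y) \<cdot>\<^bsub>LQ\<^esub> \<rho> = (larr (iota P) i (iota Y) \<cdot>\<^bsub>LQ\<^esub> larr (iota Y) r
      (iota P)) \<cdot>\<^bsub>LQ\<^esub> \<sigma>"
    unfolding \<rho>_def by (rule L.comp_assoc[OF \<sigma>(1) rH iH, symmetric])
  also have "larr (iota P) i (iota Y) \<cdot>\<^bsub>LQ\<^esub> larr (iota Y) r (iota P) = \<sigma> \<cdot>\<^bsub>LQ\<^esub> \<pi>" unfolding
      larr_comp[OF ki(2,1)] P(4) a(4) ..
  also have "(\<sigma> \<cdot>\<^bsub>LQ\<^esub> \<pi>) \<cdot>\<^bsub>LQ\<^esub> \<sigma> = \<sigma>" using L.comp_assoc[OF \<sigma>(1) piH \<sigma>(1)] ps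
      L.comp_ident_right[OF \<sigma>(1)] by simp
  finally have 2: "\<theta> \<cdot>\<^bsub>LQ\<^esub> \<rho> = Ident LQ f" using ps by simp
  note FH = functorD(2)[OF F \<rho>] functorD(2)[OF F \<theta>]
  have iso: "is_iso_arrow (mod_cat \<Lambda>) (Fa \<rho>)"
  proof (rule isoI[OF FH])
    show "Fa \<theta> \<cdot>\<^bsub>mod_cat \<Lambda>\<^esub> Fa \<rho> = Ident (mod_cat \<Lambda>) (Fo f)" using functorD(4)[OF F \<rho> \<theta>]
        functorD(3)[OF F f(1)] 2 by simp
    show "Fa \<rho> \<cdot>\<^bsub>mod_cat \<Lambda>\<^esub> Fa \<theta> = Ident (mod_cat \<Lambda>) (Fo (iota P))"
      using functorD(4)[OF F \<theta> \<rho>] functorD(3)[OF F, of "iota P"] iP 1 by simp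
  qed
  obtain q where q: "Fa \<rho> = (Fo f, q, Fo (iota P))" using FH(1) by (rule mod_HomE)
  have "free_generator \<Lambda> (Fo (iota P)) (q u0)" by
      (rule free_generator_iso[OF iso[unfolded q] FH(1)[unfolded q] u0])
  then have "equivalence_realization C \<Lambda> Fo Fa P (q u0)"
    using quasi_abelian_category_axioms \<Lambda> F ff es P(1) by
        (simp add: equivalence_realization_def equivalence_realization_axioms_def)
  then show ?thesis by (rule that)
qed

theorem equivalence_consequences:
  fixes \<Lambda> :: "('r, 'y) ring_scheme"
  assumes \<Lambda>: "ring \<Lambda>" and eq: "LQ \<approx>\<^sub>c mod_cat \<Lambda>"
  obtains P where "strong_projective_generator C P" "\<Lambda> \<simeq> End_ring C P" "noetherian_subobjects C"
    "right_artinian_ring \<Lambda> \<Longrightarrow> artinian_subobjects C"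
proof -
  obtain Fo Fa P u where "equivalence_realization C \<Lambda> Fo Fa P u" using equivalence_realized[OF \<Lambda> eq]
      .
  then interpret E: equivalence_realization C \<Lambda> Fo Fa P u .
  have "End_ring C P \<simeq> \<Lambda>" using E.scal_iso by (auto simp: is_ring_iso_def)
  then have "\<Lambda> \<simeq> End_ring C P" by (rule ring_iso_sym[OF ring_End_ring[OF E.P_obj]])
  then show ?thesis using that E.P_generator E.noetherian E.artinian by blast
qed

end

text \<open>The witness for \<Lambda> is End(P), whose elements are arrows; hence the existential
  ranges over rings on \<open>'m\<close>. A type cannot be quantified inside a formula, so rings on
  an arbitrary type \<open>'r\<close> have conjuncts of their own, which also carry the isomorphism
  with End(P). The last two conjuncts give the equivalence for every generator P.\<close>

theorem theorem5p10:
  fixes Q :: "('o, 'm) precat"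
  assumes "quasi_abelian_category Q"
  shows
    "((\<exists>\<Lambda> :: 'm ring. right_noetherian_ring \<Lambda> \<and> left_associated_abelian Q \<approx>\<^sub>c mod_cat \<Lambda>) \<longleftrightarrow>
        noetherian_subobjects Q \<and> (\<exists>P. strong_projective_generator Q P)) \<and>
     ((\<exists>\<Lambda> :: 'm ring. right_artinian_ring \<Lambda> \<and> left_associated_abelian Q \<approx>\<^sub>c mod_cat \<Lambda>) \<longleftrightarrow>
        noetherian_subobjects Q \<and> artinian_subobjects Q \<and> (\<exists>P. strong_projective_generator Q P)) \<and>
     (\<forall>\<Lambda> :: 'r ring. right_noetherian_ring \<Lambda> \<and> left_associated_abelian Q \<approx>\<^sub>c mod_cat \<Lambda> \<longrightarrow>
        noetherian_subobjects Q \<and>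
        (\<exists>P. strong_projective_generator Q P \<and> \<Lambda> \<simeq> End_ring Q P)) \<and>
     (\<forall>\<Lambda> :: 'r ring. right_artinian_ring \<Lambda> \<and> left_associated_abelian Q \<approx>\<^sub>c mod_cat \<Lambda> \<longrightarrow>
        noetherian_subobjects Q \<and> artinian_subobjects Q \<and>
        (\<exists>P. strong_projective_generator Q P \<and> \<Lambda> \<simeq> End_ring Q P)) \<and>
     (\<forall>P. noetherian_subobjects Q \<and> strong_projective_generator Q P \<longrightarrow>
        right_noetherian_ring (End_ring Q P) \<and>
        left_associated_abelian Q \<approx>\<^sub>c mod_cat (End_ring Q P)) \<and>
     (\<forall>P. noetherian_subobjects Q \<and> artinian_subobjects Q \<and> strong_projective_generator Q P \<longrightarrow>
        right_artinian_ring (End_ring Q P) \<and>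
        left_associated_abelian Q \<approx>\<^sub>c mod_cat (End_ring Q P))"
proof -
  interpret quasi_abelian_category Q by fact
  \<comment> \<open>The two cases share the equivalence and differ only in the chain condition on
    End(P).\<close>
  have bwd: "right_noetherian_ring (End_ring Q P) \<and> left_associated_abelian Q \<approx>\<^sub>c mod_cat
      (End_ring Q P) \<and>
      (artinian_subobjects Q \<longrightarrow> right_artinian_ring (End_ring Q P))"
    if "strong_projective_generator Q P" "noetherian_subobjects Q" for P
    using right_noetherian_End[OF that] LQ_equivalent_mod_End[OF that] by blast
  show ?thesis
  proof (intro conjI iffI allI impI)
    assume "\<exists>\<Lambda> :: 'm ring. right_noetherian_ring \<Lambda> \<and> left_associated_abelian Q \<approx>\<^sub>c mod_cat \<Lambda>"
    then obtain \<Lambda> :: "'m ring" where L: "ring \<Lambda>" "left_associated_abelian Q \<approx>\<^sub>c mod_cat \<Lambda>"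
      by (auto simp: right_noetherian_ring_def)
    show "noetherian_subobjects Q" "\<exists>P. strong_projective_generator Q P"
      by (rule equivalence_consequences[OF L]; blast)+
  next
    assume "noetherian_subobjects Q \<and> (\<exists>P. strong_projective_generator Q P)"
    then show "\<exists>\<Lambda> :: 'm ring. right_noetherian_ring \<Lambda> \<and> left_associated_abelian Q \<approx>\<^sub>c mod_cat \<Lambda>"
      using bwd by blast
  next
    assume "\<exists>\<Lambda> :: 'm ring. right_artinian_ring \<Lambda> \<and> left_associated_abelian Q \<approx>\<^sub>c mod_cat \<Lambda>"
    then obtain \<Lambda> :: "'m ring" where L: "ring \<Lambda>" "left_associated_abelian Q \<approx>\<^sub>c mod_cat \<Lambda>" and art:
        "right_artinian_ring \<Lambda>"
      by (auto simp: right_artinian_ring_def)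
    show "noetherian_subobjects Q" "artinian_subobjects Q" "\<exists>P. strong_projective_generator Q P"
      by (rule equivalence_consequences[OF L]; use art in blast)+
  next
    assume "noetherian_subobjects Q \<and> artinian_subobjects Q \<and> (\<exists>P. strong_projective_generator Q P)"
    then show "\<exists>\<Lambda> :: 'm ring. right_artinian_ring \<Lambda> \<and> left_associated_abelian Q \<approx>\<^sub>c mod_cat \<Lambda>"
      using bwd by blast
  next
    fix \<Lambda> :: "'r ring" assume "right_noetherian_ring \<Lambda> \<and> left_associated_abelian Q \<approx>\<^sub>c mod_cat \<Lambda>"
    then have L: "ring \<Lambda>" "left_associated_abelian Q \<approx>\<^sub>c mod_cat \<Lambda>" by
        (auto simp: right_noetherian_ring_def)
    show "noetherian_subobjects Q" "\<exists>P. strong_projective_generator Q P \<and> \<Lambda> \<simeq> End_ring Q P"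
      by (rule equivalence_consequences[OF L]; blast)+
  next
    fix \<Lambda> :: "'r ring" assume "right_artinian_ring \<Lambda> \<and> left_associated_abelian Q \<approx>\<^sub>c mod_cat \<Lambda>"
    then have L: "ring \<Lambda>" "left_associated_abelian Q \<approx>\<^sub>c mod_cat \<Lambda>" and art: "right_artinian_ring \<Lambda>"
      by (auto simp: right_artinian_ring_def)
    show "noetherian_subobjects Q" "artinian_subobjects Q" "\<exists>P. strong_projective_generator Q P \<and> \<Lambda>
        \<simeq> End_ring Q P"
      by (rule equivalence_consequences[OF L]; use art in blast)+
  qed (use bwd in blast)+
qed

end
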